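(* Let $K$ be a number field, let $S$ be a finite set of nonarchimedean places of $K$, and for each $v\in S$ fix a finite Galois extension $L_v/K_v$ with ramification index $e_v$ and inertial degree $f_v$. For $v\in S$ let $q_v$ be the order of the residue field of $K_v$, let $p_v$ be its characteristic, and let $N_v=[K_v:\mathbf{Q}_{p_v}]/[K:\mathbf{Q}]$. Let $L$ be the field of all totally $L_S/K$ numbers. Then \[ \liminf_{\alpha \in L} h(\alpha) \;\leq\; \sum_{v\in S} N_v\cdot \frac{\log p_v}{e_v(q_v^{f_v}-1)}, \] where $h$ is the absolute logarithmic Weil height.
   Context: An algebraic number $\alpha\in\overline{K}$ is called totally $L_S/K$ if for every $v\in S$, all $K$-Galois conjugates of $\alpha$ lie in $L_v$ (for any embedding $\overline{K}\hookrightarrow \overline{K_v}$ over $K$); equivalently the minimal polynomial of $\alpha$ over $K$ splits in $L_v$ for each $v\in S$. For a set $A$ of algebraic numbers, $\liminf_{\alpha\in A} h(\alpha)$ means $\sup_{F\subset A \text{ finite}}\ \inf_{\alpha\in A\setminus F} h(\alpha)$. *)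

theory Defs
  imports
    "HOL-Analysis.Infinite_Sum"
    "HOL-Library.Extended_Real"
    "HOL-Algebra.Algebra"
    "HOL-Algebra.Algebraic_Closure_Type"
begin

definition absolute_value :: "('a, 'm) ring_scheme \<Rightarrow> ('a \<Rightarrow> real) \<Rightarrow> bool" where
  "absolute_value R w \<longleftrightarrow>
     (\<forall>x\<in>carrier R. 0 \<le> w x \<and> (w x = 0 \<longleftrightarrow> x = \<zero>\<^bsub>R\<^esub>)) \<and>
     (\<forall>x\<in>carrier R. \<forall>y\<in>carrier R. w (x \<otimes>\<^bsub>R\<^esub> y) = w x * w y) \<and>
     (\<forall>x\<in>carrier R. \<forall>y\<in>carrier R. w (x \<oplus>\<^bsub>R\<^esub> y) \<le> w x + w y)"

text \<open>The completion of a field \<open>R\<close> at an absolute value \<open>w\<close> is the ring of \<open>w\<close>-Cauchy sequences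
  modulo the ideal of null sequences.\<close>

definition cauchy_seqs :: "('a, 'm) ring_scheme \<Rightarrow> ('a \<Rightarrow> real) \<Rightarrow> (nat \<Rightarrow> 'a) set" where
  "cauchy_seqs R w = {x. range x \<subseteq> carrier R \<and>
     (\<forall>\<epsilon>>0. \<exists>N. \<forall>m\<ge>N. \<forall>n\<ge>N. w (x m \<ominus>\<^bsub>R\<^esub> x n) < \<epsilon>)}"

definition cauchy_ring :: "('a, 'm) ring_scheme \<Rightarrow> ('a \<Rightarrow> real) \<Rightarrow> (nat \<Rightarrow> 'a) ring" where
  "cauchy_ring R w =
     \<lparr>carrier = cauchy_seqs R w,
      monoid.mult = (\<lambda>x y n. x n \<otimes>\<^bsub>R\<^esub> y n), one = (\<lambda>n. \<one>\<^bsub>R\<^esub>),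
      ring.zero = (\<lambda>n. \<zero>\<^bsub>R\<^esub>), add = (\<lambda>x y n. x n \<oplus>\<^bsub>R\<^esub> y n)\<rparr>"

definition null_seqs :: "('a, 'm) ring_scheme \<Rightarrow> ('a \<Rightarrow> real) \<Rightarrow> (nat \<Rightarrow> 'a) set" where
  "null_seqs R w = {x \<in> cauchy_seqs R w. (\<lambda>n. w (x n)) \<longlonglongrightarrow> 0}"

definition completion :: "('a, 'm) ring_scheme \<Rightarrow> ('a \<Rightarrow> real) \<Rightarrow> (nat \<Rightarrow> 'a) set ring" where
  "completion R w = cauchy_ring R w Quot null_seqs R w"

definition completion_class ::
    "('a, 'm) ring_scheme \<Rightarrow> ('a \<Rightarrow> real) \<Rightarrow> (nat \<Rightarrow> 'a) \<Rightarrow> (nat \<Rightarrow> 'a) set" where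
  "completion_class R w x = null_seqs R w +>\<^bsub>cauchy_ring R w\<^esub> x"

definition completion_embed ::
    "('a, 'm) ring_scheme \<Rightarrow> ('a \<Rightarrow> real) \<Rightarrow> 'a \<Rightarrow> (nat \<Rightarrow> 'a) set" where
  "completion_embed R w a = completion_class R w (\<lambda>n. a)"

text \<open>The limit does not depend on the representative.\<close>

definition completion_abs :: "('a \<Rightarrow> real) \<Rightarrow> (nat \<Rightarrow> 'a) set \<Rightarrow> real" where
  "completion_abs w A = lim (\<lambda>n. w ((SOME x. x \<in> A) n))"

text \<open>The completion of a subfield \<open>k\<close>, viewed inside the completion of \<open>R\<close>.\<close>

definition completion_of_subfield ::
    "('a, 'm) ring_scheme \<Rightarrow> ('a \<Rightarrow> real) \<Rightarrow> 'a set \<Rightarrow> (nat \<Rightarrow> 'a) set set" where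
  "completion_of_subfield R w k =
     completion_class R w ` {x \<in> cauchy_seqs R w. range x \<subseteq> k}"

text \<open>The absolute value is nonarchimedean from here up to \<open>inertial_degree\<close>.\<close>

definition valuation_ring :: "('a, 'm) ring_scheme \<Rightarrow> ('a \<Rightarrow> real) \<Rightarrow> ('a, 'm) ring_scheme" where
  "valuation_ring R w = R\<lparr>carrier := {x \<in> carrier R. w x \<le> 1}\<rparr>"

definition valuation_ideal :: "('a, 'm) ring_scheme \<Rightarrow> ('a \<Rightarrow> real) \<Rightarrow> 'a set" where
  "valuation_ideal R w = {x \<in> carrier R. w x < 1}"

definition residue_field :: "('a, 'm) ring_scheme \<Rightarrow> ('a \<Rightarrow> real) \<Rightarrow> 'a set ring" where
  "residue_field R w = valuation_ring R w Quot valuation_ideal R w"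

definition characteristic :: "('a, 'm) ring_scheme \<Rightarrow> nat" where
  "characteristic R = group.ord (add_monoid R) \<one>\<^bsub>R\<^esub>"

text \<open>The index of the value group of the subfield \<open>k\<close> in the value group of \<open>E\<close>, computed as the
  number of its cosets.\<close>

definition ramification_index :: "('a, 'm) ring_scheme \<Rightarrow> ('a \<Rightarrow> real) \<Rightarrow> 'a set \<Rightarrow> nat" where
  "ramification_index E w k =
     card ((\<lambda>x. (\<lambda>y. w x * w y) ` (k - {\<zero>\<^bsub>E\<^esub>})) ` (carrier E - {\<zero>\<^bsub>E\<^esub>}))"

text \<open>The degree of the residue field of \<open>E\<close> over the image in it of the residue field of the
  subfield \<open>k\<close>.\<close>

definition inertial_degree :: "('a, 'm) ring_scheme \<Rightarrow> ('a \<Rightarrow> real) \<Rightarrow> 'a set \<Rightarrow> nat" where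
  "inertial_degree E w k =
     ring.dim (residue_field E w)
       ((\<lambda>x. valuation_ideal E w +>\<^bsub>valuation_ring E w\<^esub> x) ` {x \<in> k. w x \<le> 1})
       (carrier (residue_field E w))"

definition finite_galois :: "('a, 'm) ring_scheme \<Rightarrow> 'a set \<Rightarrow> bool" where
  "finite_galois E k \<longleftrightarrow>
     field E \<and> subfield k E \<and> ring.finite_dimension E k (carrier E) \<and>
     {x \<in> carrier E. \<forall>\<sigma>\<in>ring_iso E E. (\<forall>y\<in>k. \<sigma> y = y) \<longrightarrow> \<sigma> x = x} = k"

text \<open>\<open>u\<close> is the extension of the absolute value \<open>w\<close> along \<open>\<iota>\<close>. It is unique on \<open>carrier E\<close> if
  \<open>R\<close> is complete.\<close>

definition finite_galois_valued_extension ::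
    "('a, 'm) ring_scheme \<Rightarrow> ('a \<Rightarrow> real) \<Rightarrow> ('b, 'n) ring_scheme \<Rightarrow> ('a \<Rightarrow> 'b) \<Rightarrow> ('b \<Rightarrow> real) \<Rightarrow> bool"
  where
  "finite_galois_valued_extension R w E \<iota> u \<longleftrightarrow>
     \<iota> \<in> ring_hom R E \<and> finite_galois E (\<iota> ` carrier R) \<and>
     absolute_value E u \<and> (\<forall>x\<in>carrier R. u (\<iota> x) = w x)"

abbreviation \<C> :: "complex ring" where
  "\<C> \<equiv> ring_of_type_algebra"

text \<open>Number fields are subfields of the complex numbers, so that the elements of \<open>\<C>\<close> algebraic
  over \<open>F\<close> form an algebraic closure of \<open>F\<close>.\<close>

definition number_field :: "complex set \<Rightarrow> bool" where
  "number_field F \<longleftrightarrow> subfield F \<C> \<and> ring.finite_dimension \<C> \<rat> F"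

abbreviation field_of :: "complex set \<Rightarrow> complex ring" where
  "field_of F \<equiv> \<C>\<lparr>carrier := F\<rparr>"

definition global_degree :: "complex set \<Rightarrow> nat" where
  "global_degree F = ring.dim \<C> \<rat> F"

definition padic_abs :: "nat \<Rightarrow> rat \<Rightarrow> real" where
  "padic_abs p r = (if r = 0 then 0 else
     real p powi (int (multiplicity (int p) (snd (quotient_of r)))
                  - int (multiplicity (int p) (fst (quotient_of r)))))"

text \<open>A place is represented by its unique absolute value restricting to the usual or to a
  \<open>p\<close>-adic absolute value on the rationals. Values outside \<open>F\<close> are pinned down by
  \<^const>\<open>extensional\<close>, so that distinct functions are distinct places.\<close>

definition archimedean_places :: "complex set \<Rightarrow> (complex \<Rightarrow> real) set" where
  "archimedean_places F = {w \<in> extensional F. absolute_value (field_of F) w \<and>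
     (\<forall>r. w (of_rat r) = \<bar>of_rat r\<bar>)}"

definition nonarchimedean_places :: "complex set \<Rightarrow> (complex \<Rightarrow> real) set" where
  "nonarchimedean_places F = {w \<in> extensional F. absolute_value (field_of F) w \<and>
     (\<exists>p. Factorial_Ring.prime p \<and> (\<forall>r. w (of_rat r) = padic_abs p r))}"

definition places :: "complex set \<Rightarrow> (complex \<Rightarrow> real) set" where
  "places F = archimedean_places F \<union> nonarchimedean_places F"

abbreviation completion_at :: "complex set \<Rightarrow> (complex \<Rightarrow> real) \<Rightarrow> (nat \<Rightarrow> complex) set ring" where
  "completion_at F w \<equiv> completion (field_of F) w"

definition local_degree :: "complex set \<Rightarrow> (complex \<Rightarrow> real) \<Rightarrow> nat" where
  "local_degree F w =
     ring.dim (completion_at F w) (completion_of_subfield (field_of F) w \<rat>)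
       (carrier (completion_at F w))"

definition place_weight :: "complex set \<Rightarrow> (complex \<Rightarrow> real) \<Rightarrow> real" where
  "place_weight F w = real (local_degree F w) / real (global_degree F)"

definition residue_order :: "complex set \<Rightarrow> (complex \<Rightarrow> real) \<Rightarrow> nat" where
  "residue_order F w = Coset.order (residue_field (completion_at F w) (completion_abs w))"

definition residue_char :: "complex set \<Rightarrow> (complex \<Rightarrow> real) \<Rightarrow> nat" where
  "residue_char F w = characteristic (residue_field (completion_at F w) (completion_abs w))"

text \<open>Only finitely many terms are nonzero. The value is the same for every number field \<open>F\<close>
  containing \<open>\<alpha>\<close>; the height uses the field generated by \<open>\<alpha>\<close> over the rationals.\<close>

definition height_over :: "complex set \<Rightarrow> complex \<Rightarrow> real" where
  "height_over F \<alpha> = (\<Sum>\<^sub>\<infinity>w\<in>places F. place_weight F w * ln (max 1 (w \<alpha>)))"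

definition weil_height :: "complex \<Rightarrow> real" where
  "weil_height \<alpha> = height_over (generate_field \<C> {\<alpha>}) \<alpha>"

definition liminf_on :: "'a set \<Rightarrow> ('a \<Rightarrow> real) \<Rightarrow> ereal" where
  "liminf_on A h = (SUP F\<in>{F. finite F \<and> F \<subseteq> A}. INF \<alpha>\<in>A - F. ereal (h \<alpha>))"

text \<open>The minimal polynomial \<open>ring.Irr \<C> K \<alpha>\<close> is a list of coefficients in \<open>K\<close>, which are
  mapped to \<open>L v\<close> through the completion of \<open>K\<close> at \<open>v\<close>.\<close>

definition totally ::
    "complex set \<Rightarrow> (complex \<Rightarrow> real) set \<Rightarrow> ((complex \<Rightarrow> real) \<Rightarrow> ('b, 'n) ring_scheme) \<Rightarrow>
     ((complex \<Rightarrow> real) \<Rightarrow> (nat \<Rightarrow> complex) set \<Rightarrow> 'b) \<Rightarrow> complex set" where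
  "totally K S L \<iota> = {\<alpha>. ring.algebraic \<C> K \<alpha> \<and>
     (\<forall>v\<in>S. ring.splitted (L v)
        (map (\<lambda>a. \<iota> v (completion_embed (field_of K) v a)) (ring.Irr \<C> K \<alpha>)))}"

end

theory Submission
  imports Defs "Berlekamp_Zassenhaus.Mahler_Measure" "Jordan_Normal_Form.Determinant"
    "Jordan_Normal_Form.Char_Poly" "HOL-Real_Asymp.Real_Asymp"
begin

text \<open>For a place \<open>v\<close> in \<open>S\<close>, spread points \<open>y\<^sub>1, \<dots>, y\<^sub>n\<close> as evenly as possible over the valuation ring
  of \<open>L\<^sub>v\<close> by means of digit expansions. The product of the factors \<open>x - \<tau> y\<^sub>j\<close> over the Galois
  group has coefficients in \<open>K\<^sub>v\<close>, and a monic polynomial that agrees with it up to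
  \<open>p\<^sub>v\<close> to the power \<open>n (1 / (e\<^sub>v (q\<^sub>v\<^sup>f - 1)) + o(1))\<close>, where \<open>n\<close> is the degree, splits in \<open>L\<^sub>v\<close>: the
  number of roots in each residue disc is what Legendre's formula counts for a factorial.

  By the pigeonhole principle there is a nonzero algebraic integer \<open>\<gamma>\<close> of \<open>K\<close> that is divisible by the
  required power of \<open>p\<^sub>v\<close> at every \<open>v\<close> and whose coordinates are bounded by the product of these powers,
  each with exponent weighted by \<open>N\<^sub>v\<close>. Reducing modulo \<open>\<gamma>\<close> gives a monic polynomial \<open>f\<close> over the integers
  of \<open>K\<close> that satisfies all the local conditions and has coefficients of the same size. Landau's
  inequality bounds the Mahler measure of its norm to the rationals, and some irreducible factor of
  the norm does not exceed the average. This factor shares a root with \<open>f\<close>, whose height is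
  the normalized logarithmic Mahler measure. Adding small multiples of \<open>\<gamma>\<close> to the constant term
  of \<open>f\<close> avoids any given finite set of roots.\<close>

section \<open>Subfields of the complex numbers and their completions\<close>

text \<open>The main local term is \<open>n / (Q - 1)\<close>; every other loss, from coinciding
  conjugates, perturbations and rounding to powers of \<open>p\<close>, is logarithmic in the degree
  and vanishes on division by it. The local estimate is carried out with the index
  \<open>ram\<close> of the value group over the closure of \<rat>, which is at least e_v, and is
  weakened to e_v at the end.

  Three obstacles shape the argument. The absolute value on L_v is given merely as an extension, so
  its Galois invariance has to be derived from completeness and finite dimension. Conjugates of well
  spread points may coincide, so the points are moved inside small discs until all their conjugates
  are distinct, with a quantitative separation. At the global end the height has to be read off from
  an abstractly defined set of places: each archimedean one is charged to a set
  \<open>{z, cnj z}\<close> of roots of the minimal polynomial, each nonarchimedean one contributes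
  zero because the root is an algebraic integer, and upper bounds for the local degrees then
  suffice.\<close>

locale valued_field = field R for R (structure) +
  fixes u :: "'a \<Rightarrow> real"
  assumes av: "absolute_value R u"
begin

lemma u_nonneg: "x \<in> carrier R \<Longrightarrow> 0 \<le> u x"
  and u_eq_0: "x \<in> carrier R \<Longrightarrow> u x = 0 \<longleftrightarrow> x = \<zero>"
  and u_mult: "x \<in> carrier R \<Longrightarrow> y \<in> carrier R \<Longrightarrow> u (x \<otimes> y) = u x * u y"
  and u_add: "x \<in> carrier R \<Longrightarrow> y \<in> carrier R \<Longrightarrow> u (x \<oplus> y) \<le> u x + u y"
  using av unfolding absolute_value_def by blast+

lemma u_zero [simp]: "u \<zero> = 0"
  using u_eq_0 by blast

lemma u_pos: "x \<in> carrier R \<Longrightarrow> x \<noteq> \<zero> \<Longrightarrow> 0 < u x"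
  using u_nonneg u_eq_0 by (metis less_eq_real_def)

lemma u_one [simp]: "u \<one> = 1"
  using u_mult[of \<one> \<one>] u_eq_0[of \<one>] one_not_zero by simp

lemma u_uminus: "x \<in> carrier R \<Longrightarrow> u (\<ominus> x) = u x"
proof -
  assume x: "x \<in> carrier R"
  have "(\<ominus> \<one>) \<otimes> (\<ominus> \<one>) = \<one>"
    by (metis l_minus l_one minus_minus one_closed a_inv_closed)
  then have "u (\<ominus> \<one>) * u (\<ominus> \<one>) = 1"
    by (metis u_mult u_one one_closed a_inv_closed)
  then have "u (\<ominus> \<one>) = 1"
    using u_nonneg[of "\<ominus> \<one>"] by (simp add: square_eq_1_iff)
  moreover have "\<ominus> x = (\<ominus> \<one>) \<otimes> x"
    using x by (simp add: l_minus)
  ultimately show ?thesis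
    using u_mult[of "\<ominus> \<one>" x] x by simp
qed

lemma u_minus_commute: "x \<in> carrier R \<Longrightarrow> y \<in> carrier R \<Longrightarrow> u (x \<ominus> y) = u (y \<ominus> x)"
  using u_uminus[of "x \<ominus> y"] by (metis a_inv_closed a_minus_def a_comm add.inv_closed minus_add minus_closed minus_minus)

lemma u_minus: "x \<in> carrier R \<Longrightarrow> y \<in> carrier R \<Longrightarrow> u (x \<ominus> y) \<le> u x + u y"
  using u_add[of x "\<ominus> y"] u_uminus[of y] by (simp add: a_minus_def)

lemma u_minus_ge: "x \<in> carrier R \<Longrightarrow> y \<in> carrier R \<Longrightarrow> u x - u y \<le> u (x \<ominus> y)"
proof -
  assume xy: "x \<in> carrier R" "y \<in> carrier R"
  have "x = (x \<ominus> y) \<oplus> y"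
    using xy by (simp add: a_minus_def a_assoc l_neg)
  then show ?thesis
    using u_add[of "x \<ominus> y" y] xy by simp
qed

lemma u_triangle:
  "\<lbrakk>x \<in> carrier R; y \<in> carrier R; z \<in> carrier R\<rbrakk> \<Longrightarrow> u (x \<ominus> z) \<le> u (x \<ominus> y) + u (y \<ominus> z)"
proof -
  assume a: "x \<in> carrier R" "y \<in> carrier R" "z \<in> carrier R"
  have "x \<ominus> z = (x \<ominus> y) \<oplus> (y \<ominus> z)"
    using a by (simp add: a_minus_def a_assoc) (metis a_assoc a_inv_closed l_neg l_zero)
  then show ?thesis
    using u_add[of "x \<ominus> y" "y \<ominus> z"] a by simp
qed

lemma u_inv: "x \<in> carrier R \<Longrightarrow> x \<noteq> \<zero> \<Longrightarrow> u (inv x) = inverse (u x)"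
proof -
  assume x: "x \<in> carrier R" "x \<noteq> \<zero>"
  then have "x \<in> Units R"
    by (simp add: field_Units)
  then have "u x * u (inv x) = 1"
    using u_mult[of x "inv x"] x by simp
  then show ?thesis
    by (metis inverse_unique)
qed

lemma u_pow: "x \<in> carrier R \<Longrightarrow> u (x [^] (n::nat)) = u x ^ n"
  by (induction n) (simp_all add: u_mult)

definition cauchy_in :: "(nat \<Rightarrow> 'a) \<Rightarrow> bool" where
  "cauchy_in x \<longleftrightarrow> (\<forall>\<epsilon>>0. \<exists>N. \<forall>m\<ge>N. \<forall>n\<ge>N. u (x m \<ominus> x n) < \<epsilon>)"

definition complete_set :: "'a set \<Rightarrow> bool" where
  "complete_set k \<longleftrightarrow>
     (\<forall>x. range x \<subseteq> k \<longrightarrow> cauchy_in x \<longrightarrow> (\<exists>l\<in>k. (\<lambda>n. u (x n \<ominus> l)) \<longlonglongrightarrow> 0))"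

lemma cauchy_inI:
  assumes "\<And>n. x n \<in> carrier R" "l \<in> carrier R" "(\<lambda>n. u (x n \<ominus> l)) \<longlonglongrightarrow> 0"
  shows "cauchy_in x"
  unfolding cauchy_in_def
proof (intro allI impI)
  fix e :: real assume "0 < e"
  then obtain N where N: "\<And>n. n \<ge> N \<Longrightarrow> u (x n \<ominus> l) < e / 2"
    using LIMSEQ_D[OF assms(3), of "e / 2"] assms u_nonneg by auto
  have "u (x m \<ominus> x n) < e" if "m \<ge> N" "n \<ge> N" for m n
    using u_triangle[of "x m" l "x n"] u_minus_commute[of l "x n"] N[OF that(1)] N[OF that(2)] assms
    by fastforce
  then show "\<exists>N. \<forall>m\<ge>N. \<forall>n\<ge>N. u (x m \<ominus> x n) < e"
    by blast
qed

lemma limit_unique: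
  assumes "\<And>n. x n \<in> carrier R" "l \<in> carrier R" "l' \<in> carrier R"
    "(\<lambda>n. u (x n \<ominus> l)) \<longlonglongrightarrow> 0" "(\<lambda>n. u (x n \<ominus> l')) \<longlonglongrightarrow> 0"
  shows "l = l'"
proof -
  have "(\<lambda>n. u (x n \<ominus> l) + u (x n \<ominus> l')) \<longlonglongrightarrow> 0 + 0"
    by (intro tendsto_add assms)
  moreover have "u (l \<ominus> l') \<le> u (x n \<ominus> l) + u (x n \<ominus> l')" for n
    using u_triangle[of l "x n" l'] u_minus_commute[of l "x n"] assms by simp
  ultimately have "u (l \<ominus> l') \<le> 0"
    by (intro LIMSEQ_le_const[where X = "\<lambda>n. u (x n \<ominus> l) + u (x n \<ominus> l')"]) auto
  then have "l \<ominus> l' = \<zero>"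
    using u_eq_0[of "l \<ominus> l'"] u_nonneg[of "l \<ominus> l'"] assms by simp
  then show ?thesis
    using assms by (simp add: r_right_minus_eq)
qed

end

section \<open>Absolute values on subfields of the complex numbers\<close>

lemma C_simps [simp]:
  "carrier (field_of F) = F" "monoid.mult (field_of F) = (*)" "monoid.one (field_of F) = 1"
  "ring.zero (field_of F) = 0" "ring.add (field_of F) = (+)"
  "carrier \<C> = UNIV" "monoid.mult \<C> = (*)" "monoid.one \<C> = 1" "ring.zero \<C> = 0" "ring.add \<C> = (+)"
  by (simp_all add: ring_of_type_algebra_def)

lemma field_C: "field \<C>"
  by (rule field_from_type_algebra)

lemma ring_C: "ring \<C>"
  using field_C by (simp add: field_def domain_def cring_def)

lemma C_a_inv [simp]: "\<ominus>\<^bsub>\<C>\<^esub> x = - x"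
proof -
  interpret field \<C> by (rule field_C)
  have "- x + x = 0" by simp
  then show ?thesis
    using minus_equality[of "- x" x] by simp
qed

lemma C_m_inv [simp]: "x \<noteq> 0 \<Longrightarrow> inv\<^bsub>\<C>\<^esub> x = inverse x"
proof -
  interpret field \<C> by (rule field_C)
  assume "x \<noteq> 0"
  then show ?thesis
    using comm_inv_char[of x "inverse x"] by simp
qed

locale complex_subfield =
  fixes F :: "complex set"
  assumes sf: "subfield F \<C>"
begin

lemma field_F: "field (field_of F)"
  using ring.subfield_iff(2)[OF ring_C sf] by simp

lemma
  shows F_0 [simp]: "0 \<in> F" and F_1 [simp]: "1 \<in> F"
    and F_add [simp]: "x \<in> F \<Longrightarrow> y \<in> F \<Longrightarrow> x + y \<in> F"
    and F_uminus [simp]: "x \<in> F \<Longrightarrow> - x \<in> F"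
    and F_mult [simp]: "x \<in> F \<Longrightarrow> y \<in> F \<Longrightarrow> x * y \<in> F"
  using subfieldE(1)[OF sf] subringE[of F \<C>] subfieldE by (force simp: )+

lemma F_diff [simp]: "x \<in> F \<Longrightarrow> y \<in> F \<Longrightarrow> x - y \<in> F"
  using F_add[of x "- y"] by simp

lemma F_inverse [simp]: "x \<in> F \<Longrightarrow> inverse x \<in> F"
  using ring.subfield_m_inv(1)[OF ring_C sf, of x] by (cases "x = 0") auto

lemma F_divide [simp]: "x \<in> F \<Longrightarrow> y \<in> F \<Longrightarrow> x / y \<in> F"
  by (simp add: divide_inverse)

lemma F_power [simp]: "x \<in> F \<Longrightarrow> x ^ n \<in> F"
  by (induction n) auto

lemma F_sum [simp]: "(\<And>i. i \<in> I \<Longrightarrow> f i \<in> F) \<Longrightarrow> sum f I \<in> F"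
  by (induction I rule: infinite_finite_induct) auto

lemma F_of_nat [simp]: "of_nat n \<in> F"
  by (induction n) auto

lemma F_of_int [simp]: "of_int n \<in> F"
  by (cases n rule: int_cases2) auto

lemma F_of_rat [simp]: "of_rat r \<in> F"
  by (cases r) (simp add: of_rat_rat)

lemma Rats_F: "\<rat> \<subseteq> F"
  by (auto elim: Rats_cases)

lemma F_a_inv: "x \<in> F \<Longrightarrow> \<ominus>\<^bsub>field_of F\<^esub> x = - x"
proof -
  interpret field "field_of F" by (rule field_F)
  assume "x \<in> F"
  then show ?thesis
    using minus_equality[of "- x" x] by simp
qed

lemma F_a_minus: "x \<in> F \<Longrightarrow> y \<in> F \<Longrightarrow> x \<ominus>\<^bsub>field_of F\<^esub> y = x - y"
  by (simp add: a_minus_def F_a_inv)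

end

locale valued_subfield = complex_subfield +
  fixes w :: "complex \<Rightarrow> real"
  assumes w_av: "absolute_value (field_of F) w"
begin

sublocale V: valued_field "field_of F" w
  using field_F w_av by (simp add: valued_field_def valued_field_axioms_def)

lemmas w_nonneg = V.u_nonneg[simplified] and w_eq_0 = V.u_eq_0[simplified]
  and w_mult = V.u_mult[simplified] and w_add = V.u_add[simplified]
  and w_0 [simp] = V.u_zero[simplified] and w_1 [simp] = V.u_one[simplified]

lemma w_uminus: "x \<in> F \<Longrightarrow> w (- x) = w x"
  using V.u_uminus[of x] by (simp add: F_a_inv)

lemma w_diff_ge: "x \<in> F \<Longrightarrow> y \<in> F \<Longrightarrow> w x - w y \<le> w (x - y)"
  using V.u_minus_ge[of x y] by (simp add: F_a_minus)

lemma w_inverse: "x \<in> F \<Longrightarrow> w (inverse x) = inverse (w x)"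
proof (cases "x = 0")
  case False
  assume "x \<in> F"
  then have "w x * w (inverse x) = 1"
    using w_mult[of x "inverse x"] False by simp
  then show ?thesis
    by (metis inverse_unique)
qed simp

lemma w_divide: "x \<in> F \<Longrightarrow> y \<in> F \<Longrightarrow> w (x / y) = w x / w y"
  by (simp add: divide_inverse w_mult w_inverse)

lemma w_power: "x \<in> F \<Longrightarrow> w (x ^ n) = w x ^ n"
  by (induction n) (simp_all add: w_mult)

section \<open>Cauchy sequences modulo null sequences\<close>

abbreviation "Cs \<equiv> cauchy_seqs (field_of F) w"
abbreviation "Ns \<equiv> null_seqs (field_of F) w"
abbreviation "CR \<equiv> cauchy_ring (field_of F) w"
abbreviation "E \<equiv> completion (field_of F) w"
abbreviation "cls \<equiv> completion_class (field_of F) w"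
abbreviation "emb \<equiv> completion_embed (field_of F) w"
abbreviation "cabs \<equiv> completion_abs w"

lemma Cs_iff: "x \<in> Cs \<longleftrightarrow>
  (\<forall>n. x n \<in> F) \<and> (\<forall>\<epsilon>>0. \<exists>N. \<forall>m\<ge>N. \<forall>n\<ge>N. w (x m - x n) < \<epsilon>)"
proof (cases "\<forall>n. x n \<in> F")
  case True
  then have "x m \<ominus>\<^bsub>field_of F\<^esub> x n = x m - x n" for m n
    by (simp add: F_a_minus)
  then show ?thesis
    using True unfolding cauchy_seqs_def by auto
qed (auto simp: cauchy_seqs_def)

lemma Cs_in: "x \<in> Cs \<Longrightarrow> x n \<in> F"
  by (simp add: Cs_iff)

lemma Cs_const: "a \<in> F \<Longrightarrow> (\<lambda>n. a) \<in> Cs"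
  by (simp add: Cs_iff)

lemma Cs_w_convergent: "x \<in> Cs \<Longrightarrow> convergent (\<lambda>n. w (x n))"
proof -
  assume x: "x \<in> Cs"
  have "Cauchy (\<lambda>n. w (x n))"
    unfolding Cauchy_def
  proof (intro allI impI)
    fix e :: real assume "0 < e"
    then obtain N where N: "\<forall>m\<ge>N. \<forall>n\<ge>N. w (x m - x n) < e"
      using x Cs_iff by blast
    have "dist (w (x m)) (w (x n)) < e" if "m \<ge> N" "n \<ge> N" for m n
      using w_diff_ge[of "x m" "x n"] w_diff_ge[of "x n" "x m"] N that Cs_in[OF x]
      by (fastforce simp: dist_real_def abs_less_iff)
    then show "\<exists>M. \<forall>m\<ge>M. \<forall>n\<ge>M. dist (w (x m)) (w (x n)) < e"
      by blast
  qed
  then show ?thesis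
    by (simp add: Cauchy_convergent_iff)
qed

lemma Cs_bounded: "x \<in> Cs \<Longrightarrow> \<exists>B>0. \<forall>n. w (x n) \<le> B"
  using Cs_w_convergent[THEN convergent_imp_Bseq] by (force simp: Bseq_def abs_le_iff)

lemma Cs_add: "x \<in> Cs \<Longrightarrow> y \<in> Cs \<Longrightarrow> (\<lambda>n. x n + y n) \<in> Cs"
proof -
  assume x: "x \<in> Cs" and y: "y \<in> Cs"
  have "\<exists>N. \<forall>m\<ge>N. \<forall>n\<ge>N. w (x m + y m - (x n + y n)) < e" if "e > 0" for e
  proof -
    obtain N M where N: "\<forall>m\<ge>N. \<forall>n\<ge>N. w (x m - x n) < e/2" and M: "\<forall>m\<ge>M. \<forall>n\<ge>M. w (y m - y n) < e/2"
      using x y \<open>e > 0\<close> unfolding Cs_iff by (meson half_gt_zero)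
    have "w (x m + y m - (x n + y n)) < e" if "m \<ge> max N M" "n \<ge> max N M" for m n
    proof -
      have "w ((x m - x n) + (y m - y n)) \<le> w (x m - x n) + w (y m - y n)"
        using Cs_in x y by (intro w_add) auto
      also have "\<dots> < e"
        using N M that by (smt (verit) field_sum_of_halves max.boundedE)
      finally show ?thesis
        by (simp add: algebra_simps)
    qed
    then show ?thesis by blast
  qed
  then show ?thesis
    using x y by (simp add: Cs_iff)
qed

lemma Cs_mult: "x \<in> Cs \<Longrightarrow> y \<in> Cs \<Longrightarrow> (\<lambda>n. x n * y n) \<in> Cs"
proof -
  assume x: "x \<in> Cs" and y: "y \<in> Cs"
  obtain A where A: "A > 0" "\<And>n. w (x n) \<le> A" using Cs_bounded[OF x] by blast
  obtain B where B: "B > 0" "\<And>n. w (y n) \<le> B" using Cs_bounded[OF y] by blast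
  have "\<exists>N. \<forall>m\<ge>N. \<forall>n\<ge>N. w (x m * y m - x n * y n) < e" if "e > 0" for e
  proof -
    obtain N M where N: "\<forall>m\<ge>N. \<forall>n\<ge>N. w (x m - x n) < e/(2*B)"
      and M: "\<forall>m\<ge>M. \<forall>n\<ge>M. w (y m - y n) < e/(2*A)"
      using x y \<open>e > 0\<close> A B unfolding Cs_iff by (meson divide_pos_pos mult_pos_pos zero_less_numeral)
    have "w (x m * y m - x n * y n) < e" if mn: "m \<ge> max N M" "n \<ge> max N M" for m n
    proof -
      have "x m * y m - x n * y n = (x m - x n) * y m + x n * (y m - y n)"
        by (simp add: algebra_simps)
      then have "w (x m * y m - x n * y n) \<le> w (x m - x n) * w (y m) + w (x n) * w (y m - y n)"
        using w_add[of "(x m - x n) * y m" "x n * (y m - y n)"] Cs_in x y by (simp add: w_mult)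
      also have "\<dots> \<le> w (x m - x n) * B + A * w (y m - y n)"
        using A B w_nonneg Cs_in x y by (intro add_mono mult_left_mono mult_right_mono) auto
      also have "w (x m - x n) * B < e / 2"
        using N mn B by (auto simp: less_divide_eq algebra_simps)
      also have "A * w (y m - y n) < e / 2"
        using M mn A by (auto simp: less_divide_eq algebra_simps)
      finally show ?thesis
        by simp
    qed
    then show ?thesis by blast
  qed
  then show ?thesis
    using x y by (simp add: Cs_iff)
qed

lemma Cs_uminus: "x \<in> Cs \<Longrightarrow> (\<lambda>n. - x n) \<in> Cs"
  using Cs_mult[OF Cs_const[of "-1"], of x] by simp

lemma Cs_diff: "x \<in> Cs \<Longrightarrow> y \<in> Cs \<Longrightarrow> (\<lambda>n. x n - y n) \<in> Cs"
  using Cs_add[OF _ Cs_uminus, of x y] by simp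

lemma CR_simps [simp]:
  "carrier CR = Cs" "monoid.mult CR = (\<lambda>x y n. x n * y n)" "monoid.one CR = (\<lambda>n. 1)"
  "ring.zero CR = (\<lambda>n. 0)" "ring.add CR = (\<lambda>x y n. x n + y n)"
  by (simp_all add: cauchy_ring_def)

lemma cring_CR: "cring CR"
proof (rule cringI)
  show "abelian_group CR"
  proof (rule abelian_groupI)
    fix x assume "x \<in> carrier CR"
    then show "\<exists>y\<in>carrier CR. y \<oplus>\<^bsub>CR\<^esub> x = \<zero>\<^bsub>CR\<^esub>"
      using Cs_uminus[of x] by (intro bexI[of _ "\<lambda>n. - x n"]) auto
  qed (auto simp: Cs_add Cs_const algebra_simps)
  show "Group.comm_monoid CR"
    by unfold_locales (auto simp: Cs_mult Cs_const algebra_simps)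
qed (auto simp: algebra_simps)

lemma CR_a_inv: "x \<in> Cs \<Longrightarrow> \<ominus>\<^bsub>CR\<^esub> x = (\<lambda>n. - x n)"
proof -
  interpret cring CR by (rule cring_CR)
  assume "x \<in> Cs"
  then show ?thesis
    using minus_equality[of "\<lambda>n. - x n" x] Cs_uminus[of x] by simp
qed

lemma Ns_iff: "x \<in> Ns \<longleftrightarrow> x \<in> Cs \<and> (\<lambda>n. w (x n)) \<longlonglongrightarrow> 0"
  by (simp add: null_seqs_def)

lemma ideal_Ns: "ideal Ns CR"
proof -
  interpret C: cring CR by (rule cring_CR)
  have mul: "(\<lambda>n. x n * a n) \<in> Ns" if a: "a \<in> Ns" and x: "x \<in> Cs" for a x
  proof -
    obtain A where A: "A > 0" "\<And>n. w (x n) \<le> A" using Cs_bounded[OF x] by blast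
    have "(\<lambda>n. A * w (a n)) \<longlonglongrightarrow> A * 0"
      using a Ns_iff by (intro tendsto_mult tendsto_const) auto
    moreover have "w (x n * a n) \<le> A * w (a n)" "0 \<le> w (x n * a n)" for n
      using A x a w_nonneg Cs_in Ns_iff by (auto simp: w_mult intro!: mult_right_mono)
    ultimately have "(\<lambda>n. w (x n * a n)) \<longlonglongrightarrow> 0"
      by (intro tendsto_sandwich[of "\<lambda>n. 0" "\<lambda>n. w (x n * a n)" _ "\<lambda>n. A * w (a n)"]) auto
    then show ?thesis
      using Cs_mult[OF x] a Ns_iff by auto
  qed
  have add: "(\<lambda>n. a n + b n) \<in> Ns" if a: "a \<in> Ns" and b: "b \<in> Ns" for a b
  proof -
    have "(\<lambda>n. w (a n) + w (b n)) \<longlonglongrightarrow> 0 + 0"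
      using a b Ns_iff by (intro tendsto_add) auto
    moreover have "w (a n + b n) \<le> w (a n) + w (b n)" "0 \<le> w (a n + b n)" for n
      using a b w_nonneg Cs_in Ns_iff w_add by auto
    ultimately have "(\<lambda>n. w (a n + b n)) \<longlonglongrightarrow> 0"
      by (intro tendsto_sandwich[of "\<lambda>n. 0" "\<lambda>n. w (a n + b n)" _ "\<lambda>n. w (a n) + w (b n)"]) auto
    then show ?thesis
      using a b Cs_add Ns_iff by auto
  qed
  show ?thesis
  proof (rule idealI)
    show "ring CR" by (rule C.ring_axioms)
    show "subgroup Ns (add_monoid CR)"
    proof (rule group.subgroupI)
      show "Group.group (add_monoid CR)" by (rule C.a_group)
      fix a assume a: "a \<in> Ns"
      then have "(\<lambda>n. - a n) \<in> Ns"
        using mul[OF a Cs_const[of "-1"]] by simp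
      then show "inv\<^bsub>add_monoid CR\<^esub> a \<in> Ns"
        using CR_a_inv[of a] a Ns_iff unfolding a_inv_def by simp
    next
      have "(\<lambda>n. 0) \<in> Ns"
        by (simp add: Ns_iff Cs_const)
      then show "Ns \<noteq> {}"
        by blast
    qed (use add in \<open>auto simp: Ns_iff\<close>)
  qed (use mul in \<open>force simp: mult.commute\<close>)+
qed

lemma cring_E: "cring E"
  unfolding completion_def by (rule ideal.quotient_is_cring[OF ideal_Ns cring_CR])

lemma cls_hom: "cls \<in> Ring.ring_hom CR E"
  unfolding completion_def using ideal.rcos_ring_hom[OF ideal_Ns]
  by (simp add: completion_class_def[abs_def])

lemma carrier_E: "carrier E = cls ` Cs"
  unfolding completion_def FactRing_def completion_class_def[abs_def]
  by (auto simp: A_RCOSETS_def' )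

lemma cls_in [simp]: "x \<in> Cs \<Longrightarrow> cls x \<in> carrier E"
  by (simp add: carrier_E)

lemma cls_eq_iff: "x \<in> Cs \<Longrightarrow> y \<in> Cs \<Longrightarrow> cls x = cls y \<longleftrightarrow> (\<lambda>n. x n - y n) \<in> Ns"
proof -
  interpret cring CR by (rule cring_CR)
  assume "x \<in> Cs" "y \<in> Cs"
  then show ?thesis
    using quotient_eq_iff_same_a_r_cos[OF ideal_Ns, of x y]
    by (simp add: completion_class_def a_minus_def CR_a_inv)
qed

lemma
  assumes "x \<in> Cs" "y \<in> Cs"
  shows cls_add: "cls x \<oplus>\<^bsub>E\<^esub> cls y = cls (\<lambda>n. x n + y n)"
    and cls_mult: "cls x \<otimes>\<^bsub>E\<^esub> cls y = cls (\<lambda>n. x n * y n)"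
  using ring_hom_add[OF cls_hom] ring_hom_mult[OF cls_hom] assms by auto

lemma cls_one: "cls (\<lambda>n. 1) = \<one>\<^bsub>E\<^esub>"
  using ring_hom_one[OF cls_hom] by simp

lemma cls_zero: "cls (\<lambda>n. 0) = \<zero>\<^bsub>E\<^esub>"
  using ring_hom_zero[OF cls_hom] cring_CR cring_E by (simp add: cring_def)

lemma cls_a_inv: "x \<in> Cs \<Longrightarrow> \<ominus>\<^bsub>E\<^esub> cls x = cls (\<lambda>n. - x n)"
proof -
  interpret cring E by (rule cring_E)
  assume x: "x \<in> Cs"
  have "cls (\<lambda>n. - x n) \<oplus>\<^bsub>E\<^esub> cls x = \<zero>\<^bsub>E\<^esub>"
    using x by (simp add: cls_add Cs_uminus cls_zero)
  then show ?thesis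
    using x minus_equality Cs_uminus by auto
qed

lemma cls_minus: "x \<in> Cs \<Longrightarrow> y \<in> Cs \<Longrightarrow> cls x \<ominus>\<^bsub>E\<^esub> cls y = cls (\<lambda>n. x n - y n)"
  by (simp add: a_minus_def cls_a_inv cls_add Cs_uminus)

text \<open>The representative chosen by \<open>completion_abs\<close> differs from \<open>x\<close>
  by a null sequence, and \<open>w\<close> changes by at most the value of the difference, so both
  sequences of values have the same limit.\<close>

lemma cabs_cls: "x \<in> Cs \<Longrightarrow> (\<lambda>n. w (x n)) \<longlonglongrightarrow> cabs (cls x)"
proof -
  interpret cring CR by (rule cring_CR)
  assume x: "x \<in> Cs"
  define y where "y = (SOME y. y \<in> cls x)"
  have "x \<in> cls x"
    unfolding completion_class_def using x ideal_Ns
    by (simp add: abelian_subgroup.a_rcos_self ideal.axioms(1) abelian_subgroupI3 is_abelian_group)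
  then have "y \<in> cls x"
    unfolding y_def by (rule someI[of "\<lambda>y. y \<in> cls x"])
  then obtain h where h: "h \<in> Ns" "y = (\<lambda>n. h n + x n)"
    unfolding completion_class_def a_r_coset_def' by auto
  then have y: "y \<in> Cs"
    using Cs_add[of h x] x Ns_iff by auto
  have "(\<lambda>n. w (y n)) \<longlonglongrightarrow> cabs (cls x)"
    unfolding completion_abs_def y_def[symmetric] using Cs_w_convergent[OF y] convergent_LIMSEQ_iff by blast
  moreover have "(\<lambda>n. w (y n) - w (x n)) \<longlonglongrightarrow> 0"
  proof (rule tendsto_rabs_zero_cancel, rule tendsto_sandwich[of "\<lambda>n. 0" _ _ "\<lambda>n. w (h n)"])
    have "\<bar>w (y n) - w (x n)\<bar> \<le> w (h n)" for n
      using w_diff_ge[of "y n" "x n"] w_diff_ge[of "x n" "y n"] w_uminus[of "h n"] x y h Ns_iff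
      by (simp add: Cs_in abs_le_iff)
    then show "\<forall>\<^sub>F n in sequentially. \<bar>w (y n) - w (x n)\<bar> \<le> w (h n)"
      by simp
  qed (use h Ns_iff in auto)
  ultimately show ?thesis
    using tendsto_diff by fastforce
qed

lemma cabs_eqI: "x \<in> Cs \<Longrightarrow> (\<lambda>n. w (x n)) \<longlonglongrightarrow> l \<Longrightarrow> cabs (cls x) = l"
  using cabs_cls LIMSEQ_unique by blast

end

section \<open>The completion as a complete valued field\<close>

context valued_subfield
begin

lemma emb_def: "emb a = cls (\<lambda>n. a)"
  by (simp add: completion_embed_def)

lemma emb_in [simp]: "a \<in> F \<Longrightarrow> emb a \<in> carrier E"
  by (simp add: emb_def Cs_const)

lemma cabs_emb: "a \<in> F \<Longrightarrow> cabs (emb a) = w a"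
  unfolding emb_def by (rule cabs_eqI) (simp_all add: Cs_const)

text \<open>A nonzero class has values that stay above some \<open>d > 0\<close> from an index on,
  which makes the termwise inverses Cauchy. Finitely many earlier terms may be \<open>0\<close>,
  where \<open>inverse 0 = 0\<close> keeps them in \<open>F\<close>.\<close>

lemma Cs_inverse: "x \<in> Cs \<Longrightarrow> cls x \<noteq> \<zero>\<^bsub>E\<^esub> \<Longrightarrow> (\<lambda>n. inverse (x n)) \<in> Cs"
proof -
  assume x: "x \<in> Cs" and nz: "cls x \<noteq> \<zero>\<^bsub>E\<^esub>"
  have "cabs (cls x) \<noteq> 0"
    using nz cabs_cls[OF x] x cls_eq_iff[OF x Cs_const[of 0]] by (auto simp: cls_zero[symmetric] Ns_iff)
  moreover have "cabs (cls x) \<ge> 0"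
    by (rule LIMSEQ_le_const[OF cabs_cls[OF x]]) (use w_nonneg Cs_in[OF x] in auto)
  ultimately obtain d where d: "d > 0" "d < cabs (cls x)"
    using dense[of 0 "cabs (cls x)"] by auto
  obtain N0 where N0: "\<And>n. n \<ge> N0 \<Longrightarrow> d < w (x n)"
    using order_tendstoD(1)[OF cabs_cls[OF x] d(2)] by (auto simp: eventually_sequentially)
  have "\<exists>N. \<forall>m\<ge>N. \<forall>n\<ge>N. w (inverse (x m) - inverse (x n)) < e" if "e > 0" for e
  proof -
    obtain N where N: "\<forall>m\<ge>N. \<forall>n\<ge>N. w (x m - x n) < e * (d * d)"
      using x \<open>e > 0\<close> d unfolding Cs_iff by (meson mult_pos_pos)
    have "w (inverse (x m) - inverse (x n)) < e" if "m \<ge> max N N0" "n \<ge> max N N0" for m n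
    proof -
      have d': "d < w (x m)" "d < w (x n)" using N0 that by auto
      then have "x m \<noteq> 0" "x n \<noteq> 0" using d by auto
      then have "inverse (x m) - inverse (x n) = (x n - x m) / (x m * x n)"
        by (simp add: field_simps)
      then have "w (inverse (x m) - inverse (x n)) = w (x n - x m) / (w (x m) * w (x n))"
        using Cs_in[OF x] by (simp add: w_mult w_divide)
      also have "\<dots> \<le> w (x n - x m) / (d * d)"
        using d d' w_nonneg Cs_in[OF x] by (intro divide_left_mono mult_mono mult_pos_pos) auto
      also have "\<dots> < e"
        using N that d by (simp add: divide_less_eq)
      finally show ?thesis .
    qed
    then show ?thesis by blast
  qed
  then show ?thesis
    using Cs_in[OF x] by (simp add: Cs_iff)
qed

lemma cls_inverse:
  assumes "x \<in> Cs" "cls x \<noteq> \<zero>\<^bsub>E\<^esub>"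
  shows "cls x \<otimes>\<^bsub>E\<^esub> cls (\<lambda>n. inverse (x n)) = \<one>\<^bsub>E\<^esub>"
proof -
  have "\<not> (\<lambda>n. w (x n)) \<longlonglongrightarrow> 0"
    using assms cls_eq_iff[OF assms(1) Cs_const[of 0]] by (auto simp: cls_zero[symmetric] Ns_iff)
  then have "cabs (cls x) \<noteq> 0"
    using cabs_cls[OF assms(1)] by auto
  then have "\<forall>\<^sub>F n in sequentially. w (x n) \<noteq> 0"
    by (rule tendsto_imp_eventually_ne[OF cabs_cls[OF assms(1)]])
  then have "\<forall>\<^sub>F n in sequentially. 0 = w (x n * inverse (x n) - 1)"
  proof eventually_elim
    case (elim n)
    then have "x n \<noteq> 0"
      by auto
    then show ?case
      by simp
  qed
  then have "(\<lambda>n. w (x n * inverse (x n) - 1)) \<longlonglongrightarrow> 0"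
    by (rule Lim_transform_eventually[OF tendsto_const])
  then show ?thesis
    using assms Cs_inverse cls_eq_iff[of "\<lambda>n. x n * inverse (x n)" "\<lambda>n. 1"]
    by (simp add: cls_mult cls_one[symmetric] Cs_mult Cs_const Ns_iff Cs_diff)
qed

lemma field_E: "field E"
proof -
  interpret cring E by (rule cring_E)
  have "\<one>\<^bsub>E\<^esub> \<noteq> \<zero>\<^bsub>E\<^esub>"
    using cls_eq_iff[of "\<lambda>n. 1" "\<lambda>n. 0"] LIMSEQ_unique[OF tendsto_const, of "1::real" 0]
    by (auto simp: cls_zero[symmetric] cls_one[symmetric] Ns_iff Cs_const)
  then show ?thesis
  proof (intro cring_fieldI2)
    fix a assume "a \<in> carrier E" "a \<noteq> \<zero>\<^bsub>E\<^esub>"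
    then obtain x where "x \<in> Cs" "a = cls x" "cls x \<noteq> \<zero>\<^bsub>E\<^esub>"
      by (auto simp: carrier_E)
    then show "\<exists>b\<in>carrier E. a \<otimes>\<^bsub>E\<^esub> b = \<one>\<^bsub>E\<^esub>"
      using cls_inverse Cs_inverse by (intro bexI[of _ "cls (\<lambda>n. inverse (x n))"]) auto
  qed auto
qed

lemma cabs_nonneg: "x \<in> carrier E \<Longrightarrow> 0 \<le> cabs x"
  unfolding carrier_E using w_nonneg Cs_in by (auto intro!: LIMSEQ_le_const[OF cabs_cls])

lemma cabs_absolute_value: "absolute_value E cabs"
  unfolding absolute_value_def
proof (intro conjI ballI)
  fix a b assume "a \<in> carrier E" "b \<in> carrier E"
  then obtain x y where xy: "x \<in> Cs" "y \<in> Cs" "a = cls x" "b = cls y"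
    by (auto simp: carrier_E)
  show "cabs (a \<otimes>\<^bsub>E\<^esub> b) = cabs a * cabs b"
    unfolding xy(3,4) cls_mult[OF xy(1,2)]
    using tendsto_mult[OF cabs_cls cabs_cls, OF xy(1,2)] Cs_in xy
    by (intro cabs_eqI Cs_mult) (simp_all add: w_mult)
  show "cabs (a \<oplus>\<^bsub>E\<^esub> b) \<le> cabs a + cabs b"
    unfolding xy(3,4) cls_add[OF xy(1,2)]
    by (rule LIMSEQ_le[OF cabs_cls tendsto_add[OF cabs_cls cabs_cls]])
       (use xy Cs_in w_add in \<open>auto simp: Cs_add\<close>)
next
  fix a assume "a \<in> carrier E"
  then obtain x where x: "x \<in> Cs" "a = cls x"
    by (auto simp: carrier_E)
  show "0 \<le> cabs a"
    by (rule cabs_nonneg) fact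
  show "cabs a = 0 \<longleftrightarrow> a = \<zero>\<^bsub>E\<^esub>"
    using cabs_cls[OF x(1)] cabs_eqI[OF x(1), of 0] x cls_eq_iff[OF x(1) Cs_const[of 0]]
    by (auto simp: cls_zero[symmetric] Ns_iff)
qed

sublocale E: valued_field E cabs
  using field_E cabs_absolute_value by (simp add: valued_field_def valued_field_axioms_def)

lemma emb_hom: "emb \<in> Ring.ring_hom (field_of F) E"
  by (rule ring_hom_memI) (simp_all add: emb_def cls_mult cls_add cls_one Cs_const)

lemma emb_minus: "a \<in> F \<Longrightarrow> b \<in> F \<Longrightarrow> emb a \<ominus>\<^bsub>E\<^esub> emb b = emb (a - b)"
  by (simp add: emb_def cls_minus Cs_const)

abbreviation "clos k \<equiv> completion_of_subfield (field_of F) w k"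

lemma clos_iff: "a \<in> clos k \<longleftrightarrow> (\<exists>x. x \<in> Cs \<and> range x \<subseteq> k \<and> a = cls x)"
  by (auto simp: completion_of_subfield_def)

lemma clos_F: "clos F = carrier E"
  by (auto simp: completion_of_subfield_def carrier_E Cs_iff image_iff) 

lemma emb_clos: "a \<in> k \<Longrightarrow> a \<in> F \<Longrightarrow> emb a \<in> clos k"
  by (auto simp: clos_iff emb_def Cs_const intro!: exI[of _ "\<lambda>n. a"])

lemma clos_in: "a \<in> clos k \<Longrightarrow> a \<in> carrier E"
  by (auto simp: clos_iff)

lemma cls_approx:
  assumes "x \<in> Cs" "e > 0"
  shows "\<exists>N. \<forall>n\<ge>N. cabs (cls x \<ominus>\<^bsub>E\<^esub> emb (x n)) < e"
proof -
  obtain N where N: "\<forall>m\<ge>N. \<forall>n\<ge>N. w (x m - x n) < e / 2"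
    using assms unfolding Cs_iff by (meson half_gt_zero)
  have "cabs (cls x \<ominus>\<^bsub>E\<^esub> emb (x n)) \<le> e / 2" if "n \<ge> N" for n
  proof -
    have xn: "x n \<in> F" using assms Cs_in by blast
    have "(\<lambda>m. w (x m - x n)) \<longlonglongrightarrow> cabs (cls (\<lambda>m. x m - x n))"
      using assms xn by (intro cabs_cls Cs_diff Cs_const)
    then have "cabs (cls (\<lambda>m. x m - x n)) \<le> e / 2"
      by (rule LIMSEQ_le_const2) (use N that in \<open>auto intro!: exI[of _ N] less_imp_le\<close>)
    then show ?thesis
      using assms xn by (simp add: emb_def cls_minus Cs_const)
  qed
  moreover have "e / 2 < e"
    using assms by simp
  ultimately show ?thesis
    by (intro exI[of _ N]) (meson order.strict_trans1)
qed

lemma clos_approx: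
  assumes "a \<in> clos k" "e > 0"
  shows "\<exists>b\<in>k. b \<in> F \<and> cabs (a \<ominus>\<^bsub>E\<^esub> emb b) < e"
proof -
  obtain x where x: "x \<in> Cs" "range x \<subseteq> k" "a = cls x"
    using assms clos_iff by blast
  then show ?thesis
    using cls_approx[OF x(1) assms(2)] Cs_in[OF x(1)] by (metis order_refl range_subsetD)
qed

lemma clos_limit:
  assumes a: "\<And>n. a n \<in> k" "\<And>n. a n \<in> F" and c: "E.cauchy_in (\<lambda>n. emb (a n))"
  shows "a \<in> Cs" "(\<lambda>n. cabs (emb (a n) \<ominus>\<^bsub>E\<^esub> cls a)) \<longlonglongrightarrow> 0" "cls a \<in> clos k"
proof -
  show Cs: "a \<in> Cs"
    using c a unfolding E.cauchy_in_def Cs_iff by (simp add: emb_minus cabs_emb)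
  then show "cls a \<in> clos k"
    using a by (auto simp: clos_iff)
  show "(\<lambda>n. cabs (emb (a n) \<ominus>\<^bsub>E\<^esub> cls a)) \<longlonglongrightarrow> 0"
  proof (rule LIMSEQ_I)
    fix e :: real assume "0 < e"
    then show "\<exists>no. \<forall>n\<ge>no. norm (cabs (emb (a n) \<ominus>\<^bsub>E\<^esub> cls a) - 0) < e"
      using cls_approx[OF Cs, of e] a Cs
      by (simp add: E.u_minus_commute[of "emb _"] cabs_nonneg)
  qed
qed

text \<open>Diagonal argument: each class in the sequence is replaced by an element of
  \<open>k\<close> within \<open>1 / (n + 1)\<close> of it. These elements form a Cauchy sequence in
  the field itself, and its class is the limit.\<close>

lemma complete_clos: "E.complete_set (clos k)"
  unfolding E.complete_set_def
proof (intro allI impI)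
  fix x assume x: "range x \<subseteq> clos k" and cx: "E.cauchy_in x"
  have "\<exists>b\<in>k. b \<in> F \<and> cabs (x n \<ominus>\<^bsub>E\<^esub> emb b) < inverse (Suc n)" for n
    using clos_approx[of "x n" k "inverse (Suc n)"] x by auto
  then obtain a where a: "\<And>n. a n \<in> k" "\<And>n. a n \<in> F" "\<And>n. cabs (x n \<ominus>\<^bsub>E\<^esub> emb (a n)) < inverse (Suc n)"
    by metis
  have xE: "x n \<in> carrier E" for n
    using x clos_in by auto
  have lim: "(\<lambda>n. cabs (x n \<ominus>\<^bsub>E\<^esub> emb (a n))) \<longlonglongrightarrow> 0"
  proof (rule tendsto_sandwich[of "\<lambda>n. 0" _ _ "\<lambda>n. inverse (real (Suc n))"])
    show "(\<lambda>n. inverse (real (Suc n))) \<longlonglongrightarrow> 0"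
      by (rule LIMSEQ_inverse_real_of_nat)
  qed (use a xE cabs_nonneg in \<open>auto intro!: always_eventually less_imp_le\<close>)
  have "E.cauchy_in (\<lambda>n. emb (a n))"
    unfolding E.cauchy_in_def
  proof (intro allI impI)
    fix e :: real assume "0 < e"
    then obtain N M where N: "\<And>m n. m \<ge> N \<Longrightarrow> n \<ge> N \<Longrightarrow> cabs (x m \<ominus>\<^bsub>E\<^esub> x n) < e / 3"
      and M: "\<And>n. n \<ge> M \<Longrightarrow> cabs (x n \<ominus>\<^bsub>E\<^esub> emb (a n)) < e / 3"
      using cx LIMSEQ_D[OF lim, of "e / 3"] xE a cabs_nonneg unfolding E.cauchy_in_def
      by (metis (no_types, lifting) abs_of_nonneg diff_zero divide_pos_pos real_norm_def E.minus_closed emb_in zero_less_numeral)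
    have "cabs (emb (a m) \<ominus>\<^bsub>E\<^esub> emb (a n)) < e" if mn: "m \<ge> max N M" "n \<ge> max N M" for m n
    proof -
      have "cabs (emb (a m) \<ominus>\<^bsub>E\<^esub> emb (a n)) \<le> cabs (emb (a m) \<ominus>\<^bsub>E\<^esub> x m) + (cabs (x m \<ominus>\<^bsub>E\<^esub> x n) + cabs (x n \<ominus>\<^bsub>E\<^esub> emb (a n)))"
        using E.u_triangle[of "emb (a m)" "x m" "emb (a n)"] E.u_triangle[of "x m" "x n" "emb (a n)"] xE a by simp
      also have "\<dots> < e"
        using N[of m n] M[of m] M[of n] mn xE a by (simp add: E.u_minus_commute[of "emb _" "x _"])
      finally show ?thesis .
    qed
    then show "\<exists>N. \<forall>m\<ge>N. \<forall>n\<ge>N. cabs (emb (a m) \<ominus>\<^bsub>E\<^esub> emb (a n)) < e"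
      by blast
  qed
  note cl = clos_limit[OF a(1,2) this]
  have "(\<lambda>n. cabs (x n \<ominus>\<^bsub>E\<^esub> emb (a n)) + cabs (emb (a n) \<ominus>\<^bsub>E\<^esub> cls a)) \<longlonglongrightarrow> 0 + 0"
    by (intro tendsto_add lim cl)
  then have "(\<lambda>n. cabs (x n \<ominus>\<^bsub>E\<^esub> cls a)) \<longlonglongrightarrow> 0"
  proof (intro tendsto_sandwich[of "\<lambda>n. 0" "\<lambda>n. cabs (x n \<ominus>\<^bsub>E\<^esub> cls a)" _ "\<lambda>n. cabs (x n \<ominus>\<^bsub>E\<^esub> emb (a n)) + cabs (emb (a n) \<ominus>\<^bsub>E\<^esub> cls a)"])
    show "\<forall>\<^sub>F n in sequentially. cabs (x n \<ominus>\<^bsub>E\<^esub> cls a) \<le> cabs (x n \<ominus>\<^bsub>E\<^esub> emb (a n)) + cabs (emb (a n) \<ominus>\<^bsub>E\<^esub> cls a)"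
      using xE a cl by (intro always_eventually allI E.u_triangle) auto
  qed (use xE cl cabs_nonneg in auto)
  then show "\<exists>l\<in>clos k. (\<lambda>n. cabs (x n \<ominus>\<^bsub>E\<^esub> l)) \<longlonglongrightarrow> 0"
    using cl by blast
qed

lemma subfield_clos:
  assumes k: "subfield k \<C>" "k \<subseteq> F"
  shows "subfield (clos k) E"
proof -
  interpret k: complex_subfield k
    using k by (simp add: complex_subfield_def)
  show ?thesis
  proof (rule E.subfieldI')
    show "subring (clos k) E"
    proof (rule E.subringI)
      show "clos k \<subseteq> carrier E"
        using clos_in by blast
      show "\<one>\<^bsub>E\<^esub> \<in> clos k"
        using emb_clos[of 1 k] by (simp add: emb_def cls_one)
      show "\<ominus>\<^bsub>E\<^esub> h \<in> clos k" if h: "h \<in> clos k" for h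
      proof -
        obtain x where "x \<in> Cs" "range x \<subseteq> k" "h = cls x"
          using h unfolding clos_iff by blast
        then show ?thesis
          unfolding clos_iff using Cs_uminus[of x] by (intro exI[of _ "\<lambda>n. - x n"]) (auto simp: cls_a_inv image_subset_iff)
      qed
      show "h1 \<otimes>\<^bsub>E\<^esub> h2 \<in> clos k" if h: "h1 \<in> clos k" "h2 \<in> clos k" for h1 h2
      proof -
        obtain x y where "x \<in> Cs" "range x \<subseteq> k" "h1 = cls x" "y \<in> Cs" "range y \<subseteq> k" "h2 = cls y"
          using h unfolding clos_iff by blast
        then show ?thesis
          unfolding clos_iff using Cs_mult[of x y] by (intro exI[of _ "\<lambda>n. x n * y n"]) (auto simp: cls_mult image_subset_iff)
      qed
      show "h1 \<oplus>\<^bsub>E\<^esub> h2 \<in> clos k" if h: "h1 \<in> clos k" "h2 \<in> clos k" for h1 h2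
      proof -
        obtain x y where "x \<in> Cs" "range x \<subseteq> k" "h1 = cls x" "y \<in> Cs" "range y \<subseteq> k" "h2 = cls y"
          using h unfolding clos_iff by blast
        then show ?thesis
          unfolding clos_iff using Cs_add[of x y] by (intro exI[of _ "\<lambda>n. x n + y n"]) (auto simp: cls_add image_subset_iff)
      qed
    qed
  next
    fix h assume "h \<in> clos k - {\<zero>\<^bsub>E\<^esub>}"
    then obtain x where x: "x \<in> Cs" "range x \<subseteq> k" "h = cls x" "cls x \<noteq> \<zero>\<^bsub>E\<^esub>"
      by (metis DiffD1 DiffD2 clos_iff singletonI)
    have "inv\<^bsub>E\<^esub> h = cls (\<lambda>n. inverse (x n))"
      unfolding x(3) by (rule E.comm_inv_char) (use x cls_inverse[of x] Cs_inverse[of x] in auto)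
    then show "inv\<^bsub>E\<^esub> h \<in> clos k"
      using x Cs_inverse unfolding clos_iff by (intro exI[of _ "\<lambda>n. inverse (x n)"]) (auto simp: image_subset_iff)
  qed
qed

end

section \<open>Finite-dimensional spaces over a complete subfield\<close>

lemma set_map2_subset:
  assumes "\<And>a b. a \<in> A \<Longrightarrow> b \<in> B \<Longrightarrow> f a b \<in> C" "set xs \<subseteq> A" "set ys \<subseteq> B"
  shows "set (map2 f xs ys) \<subseteq> C"
proof
  fix z assume "z \<in> set (map2 f xs ys)"
  then obtain a b where "(a, b) \<in> set (zip xs ys)" "z = f a b"
    by auto
  then show "z \<in> C"
    using assms set_zip_leftD set_zip_rightD by (metis subsetD)
qed

context valued_field
begin

lemma combine_minus:
  "\<lbrakk>length Ks = length Us; length Ls = length Us; set Ks \<subseteq> carrier R; set Ls \<subseteq> carrier R; set Us \<subseteq> carrier R\<rbrakk>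
    \<Longrightarrow> combine (map2 (\<lambda>x y. x \<ominus> y) Ks Ls) Us = combine Ks Us \<ominus> combine Ls Us"
proof (induction Us arbitrary: Ks Ls)
  case (Cons v Us)
  then obtain a Ks' b Ls' where [simp]: "Ks = a # Ks'" "Ls = b # Ls'"
    by (metis length_Suc_conv length_Cons)
  have c: "a \<in> carrier R" "b \<in> carrier R" "v \<in> carrier R" "set Us \<subseteq> carrier R"
    "combine Ks' Us \<in> carrier R" "combine Ls' Us \<in> carrier R"
    using Cons.prems by auto
  have "(a \<ominus> b) \<otimes> v \<oplus> (combine Ks' Us \<ominus> combine Ls' Us)
      = a \<otimes> v \<oplus> combine Ks' Us \<ominus> (b \<otimes> v \<oplus> combine Ls' Us)"
    using c by algebra
  then show ?case
    using Cons by simp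
qed (simp add: a_minus_def)

lemma u_combine_le:
  "\<lbrakk>length Ks = length Us; set Ks \<subseteq> carrier R; set Us \<subseteq> carrier R\<rbrakk>
    \<Longrightarrow> u (combine Ks Us) \<le> (\<Sum>i<length Us. u (Ks ! i) * u (Us ! i))"
proof (induction Us arbitrary: Ks)
  case (Cons v Us)
  then obtain a Ks' where [simp]: "Ks = a # Ks'"
    by (metis length_Suc_conv length_Cons)
  have "u (a \<otimes> v \<oplus> combine Ks' Us) \<le> u a * u v + u (combine Ks' Us)"
    using u_add[of "a \<otimes> v" "combine Ks' Us"] Cons.prems by (auto simp: u_mult)
  then show ?case
    using Cons.IH[of Ks'] Cons.prems by (simp add: sum.lessThan_Suc_shift del: sum.lessThan_Suc)
qed simp

text \<open>Continuity of all coordinate functionals with one constant \<open>C\<close>; together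
  with \<open>u_combine_le\<close> it expresses that \<open>u\<close> is equivalent to the maximum
  norm of the coordinates.\<close>

definition coord_bound :: "'a set \<Rightarrow> 'a list \<Rightarrow> real \<Rightarrow> bool" where
  "coord_bound k Us C \<longleftrightarrow> (\<forall>Ks. set Ks \<subseteq> k \<longrightarrow> length Ks = length Us \<longrightarrow>
     (\<forall>i<length Us. u (Ks ! i) \<le> C * u (combine Ks Us)))"

text \<open>Bounded coordinate functionals turn a Cauchy sequence of vectors into Cauchy sequences
  of coordinates, whose limits exist in \<open>k\<close> and recombine to the limit vector.\<close>

lemma complete_Span:
  assumes k: "subfield k R" and c: "complete_set k" and Us: "set Us \<subseteq> carrier R"
    and C: "0 < C" "coord_bound k Us C"
  shows "complete_set (Span k Us)"
  unfolding complete_set_def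
proof (intro allI impI)
  fix x assume x: "range x \<subseteq> Span k Us" "cauchy_in x"
  have kR: "k \<subseteq> carrier R"
    using subfieldE(3)[OF k] .
  have "\<exists>Ks. set Ks \<subseteq> k \<and> length Ks = length Us \<and> x n = combine Ks Us" for n
    using Span_mem_iff_length_version[OF k Us, of "x n"] x(1) by auto
  then obtain Ks where Ks: "\<And>n. set (Ks n) \<subseteq> k" "\<And>n. length (Ks n) = length Us" "\<And>n. x n = combine (Ks n) Us"
    by metis
  have sub: "a \<ominus> b \<in> k" if "a \<in> k" "b \<in> k" for a b
    using that subringE(5,7)[OF subfieldE(1)[OF k]] by (simp add: a_minus_def)
  have nth: "Ks n ! i \<in> k" if "i < length Us" for n i
    using Ks that by (metis nth_mem subsetD)
  have xc: "x n \<in> carrier R" for n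
    using x(1) Span_in_carrier[OF kR Us] by auto
  have "\<exists>l\<in>k. (\<lambda>n. u (Ks n ! i \<ominus> l)) \<longlonglongrightarrow> 0" if i: "i < length Us" for i
  proof -
    have "cauchy_in (\<lambda>n. Ks n ! i)"
      unfolding cauchy_in_def
    proof (intro allI impI)
      fix e :: real assume "0 < e"
      then obtain N where N: "\<forall>m\<ge>N. \<forall>n\<ge>N. u (x m \<ominus> x n) < e / C"
        using x(2) C(1) unfolding cauchy_in_def by (meson divide_pos_pos)
      have "u (Ks m ! i \<ominus> Ks n ! i) < e" if mn: "m \<ge> N" "n \<ge> N" for m n
      proof -
        define D where "D = map2 (\<lambda>x y. x \<ominus> y) (Ks m) (Ks n)"
        have D: "set D \<subseteq> k"
          unfolding D_def by (rule set_map2_subset[where A = k and B = k]) (use Ks sub in auto)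
        have D': "length D = length Us" "D ! i = Ks m ! i \<ominus> Ks n ! i"
          unfolding D_def using Ks i by auto
        have "combine D Us = x m \<ominus> x n"
          unfolding D_def Ks(3) using Ks kR Us by (intro combine_minus) (simp_all add: order_trans[of _ k])
        then have "u (D ! i) \<le> C * u (x m \<ominus> x n)"
          using C(2) D D' i unfolding coord_bound_def by metis
        also have "\<dots> < e"
          using N mn C(1) by (simp add: less_divide_eq mult.commute)
        finally show ?thesis
          using D' by simp
      qed
      then show "\<exists>N. \<forall>m\<ge>N. \<forall>n\<ge>N. u (Ks m ! i \<ominus> Ks n ! i) < e"
        by blast
    qed
    then show ?thesis
      using c nth[OF i] unfolding complete_set_def by (simp add: image_subset_iff)
  qed
  then obtain l where l: "\<And>i. i < length Us \<Longrightarrow> l i \<in> k" "\<And>i. i < length Us \<Longrightarrow> (\<lambda>n. u (Ks n ! i \<ominus> l i)) \<longlonglongrightarrow> 0"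
    by metis
  define L where "L = map l [0..<length Us]"
  have L: "set L \<subseteq> k" "length L = length Us" "\<And>i. i < length Us \<Longrightarrow> L ! i = l i"
    using l by (auto simp: L_def)
  have LS: "combine L Us \<in> Span k Us"
    using Span_mem_iff_length_version[OF k Us] L by blast
  have "(\<lambda>n. \<Sum>i<length Us. u (Ks n ! i \<ominus> l i) * u (Us ! i)) \<longlonglongrightarrow> (\<Sum>i<length Us. 0 * u (Us ! i))"
    using l by (intro tendsto_sum tendsto_mult tendsto_const) auto
  moreover have "u (x n \<ominus> combine L Us) \<le> (\<Sum>i<length Us. u (Ks n ! i \<ominus> l i) * u (Us ! i))" for n
  proof -
    define D where "D = map2 (\<lambda>x y. x \<ominus> y) (Ks n) L"
    have "set D \<subseteq> k"
      unfolding D_def by (rule set_map2_subset[where A = k and B = k]) (use Ks L sub in auto)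
    then have D: "set D \<subseteq> carrier R" "length D = length Us"
      using Ks L kR by (auto simp: D_def)
    have "combine D Us = x n \<ominus> combine L Us"
      unfolding D_def Ks(3) using Ks L kR Us by (intro combine_minus) (simp_all add: order_trans[of _ k])
    moreover have "D ! i = Ks n ! i \<ominus> l i" if "i < length Us" for i
      using that L Ks by (simp add: D_def)
    ultimately show ?thesis
      using u_combine_le[OF D(2,1) Us] by simp
  qed
  moreover have "0 \<le> u (x n \<ominus> combine L Us)" for n
    using xc LS Span_in_carrier[OF kR Us] by (intro u_nonneg) auto
  ultimately have "(\<lambda>n. u (x n \<ominus> combine L Us)) \<longlonglongrightarrow> 0"
    by (intro tendsto_sandwich[of "\<lambda>n. 0" "\<lambda>n. u (x n \<ominus> combine L Us)" _ "\<lambda>n. \<Sum>i<length Us. u (Ks n ! i \<ominus> l i) * u (Us ! i)"]) auto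
  then show "\<exists>l\<in>Span k Us. (\<lambda>n. u (x n \<ominus> l)) \<longlonglongrightarrow> 0"
    using LS by blast
qed

text \<open>Otherwise elements of \<open>V\<close> would converge to \<open>b\<close>, and
  completeness together with uniqueness of limits would place \<open>b\<close> in
  \<open>V\<close>.\<close>

lemma complete_dist_pos:
  assumes c: "complete_set V" and V: "V \<subseteq> carrier R" and b: "b \<in> carrier R" "b \<notin> V"
  shows "\<exists>d>0. \<forall>s\<in>V. d \<le> u (b \<ominus> s)"
proof (rule ccontr)
  assume "\<not> ?thesis"
  then have "\<exists>s\<in>V. u (b \<ominus> s) < inverse (Suc n)" for n :: nat
    by (meson inverse_positive_iff_positive not_le of_nat_0_less_iff zero_less_Suc)
  then obtain s where s: "\<And>n. s n \<in> V" "\<And>n. u (b \<ominus> s n) < inverse (Suc n)"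
    by metis
  have sc: "s n \<in> carrier R" for n
    using s V by auto
  have lim: "(\<lambda>n. u (s n \<ominus> b)) \<longlonglongrightarrow> 0"
  proof (rule tendsto_sandwich[of "\<lambda>n. 0" _ _ "\<lambda>n. inverse (real (Suc n))"])
    show "(\<lambda>n. inverse (real (Suc n))) \<longlonglongrightarrow> 0"
      by (rule LIMSEQ_inverse_real_of_nat)
  qed (use s sc b u_nonneg in \<open>auto simp: u_minus_commute[of _ b] intro!: always_eventually less_imp_le\<close>)
  have "cauchy_in s"
    by (rule cauchy_inI[OF sc b(1) lim])
  then obtain l where l: "l \<in> V" "(\<lambda>n. u (s n \<ominus> l)) \<longlonglongrightarrow> 0"
    using c s unfolding complete_set_def by (metis image_subset_iff)
  then have "b = l"
    using limit_unique[OF sc b(1) _ lim] V by blast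
  then show False
    using b l by simp
qed

text \<open>Induction on the basis. The span of the tail is complete by induction, so
  \<open>v\<close> has a positive distance \<open>d\<close> from it. This bounds the coefficient of
  \<open>v\<close>, and subtracting that term reduces the other coordinates to the tail.\<close>

theorem coord_bound_exists:
  assumes k: "subfield k R" and c: "complete_set k"
  shows "independent k Us \<Longrightarrow> \<exists>C>0. coord_bound k Us C"
proof (induction Us)
  case Nil
  then show ?case
    by (intro exI[of _ 1]) (simp add: coord_bound_def)
next
  case (Cons v Us)
  have v: "v \<notin> Span k Us" "v \<in> carrier R" and ind: "independent k Us"
    using independent_backwards[OF Cons.prems] by auto
  have Us: "set Us \<subseteq> carrier R"
    using independent_in_carrier[OF ind] .
  have kR: "k \<subseteq> carrier R"
    using subfieldE(3)[OF k] .
  obtain C where C: "C > 0" "coord_bound k Us C"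
    using Cons.IH[OF ind] by blast
  obtain d where d: "d > 0" "\<And>s. s \<in> Span k Us \<Longrightarrow> d \<le> u (v \<ominus> s)"
    using complete_dist_pos[OF complete_Span[OF k c Us C] Span_in_carrier[OF kR Us] v(2,1)] by blast
  \<comment> \<open>\<open>1 / d\<close> serves the coefficient of \<open>v\<close>; for the others
    the tail \<open>s\<close> has value at most \<open>(1 + u v / d) * u y\<close>, which is
    multiplied by the constant \<open>C\<close> of the tail.\<close>
  define C' where "C' = 1 / d + C * (1 + u v / d)"
  have uv: "u v \<ge> 0"
    using v u_nonneg by simp
  have "C' > 0" "1 / d \<le> C'" "C * (1 + u v / d) \<le> C'"
    unfolding C'_def using C d uv by (auto intro!: add_pos_pos add_pos_nonneg mult_pos_pos)
  moreover have "coord_bound k (v # Us) C'"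
    unfolding coord_bound_def
  proof (intro allI impI)
    fix Ks i assume Ks: "set Ks \<subseteq> k" "length Ks = length (v # Us)" and i: "i < length (v # Us)"
    then obtain a Ks' where [simp]: "Ks = a # Ks'" and l: "length Ks' = length Us"
      by (metis length_Suc_conv length_Cons)
    define s where "s = combine Ks' Us"
    define y where "y = a \<otimes> v \<oplus> s"
    have a: "a \<in> k" "a \<in> carrier R" and sS: "s \<in> Span k Us" and sc: "s \<in> carrier R"
      using Ks kR l Span_mem_iff_length_version[OF k Us] Span_in_carrier[OF kR Us] by (auto simp: s_def)
    have yc: "y \<in> carrier R"
      using a sc v by (simp add: y_def)
    have ua: "u a * d \<le> u y"
    proof (cases "a = \<zero>")
      case False
      have ia: "inv a \<in> k" "inv a \<in> carrier R" "a \<otimes> inv a = \<one>"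
        using subfield_m_inv[OF k] a False kR by auto
      define s' where "s' = \<ominus> (inv a \<otimes> s)"
      have s': "s' \<in> Span k Us"
        using Span_subgroup_props(4)[OF k Us] Span_smult_closed[OF k Us] ia sS by (simp add: s'_def)
      have "a \<otimes> (v \<ominus> s') = a \<otimes> v \<oplus> (a \<otimes> inv a) \<otimes> s"
        using a v ia(2) sc unfolding s'_def by algebra
      then have "y = a \<otimes> (v \<ominus> s')"
        using ia sc by (simp add: y_def)
      then have "u y = u a * u (v \<ominus> s')"
        using a v s' Span_in_carrier[OF kR Us] by (auto intro!: u_mult)
      then show ?thesis
        using d(2)[OF s'] u_nonneg[OF a(2)] by (simp add: mult_left_mono)
    qed (use yc u_nonneg in auto)
    then have ua': "u a \<le> u y / d"
      using d by (simp add: le_divide_eq)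
    have "s = y \<ominus> a \<otimes> v"
      using a v sc unfolding y_def by algebra
    then have "u s \<le> u y + u a * u v"
      using u_minus[of y "a \<otimes> v"] yc a v by (simp add: u_mult)
    also have "\<dots> \<le> u y + u y / d * u v"
      using mult_right_mono[OF ua' uv] by simp
    finally have us: "u s \<le> (1 + u v / d) * u y"
      by (simp add: algebra_simps)
    have uy: "u y \<ge> 0"
      using yc u_nonneg by simp
    have "combine Ks (v # Us) = y"
      by (simp add: y_def s_def)
    moreover have "u (Ks ! i) \<le> C' * u y"
    proof (cases i)
      case 0
      then have "u (Ks ! i) \<le> 1 / d * u y"
        using ua' by simp
      also have "\<dots> \<le> C' * u y"
        using \<open>1 / d \<le> C'\<close> uy by (rule mult_right_mono)
      finally show ?thesis .
    next
      case (Suc j)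
      then have "u (Ks ! i) \<le> C * u s"
        using C(2) Ks l i unfolding coord_bound_def s_def by auto
      also have "\<dots> \<le> C * ((1 + u v / d) * u y)"
        using us C by (intro mult_left_mono) auto
      also have "\<dots> \<le> C' * u y"
        using \<open>C * (1 + u v / d) \<le> C'\<close> uy by (simp flip: mult.assoc add: mult_right_mono)
      finally show ?thesis .
    qed
    ultimately show "u (Ks ! i) \<le> C' * u (combine Ks (v # Us))"
      by simp
  qed
  ultimately show ?case
    by blast
qed

corollary complete_independent_Span:
  assumes "subfield k R" "complete_set k" "independent k Us"
  shows "complete_set (Span k Us)"
  using coord_bound_exists[OF assms] complete_Span[OF assms(1,2) independent_in_carrier[OF assms(3)]] by blast

text \<open>Linearity and the coordinate bound give \<open>u (\<tau> y) \<le> B * u y\<close> for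
  some \<open>B\<close>. Applied to all powers of \<open>x\<close>, multiplicativity forces the
  constant down to 1. This replaces uniqueness of the extended absolute value.\<close>

lemma isometry_of_linear:
  assumes k: "subfield k R" "complete_set k" and fd: "finite_dimension k (carrier R)"
    and \<tau>: "\<tau> \<in> Ring.ring_hom R R" "\<And>a. a \<in> k \<Longrightarrow> \<tau> a = a" and x: "x \<in> carrier R"
  shows "u (\<tau> x) \<le> u x"
proof -
  obtain Us where Us: "independent k Us" "Span k Us = carrier R" "set Us \<subseteq> carrier R"
    using finite_dimensionE[OF k(1) fd] exists_base[OF k(1)] by blast
  obtain C where C: "C > 0" "coord_bound k Us C"
    using coord_bound_exists[OF k Us(1)] by blast
  have kR: "k \<subseteq> carrier R"
    using subfieldE(3)[OF k(1)] .
  have \<tau>c: "\<tau> y \<in> carrier R" if "y \<in> carrier R" for y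
    using ring_hom_closed[OF \<tau>(1)] that .
  define B where "B = (\<Sum>i<length Us. C * u (\<tau> (Us ! i)))"
  have bound: "u (\<tau> y) \<le> B * u y" if y: "y \<in> carrier R" for y
  proof -
    obtain Ks where Ks: "set Ks \<subseteq> k" "length Ks = length Us" "y = combine Ks Us"
      using Span_mem_iff_length_version[OF k(1) Us(3), of y] Us(2) y by auto
    interpret ring_hom_ring R R \<tau>
      by (rule ring_hom_ringI2[OF ring_axioms ring_axioms \<tau>(1)])
    have \<tau>Us: "set (map \<tau> Us) \<subseteq> carrier R"
      using Us(3) \<tau>c by auto
    have "\<tau> y = combine (map \<tau> Ks) (map \<tau> Us)"
      unfolding Ks(3) using Ks kR Us by (intro combine_hom[symmetric]) auto
    also have "map \<tau> Ks = Ks"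
      using Ks \<tau>(2) by (intro map_idI) auto
    also have "u (combine Ks (map \<tau> Us)) \<le> (\<Sum>i<length Us. u (Ks ! i) * u (\<tau> (Us ! i)))"
      using u_combine_le[of Ks "map \<tau> Us"] Ks kR \<tau>Us by auto
    also have "\<dots> \<le> (\<Sum>i<length Us. C * u (combine Ks Us) * u (\<tau> (Us ! i)))"
      using C(2) Ks Us(3) \<tau>c unfolding coord_bound_def
      by (intro sum_mono mult_right_mono) (auto intro!: u_nonneg \<tau>c simp: subset_iff)
    also have "\<dots> = B * u y"
      unfolding B_def Ks(3) by (simp add: sum_distrib_left sum_distrib_right mult.commute mult.left_commute)
    finally show ?thesis .
  qed
  show ?thesis
  proof (rule ccontr)
    assume "\<not> ?thesis"
    then have less: "u x < u (\<tau> x)" by simp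
    then have "x \<noteq> \<zero>"
      using ring_hom_zero[OF \<tau>(1) ring_axioms ring_axioms] by auto
    then have ux: "u x > 0"
      using x u_pos by simp
    define r where "r = u (\<tau> x) / u x"
    have "r > 1"
      using less ux by (simp add: r_def)
    then obtain n where n: "B < r ^ n"
      using real_arch_pow by blast
    have "\<tau> (x [^] n) = \<tau> x [^] n"
      by (induction n) (use x ring_hom_mult[OF \<tau>(1)] ring_hom_one[OF \<tau>(1)] in auto)
    then have "u (\<tau> x) ^ n \<le> B * u x ^ n"
      using bound[of "x [^] n"] x \<tau>c[OF x] by (simp add: u_pow)
    then have "r ^ n \<le> B"
      using ux by (simp add: r_def power_divide divide_le_eq)
    then show False
      using n by simp
  qed
qed

end

section \<open>Ultrametric fields and their residue fields\<close>

context valued_field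
begin

abbreviation nat_elem :: "nat \<Rightarrow> 'a" where
  "nat_elem n \<equiv> [n] \<cdot> \<one>"

lemma nat_elem_in [simp]: "nat_elem n \<in> carrier R"
  by simp

lemma nat_elem_Suc: "nat_elem (Suc n) = nat_elem n \<oplus> \<one>"
  by (simp add: add.nat_pow_Suc)

lemma nat_elem_add: "nat_elem (m + n) = nat_elem m \<oplus> nat_elem n"
  by (simp add: add.nat_pow_mult)

lemma add_minus_cancel: "x \<in> carrier R \<Longrightarrow> y \<in> carrier R \<Longrightarrow> (x \<oplus> y) \<ominus> y = x"
  by algebra

lemma nat_elem_mult: "nat_elem (m * n) = nat_elem m \<otimes> nat_elem n"
proof (induction n)
  case (Suc n)
  then show ?case
    by (simp add: nat_elem_add nat_elem_Suc r_distr a_comm)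
qed simp

lemma nat_elem_pow: "nat_elem (m ^ n) = nat_elem m [^] n"
proof (induction n)
  case (Suc n)
  then show ?case
    by (simp add: nat_elem_mult m_comm)
qed simp

lemma nat_elem_subring: "subring k R \<Longrightarrow> nat_elem n \<in> k"
  by (induction n) (simp_all add: nat_elem_Suc subringE(2,3,7))

definition ultrametric :: bool where
  "ultrametric \<longleftrightarrow> (\<forall>x\<in>carrier R. \<forall>y\<in>carrier R. u (x \<oplus> y) \<le> max (u x) (u y))"

context
  fixes x
  assumes x: "x \<in> carrier R"
begin

text \<open>Horner expressions in \<open>x\<close> of degree \<open>n\<close> with natural coefficients: closed under
  multiplication by \<open>\<one> \<oplus> x\<close> at the cost of raising the degree by one, which replaces the
  binomial theorem.\<close>

primrec horner :: "nat \<Rightarrow> 'a set" where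
  "horner 0 = range nat_elem"
| "horner (Suc n) = {nat_elem c \<oplus> x \<otimes> z | c z. z \<in> horner n}"

lemma horner_in: "z \<in> horner n \<Longrightarrow> z \<in> carrier R"
  using x by (induction n arbitrary: z) auto

lemma horner_add: "z \<in> horner n \<Longrightarrow> nat_elem c \<oplus> z \<in> horner n"
proof (cases n)
  case 0
  assume "z \<in> horner n"
  then obtain c' where "z = nat_elem c'"
    using 0 by auto
  then have "nat_elem c \<oplus> z = nat_elem (c + c')"
    by (simp add: nat_elem_add)
  then show ?thesis
    using 0 by auto
next
  case (Suc m)
  assume "z \<in> horner n"
  then obtain c' z' where "z = nat_elem c' \<oplus> x \<otimes> z'" "z' \<in> horner m"
    using Suc by auto
  then show ?thesis
    using Suc x horner_in[of z' m] by (auto simp: a_assoc[symmetric] nat_elem_add[symmetric])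
qed

lemma horner_mult: "z \<in> horner n \<Longrightarrow> (\<one> \<oplus> x) \<otimes> z \<in> horner (Suc n)"
proof (induction n arbitrary: z)
  case 0
  then obtain c where "z = nat_elem c" by auto
  then have "(\<one> \<oplus> x) \<otimes> z = nat_elem c \<oplus> x \<otimes> nat_elem c"
    using x by (simp add: l_distr)
  then show ?case by auto
next
  case (Suc n)
  then obtain c z' where z: "z = nat_elem c \<oplus> x \<otimes> z'" "z' \<in> horner n"
    by auto
  have "(\<one> \<oplus> x) \<otimes> z = nat_elem c \<oplus> x \<otimes> (nat_elem c \<oplus> (\<one> \<oplus> x) \<otimes> z')"
    using x horner_in[OF z(2)] nat_elem_in[of c] one_closed unfolding z(1) by algebra
  then show ?case
    using horner_add[OF Suc.IH[OF z(2)]] by auto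
qed

lemma horner_bound:
  assumes "u x \<le> 1" "\<And>n. u (nat_elem n) \<le> 1"
  shows "z \<in> horner n \<Longrightarrow> u z \<le> real n + 1"
proof (induction n arbitrary: z)
  case (Suc n)
  then obtain c z' where z: "z = nat_elem c \<oplus> x \<otimes> z'" "z' \<in> horner n"
    by auto
  have "u z \<le> u (nat_elem c) + u x * u z'"
    using u_add[of "nat_elem c" "x \<otimes> z'"] x horner_in[OF z(2)] z by (simp add: u_mult)
  also have "\<dots> \<le> 1 + 1 * (real n + 1)"
    using assms Suc.IH[OF z(2)] x horner_in[OF z(2)] by (intro add_mono mult_mono) (auto intro: u_nonneg)
  finally show ?case by simp
qed (use assms in auto)

text \<open>The power \<open>(\<one> \<oplus> x) [^] n\<close> is a Horner expression of degree
  \<open>n\<close>, so its value is at most \<open>n + 1\<close>; exponential growth of a base above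
  1 would contradict this.\<close>

lemma u_one_add_le:
  assumes "u x \<le> 1" "\<And>n. u (nat_elem n) \<le> 1"
  shows "u (\<one> \<oplus> x) \<le> 1"
proof (rule ccontr)
  assume "\<not> ?thesis"
  then have r: "u (\<one> \<oplus> x) > 1" by simp
  have "(\<one> \<oplus> x) [^] n \<in> horner n" for n
  proof (induction n)
    case 0
    have "\<one> = nat_elem 1" by simp
    then show ?case by (metis horner.simps(1) nat_pow_0 rangeI)
  next
    case (Suc n)
    then show ?case
      using horner_mult[OF Suc] x by (simp add: m_comm)
  qed
  then have "u (\<one> \<oplus> x) ^ n \<le> real n + 1" for n
    using horner_bound[OF assms, of "(\<one> \<oplus> x) [^] n" n] x by (simp add: u_pow)
  moreover have "eventually (\<lambda>n. real n + 1 < u (\<one> \<oplus> x) ^ n) sequentially"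
    using r by real_asymp
  ultimately show False
    using eventually_happens[of _ "sequentially"] by (smt (verit, best) eventually_mono not_le sequentially_bot)
qed

end

text \<open>Dividing by the summand of larger value reduces the claim to sums
  \<open>\<one> \<oplus> x\<close> with \<open>u x \<le> 1\<close>. The criterion lets one property
  of the rationals pass to every field above them.\<close>

theorem ultrametricI:
  assumes "\<And>n. u (nat_elem n) \<le> 1"
  shows ultrametric
proof -
  have le: "u (x \<oplus> y) \<le> u y" if x: "x \<in> carrier R" and y: "y \<in> carrier R" and xy: "u x \<le> u y" for x y
  proof (cases "y = \<zero>")
    case True
    then show ?thesis using x y xy by simp
  next
    case False
    have iy: "inv y \<in> carrier R" "y \<otimes> inv y = \<one>"
      using y False by (simp_all add: field_Units)
    have "x \<oplus> y = y \<otimes> (\<one> \<oplus> inv y \<otimes> x)"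
    proof -
      have "y \<otimes> (\<one> \<oplus> inv y \<otimes> x) = y \<oplus> (y \<otimes> inv y) \<otimes> x"
        using x y iy(1) by algebra
      then show ?thesis
        using x y iy by (simp add: a_comm)
    qed
    moreover have "u (\<one> \<oplus> inv y \<otimes> x) \<le> 1"
      using x y iy False xy u_pos[OF y False]
      by (intro u_one_add_le assms) (auto simp: u_mult u_inv divide_simps)
    ultimately show ?thesis
      using x y iy u_nonneg[OF y] by (simp add: u_mult mult_left_le)
  qed
  show ?thesis
    unfolding ultrametric_def
  proof (intro ballI)
    fix x y assume "x \<in> carrier R" "y \<in> carrier R"
    then show "u (x \<oplus> y) \<le> max (u x) (u y)"
      using le[of x y] le[of y x] by (cases "u x \<le> u y") (auto simp: a_comm)
  qed
qed

end

section \<open>Valuation ring and residue field\<close>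

locale ultrametric_field = valued_field +
  assumes um: ultrametric
begin

lemma u_add_max: "x \<in> carrier R \<Longrightarrow> y \<in> carrier R \<Longrightarrow> u (x \<oplus> y) \<le> max (u x) (u y)"
  using um by (simp add: ultrametric_def)

lemma u_minus_max: "x \<in> carrier R \<Longrightarrow> y \<in> carrier R \<Longrightarrow> u (x \<ominus> y) \<le> max (u x) (u y)"
  using u_add_max[of x "\<ominus> y"] by (simp add: a_minus_def u_uminus)

lemma u_triangle_max:
  "\<lbrakk>x \<in> carrier R; y \<in> carrier R; z \<in> carrier R\<rbrakk> \<Longrightarrow> u (x \<ominus> z) \<le> max (u (x \<ominus> y)) (u (y \<ominus> z))"
proof -
  assume a: "x \<in> carrier R" "y \<in> carrier R" "z \<in> carrier R"
  have "x \<ominus> z = (x \<ominus> y) \<oplus> (y \<ominus> z)"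
    using a by algebra
  then show ?thesis
    using u_add_max[of "x \<ominus> y" "y \<ominus> z"] a by simp
qed

lemma u_eq_of_close:
  assumes "x \<in> carrier R" "y \<in> carrier R" "u (x \<ominus> y) < u x"
  shows "u y = u x"
proof (rule antisym)
  have "y = x \<ominus> (x \<ominus> y)" "x = y \<oplus> (x \<ominus> y)"
    using assms(1,2) by algebra+
  then show "u y \<le> u x" "u x \<le> u y"
    using u_minus_max[of x "x \<ominus> y"] u_add_max[of y "x \<ominus> y"] assms by auto
qed

lemma u_le_of_close:
  "x \<in> carrier R \<Longrightarrow> y \<in> carrier R \<Longrightarrow> u y \<le> max (u x) (u (x \<ominus> y))"
proof -
  assume xy: "x \<in> carrier R" "y \<in> carrier R"
  then have "y = x \<ominus> (x \<ominus> y)"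
    by algebra
  then show ?thesis
    using u_minus_max[of x "x \<ominus> y"] xy by simp
qed

lemma u_nat_elem_le: "u (nat_elem n) \<le> 1"
proof (induction n)
  case (Suc n)
  then show ?case
    using u_add_max[of "nat_elem n" \<one>] by (simp add: nat_elem_Suc)
qed simp

abbreviation "Oring \<equiv> valuation_ring R u"
abbreviation "Mid \<equiv> valuation_ideal R u"
abbreviation "Res \<equiv> residue_field R u"
definition rescls :: "'a \<Rightarrow> 'a set" where
  "rescls x = Mid +>\<^bsub>Oring\<^esub> x"

lemma Oring_simps [simp]:
  "carrier Oring = {x \<in> carrier R. u x \<le> 1}" "monoid.mult Oring = monoid.mult R"
  "monoid.one Oring = \<one>" "ring.zero Oring = \<zero>" "ring.add Oring = ring.add R"
  by (simp_all add: valuation_ring_def)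

lemma subring_O: "subring {x \<in> carrier R. u x \<le> 1} R"
proof (rule subringI)
  fix a b assume "a \<in> {x \<in> carrier R. u x \<le> 1}" "b \<in> {x \<in> carrier R. u x \<le> 1}"
  then show "a \<otimes> b \<in> {x \<in> carrier R. u x \<le> 1}" "a \<oplus> b \<in> {x \<in> carrier R. u x \<le> 1}"
    using u_add_max[of a b] by (auto simp: u_mult intro!: mult_le_one u_nonneg)
qed (auto simp: u_uminus)

lemma cring_O: "cring Oring"
  using subcring_iff[of "{x \<in> carrier R. u x \<le> 1}"] subcringI'[OF subring_O]
  unfolding valuation_ring_def by auto

lemma O_a_inv: "x \<in> carrier Oring \<Longrightarrow> \<ominus>\<^bsub>Oring\<^esub> x = \<ominus> x"
proof -
  interpret O: cring Oring by (rule cring_O)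
  assume "x \<in> carrier Oring"
  then show ?thesis
    using O.minus_equality[of "\<ominus> x" x] by (simp add: u_uminus l_neg)
qed

lemma ideal_M: "ideal Mid Oring"
proof -
  interpret O: cring Oring by (rule cring_O)
  show ?thesis
  proof (rule idealI)
    show "ring Oring" by (rule O.ring_axioms)
    show "subgroup Mid (add_monoid Oring)"
    proof (rule group.subgroupI)
      show "Group.group (add_monoid Oring)" by (rule O.a_group)
      show "Mid \<noteq> {}"
        using zero_closed u_zero by (force simp: valuation_ideal_def)
      fix a assume a: "a \<in> Mid"
      then show "inv\<^bsub>add_monoid Oring\<^esub> a \<in> Mid"
        using O_a_inv[of a] unfolding a_inv_def by (simp add: valuation_ideal_def u_uminus flip: a_inv_def)
      fix b assume "b \<in> Mid"
      then show "a \<otimes>\<^bsub>add_monoid Oring\<^esub> b \<in> Mid"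
        using a u_add_max[of a b] by (auto simp: valuation_ideal_def)
    qed (auto simp: valuation_ideal_def)
    fix a x assume a: "a \<in> Mid" and x: "x \<in> carrier Oring"
    then have "u x * u a < 1"
      using u_nonneg[of a] mult_left_le_one_le[of "u a" "u x"] u_nonneg[of x] by (auto simp: valuation_ideal_def)
    then show "x \<otimes>\<^bsub>Oring\<^esub> a \<in> Mid" "a \<otimes>\<^bsub>Oring\<^esub> x \<in> Mid"
      using a x by (auto simp: valuation_ideal_def u_mult mult.commute)
  qed
qed

lemma cring_Res: "cring Res"
  unfolding residue_field_def by (rule ideal.quotient_is_cring[OF ideal_M cring_O])

lemma rescls_hom: "rescls \<in> Ring.ring_hom Oring Res"
  unfolding residue_field_def using ideal.rcos_ring_hom[OF ideal_M]
  by (simp add: rescls_def[abs_def])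

lemma carrier_Res: "carrier Res = rescls ` {x \<in> carrier R. u x \<le> 1}"
  unfolding residue_field_def FactRing_def rescls_def[abs_def]
  by (auto simp: A_RCOSETS_def')

lemma rescls_eq_iff:
  assumes "x \<in> carrier R" "u x \<le> 1" "y \<in> carrier R" "u y \<le> 1"
  shows "rescls x = rescls y \<longleftrightarrow> u (x \<ominus> y) < 1"
proof -
  interpret O: cring Oring by (rule cring_O)
  have "x \<ominus>\<^bsub>Oring\<^esub> y = x \<ominus> y"
    using assms O_a_inv[of y] by (simp add: a_minus_def)
  then show ?thesis
    using O.quotient_eq_iff_same_a_r_cos[OF ideal_M, of x y] assms
    by (auto simp: rescls_def valuation_ideal_def)
qed

lemma
  assumes "x \<in> carrier R" "u x \<le> 1" "y \<in> carrier R" "u y \<le> 1"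
  shows rescls_add: "rescls x \<oplus>\<^bsub>Res\<^esub> rescls y = rescls (x \<oplus> y)"
    and rescls_mult: "rescls x \<otimes>\<^bsub>Res\<^esub> rescls y = rescls (x \<otimes> y)"
  using ring_hom_add[OF rescls_hom] ring_hom_mult[OF rescls_hom] assms by auto

lemma rescls_one: "rescls \<one> = \<one>\<^bsub>Res\<^esub>"
  using ring_hom_one[OF rescls_hom] by simp

lemma rescls_zero: "rescls \<zero> = \<zero>\<^bsub>Res\<^esub>"
  using ring_hom_zero[OF rescls_hom] cring_O cring_Res by (simp add: cring_def)

lemma field_Res: "field Res"
proof -
  interpret Q: cring Res by (rule cring_Res)
  show ?thesis
  proof (rule Q.cring_fieldI2)
    show "\<zero>\<^bsub>Res\<^esub> \<noteq> \<one>\<^bsub>Res\<^esub>"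
      using rescls_eq_iff[of \<zero> \<one>] u_minus_commute[of \<zero> \<one>] 
      by (simp add: rescls_one[symmetric] rescls_zero[symmetric] a_minus_def)
    fix a assume a: "a \<in> carrier Res" "a \<noteq> \<zero>\<^bsub>Res\<^esub>"
    then obtain x where x: "x \<in> carrier R" "u x \<le> 1" "a = rescls x"
      by (auto simp: carrier_Res)
    then have "u x = 1"
      using a rescls_eq_iff[of x \<zero>] by (simp add: rescls_zero a_minus_def)
    then have "x \<noteq> \<zero>"
      by auto
    then have "u (inv x) = 1" "inv x \<in> carrier R" "x \<otimes> inv x = \<one>"
      using x \<open>u x = 1\<close> by (auto simp: u_inv field_Units)
    then show "\<exists>b\<in>carrier Res. a \<otimes>\<^bsub>Res\<^esub> b = \<one>\<^bsub>Res\<^esub>"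
      using x by (intro bexI[of _ "rescls (inv x)"]) (auto simp: rescls_mult rescls_one carrier_Res)
  qed
qed

end

text \<open>Coordinates with respect to a basis identify the field with the lists of length
  \<open>dim\<close> over \<open>K\<close>. Finite dimension is obtained by taking the whole finite
  carrier as a spanning list.\<close>

lemma (in field) card_finite_field_extension:
  assumes fin: "finite (carrier R)" and K: "subfield K R"
  shows "card (carrier R) = card K ^ dim K (carrier R)" "0 < dim K (carrier R)"
proof -
  obtain xs where xs: "set xs = carrier R"
    using finite_list[OF fin] by blast
  have "Span K xs = carrier R"
    using Span_base_incl[OF K, of xs] Span_in_carrier[OF subfieldE(3)[OF K], of xs] xs by auto
  then have fd: "finite_dimension K (carrier R)"
    using Span_finite_dimension[OF K, of xs] xs by auto
  define n where "n = dim K (carrier R)"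
  have dn: "dimension n K (carrier R)"
    using finite_dimensionE[OF K fd] by (simp add: over_def n_def)
  then obtain Us where Us: "set Us \<subseteq> carrier R" "independent K Us" "length Us = n" "Span K Us = carrier R"
    using exists_base[OF K] by blast
  have "bij_betw (\<lambda>Ks. combine Ks Us) {Ks. set Ks \<subseteq> K \<and> length Ks = n} (carrier R)"
    unfolding bij_betw_def
  proof
    show "inj_on (\<lambda>Ks. combine Ks Us) {Ks. set Ks \<subseteq> K \<and> length Ks = n}"
    proof (rule inj_onI)
      fix Ks Ls assume *: "Ks \<in> {Ks. set Ks \<subseteq> K \<and> length Ks = n}" "Ls \<in> {Ks. set Ks \<subseteq> K \<and> length Ks = n}"
        "combine Ks Us = combine Ls Us"
      have "combine Ks Us \<in> Span K Us"
        unfolding Span_eq_combine_set_length_version[OF K Us(1)] using * Us(3) by (intro CollectI exI[of _ Ks]) auto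
      then have "\<exists>!Ls. set Ls \<subseteq> K \<and> length Ls = length Us \<and> combine Ks Us = combine Ls Us"
        by (rule unique_decomposition[OF K Us(2)])
      then show "Ks = Ls"
        using * Us(3) by (elim ex1E) (metis (lifting) mem_Collect_eq)
    qed
    show "(\<lambda>Ks. combine Ks Us) ` {Ks. set Ks \<subseteq> K \<and> length Ks = n} = carrier R"
      using Span_eq_combine_set_length_version[OF K Us(1)] Us by auto
  qed
  then have "card (carrier R) = card {Ks. set Ks \<subseteq> K \<and> length Ks = n}"
    by (simp add: bij_betw_same_card)
  also have "\<dots> = card K ^ n"
    using card_lists_length_eq[of K n] fin subfieldE(3)[OF K] finite_subset by blast
  finally show "card (carrier R) = card K ^ dim K (carrier R)"
    by (simp add: n_def)
  show "0 < dim K (carrier R)"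
  proof (rule ccontr)
    assume "\<not> ?thesis"
    then have "carrier R = {\<zero>}"
      using dn dimension_zero[OF K] by (simp add: n_def)
    then show False
      using one_closed one_not_zero by auto
  qed
qed

section \<open>Finite extensions of the p-adic numbers\<close>

lemma powi_le_iff: "1 < (b::real) \<Longrightarrow> b powi i \<le> b powi j \<longleftrightarrow> i \<le> j"
  by (metis not_le order_less_imp_le order_refl power_int_strict_increasing power_int_increasing less_imp_le)

declare (in ring) Span.simps [simp del]

text \<open>The subfield \<open>k0\<close> stands for the p-adic numbers: its nonzero values are
  integral powers of \<open>p\<close>, and natural numbers below \<open>p ^ k\<close> represent its
  integers to precision \<open>1 / p ^ k\<close>. The locale is instantiated both for the completion
  K_v and for L_v.\<close>

locale padic_field = ultrametric_field +
  fixes p :: nat and k0 :: "'a set"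
  assumes prime_p: "Factorial_Ring.prime p"
    and k0: "subfield k0 R" and k0_complete: "complete_set k0"
    and u_p: "u (nat_elem p) = 1 / p"
    and k0_value: "\<And>x. x \<in> k0 \<Longrightarrow> x \<noteq> \<zero> \<Longrightarrow> \<exists>i::int. u x = real p powi i"
    and k0_residue: "\<And>x k. x \<in> k0 \<Longrightarrow> u x \<le> 1 \<Longrightarrow> \<exists>a<p ^ k. u (x \<ominus> nat_elem a) \<le> 1 / real p ^ k"
    and fin_dim: "finite_dimension k0 (carrier R)"
begin

lemma p_gt_1: "1 < p"
  using prime_p prime_gt_1_nat by blast

lemma k0_in: "x \<in> k0 \<Longrightarrow> x \<in> carrier R"
  using subfieldE(3)[OF k0] by auto

lemma nat_elem_k0: "nat_elem n \<in> k0"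
  by (rule nat_elem_subring[OF subfieldE(1)[OF k0]])

lemma u_p_pow: "u (nat_elem (p ^ k)) = 1 / real p ^ k"
  by (simp add: nat_elem_pow u_pow u_p power_divide)

lemma nat_elem_p_pow_nz: "nat_elem (p ^ k) \<noteq> \<zero>"
proof
  assume "nat_elem (p ^ k) = \<zero>"
  then show False
    using u_p_pow[of k] p_gt_1 by simp
qed

text \<open>The values are powers of \<open>p\<close> with integral exponents, so a bounded nonempty
  set of them has a largest element.\<close>

lemma max_value:
  assumes A: "A \<subseteq> k0 - {\<zero>}" "A \<noteq> {}" and C: "\<And>a. a \<in> A \<Longrightarrow> u a \<le> C"
  shows "\<exists>a\<in>A. \<forall>b\<in>A. u b \<le> u a"
proof -
  obtain i where i: "\<And>a. a \<in> A \<Longrightarrow> u a = real p powi i a"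
    using k0_value A by (metis Diff_iff singletonI subsetD)
  obtain N :: nat where "C < real p ^ N"
    using real_arch_pow[of "real p" C] p_gt_1 by auto
  then have "real p powi i a \<le> real p powi int N" if "a \<in> A" for a
    using C[OF that] i[OF that] by simp
  then have iN: "i a \<le> int N" if "a \<in> A" for a
    using powi_le_iff p_gt_1 that by (metis of_nat_1 of_nat_less_iff)
  obtain a where a: "a \<in> A" "\<And>b. b \<in> A \<Longrightarrow> nat (int N - i a) \<le> nat (int N - i b)"
    using A ex_has_least_nat[of "\<lambda>a. a \<in> A" _ "\<lambda>a. nat (int N - i a)"] by blast
  have "u b \<le> u a" if "b \<in> A" for b
  proof -
    have "i b \<le> i a"
      using a(2)[OF that] iN[OF that] iN[OF a(1)] by linarith
    then show ?thesis
      using i that a p_gt_1 by (simp add: powi_le_iff)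
  qed
  then show ?thesis
    using a by blast
qed

text \<open>A substitute for an integral basis, built one vector at a time. Among the coefficients
  of \<open>v\<close> in unit-ball vectors \<open>a \<otimes> v \<oplus> s\<close> one,
  \<open>a0\<close>, has the largest value. Every unit-ball vector is then
  \<open>t0 \<otimes> z \<oplus> y\<close> with \<open>z = a0 \<otimes> v \<oplus> s0\<close>,
  \<open>u t0 \<le> 1\<close> and \<open>y\<close> in the unit ball of the smaller span;
  approximating \<open>t0\<close> costs a factor \<open>p ^ k\<close>.\<close>

lemma Span_residues:
  "independent k0 Us \<Longrightarrow> \<exists>T. finite T \<and> T \<subseteq> carrier R \<and> card T \<le> (p ^ k) ^ length Us \<and>
     (\<forall>x\<in>Span k0 Us. u x \<le> 1 \<longrightarrow> (\<exists>t\<in>T. u (x \<ominus> t) \<le> 1 / real p ^ k))"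
proof (induction Us)
  case Nil
  then show ?case
    by (intro exI[of _ "{\<zero>}"]) (simp add: a_minus_def Span.simps)
next
  case (Cons v Us)
  have v: "v \<notin> Span k0 Us" "v \<in> carrier R" and ind: "independent k0 Us"
    using independent_backwards[OF Cons.prems] by auto
  have Us: "set Us \<subseteq> carrier R"
    using independent_in_carrier[OF ind] .
  have SR: "s \<in> carrier R" if "s \<in> Span k0 Us" for s
    using Span_in_carrier[OF subfieldE(3)[OF k0] Us] that by auto
  obtain T where T: "finite T" "T \<subseteq> carrier R" "card T \<le> (p ^ k) ^ length Us"
    "\<And>x. x \<in> Span k0 Us \<Longrightarrow> u x \<le> 1 \<Longrightarrow> \<exists>t\<in>T. u (x \<ominus> t) \<le> 1 / real p ^ k"
    using Cons.IH[OF ind] by blast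
  obtain C where C: "C > 0" "coord_bound k0 (v # Us) C"
    using coord_bound_exists[OF k0 k0_complete Cons.prems] by blast
  \<comment> \<open>The coordinate bound keeps the values of these coefficients bounded, so
    \<open>max_value\<close> provides one of largest value.\<close>
  define A where "A = {a \<in> k0 - {\<zero>}. \<exists>s\<in>Span k0 Us. u (a \<otimes> v \<oplus> s) \<le> 1}"
  have "u a \<le> C" if aA: "a \<in> A" for a
  proof -
    obtain s where s: "a \<in> k0" "s \<in> Span k0 Us" "u (a \<otimes> v \<oplus> s) \<le> 1"
      using aA unfolding A_def by blast
    obtain Ks where Ks: "set Ks \<subseteq> k0" "length Ks = length Us" "s = combine Ks Us"
      using Span_mem_iff_length_version[OF k0 Us] s by blast
    have "u ((a # Ks) ! 0) \<le> C * u (combine (a # Ks) (v # Us))"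
      using C(2)[unfolded coord_bound_def, rule_format, of "a # Ks" 0] s Ks by auto
    also have "\<dots> \<le> C * 1"
      using s Ks C by (intro mult_left_mono) auto
    finally show ?thesis by simp
  qed
  moreover have "A \<noteq> {}"
  proof -
    obtain m where m: "u v < real p ^ m"
      using real_arch_pow[of "real p" "u v"] p_gt_1 by auto
    have "u (nat_elem (p ^ m) \<otimes> v \<oplus> \<zero>) \<le> 1"
      using m v p_gt_1 by (simp add: u_mult u_p_pow divide_simps)
    then have "nat_elem (p ^ m) \<in> A"
      unfolding A_def using nat_elem_k0 nat_elem_p_pow_nz Span_subgroup_props(2)[OF k0 Us] by blast
    then show ?thesis by blast
  qed
  moreover have "A \<subseteq> k0 - {\<zero>}"
    by (auto simp: A_def)
  ultimately obtain a0 where a0: "a0 \<in> A" "\<And>a. a \<in> A \<Longrightarrow> u a \<le> u a0"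
    using max_value[of A C] by blast
  obtain s0 where s0: "s0 \<in> Span k0 Us" "u (a0 \<otimes> v \<oplus> s0) \<le> 1" and a0': "a0 \<in> k0" "a0 \<noteq> \<zero>" "a0 \<in> carrier R"
    using a0(1) k0_in by (auto simp: A_def)
  define z where "z = a0 \<otimes> v \<oplus> s0"
  have z: "z \<in> carrier R" "u z \<le> 1"
    using s0 a0' v SR by (auto simp: z_def)
  define T' where "T' = (\<lambda>(c, t). nat_elem c \<otimes> z \<oplus> t) ` ({..<p ^ k} \<times> T)"
  have "card T' \<le> card ({..<p ^ k} \<times> T)"
    unfolding T'_def using T by (intro card_image_le) auto
  also have "\<dots> \<le> (p ^ k) * (p ^ k) ^ length Us"
    using T by (simp add: card_cartesian_product)
  finally have "card T' \<le> (p ^ k) ^ length (v # Us)"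
    by simp
  moreover have "finite T'" "T' \<subseteq> carrier R"
    using T z by (auto simp: T'_def)
  moreover have "\<exists>t\<in>T'. u (x \<ominus> t) \<le> 1 / real p ^ k" if x: "x \<in> Span k0 (v # Us)" "u x \<le> 1" for x
  proof -
    obtain a s where as: "a \<in> k0" "s \<in> Span k0 Us" "x = a \<otimes> v \<oplus> s"
      using x(1) by (auto simp: Span.simps line_extension_mem_iff)
    have ac: "a \<in> carrier R" "s \<in> carrier R"
      using as k0_in SR by auto
    have ia: "inv a0 \<in> k0" "inv a0 \<in> carrier R" "a0 \<otimes> inv a0 = \<one>"
      using subfield_m_inv[OF k0] a0' k0_in by auto
    define t0 where "t0 = a \<otimes> inv a0"
    have t0: "t0 \<in> k0" "t0 \<in> carrier R"
      using as ia subringE(6)[OF subfieldE(1)[OF k0]] k0_in by (auto simp: t0_def)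
    have "u a \<le> u a0"
      using a0(2)[of a] as x u_nonneg[of a0] a0' by (cases "a = \<zero>") (auto simp: A_def)
    then have "u t0 \<le> 1"
      unfolding t0_def using ac ia a0' u_pos[of a0] by (simp add: u_mult u_inv divide_simps)
    then obtain c where c: "c < p ^ k" "u (t0 \<ominus> nat_elem c) \<le> 1 / real p ^ k"
      using k0_residue[OF t0(1)] by blast
    define y where "y = s \<ominus> t0 \<otimes> s0"
    have s0c: "s0 \<in> carrier R"
      using s0 SR by auto
    have yS: "y \<in> Span k0 Us" and yc: "y \<in> carrier R"
      unfolding y_def using as s0 t0 Span_subgroup_props(3,4)[OF k0 Us] Span_smult_closed[OF k0 Us] SR
      by (auto simp: a_minus_def)
    have "t0 \<otimes> a0 = a"
    proof -
      have "t0 \<otimes> a0 = a \<otimes> (a0 \<otimes> inv a0)"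
        unfolding t0_def using ac(1) ia(2) a0'(3) by algebra
      then show ?thesis
        using ia ac by simp
    qed
    then have xy: "x = t0 \<otimes> z \<oplus> y"
    proof -
      have "t0 \<otimes> z \<oplus> y = (t0 \<otimes> a0) \<otimes> v \<oplus> s"
        unfolding z_def y_def using t0(2) a0'(3) v(2) s0c ac(2) by algebra
      then show ?thesis
        using \<open>t0 \<otimes> a0 = a\<close> as by simp
    qed
    have "y = x \<ominus> t0 \<otimes> z"
      unfolding xy using yc t0(2) z(1) by algebra
    then have "u y \<le> max (u x) (u (t0 \<otimes> z))"
      using u_minus_max[of x "t0 \<otimes> z"] xy t0 z yc by simp
    also have "\<dots> \<le> 1"
      using x(2) \<open>u t0 \<le> 1\<close> z t0 by (auto simp: u_mult intro!: mult_le_one u_nonneg)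
    finally obtain t where t: "t \<in> T" "u (y \<ominus> t) \<le> 1 / real p ^ k"
      using T(4)[OF yS] by blast
    have tc: "t \<in> carrier R"
      using t T by auto
    have "x \<ominus> (nat_elem c \<otimes> z \<oplus> t) = (t0 \<ominus> nat_elem c) \<otimes> z \<oplus> (y \<ominus> t)"
      unfolding xy using yc t0(2) z(1) tc nat_elem_in[of c] by algebra
    then have "u (x \<ominus> (nat_elem c \<otimes> z \<oplus> t)) \<le> max (u (t0 \<ominus> nat_elem c) * u z) (u (y \<ominus> t))"
      using u_add_max[of "(t0 \<ominus> nat_elem c) \<otimes> z" "y \<ominus> t"] yc t0 z tc by (simp add: u_mult)
    also have "u (t0 \<ominus> nat_elem c) * u z \<le> 1 / real p ^ k * 1"
      using c z t0 by (intro mult_mono u_nonneg) auto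
    finally have "u (x \<ominus> (nat_elem c \<otimes> z \<oplus> t)) \<le> 1 / real p ^ k"
      using t by simp
    then show ?thesis
      using c t unfolding T'_def by (intro bexI[of _ "nat_elem c \<otimes> z \<oplus> t"] image_eqI[of _ _ "(c, t)"]) auto
  qed
  ultimately show ?case
    by blast
qed

text \<open>The exponent \<open>dim k0 (carrier R)\<close> becomes the local degree, and through the
  pigeonhole principle the weight of the place in the final bound.\<close>

lemma residues:
  "\<exists>T. finite T \<and> T \<subseteq> carrier R \<and> card T \<le> p ^ (k * dim k0 (carrier R)) \<and>
     (\<forall>x\<in>carrier R. u x \<le> 1 \<longrightarrow> (\<exists>t\<in>T. u (x \<ominus> t) \<le> 1 / real p ^ k))"
proof -
  obtain Us where Us: "independent k0 Us" "Span k0 Us = carrier R" "length Us = dim k0 (carrier R)"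
    using finite_dimensionE[OF k0 fin_dim] exists_base[OF k0] unfolding over_def by blast
  then show ?thesis
    using Span_residues[OF Us(1), of k] by (simp add: power_mult)
qed

text \<open>An element of value above \<open>1 / p\<close> has the same value as its representative
  modulo \<open>p\<close>, and there are finitely many representatives.\<close>

lemma finite_values: "finite {u x | x. x \<in> carrier R \<and> 1 / p \<le> u x \<and> u x \<le> 1}"
proof -
  obtain T where T: "finite T" "T \<subseteq> carrier R"
    "\<And>x. x \<in> carrier R \<Longrightarrow> u x \<le> 1 \<Longrightarrow> \<exists>t\<in>T. u (x \<ominus> t) \<le> 1 / real p ^ 1"
    using residues[of 1] by blast
  have "{u x | x. x \<in> carrier R \<and> 1 / p \<le> u x \<and> u x \<le> 1} \<subseteq> insert (1 / p) (u ` T)"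
  proof clarify
    fix x assume x: "x \<in> carrier R" "1 / p \<le> u x" "u x \<le> 1" "u x \<notin> u ` T"
    obtain t where t: "t \<in> T" "u (x \<ominus> t) \<le> 1 / real p"
      using T(3)[OF x(1,3)] by auto
    have "\<not> u (x \<ominus> t) < u x"
      using u_eq_of_close[of x t] x t T(2) by (metis imageI subsetD)
    then show "u x = 1 / p"
      using x t by simp
  qed
  then show ?thesis
    by (rule finite_subset) (use T in simp)
qed

text \<open>The value of a uniformizer. The lower bound \<open>1 / p\<close>, attained by
  \<open>p\<close> itself, makes the set finite and nonempty, so that \<open>Max\<close> is
  meaningful.\<close>

definition rho :: real where
  "rho = Max {u x | x. x \<in> carrier R \<and> 1 / p \<le> u x \<and> u x < 1}"

lemma rho:
  shows rho_pos: "0 < rho" and rho_less: "rho < 1" and rho_ex: "\<exists>x\<in>carrier R. u x = rho"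
    and rho_value: "\<And>x. x \<in> carrier R \<Longrightarrow> u x \<le> 1 \<Longrightarrow> x \<noteq> \<zero> \<Longrightarrow> \<exists>n::nat. u x = rho ^ n"
proof -
  let ?V = "{u x | x. x \<in> carrier R \<and> 1 / p \<le> u x \<and> u x < 1}"
  have fin: "finite ?V"
    by (rule finite_subset[OF _ finite_values]) auto
  have "1 / real p < 1"
    using p_gt_1 by simp
  then have "1 / real p \<in> ?V"
    using u_p by (auto intro!: exI[of _ "nat_elem p"])
  then have "rho \<in> ?V"
    unfolding rho_def using fin by (intro Max_in) auto
  then obtain w where w: "w \<in> carrier R" "u w = rho" "1 / p \<le> rho" "rho < 1"
    by auto
  show "rho < 1" "\<exists>x\<in>carrier R. u x = rho"
    using w by auto
  show pos: "0 < rho"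
    using w(3) p_gt_1 by (intro less_le_trans[of 0 "1 / real p" rho]) simp_all
  have wnz: "w \<noteq> \<zero>"
    using w pos by auto
  show "\<exists>n::nat. u x = rho ^ n" if x: "x \<in> carrier R" "u x \<le> 1" "x \<noteq> \<zero>" for x
  proof -
    have "\<exists>n. rho ^ n < u x"
      using real_arch_pow_inv[OF u_pos[OF x(1,3)] w(4)] by blast
    \<comment> \<open>\<open>n\<close> is the first exponent with \<open>rho ^ n\<close> below
      \<open>u x\<close>, so dividing \<open>x\<close> by a power of the uniformizer one lower
      leaves a value above \<open>rho\<close> and at most 1. By maximality of \<open>rho\<close>
      this value is 1.\<close>
    define n where "n = (LEAST n. rho ^ n < u x)"
    have n: "rho ^ n < u x"
      unfolding n_def by (rule LeastI_ex) fact
    then obtain m where m: "n = Suc m"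
      using x(2) by (cases n) auto
    have "\<not> rho ^ m < u x"
      using not_less_Least[of m "\<lambda>n. rho ^ n < u x"] m by (simp add: n_def)
    have iw: "inv (w [^] m) \<in> carrier R" "u (inv (w [^] m)) = inverse (rho ^ m)"
    proof -
      have "w [^] m \<noteq> \<zero>"
      proof
        assume "w [^] m = \<zero>"
        then show False
          using u_pow[OF w(1), of m] w(2) pos by simp
      qed
      then show "inv (w [^] m) \<in> carrier R" "u (inv (w [^] m)) = inverse (rho ^ m)"
        using w by (auto simp: u_inv u_pow field_Units intro!: Units_inv_closed)
    qed
    define y where "y = x \<otimes> inv (w [^] m)"
    have y: "y \<in> carrier R" "u y = u x / rho ^ m"
      using x iw by (auto simp: y_def u_mult divide_inverse)
    have "rho < u y" "u y \<le> 1"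
      using n \<open>\<not> rho ^ m < u x\<close> pos unfolding y(2) m by (simp_all add: pos_less_divide_eq)
    have "u y = 1"
    proof (rule ccontr)
      assume "u y \<noteq> 1"
      then have "u y \<in> ?V"
        using y(1) w(3) \<open>rho < u y\<close> \<open>u y \<le> 1\<close> by auto
      then have "u y \<le> rho"
        unfolding rho_def using fin by (intro Max_ge) auto
      then show False
        using \<open>rho < u y\<close> by simp
    qed
    moreover have "u x = u y * rho ^ m"
      using y pos by simp
    ultimately show ?thesis
      by auto
  qed
qed

text \<open>The ramification index over \<open>k0\<close>, that is, over the p-adic numbers and not
  over the base field of the Galois extension.\<close>

definition ram :: nat where
  "ram = (SOME j. 1 / real p = rho ^ j)"

lemma ram: "1 / real p = rho ^ ram" "0 < ram"
proof -
  have "nat_elem p \<noteq> \<zero>"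
    using u_p p_gt_1 by auto
  then show r: "1 / real p = rho ^ ram"
    unfolding ram_def using rho_value[of "nat_elem p"] u_p p_gt_1 by (intro someI_ex[of "\<lambda>j. 1 / real p = rho ^ j"]) auto
  show "0 < ram"
    using r p_gt_1 by (cases "ram = 0") auto
qed

text \<open>Among the scalars that bring \<open>x\<close> into the unit ball one has the largest
  value; dividing it by \<open>p\<close> leaves the ball, which gives the lower bound
  \<open>1 / p\<close>.\<close>

lemma scale_into_unit:
  assumes x: "x \<in> carrier R" "x \<noteq> \<zero>"
  shows "\<exists>a\<in>k0 - {\<zero>}. 1 / p < u (x \<otimes> a) \<and> u (x \<otimes> a) \<le> 1"
proof -
  define A where "A = {a \<in> k0 - {\<zero>}. u (x \<otimes> a) \<le> 1}"
  have ux: "0 < u x"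
    using x u_pos by auto
  have bound: "u a \<le> 1 / u x" if "a \<in> A" for a
    using that k0_in[of a] x ux by (auto simp: A_def u_mult le_divide_eq mult.commute)
  obtain m where m: "u x < real p ^ m"
    using real_arch_pow[of "real p" "u x"] p_gt_1 by auto
  note nz = nat_elem_p_pow_nz
  have "nat_elem (p ^ m) \<in> A"
    using m x p_gt_1 nz nat_elem_k0 by (auto simp: A_def u_mult u_p_pow divide_simps)
  then obtain a where a: "a \<in> A" "\<And>b. b \<in> A \<Longrightarrow> u b \<le> u a"
    using max_value[of A, OF _ _ bound] by (auto simp: A_def)
  have a': "a \<in> k0" "a \<noteq> \<zero>" "a \<in> carrier R" "u (x \<otimes> a) \<le> 1"
    using a k0_in by (auto simp: A_def)
  have ip: "inv (nat_elem p) \<in> k0" "inv (nat_elem p) \<noteq> \<zero>" "u (inv (nat_elem p)) = p"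
    using subfield_m_inv[OF k0, of "nat_elem p"] nz[of 1] nat_elem_k0[of p] u_inv[of "nat_elem p"] u_p by auto
  define b where "b = a \<otimes> inv (nat_elem p)"
  have b: "b \<in> k0" "b \<noteq> \<zero>" "b \<in> carrier R"
    using a' ip subringE(6)[OF subfieldE(1)[OF k0]] k0_in integral[of a "inv (nat_elem p)"] by (auto simp: b_def)
  have "1 / p < u (x \<otimes> a)"
  proof (rule ccontr)
    assume "\<not> ?thesis"
    then have "u (x \<otimes> b) \<le> 1"
      using a' ip k0_in x p_gt_1 by (auto simp: b_def u_mult field_simps)
    then have "u b \<le> u a"
      using a(2) b by (simp add: A_def)
    then show False
      using a' ip k0_in p_gt_1 u_pos[of a] by (simp add: b_def u_mult)
  qed
  then show ?thesis
    using a' by blast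
qed

text \<open>Scaling by \<open>k0\<close> shows that each coset of the value group of
  \<open>k\<close> contains some \<open>rho ^ n\<close> with \<open>n < ram\<close>. The finiteness
  obtained this way also keeps \<open>card\<close> from taking its default value 0.\<close>

lemma ramification_index_bounds:
  assumes k: "subfield k R" "k0 \<subseteq> k"
  shows "1 \<le> ramification_index R u k" "ramification_index R u k \<le> ram"
proof -
  let ?co = "\<lambda>r. (\<lambda>y. r * u y) ` (k - {\<zero>})"
  let ?C = "(\<lambda>x. ?co (u x)) ` (carrier R - {\<zero>})"
  let ?D = "(\<lambda>n. ?co (rho ^ n)) ` {..<ram}"
  have sub: "?C \<subseteq> ?D"
  proof
    fix c assume "c \<in> ?C"
    then obtain x where x: "x \<in> carrier R" "x \<noteq> \<zero>" and c: "c = ?co (u x)"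
      by blast
    obtain a where a: "a \<in> k0" "a \<noteq> \<zero>" "1 / p < u (x \<otimes> a)" "u (x \<otimes> a) \<le> 1"
      using scale_into_unit[OF x] by blast
    have kc: "y \<in> carrier R" if "y \<in> k" for y
      using that subfieldE(3)[OF k(1)] by auto
    have ak: "a \<in> k" "a \<in> carrier R" "inv a \<in> k" "inv a \<in> carrier R" "inv a \<noteq> \<zero>" "a \<otimes> inv a = \<one>"
      using a k k0_in subfield_m_inv[OF k(1), of a] kc by auto
    obtain n where n: "u (x \<otimes> a) = rho ^ n"
      using rho_value[of "x \<otimes> a"] x a ak integral by blast
    have "rho ^ ram < rho ^ n"
      using a n ram by simp
    then have "n < ram"
      using rho_pos rho_less by (meson linorder_not_less order_less_imp_le power_decreasing order_less_le_trans less_irrefl)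
    moreover have "?co (u x) = ?co (rho ^ n)"
    proof (intro equalityI subsetI)
      fix r assume "r \<in> ?co (u x)"
      then obtain y where y: "y \<in> k" "y \<noteq> \<zero>" "r = u x * u y" by auto
      have yc: "y \<in> carrier R" using y kc by blast
      have "r = rho ^ n * u (inv a \<otimes> y)"
        using y yc ak a x u_pos[of a] by (simp flip: n add: u_mult u_inv)
      then show "r \<in> ?co (rho ^ n)"
        using ak y yc subringE(6)[OF subfieldE(1)[OF k(1)]] integral[of "inv a" y] by blast
    next
      fix r assume "r \<in> ?co (rho ^ n)"
      then obtain y where y: "y \<in> k" "y \<noteq> \<zero>" "r = rho ^ n * u y" by auto
      have yc: "y \<in> carrier R" using y kc by blast
      have "r = u x * u (a \<otimes> y)"
        using y yc ak a x by (simp flip: n add: u_mult)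
      then show "r \<in> ?co (u x)"
        using ak a y yc subringE(6)[OF subfieldE(1)[OF k(1)]] integral[of a y] by blast
    qed
    ultimately show "c \<in> (\<lambda>n. ?co (rho ^ n)) ` {..<ram}"
      unfolding c by blast
  qed
  have "finite ?D"
    by simp
  then have "finite ?C" "card ?C \<le> card ?D"
    using finite_subset[OF sub] card_mono[OF _ sub] by blast+
  moreover have "card ?D \<le> ram"
    using card_image_le[of "{..<ram}" "\<lambda>n. ?co (rho ^ n)"] by simp
  moreover have "?C \<noteq> {}"
    using one_closed one_not_zero by blast
  ultimately have "0 < card ?C" "card ?C \<le> ram"
    using card_gt_0_iff[of ?C] by (blast, linarith)
  then show "1 \<le> ramification_index R u k" "ramification_index R u k \<le> ram"
    unfolding ramification_index_def by linarith+
qed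

lemma finite_Res: "finite (carrier Res)"
proof -
  obtain T where T: "finite T" "T \<subseteq> carrier R"
    "\<And>x. x \<in> carrier R \<Longrightarrow> u x \<le> 1 \<Longrightarrow> \<exists>t\<in>T. u (x \<ominus> t) \<le> 1 / real p ^ 1"
    using residues[of 1] by blast
  have "carrier Res \<subseteq> rescls ` T"
  proof
    fix a assume "a \<in> carrier Res"
    then obtain x where x: "x \<in> carrier R" "u x \<le> 1" "a = rescls x"
      by (auto simp: carrier_Res)
    obtain t where t: "t \<in> T" "u (x \<ominus> t) \<le> 1 / p"
      using T(3)[OF x(1,2)] by auto
    have tc: "t \<in> carrier R" using t T by auto
    have l: "u (x \<ominus> t) < 1"
      using t p_gt_1 by (smt (verit) divide_less_eq_1 of_nat_1 of_nat_less_iff)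
    have "t = x \<ominus> (x \<ominus> t)"
      using x(1) tc by algebra
    then have "u t \<le> 1"
      using u_minus_max[of x "x \<ominus> t"] x tc l by auto
    then have "a = rescls t"
      using rescls_eq_iff[OF x(1,2) tc] l x by simp
    then show "a \<in> rescls ` T"
      using t by blast
  qed
  then show ?thesis
    using T finite_subset by blast
qed

lemma characteristic_Res: "characteristic Res = p"
proof -
  interpret Q: field Res by (rule field_Res)
  have cl: "[n] \<cdot>\<^bsub>Res\<^esub> \<one>\<^bsub>Res\<^esub> = rescls (nat_elem n)" for n :: nat
  proof (induction n)
    case (Suc n)
    then show ?case
      using rescls_add[of "nat_elem n" \<one>] u_nat_elem_le[of n]
      by (simp add: Q.add.nat_pow_Suc nat_elem_Suc rescls_one)
  qed (simp add: rescls_zero)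
  have "rescls (nat_elem p) = \<zero>\<^bsub>Res\<^esub>"
    using rescls_eq_iff[of "nat_elem p" \<zero>] u_nat_elem_le[of p] u_p p_gt_1
    by (simp add: rescls_zero a_minus_def)
  then have "Q.add.ord \<one>\<^bsub>Res\<^esub> dvd p"
    using Q.add.pow_eq_id[of "\<one>\<^bsub>Res\<^esub>" p] cl[of p] by simp
  moreover have "Q.add.ord \<one>\<^bsub>Res\<^esub> \<noteq> 1"
    using Q.add.ord_eq_1[of "\<one>\<^bsub>Res\<^esub>"] by simp
  ultimately have "Q.add.ord \<one>\<^bsub>Res\<^esub> = p"
    using prime_p prime_nat_iff by blast
  then show ?thesis
    by (simp add: characteristic_def)
qed

end

section \<open>Places above a prime number\<close>

lemma padic_abs_of_int:
  "padic_abs p (of_int m) = (if m = 0 then 0 else 1 / real p ^ multiplicity (int p) m)"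
  by (simp add: padic_abs_def power_int_minus divide_inverse)

context valued_subfield
begin

lemma emb_0 [simp]: "emb 0 = \<zero>\<^bsub>E\<^esub>" and emb_1 [simp]: "emb 1 = \<one>\<^bsub>E\<^esub>"
  by (simp_all add: emb_def cls_zero cls_one)

lemma emb_add: "a \<in> F \<Longrightarrow> b \<in> F \<Longrightarrow> emb (a + b) = emb a \<oplus>\<^bsub>E\<^esub> emb b"
  and emb_mult: "a \<in> F \<Longrightarrow> b \<in> F \<Longrightarrow> emb (a * b) = emb a \<otimes>\<^bsub>E\<^esub> emb b"
  using ring_hom_add[OF emb_hom] ring_hom_mult[OF emb_hom] by simp_all

lemma nat_elem_E: "E.nat_elem n = emb (of_nat n)"
  by (induction n) (simp_all add: E.nat_elem_Suc emb_add add.commute[of 1])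

lemma emb_combine:
  "set Ks \<subseteq> F \<Longrightarrow> set Vs \<subseteq> F \<Longrightarrow>
    emb (ring.combine \<C> Ks Vs) = E.combine (map emb Ks) (map emb Vs)"
proof (induction Ks Vs rule: list_induct2')
  case (4 a Ks b Vs)
  have "ring.combine \<C> Ks Vs \<in> F" if "set Ks \<subseteq> F" "set Vs \<subseteq> F" for Ks Vs
    using that by (induction Ks Vs rule: list_induct2') (simp_all add: ring.combine.simps[OF ring_C])
  then show ?case
    using 4 by (simp add: ring.combine.simps[OF ring_C] emb_add emb_mult)
qed (simp_all add: ring.combine.simps[OF ring_C])

text \<open>A finite-dimensional subspace over the closure of \<open>\<rat>\<close> is complete, so it is everything once
  it is dense.\<close>

lemma Span_dense_completion:
  assumes Q: "subfield \<rat> \<C>" and VF: "set Vs \<subseteq> F"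
    and dense: "\<And>a e. a \<in> F \<Longrightarrow> 0 < e \<Longrightarrow> \<exists>b\<in>ring.Span \<C> \<rat> Vs. w (a - b) < e"
  shows "E.Span (clos \<rat>) (map emb Vs) = carrier E"
proof -
  interpret C: field \<C> by (rule field_C)
  have VC: "set Vs \<subseteq> carrier \<C>" by simp
  have sub: "subfield (clos \<rat>) E"
    using subfield_clos[OF Q Rats_F] .
  have eV: "set (map emb Vs) \<subseteq> carrier E"
    using VF by auto
  let ?S = "E.Span (clos \<rat>) (map emb Vs)"
  have fd: "E.finite_dimension (clos \<rat>) ?S"
    using E.Span_finite_dimension[OF sub eV] .
  \<comment> \<open>The images of \<open>Vs\<close> may be dependent over the closure of \<rat>, and
    completeness is available for spans of independent lists; hence a basis of the same span is
    taken.\<close>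
  then obtain Us where "E.independent (clos \<rat>) Us" "E.Span (clos \<rat>) Us = ?S"
    using E.finite_dimensionE[OF sub] E.exists_base[OF sub] by blast
  then have cS: "E.complete_set ?S"
    using E.complete_independent_Span[OF sub complete_clos, of Us] by simp
  have emb_S: "b \<in> F \<and> emb b \<in> ?S" if b: "b \<in> C.Span \<rat> Vs" for b
  proof -
    obtain Ks where Ks: "set Ks \<subseteq> \<rat>" "length Ks = length Vs" "b = C.combine Ks Vs"
      using C.Span_mem_iff_length_version[OF Q VC, of b] b by blast
    have KF: "set Ks \<subseteq> F"
      using Ks Rats_F by blast
    have "C.combine Ks Vs \<in> F"
      using KF VF by (induction Ks Vs rule: list_induct2') (simp_all add: C.combine.simps)
    moreover have "emb b = E.combine (map emb Ks) (map emb Vs)"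
      using Ks KF VF emb_combine by simp
    moreover have "set (map emb Ks) \<subseteq> clos \<rat>"
      using Ks KF emb_clos by auto
    ultimately show ?thesis
      using E.Span_mem_iff_length_version[OF sub eV, of "emb b"] Ks(2,3) by (metis length_map)
  qed
  have "carrier E \<subseteq> ?S"
  proof
    fix x assume x: "x \<in> carrier E"
    have "\<exists>b\<in>C.Span \<rat> Vs. cabs (emb b \<ominus>\<^bsub>E\<^esub> x) < e" if e: "0 < e" for e
    proof -
      obtain a where a: "a \<in> F" "cabs (x \<ominus>\<^bsub>E\<^esub> emb a) < e / 2"
        using clos_approx[of x F "e / 2"] x e clos_F by auto
      obtain b where b: "b \<in> C.Span \<rat> Vs" "w (a - b) < e / 2"
        using dense[OF a(1), of "e / 2"] e by auto
      have bF: "b \<in> F"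
        using emb_S[OF b(1)] ..
      have "cabs (emb b \<ominus>\<^bsub>E\<^esub> x) = cabs (x \<ominus>\<^bsub>E\<^esub> emb b)"
        using x bF by (intro E.u_minus_commute) simp_all
      also have "\<dots> \<le> cabs (x \<ominus>\<^bsub>E\<^esub> emb a) + cabs (emb a \<ominus>\<^bsub>E\<^esub> emb b)"
        using x a bF by (intro E.u_triangle) simp_all
      also have "\<dots> < e"
        using a b bF by (simp add: emb_minus cabs_emb)
      finally show ?thesis
        using b(1) by blast
    qed
    then have "\<forall>n. \<exists>b. b \<in> C.Span \<rat> Vs \<and> cabs (emb b \<ominus>\<^bsub>E\<^esub> x) < inverse (Suc n)"
      by (metis inverse_positive_iff_positive of_nat_0_less_iff zero_less_Suc)
    then obtain s where s: "\<And>n. s n \<in> C.Span \<rat> Vs" "\<And>n. cabs (emb (s n) \<ominus>\<^bsub>E\<^esub> x) < inverse (Suc n)"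
      by metis
    have sF: "s n \<in> F" for n
      using emb_S[OF s(1)] ..
    have lim: "(\<lambda>n. cabs (emb (s n) \<ominus>\<^bsub>E\<^esub> x)) \<longlonglongrightarrow> 0"
    proof (rule tendsto_sandwich[OF _ _ tendsto_const LIMSEQ_inverse_real_of_nat])
      show "\<forall>\<^sub>F n in sequentially. cabs (emb (s n) \<ominus>\<^bsub>E\<^esub> x) \<le> inverse (real (Suc n))"
        using s(2) less_imp_le by (intro always_eventually) blast
    qed (use x sF in \<open>auto intro!: always_eventually cabs_nonneg\<close>)
    have "E.cauchy_in (\<lambda>n. emb (s n))"
      by (rule E.cauchy_inI[OF _ x lim]) (use sF in simp)
    moreover have "range (\<lambda>n. emb (s n)) \<subseteq> ?S"
      using emb_S s(1) by blast
    ultimately obtain l where l: "l \<in> ?S" "(\<lambda>n. cabs (emb (s n) \<ominus>\<^bsub>E\<^esub> l)) \<longlonglongrightarrow> 0"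
      using cS unfolding E.complete_set_def by blast
    have "l \<in> carrier E"
      using l E.Span_in_carrier[OF subfieldE(3)[OF sub] eV] by blast
    then have "x = l"
      using E.limit_unique[OF _ x _ lim l(2)] sF by simp
    then show "x \<in> ?S"
      using l by simp
  qed
  then show "?S = carrier E"
    using E.Span_in_carrier[OF subfieldE(3)[OF sub] eV] by blast
qed

lemma finite_dimension_completion:
  assumes "ring.finite_dimension \<C> \<rat> F" "subfield \<rat> \<C>"
  shows "E.finite_dimension (clos \<rat>) (carrier E)"
proof -
  interpret C: field \<C> by (rule field_C)
  obtain Vs where Vs: "C.Span \<rat> Vs = F"
    using C.exists_base[OF assms(2)] C.finite_dimensionE[OF assms(2,1)] by blast
  have VF: "set Vs \<subseteq> F"
    using C.Span_base_incl[OF assms(2), of Vs] Vs by simp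
  have "E.Span (clos \<rat>) (map emb Vs) = carrier E"
  proof (rule Span_dense_completion[OF assms(2) VF])
    show "\<exists>b\<in>C.Span \<rat> Vs. w (a - b) < e" if "a \<in> F" "0 < e" for a e
      using that Vs by (intro bexI[of _ a]) simp_all
  qed
  moreover have "E.finite_dimension (clos \<rat>) (E.Span (clos \<rat>) (map emb Vs))"
    by (rule E.Span_finite_dimension[OF subfield_clos[OF assms(2) Rats_F]]) (use VF in auto)
  ultimately show ?thesis
    by simp
qed

end

lemma subfield_Rats: "subfield \<rat> \<C>"
proof -
  interpret C: field \<C> by (rule field_C)
  show ?thesis
    by (rule C.subfieldI'[OF C.subringI]) auto
qed

section \<open>Nonarchimedean absolute values on a number field\<close>

locale padic_subfield = valued_subfield +
  fixes p :: nat
  assumes prime_p: "Factorial_Ring.prime p" and w_rat: "\<And>r. w (of_rat r) = padic_abs p r"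
    and fin_dim: "ring.finite_dimension \<C> \<rat> F"
begin

lemma p_gt_1: "1 < p"
  using prime_p prime_gt_1_nat by blast

lemma w_of_int: "w (of_int m) = (if m = 0 then 0 else 1 / real p ^ multiplicity (int p) m)"
  using w_rat[of "of_int m"] by (simp add: padic_abs_of_int)

lemma w_of_int_le: "w (of_int m) \<le> 1"
  using p_gt_1 by (simp add: w_of_int divide_le_eq)

lemma w_of_nat_le: "w (of_nat m) \<le> 1"
  using w_of_int_le[of "int m"] by simp

lemma w_p: "w (of_nat p) = 1 / p"
  using w_of_int[of "int p"] p_gt_1 multiplicity_self[of "int p"] by (simp add: zdvd1_eq)

lemma w_of_int_dvd: "int p ^ k dvd m \<Longrightarrow> w (of_int m) \<le> 1 / real p ^ k"
proof (cases "m = 0")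
  case False
  assume "int p ^ k dvd m"
  then have "k \<le> multiplicity (int p) m"
    using False p_gt_1 prime_p by (intro multiplicity_geI) (auto simp: zdvd1_eq)
  then show ?thesis
    using False p_gt_1 by (simp add: w_of_int divide_le_cancel frac_le power_increasing)
qed simp

lemma V_nat_elem: "V.nat_elem n = of_nat n"
  by (induction n) (simp_all add: V.nat_elem_Suc add.commute)

sublocale V: ultrametric_field "field_of F" w
proof
  show V.ultrametric
    by (rule V.ultrametricI) (simp only: V_nat_elem w_of_nat_le)
qed

lemma w_add_max: "x \<in> F \<Longrightarrow> y \<in> F \<Longrightarrow> w (x + y) \<le> max (w x) (w y)"
  using V.u_add_max[of x y] by simp

lemma w_diff_max: "x \<in> F \<Longrightarrow> y \<in> F \<Longrightarrow> w (x - y) \<le> max (w x) (w y)"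
  using V.u_minus_max[of x y] by (simp add: F_a_minus)

lemma w_sum_max: "(\<And>i. i \<in> I \<Longrightarrow> f i \<in> F) \<Longrightarrow> (\<And>i. i \<in> I \<Longrightarrow> w (f i) \<le> b) \<Longrightarrow> 0 \<le> b \<Longrightarrow> w (sum f I) \<le> b"
proof (induction I rule: infinite_finite_induct)
  case (insert i I)
  then show ?case
    using w_add_max[of "f i" "sum f I"] by (auto intro: order_trans)
qed auto

sublocale E: ultrametric_field E cabs
proof
  show E.ultrametric
    by (rule E.ultrametricI) (simp add: nat_elem_E cabs_emb w_of_nat_le)
qed

lemma clos_Rats_approx:
  assumes "x \<in> clos \<rat>" "e > 0"
  shows "\<exists>r. cabs (x \<ominus>\<^bsub>E\<^esub> emb (of_rat r)) < e"
  using clos_approx[OF assms] by (auto elim!: Rats_cases)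

text \<open>A reduced fraction of value at most 1 has a denominator prime to \<open>p\<close>; that
  denominator is invertible modulo \<open>p ^ k\<close>, and \<open>a\<close> is the quotient
  computed there.\<close>

lemma rat_residue:
  assumes "w (of_rat r) \<le> 1"
  shows "\<exists>a<p ^ k. w (of_rat r - of_nat a) \<le> 1 / real p ^ k"
proof -
  obtain s t where st: "quotient_of r = (s, t)"
    by (cases "quotient_of r")
  have t: "t > 0" "algebraic_semidom_class.coprime s t" "r = of_int s / of_int t"
    using quotient_of_denom_pos[OF st] quotient_of_coprime[OF st] quotient_of_div[OF st] by auto
  have pp: "Factorial_Ring.prime (int p)"
    using prime_p by simp
  have pt: "\<not> int p dvd t"
  proof
    assume d: "int p dvd t"
    have ns: "\<not> int p dvd s"
      using coprime_common_divisor[OF t(2) _ d] p_gt_1 by (auto simp: zdvd1_eq)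
    then have s: "s \<noteq> 0" "multiplicity (int p) s = 0"
      by (auto simp: not_dvd_imp_multiplicity_0)
    have m: "multiplicity (int p) t \<ge> 1"
      using d t(1) pp by (intro multiplicity_geI) auto
    have "r \<noteq> 0"
      using s t by auto
    then have "w (of_rat r) = real p powi int (multiplicity (int p) t)"
      using st s by (simp add: w_rat padic_abs_def)
    also have "\<dots> > 1"
      using m p_gt_1 by (simp add: one_less_power)
    finally show False
      using assms by simp
  qed
  then have wt: "w (of_int t) = 1"
    using t(1) by (simp add: w_of_int not_dvd_imp_multiplicity_0)
  have "algebraic_semidom_class.coprime (int p) t"
    by (rule prime_imp_coprime[OF pp pt])
  then have "algebraic_semidom_class.coprime t (int p ^ k)"
    by (simp add: ac_simps)
  then obtain y where y: "[t * y = 1] (mod int p ^ k)"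
    using cong_solve_coprime_int by blast
  define a where "a = nat ((s * y) mod int p ^ k)"
  have pk: "int p ^ k > 0"
    using p_gt_1 by simp
  have a: "a < p ^ k" "int a = (s * y) mod int p ^ k"
    using pk by (auto simp: a_def nat_less_iff)
  have "((s * y) mod int p ^ k * t) mod int p ^ k = (s * y * t) mod int p ^ k"
    by (rule mod_mult_left_eq)
  also have "s * y * t = s * (t * y)"
    by simp
  finally have "[int a * t = s * (t * y)] (mod int p ^ k)"
    unfolding a(2) Cong.cong_def .
  also have "[s * (t * y) = s * 1] (mod int p ^ k)"
    using y by (rule cong_scalar_left)
  finally have "int p ^ k dvd s - int a * t"
    by (simp add: cong_iff_dvd_diff dvd_diff_commute)
  then have "w (of_int (s - int a * t)) \<le> 1 / real p ^ k"
    by (rule w_of_int_dvd)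
  moreover have "of_rat r - of_nat a = (of_int (s - int a * t) / of_int t :: complex)"
    unfolding t(3) using t(1) by (simp add: of_rat_divide field_simps)
  ultimately show ?thesis
    using a(1) wt w_divide[of "of_int (s - int a * t)" "of_int t"] by (metis F_of_int div_by_1)
qed

text \<open>An element has the same value as any sufficiently close rational, so passing to the
  closure adds no new values.\<close>

lemma clos_Rats_value:
  assumes x: "x \<in> clos \<rat>" "x \<noteq> \<zero>\<^bsub>E\<^esub>"
  shows "\<exists>i::int. cabs x = real p powi i"
proof -
  from x have xc: "x \<in> carrier E" using clos_in by blast
  obtain r where r: "cabs (x \<ominus>\<^bsub>E\<^esub> emb (of_rat r)) < cabs x"
    using clos_Rats_approx[OF x(1) E.u_pos[OF xc x(2)]] by blast
  then have *: "w (of_rat r) = cabs x"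
    using E.u_eq_of_close[OF xc, of "emb (of_rat r)"] by (simp add: cabs_emb)
  then have "r \<noteq> 0"
    using E.u_pos[OF xc x(2)] by auto
  then show ?thesis
    using *[symmetric] by (auto simp: w_rat padic_abs_def)
qed

lemma clos_Rats_residue:
  assumes x: "x \<in> clos \<rat>" "cabs x \<le> 1"
  shows "\<exists>a<p ^ k. cabs (x \<ominus>\<^bsub>E\<^esub> E.nat_elem a) \<le> 1 / real p ^ k"
proof -
  from x have xc: "x \<in> carrier E" using clos_in by blast
  have pk: "1 / real p ^ k > 0" "1 / real p ^ k \<le> 1"
    using p_gt_1 by (auto simp: divide_le_eq)
  obtain r where r: "cabs (x \<ominus>\<^bsub>E\<^esub> emb (of_rat r)) < 1 / real p ^ k"
    using clos_Rats_approx[OF x(1) pk(1)] by blast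
  have "w (of_rat r) \<le> max (cabs x) (cabs (x \<ominus>\<^bsub>E\<^esub> emb (of_rat r)))"
    using E.u_le_of_close[OF xc, of "emb (of_rat r)"] by (simp add: cabs_emb)
  also have "\<dots> \<le> 1"
    using x(2) less_imp_le[OF less_le_trans[OF r pk(2)]] by simp
  finally have "w (of_rat r) \<le> 1" .
  then obtain a where a: "a < p ^ k" "w (of_rat r - of_nat a) \<le> 1 / real p ^ k"
    using rat_residue by blast
  have "cabs (x \<ominus>\<^bsub>E\<^esub> E.nat_elem a) \<le> max (cabs (x \<ominus>\<^bsub>E\<^esub> emb (of_rat r))) (cabs (emb (of_rat r) \<ominus>\<^bsub>E\<^esub> emb (of_nat a)))"
    unfolding nat_elem_E using xc by (intro E.u_triangle_max) auto
  also have "\<dots> \<le> 1 / real p ^ k"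
    using a r by (simp add: emb_minus cabs_emb)
  finally show "\<exists>a<p ^ k. cabs (x \<ominus>\<^bsub>E\<^esub> E.nat_elem a) \<le> 1 / real p ^ k"
    using a by blast
qed

sublocale P: padic_field E cabs p "clos \<rat>"
  by (intro padic_field.intro padic_field_axioms.intro E.ultrametric_field_axioms prime_p
      subfield_clos[OF subfield_Rats Rats_F] complete_clos clos_Rats_value clos_Rats_residue
      finite_dimension_completion[OF fin_dim subfield_Rats])
     (simp_all add: nat_elem_E cabs_emb w_p)

lemma residue_char: "residue_char F w = p"
  by (simp add: residue_char_def P.characteristic_Res)

text \<open>The label of \<open>x\<close> is a representative of \<open>emb x\<close> modulo
  \<open>p ^ k\<close> in the completion. Labels keep the pigeonhole arguments within
  \<open>F\<close>: equal labels mean congruent elements, and their number is bounded by the local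
  degree.\<close>

lemma integral_residue_classes:
  obtains cl :: "complex \<Rightarrow> (nat \<Rightarrow> complex) set" where
    "finite (cl ` {x \<in> F. w x \<le> 1})"
    "card (cl ` {x \<in> F. w x \<le> 1}) \<le> p ^ (k * local_degree F w)"
    "\<And>x y. \<lbrakk>x \<in> F; y \<in> F; w x \<le> 1; w y \<le> 1; cl x = cl y\<rbrakk> \<Longrightarrow> w (x - y) \<le> 1 / real p ^ k"
proof -
  obtain T where T: "finite T" "T \<subseteq> carrier E" "card T \<le> p ^ (k * E.dim (clos \<rat>) (carrier E))"
    "\<And>x. x \<in> carrier E \<Longrightarrow> cabs x \<le> 1 \<Longrightarrow> \<exists>t\<in>T. cabs (x \<ominus>\<^bsub>E\<^esub> t) \<le> 1 / real p ^ k"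
    using P.residues[of k] by blast
  define cl where "cl x = (SOME t. t \<in> T \<and> cabs (emb x \<ominus>\<^bsub>E\<^esub> t) \<le> 1 / real p ^ k)" for x
  have cl: "cl x \<in> T" "cabs (emb x \<ominus>\<^bsub>E\<^esub> cl x) \<le> 1 / real p ^ k" if "x \<in> F" "w x \<le> 1" for x
    using someI_ex[of "\<lambda>t. t \<in> T \<and> cabs (emb x \<ominus>\<^bsub>E\<^esub> t) \<le> 1 / real p ^ k"] T(4)[of "emb x"] that
    unfolding cl_def by (auto simp: cabs_emb)
  have sub: "cl ` {x \<in> F. w x \<le> 1} \<subseteq> T"
    using cl by auto
  show thesis
  proof (rule that)
    show "finite (cl ` {x \<in> F. w x \<le> 1})"
      using sub T finite_subset by blast
    show "card (cl ` {x \<in> F. w x \<le> 1}) \<le> p ^ (k * local_degree F w)"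
      using card_mono[OF T(1) sub] T(3) by (simp add: local_degree_def)
    fix x y assume xy: "x \<in> F" "y \<in> F" "w x \<le> 1" "w y \<le> 1" "cl x = cl y"
    have "cl x \<in> carrier E"
      using cl T xy by blast
    then have "cabs (emb x \<ominus>\<^bsub>E\<^esub> emb y) \<le> max (cabs (emb x \<ominus>\<^bsub>E\<^esub> cl x)) (cabs (cl x \<ominus>\<^bsub>E\<^esub> emb y))"
      using xy by (intro E.u_triangle_max) auto
    also have "\<dots> \<le> 1 / real p ^ k"
      using cl[OF xy(1,3)] cl[OF xy(2,4)] xy T by (auto simp: E.u_minus_commute[of "cl y" "emb y"])
    finally show "w (x - y) \<le> 1 / real p ^ k"
      using xy by (simp add: emb_minus cabs_emb)
  qed
qed

end

section \<open>The Galois extension of a completion\<close>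

locale padic_galois = padic_subfield +
  fixes L :: "'b ring" and \<iota> :: "(nat \<Rightarrow> complex) set \<Rightarrow> 'b" and u :: "'b \<Rightarrow> real"
  assumes ext: "finite_galois_valued_extension E cabs L \<iota> u"
begin

definition kL :: "'b set" where "kL = \<iota> ` carrier E"
definition k0L :: "'b set" where "k0L = \<iota> ` clos \<rat>"

lemma field_L: "field L" and kL: "subfield kL L" and fin_dim_kL: "ring.finite_dimension L kL (carrier L)"
  and galois: "{x \<in> carrier L. \<forall>\<sigma>\<in>ring_iso L L. (\<forall>y\<in>kL. \<sigma> y = y) \<longrightarrow> \<sigma> x = x} = kL"
  and \<iota>_hom: "\<iota> \<in> Ring.ring_hom E L" and u_\<iota>: "\<And>x. x \<in> carrier E \<Longrightarrow> u (\<iota> x) = cabs x"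
  and u_av: "absolute_value L u"
  using ext unfolding finite_galois_valued_extension_def finite_galois_def kL_def by auto

sublocale L: valued_field L u
  using field_L u_av by (simp add: valued_field_def valued_field_axioms_def)

sublocale h: ring_hom_ring E L \<iota>
  by (rule ring_hom_ringI2[OF E.ring_axioms L.ring_axioms \<iota>_hom])

lemma nat_elem_L: "L.nat_elem n = \<iota> (E.nat_elem n)"
  by (induction n) (simp_all add: L.nat_elem_Suc E.nat_elem_Suc)

sublocale L: ultrametric_field L u
proof
  show L.ultrametric
    by (rule L.ultrametricI) (simp add: nat_elem_L u_\<iota> E.u_nat_elem_le)
qed

lemma u_\<iota>_minus: "x \<in> carrier E \<Longrightarrow> y \<in> carrier E \<Longrightarrow> u (\<iota> x \<ominus>\<^bsub>L\<^esub> \<iota> y) = cabs (x \<ominus>\<^bsub>E\<^esub> y)"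
  by (simp add: a_minus_def u_\<iota> flip: h.hom_a_inv h.hom_add)

lemma inj_\<iota>: "inj_on \<iota> (carrier E)"
proof (rule inj_onI)
  fix x y assume xy: "x \<in> carrier E" "y \<in> carrier E" "\<iota> x = \<iota> y"
  have "\<iota> x \<ominus>\<^bsub>L\<^esub> \<iota> y = \<zero>\<^bsub>L\<^esub>"
    unfolding xy(3) a_minus_def using ring_hom_closed[OF \<iota>_hom xy(2)] by (rule L.r_neg)
  then have "cabs (x \<ominus>\<^bsub>E\<^esub> y) = 0"
    using u_\<iota>_minus[OF xy(1,2)] by simp
  then show "x = y"
    using E.u_eq_0[of "x \<ominus>\<^bsub>E\<^esub> y"] xy by (simp add: E.r_right_minus_eq)
qed

lemma complete_image:
  assumes "E.complete_set A" "A \<subseteq> carrier E"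
  shows "L.complete_set (\<iota> ` A)"
  unfolding L.complete_set_def
proof (intro allI impI)
  fix x assume x: "range x \<subseteq> \<iota> ` A" "L.cauchy_in x"
  then have "\<exists>a\<in>A. x n = \<iota> a" for n
    by auto
  then obtain a where a: "\<And>n. a n \<in> A" "\<And>n. x n = \<iota> (a n)"
    by metis
  have ac: "a n \<in> carrier E" for n
    using a assms by auto
  have "E.cauchy_in a"
    using x(2) ac unfolding L.cauchy_in_def E.cauchy_in_def by (simp add: a(2) u_\<iota>_minus)
  moreover have "range a \<subseteq> A"
    using a by auto
  ultimately obtain l where l: "l \<in> A" "(\<lambda>n. cabs (a n \<ominus>\<^bsub>E\<^esub> l)) \<longlonglongrightarrow> 0"
    using assms(1) unfolding E.complete_set_def by blast
  then have "(\<lambda>n. u (x n \<ominus>\<^bsub>L\<^esub> \<iota> l)) \<longlonglongrightarrow> 0"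
    using ac assms(2) by (simp add: a(2) u_\<iota>_minus subset_iff)
  then show "\<exists>l\<in>\<iota> ` A. (\<lambda>n. u (x n \<ominus>\<^bsub>L\<^esub> l)) \<longlonglongrightarrow> 0"
    using l by blast
qed

lemma complete_kL: "L.complete_set kL"
  unfolding kL_def using complete_image[OF complete_clos[of F]] by (simp add: clos_F)

lemma k0L_subset: "k0L \<subseteq> kL"
  unfolding k0L_def kL_def using clos_in by blast

lemma k0L: "subfield k0L L"
  unfolding k0L_def using h.img_is_subfield(2)[OF P.k0] by simp

lemma fin_dim_k0L: "L.finite_dimension k0L (carrier L)"
proof -
  have "E.dimension (E.dim (clos \<rat>) (carrier E)) (clos \<rat>) (carrier E)"
    using E.finite_dimensionE[OF P.k0 P.fin_dim] by (simp add: over_def)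
  then have "L.finite_dimension k0L kL"
    unfolding k0L_def kL_def
    by (intro L.finite_dimensionI h.inj_hom_dimension[OF P.k0 _ inj_\<iota>]) simp_all
  then show ?thesis
    using L.telescopic_base_dim(1)[OF k0L kL _ fin_dim_kL] by blast
qed

sublocale Q: padic_field L u p k0L
proof (intro padic_field.intro padic_field_axioms.intro L.ultrametric_field_axioms prime_p k0L fin_dim_k0L)
  show "L.complete_set k0L"
    unfolding k0L_def by (rule complete_image[OF complete_clos]) (use clos_in in blast)
  show "u (L.nat_elem p) = 1 / real p"
    using P.u_p by (simp add: nat_elem_L u_\<iota>)
next
  fix x assume "x \<in> k0L" "x \<noteq> \<zero>\<^bsub>L\<^esub>"
  then obtain y where "y \<in> clos \<rat>" "x = \<iota> y"
    by (auto simp: k0L_def)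
  with \<open>x \<noteq> \<zero>\<^bsub>L\<^esub>\<close> have y: "y \<in> clos \<rat>" "x = \<iota> y" "y \<noteq> \<zero>\<^bsub>E\<^esub>"
    by auto
  then show "\<exists>i. u x = real p powi i"
    using clos_Rats_value[OF y(1,3)] clos_in by (simp add: u_\<iota>)
next
  fix x k assume "x \<in> k0L" "u x \<le> 1"
  then obtain y where y: "y \<in> clos \<rat>" "x = \<iota> y" "cabs y \<le> 1"
    using clos_in by (auto simp: k0L_def u_\<iota>)
  then show "\<exists>a<p ^ k. u (x \<ominus>\<^bsub>L\<^esub> L.nat_elem a) \<le> 1 / real p ^ k"
    using clos_Rats_residue[OF y(1,3), of k] clos_in by (simp add: nat_elem_L u_\<iota>_minus)
qed

abbreviation "ram_index \<equiv> ramification_index L u kL"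
abbreviation "in_deg \<equiv> inertial_degree L u kL"

lemma ram_index: "1 \<le> ram_index" "ram_index \<le> Q.ram"
  using Q.ramification_index_bounds[OF kL k0L_subset] by auto

text \<open>Because \<open>\<iota>\<close> preserves values, the residue field of the completion
  embeds into that of \<open>L\<close>; the cardinality is then that of a finite field over a
  subfield with \<open>residue_order F w\<close> elements.\<close>

lemma card_Res: "card (carrier L.Res) = residue_order F w ^ in_deg" "0 < in_deg"
proof -
  interpret RL: field L.Res by (rule L.field_Res)
  interpret RE: field E.Res by (rule E.field_Res)
  let ?O = "{x \<in> carrier E. cabs x \<le> 1}"
  \<comment> \<open>The embedding of residue fields, defined through a chosen representative; the
    fact \<open>g\<close> shows that the choice does not affect the class.\<close>
  define g where "g = (\<lambda>A. L.rescls (\<iota> (SOME x. x \<in> ?O \<and> A = E.rescls x)))"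
  have g: "g (E.rescls x) = L.rescls (\<iota> x)" if x: "x \<in> ?O" for x
  proof -
    define y where "y = (SOME y. y \<in> ?O \<and> E.rescls x = E.rescls y)"
    have y: "y \<in> ?O" "E.rescls x = E.rescls y"
      using someI[of "\<lambda>y. y \<in> ?O \<and> E.rescls x = E.rescls y" x] x by (simp_all add: y_def)
    have "g (E.rescls x) = L.rescls (\<iota> y)"
      by (simp add: g_def y_def)
    then show ?thesis
      using x y E.rescls_eq_iff[of x y] L.rescls_eq_iff[of "\<iota> x" "\<iota> y"]
      by (simp add: u_\<iota> u_\<iota>_minus)
  qed
  let ?K = "L.rescls ` {x \<in> kL. u x \<le> 1}"
  have K: "?K = g ` carrier E.Res"
    unfolding E.carrier_Res image_image kL_def by (force simp: g u_\<iota> image_iff)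
  have inj: "inj_on g (carrier E.Res)"
  proof (rule inj_onI)
    fix A B assume "A \<in> carrier E.Res" "B \<in> carrier E.Res" "g A = g B"
    then obtain x y where "x \<in> ?O" "y \<in> ?O" "A = E.rescls x" "B = E.rescls y" "L.rescls (\<iota> x) = L.rescls (\<iota> y)"
      unfolding E.carrier_Res using g by auto
    then show "A = B"
      using E.rescls_eq_iff[of x y] L.rescls_eq_iff[of "\<iota> x" "\<iota> y"] by (simp add: u_\<iota> u_\<iota>_minus)
  qed
  have "g \<in> Ring.ring_hom E.Res L.Res"
  proof (rule ring_hom_memI)
    fix A B assume "A \<in> carrier E.Res" "B \<in> carrier E.Res"
    then obtain x y where xy: "x \<in> ?O" "y \<in> ?O" "A = E.rescls x" "B = E.rescls y"
      unfolding E.carrier_Res by auto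
    show "g A \<in> carrier L.Res"
      using xy by (auto simp: g L.carrier_Res u_\<iota>)
    have "x \<otimes>\<^bsub>E\<^esub> y \<in> ?O" "x \<oplus>\<^bsub>E\<^esub> y \<in> ?O"
      using xy subringE(6,7)[OF E.subring_O, of x y] by auto
    then show "g (A \<otimes>\<^bsub>E.Res\<^esub> B) = g A \<otimes>\<^bsub>L.Res\<^esub> g B" "g (A \<oplus>\<^bsub>E.Res\<^esub> B) = g A \<oplus>\<^bsub>L.Res\<^esub> g B"
      using xy by (simp_all add: E.rescls_mult L.rescls_mult E.rescls_add L.rescls_add g u_\<iota>)
  next
    show "g \<one>\<^bsub>E.Res\<^esub> = \<one>\<^bsub>L.Res\<^esub>"
      using g[of "\<one>\<^bsub>E\<^esub>"] by (simp add: E.rescls_one L.rescls_one)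
  qed
  then interpret g: ring_hom_ring E.Res L.Res g
    by (intro ring_hom_ringI2 RE.ring_axioms RL.ring_axioms)
  have "subfield (carrier E.Res) E.Res"
    using RE.carrier_is_subfield .
  then have sub: "subfield ?K L.Res"
    unfolding K using g.img_is_subfield(2) by simp
  have "in_deg = ring.dim L.Res ?K (carrier L.Res)"
    by (simp add: inertial_degree_def L.rescls_def)
  moreover have "card ?K = residue_order F w"
    unfolding K residue_order_def Coset.order_def by (rule card_image[OF inj])
  ultimately show "card (carrier L.Res) = residue_order F w ^ in_deg" "0 < in_deg"
    using RL.card_finite_field_extension[OF Q.finite_Res sub] by auto
qed

end

section \<open>Galois stable products of linear factors\<close>

context ring
begin

text \<open>\<open>rc bs i\<close> is the coefficient of \<open>x ^ i\<close> in the product of \<open>x - b\<close> over \<open>bs\<close>.\<close>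

primrec rc :: "'a list \<Rightarrow> nat \<Rightarrow> 'a" where
  "rc [] i = (if i = 0 then \<one> else \<zero>)"
| "rc (b # bs) i = (if i = 0 then \<zero> else rc bs (i - 1)) \<ominus> b \<otimes> rc bs i"

primrec rprod :: "'a list \<Rightarrow> 'a \<Rightarrow> 'a" where
  "rprod [] x = \<one>"
| "rprod (b # bs) x = (x \<ominus> b) \<otimes> rprod bs x"

text \<open>Coefficient lists start with the highest degree, whence the reversal. Truncation at
  \<open>m\<close> makes induction on the number of coefficients possible.\<close>

definition psum :: "(nat \<Rightarrow> 'a) \<Rightarrow> nat \<Rightarrow> 'a \<Rightarrow> 'a" where
  "psum c m x = eval (map c (rev [0..<m])) x"

lemma psum_0 [simp]: "psum c 0 x = \<zero>"
  and psum_Suc [simp]: "psum c (Suc m) x = c m \<otimes> x [^] m \<oplus> psum c m x"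
  by (simp_all add: psum_def)

end

context cring
begin

lemma rc_in [simp]: "set bs \<subseteq> carrier R \<Longrightarrow> rc bs i \<in> carrier R"
  by (induction bs arbitrary: i) auto

lemma rprod_in [simp]: "set bs \<subseteq> carrier R \<Longrightarrow> x \<in> carrier R \<Longrightarrow> rprod bs x \<in> carrier R"
  by (induction bs) auto

lemma psum_in [simp]: "(\<And>i. i < m \<Longrightarrow> c i \<in> carrier R) \<Longrightarrow> x \<in> carrier R \<Longrightarrow> psum c m x \<in> carrier R"
  by (induction m) auto

lemma rc_high: "set bs \<subseteq> carrier R \<Longrightarrow> length bs < i \<Longrightarrow> rc bs i = \<zero>"
  by (induction bs arbitrary: i) (auto simp: a_minus_def)

lemma rc_length: "set bs \<subseteq> carrier R \<Longrightarrow> rc bs (length bs) = \<one>"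
  by (induction bs) (auto simp: rc_high a_minus_def)

text \<open>Multiplication by \<open>x - b\<close> on coefficients. The two truncations on the right
  differ by one because the factor \<open>x\<close> raises every exponent.\<close>

lemma psum_shift:
  assumes c: "\<And>i. c i \<in> carrier R" and b: "b \<in> carrier R" and x: "x \<in> carrier R"
  shows "psum (\<lambda>i. (if i = 0 then \<zero> else c (i - 1)) \<ominus> b \<otimes> c i) (Suc m) x
    = x \<otimes> psum c m x \<ominus> b \<otimes> psum c (Suc m) x"
proof (induction m)
  case 0
  show ?case
    using c[of 0] b x by (simp add: a_minus_def)
next
  case (Suc m)
  let ?d = "\<lambda>i. (if i = 0 then \<zero> else c (i - 1)) \<ominus> b \<otimes> c i"
  have "psum ?d (Suc (Suc m)) x = ?d (Suc m) \<otimes> x [^] Suc m \<oplus> psum ?d (Suc m) x"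
    by (rule psum_Suc)
  also have "\<dots> = (c m \<ominus> b \<otimes> c (Suc m)) \<otimes> (x \<otimes> x [^] m) \<oplus> (x \<otimes> psum c m x \<ominus> b \<otimes> (c m \<otimes> x [^] m \<oplus> psum c m x))"
    unfolding Suc.IH using x by (simp add: m_comm)
  also have "\<dots> = x \<otimes> (c m \<otimes> x [^] m \<oplus> psum c m x) \<ominus> b \<otimes> (c (Suc m) \<otimes> (x \<otimes> x [^] m) \<oplus> (c m \<otimes> x [^] m \<oplus> psum c m x))"
  proof -
    have "c m \<in> carrier R" "c (Suc m) \<in> carrier R" "x [^] m \<in> carrier R" "psum c m x \<in> carrier R"
      using c x by auto
    with b x show ?thesis
      by algebra
  qed
  finally show ?case
    using x by (simp add: m_comm)
qed

lemma psum_rc: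
  assumes "set bs \<subseteq> carrier R" "x \<in> carrier R"
  shows "psum (rc bs) (Suc (length bs)) x = rprod bs x"
  using assms
proof (induction bs)
  case (Cons b bs)
  have bs: "set bs \<subseteq> carrier R" "b \<in> carrier R" and x: "x \<in> carrier R"
    using Cons.prems by auto
  have "psum (rc (b # bs)) (Suc (Suc (length bs))) x
      = x \<otimes> psum (rc bs) (Suc (length bs)) x \<ominus> b \<otimes> psum (rc bs) (Suc (Suc (length bs))) x"
  proof -
    have "rc (b # bs) = (\<lambda>i. (if i = 0 then \<zero> else rc bs (i - 1)) \<ominus> b \<otimes> rc bs i)"
      by (rule ext) (rule rc.simps(2))
    then show ?thesis
      using psum_shift[of "rc bs" b x "Suc (length bs)"] bs x by simp
  qed
  also have "psum (rc bs) (Suc (Suc (length bs))) x = psum (rc bs) (Suc (length bs)) x"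
    using bs x by (subst psum_Suc) (simp add: rc_high)
  also have "psum (rc bs) (Suc (length bs)) x = rprod bs x"
    using Cons.IH bs x by simp
  also have "x \<otimes> rprod bs x \<ominus> b \<otimes> rprod bs x = (x \<ominus> b) \<otimes> rprod bs x"
    using bs(2) x rprod_in[OF bs(1) x] by algebra
  finally show ?case
    by simp
qed simp

lemma rc_swap:
  assumes "a \<in> carrier R" "b \<in> carrier R" "set bs \<subseteq> carrier R"
  shows "rc (a # b # bs) = rc (b # a # bs)"
proof
  fix i
  have *: "rc bs j \<in> carrier R" for j
    using assms by simp
  consider "i = 0" | "i = 1" | j where "i = Suc (Suc j)"
    by (metis One_nat_def old.nat.exhaust)
  then show "rc (a # b # bs) i = rc (b # a # bs) i"
  proof cases
    case 1
    then have "rc (a # b # bs) i = \<zero> \<ominus> a \<otimes> (\<zero> \<ominus> b \<otimes> rc bs 0)"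
      "rc (b # a # bs) i = \<zero> \<ominus> b \<otimes> (\<zero> \<ominus> a \<otimes> rc bs 0)"
      by simp_all
    moreover have "\<zero> \<ominus> a \<otimes> (\<zero> \<ominus> b \<otimes> rc bs 0) = \<zero> \<ominus> b \<otimes> (\<zero> \<ominus> a \<otimes> rc bs 0)"
      using assms(1,2) *[of 0] by algebra
    ultimately show ?thesis
      by (simp only:)
  next
    case 2
    then have "rc (a # b # bs) i = (\<zero> \<ominus> b \<otimes> rc bs 0) \<ominus> a \<otimes> (rc bs 0 \<ominus> b \<otimes> rc bs 1)"
      "rc (b # a # bs) i = (\<zero> \<ominus> a \<otimes> rc bs 0) \<ominus> b \<otimes> (rc bs 0 \<ominus> a \<otimes> rc bs 1)"
      by simp_all
    moreover have "(\<zero> \<ominus> b \<otimes> rc bs 0) \<ominus> a \<otimes> (rc bs 0 \<ominus> b \<otimes> rc bs 1)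
        = (\<zero> \<ominus> a \<otimes> rc bs 0) \<ominus> b \<otimes> (rc bs 0 \<ominus> a \<otimes> rc bs 1)"
      using assms(1,2) *[of 0] *[of 1] by algebra
    ultimately show ?thesis
      by (simp only:)
  next
    case (3 j)
    let ?r = "rc bs j" and ?s = "rc bs (Suc j)" and ?t = "rc bs (Suc (Suc j))"
    have "rc (a # b # bs) i = (?r \<ominus> b \<otimes> ?s) \<ominus> a \<otimes> (?s \<ominus> b \<otimes> ?t)"
      "rc (b # a # bs) i = (?r \<ominus> a \<otimes> ?s) \<ominus> b \<otimes> (?s \<ominus> a \<otimes> ?t)"
      using 3 by simp_all
    moreover have "(?r \<ominus> b \<otimes> ?s) \<ominus> a \<otimes> (?s \<ominus> b \<otimes> ?t) = (?r \<ominus> a \<otimes> ?s) \<ominus> b \<otimes> (?s \<ominus> a \<otimes> ?t)"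
      using assms(1,2) *[of j] *[of "Suc j"] *[of "Suc (Suc j)"] by algebra
    ultimately show ?thesis
      by (simp only:)
  qed
qed

lemma rc_remove1:
  "b \<in> set bs \<Longrightarrow> set bs \<subseteq> carrier R \<Longrightarrow> rc bs = rc (b # remove1 b bs)"
proof (induction bs)
  case (Cons a bs)
  show ?case
  proof (cases "a = b")
    case False
    then have b: "b \<in> set bs" "set bs \<subseteq> carrier R" "a \<in> carrier R" "b \<in> carrier R"
      using Cons.prems by auto
    have "set (remove1 b bs) \<subseteq> carrier R"
      using b set_remove1_subset[of b bs] by blast
    then have "rc (b # a # remove1 b bs) = rc (a # b # remove1 b bs)"
      using b by (intro rc_swap) auto
    also have "\<dots> = rc (a # bs)"
      using Cons.IH b by (intro ext) simp
    finally show ?thesis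
      using False by simp
  qed simp
qed simp

text \<open>Adjacent roots can be swapped, and swaps generate all rearrangements. The coefficients
  are thus symmetric functions of the roots, which is what makes them Galois invariant.\<close>

lemma rc_mset:
  "mset xs = mset ys \<Longrightarrow> set xs \<subseteq> carrier R \<Longrightarrow> rc xs = rc ys"
proof (induction ys arbitrary: xs)
  case (Cons b ys)
  have b: "b \<in> set xs"
    using Cons.prems by (metis list.set_intros(1) set_mset_mset)
  have "mset (remove1 b xs) = mset ys"
    using Cons.prems by simp
  moreover have "set (remove1 b xs) \<subseteq> carrier R"
    using Cons.prems(2) set_remove1_subset[of b xs] by blast
  ultimately have "rc (remove1 b xs) = rc ys"
    by (rule Cons.IH)
  then show ?case
    using rc_remove1[OF b Cons.prems(2)] by (intro ext) simp
qed simp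

end

section \<open>Galois action on products of linear factors\<close>

lemma (in ring_hom_cring) rc_hom:
  "set bs \<subseteq> carrier R \<Longrightarrow> h (R.rc bs i) = S.rc (map h bs) i"
  by (induction bs arbitrary: i) (auto simp: a_minus_def)

text \<open>Two base fields occur: residues and values are counted over \<open>k0\<close>, the
  p-adic numbers, while the Galois group is taken over \<open>k\<close>, the image of K_v.\<close>

locale local_extension = padic_field +
  fixes k :: "'a set"
  assumes k: "subfield k R" and k0_k: "k0 \<subseteq> k" and k_complete: "complete_set k"
    and fin_dim_k: "finite_dimension k (carrier R)"
    and galois: "{x \<in> carrier R. \<forall>\<sigma>\<in>ring_iso R R. (\<forall>y\<in>k. \<sigma> y = y) \<longrightarrow> \<sigma> x = x} = k"
begin

lemma k_in: "x \<in> k \<Longrightarrow> x \<in> carrier R"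
  using subfieldE(3)[OF k] by auto

text \<open>\<open>ring_iso\<close> constrains functions only on the carrier. Restriction identifies
  automorphisms that agree there, so that the set is finite and its elements can be counted.\<close>

definition Gal :: "('a \<Rightarrow> 'a) set" where
  "Gal = (\<lambda>\<sigma>. restrict \<sigma> (carrier R)) ` {\<sigma> \<in> ring_iso R R. \<forall>y\<in>k. \<sigma> y = y}"

lemma Gal_iff: "\<tau> \<in> Gal \<longleftrightarrow> \<tau> \<in> extensional (carrier R) \<and> \<tau> \<in> ring_iso R R \<and> (\<forall>y\<in>k. \<tau> y = y)"
proof -
  have r: "restrict \<sigma> (carrier R) \<in> ring_iso R R" if "\<sigma> \<in> ring_iso R R" for \<sigma>
    using that unfolding ring_iso_def by (auto intro!: ring_hom_memI
      simp: ring_hom_closed ring_hom_mult ring_hom_add ring_hom_one bij_betw_restrict_eq)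
  show ?thesis
  proof
    assume "\<tau> \<in> Gal"
    then show "\<tau> \<in> extensional (carrier R) \<and> \<tau> \<in> ring_iso R R \<and> (\<forall>y\<in>k. \<tau> y = y)"
      unfolding Gal_def using r k_in by auto
  next
    assume *: "\<tau> \<in> extensional (carrier R) \<and> \<tau> \<in> ring_iso R R \<and> (\<forall>y\<in>k. \<tau> y = y)"
    then have "\<tau> = restrict \<tau> (carrier R)"
      by (simp add: extensional_restrict)
    with * show "\<tau> \<in> Gal"
      unfolding Gal_def by blast
  qed
qed

lemma Gal_hom: "\<tau> \<in> Gal \<Longrightarrow> \<tau> \<in> Ring.ring_hom R R"
  and Gal_bij: "\<tau> \<in> Gal \<Longrightarrow> bij_betw \<tau> (carrier R) (carrier R)"
  and Gal_fix: "\<tau> \<in> Gal \<Longrightarrow> y \<in> k \<Longrightarrow> \<tau> y = y"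
  by (auto simp: Gal_iff ring_iso_def)

lemma Gal_in: "\<tau> \<in> Gal \<Longrightarrow> x \<in> carrier R \<Longrightarrow> \<tau> x \<in> carrier R"
  using ring_hom_closed[OF Gal_hom] .

lemma Gal_hom_ring: "\<tau> \<in> Gal \<Longrightarrow> ring_hom_cring R R \<tau>"
  by (intro ring_hom_cringI ring_hom_ringI2 ring_axioms cring_axioms is_cring Gal_hom)

lemma Gal_ring_hom_ring: "\<tau> \<in> Gal \<Longrightarrow> ring_hom_ring R R \<tau>"
  by (intro ring_hom_ringI2 ring_axioms Gal_hom)

lemma Gal_minus: "\<tau> \<in> Gal \<Longrightarrow> x \<in> carrier R \<Longrightarrow> y \<in> carrier R \<Longrightarrow> \<tau> (x \<ominus> y) = \<tau> x \<ominus> \<tau> y"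
proof -
  assume t: "\<tau> \<in> Gal" "x \<in> carrier R" "y \<in> carrier R"
  interpret ring_hom_cring R R \<tau> by (rule Gal_hom_ring[OF t(1)])
  show ?thesis
    using t by (simp add: a_minus_def)
qed

lemma Gal_fixed: "x \<in> carrier R \<Longrightarrow> (\<And>\<tau>. \<tau> \<in> Gal \<Longrightarrow> \<tau> x = x) \<Longrightarrow> x \<in> k"
proof -
  assume x: "x \<in> carrier R" "\<And>\<tau>. \<tau> \<in> Gal \<Longrightarrow> \<tau> x = x"
  have "\<sigma> x = x" if "\<sigma> \<in> ring_iso R R" "\<forall>y\<in>k. \<sigma> y = y" for \<sigma>
    using x(2)[of "restrict \<sigma> (carrier R)"] that x(1) by (auto simp: Gal_def)
  then show ?thesis
    using galois x(1) by blast
qed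

lemma Gal_id: "restrict (\<lambda>x. x) (carrier R) \<in> Gal"
  unfolding Gal_def by (rule image_eqI[of _ _ "\<lambda>x. x"]) (auto simp: ring_iso_def bij_betw_def intro!: ring_hom_memI)

text \<open>\<open>isometry_of_linear\<close> applied to \<tau> gives one inequality and applied to
  its inverse gives the other.\<close>

lemma Gal_isometry:
  assumes t: "\<tau> \<in> Gal" and x: "x \<in> carrier R"
  shows "u (\<tau> x) = u x"
proof (rule antisym)
  show "u (\<tau> x) \<le> u x"
    by (rule isometry_of_linear[OF k k_complete fin_dim_k Gal_hom[OF t] Gal_fix[OF t] x])
  let ?s = "inv_into (carrier R) \<tau>"
  have bij: "bij_betw \<tau> (carrier R) (carrier R)"
    using Gal_bij[OF t] .
  have s: "?s \<in> ring_iso R R"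
    by (rule ring_iso_set_sym[OF ring_axioms]) (use t in \<open>simp add: Gal_iff\<close>)
  have sy: "?s (\<tau> y) = y" if "y \<in> carrier R" for y
    using bij that by (simp add: bij_betw_inv_into_left)
  have "?s y = y" if "y \<in> k" for y
    using sy[OF k_in[OF that]] Gal_fix[OF t that] by simp
  then have "u (?s (\<tau> x)) \<le> u (\<tau> x)"
    using s Gal_in[OF t x] by (intro isometry_of_linear[OF k k_complete fin_dim_k]) (auto simp: ring_iso_def)
  then show "u x \<le> u (\<tau> x)"
    using sy[OF x] by simp
qed

text \<open>Left translation in the group. It shows that a union of orbits is mapped onto itself by
  every automorphism.\<close>

lemma Gal_compose:
  fixes \<sigma>
  assumes "\<sigma> \<in> Gal"
  shows "bij_betw (compose (carrier R) \<sigma>) Gal Gal"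
proof -
  have cl: "compose (carrier R) \<sigma>' \<tau> \<in> Gal" if "\<sigma>' \<in> Gal" "\<tau> \<in> Gal" for \<sigma>' \<tau>
  proof -
    have "\<sigma>' \<circ> \<tau> \<in> ring_iso R R"
      using ring_iso_set_trans[of \<tau> R R \<sigma>' R] that by (simp add: Gal_iff)
    moreover have "compose (carrier R) \<sigma>' \<tau> = restrict (\<sigma>' \<circ> \<tau>) (carrier R)"
      by (auto simp: compose_def)
    ultimately show ?thesis
      unfolding Gal_def using that by (intro image_eqI[of _ _ "\<sigma>' \<circ> \<tau>"]) (auto simp: Gal_fix)
  qed
  let ?s = "restrict (inv_into (carrier R) \<sigma>) (carrier R)"
  have bij: "bij_betw \<sigma> (carrier R) (carrier R)"
    using Gal_bij[OF assms] .
  have sy: "inv_into (carrier R) \<sigma> (\<sigma> y) = y" "\<sigma> (inv_into (carrier R) \<sigma> y) = y" "inv_into (carrier R) \<sigma> y \<in> carrier R"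
    if "y \<in> carrier R" for y
    using bij that by (auto simp: bij_betw_inv_into_left bij_betw_inv_into_right bij_betw_def intro: inv_into_into)
  have "inv_into (carrier R) \<sigma> \<in> ring_iso R R"
    by (rule ring_iso_set_sym[OF ring_axioms]) (use assms in \<open>simp add: Gal_iff\<close>)
  moreover have "inv_into (carrier R) \<sigma> y = y" if "y \<in> k" for y
    using sy(1)[OF k_in[OF that]] Gal_fix[OF assms that] by simp
  ultimately have s: "?s \<in> Gal"
    unfolding Gal_def by blast
  have l: "compose (carrier R) ?s (compose (carrier R) \<sigma> \<tau>) = \<tau>"
    "compose (carrier R) \<sigma> (compose (carrier R) ?s \<tau>) = \<tau>" if t: "\<tau> \<in> Gal" for \<tau>
    using t sy Gal_in[OF t] Gal_in[OF assms]
    by (auto simp: compose_def Gal_iff extensional_def intro!: ext)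
  show ?thesis
    by (rule bij_betw_byWitness[where f' = "compose (carrier R) ?s"]) (use l cl[OF assms] cl[OF s] in auto)
qed

text \<open>An automorphism is determined by the images of a basis, and each image is a root of the
  minimal polynomial of the basis element, which has finitely many roots.\<close>

lemma finite_Gal: "finite Gal"
proof -
  obtain Us where Us: "independent k Us" "Span k Us = carrier R" "set Us \<subseteq> carrier R"
    using finite_dimensionE[OF k fin_dim_k] exists_base[OF k] by blast
  define Z where "Z = (\<Union>b\<in>set Us. {x. is_root (Irr k b) x})"
  have alg: "(algebraic over k) b" if "b \<in> set Us" for b
    using finite_dimension_imp_algebraic[OF k _ fin_dim_k] that Us(3) carrier_is_subring by auto
  have carr: "Irr k b \<in> carrier (poly_ring R)" if "b \<in> set Us" for b
    using IrrE(1)[OF k _ alg[OF that]] carrier_polynomial_shell[OF subfieldE(1)[OF k]] Us that by auto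
  have "finite Z"
    unfolding Z_def using carr by (auto intro!: finite_number_of_roots)
  have inZ: "\<tau> b \<in> Z" if t: "\<tau> \<in> Gal" and b: "b \<in> set Us" for \<tau> b
  proof -
    interpret ring_hom_ring R R \<tau> by (rule Gal_ring_hom_ring[OF t])
    have bR: "b \<in> carrier R" using b Us by auto
    note Irr = IrrE[OF k bR alg[OF b]]
    have Pk: "set (Irr k b) \<subseteq> k"
      using Irr(1) polynomial_incl by (simp add: univ_poly_carrier[symmetric])
    have ne: "Irr k b \<noteq> []"
      using Irr(3) Irr(2) pirreducibleE(1)[OF subfieldE(1)[OF k] Irr(1,2)] by auto
    have "eval (map \<tau> (Irr k b)) (\<tau> b) = \<tau> (eval (Irr k b) b)"
      using eval_hom[OF subfieldE(1)[OF k] bR Irr(1)] by simp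
    also have "map \<tau> (Irr k b) = Irr k b"
      using Pk Gal_fix[OF t] by (intro map_idI) auto
    finally have "eval (Irr k b) (\<tau> b) = \<zero>"
      using Irr(4) by simp
    then show ?thesis
      unfolding Z_def is_root_def using ne Gal_in[OF t bR] b by auto
  qed
  have inj: "inj_on (\<lambda>\<tau>. map \<tau> Us) Gal"
  proof (rule inj_onI)
    fix \<tau> \<sigma> assume t: "\<tau> \<in> Gal" and s: "\<sigma> \<in> Gal" and eq: "map \<tau> Us = map \<sigma> Us"
    interpret t: ring_hom_ring R R \<tau> by (rule Gal_ring_hom_ring[OF t])
    interpret s: ring_hom_ring R R \<sigma> by (rule Gal_ring_hom_ring[OF s])
    show "\<tau> = \<sigma>"
    proof (rule extensionalityI[of _ "carrier R"])
      fix x assume "x \<in> carrier R"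
      then obtain Ks where Ks: "set Ks \<subseteq> k" "x = combine Ks Us"
        using Span_mem_iff_length_version[OF k Us(3), of x] Us(2) by auto
      then have KR: "set Ks \<subseteq> carrier R"
        using k_in by auto
      have "map \<tau> Ks = Ks" "map \<sigma> Ks = Ks"
        using Ks Gal_fix t s by (auto intro!: map_idI)
      then show "\<tau> x = \<sigma> x"
        using t.combine_hom[OF KR Us(3)] s.combine_hom[OF KR Us(3)] eq Ks by simp
    qed (use t s in \<open>auto simp: Gal_iff\<close>)
  qed
  have "(\<lambda>\<tau>. map \<tau> Us) ` Gal \<subseteq> {xs. set xs \<subseteq> Z \<and> length xs = length Us}"
    using inZ by auto
  then have "finite ((\<lambda>\<tau>. map \<tau> Us) ` Gal)"
    using finite_lists_length_eq[OF \<open>finite Z\<close>] by (rule finite_subset)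
  then show ?thesis
    using inj by (rule finite_imageD)
qed

text \<open>An automorphism permutes the distinct roots, so it fixes the coefficients, and the fixed
  field is \<open>k\<close>.\<close>

lemma rc_in_k:
  assumes "distinct bs" "set bs \<subseteq> carrier R" "\<And>\<tau>. \<tau> \<in> Gal \<Longrightarrow> \<tau> ` set bs = set bs"
  shows "rc bs i \<in> k"
proof (rule Gal_fixed)
  fix \<tau> assume t: "\<tau> \<in> Gal"
  interpret ring_hom_cring R R \<tau> by (rule Gal_hom_ring[OF t])
  have "inj_on \<tau> (set bs)"
    using Gal_bij[OF t] assms(2) by (meson bij_betw_def inj_on_subset)
  then have "distinct (map \<tau> bs)"
    using assms(1) by (simp add: distinct_map)
  then have "mset (map \<tau> bs) = mset bs"
    using assms(1) assms(3)[OF t] set_eq_iff_mset_eq_distinct[of "map \<tau> bs" bs] by simp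
  then have "rc (map \<tau> bs) = rc bs"
    using assms(2) Gal_in[OF t] by (intro rc_mset) auto
  then show "\<tau> (rc bs i) = rc bs i"
    using rc_hom[OF assms(2)] by simp
qed (use assms in simp)

end

section \<open>Roots of nearby polynomials\<close>

context ultrametric_field
begin

lemma u_rprod: "set bs \<subseteq> carrier R \<Longrightarrow> x \<in> carrier R \<Longrightarrow> u (rprod bs x) = (\<Prod>b\<leftarrow>bs. u (x \<ominus> b))"
  by (induction bs) (auto simp: u_mult)

lemma u_pow_minus:
  assumes "x \<in> carrier R" "y \<in> carrier R" "u x \<le> 1" "u y \<le> 1"
  shows "u (x [^] (m::nat) \<ominus> y [^] m) \<le> u (x \<ominus> y)"
proof (induction m)
  case 0
  then show ?case
    using assms by (simp add: a_minus_def r_neg u_nonneg)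
next
  case (Suc m)
  have p: "x [^] m \<in> carrier R" "y [^] m \<in> carrier R"
    using assms by auto
  have "x [^] m \<otimes> x \<ominus> y [^] m \<otimes> y = (x [^] m \<ominus> y [^] m) \<otimes> x \<oplus> y [^] m \<otimes> (x \<ominus> y)"
    using assms(1,2) p by algebra
  then have "u (x [^] Suc m \<ominus> y [^] Suc m) \<le> max (u (x [^] m \<ominus> y [^] m) * u x) (u (y [^] m) * u (x \<ominus> y))"
    using u_add_max[of "(x [^] m \<ominus> y [^] m) \<otimes> x" "y [^] m \<otimes> (x \<ominus> y)"] assms p by (simp add: u_mult)
  also have "u (x [^] m \<ominus> y [^] m) * u x \<le> u (x \<ominus> y) * 1"
    using Suc.IH assms p by (intro mult_mono u_nonneg) auto
  also have "u (y [^] m) * u (x \<ominus> y) \<le> 1 * u (x \<ominus> y)"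
    using assms by (intro mult_right_mono u_nonneg) (auto simp: u_pow power_le_one u_nonneg)
  finally show ?case
    by simp
qed

lemma psum_small:
  assumes d: "\<And>i. i < m \<Longrightarrow> d i \<in> carrier R" "\<And>i. i < m \<Longrightarrow> u (d i) \<le> \<eta>" and e: "0 \<le> \<eta>"
    and x: "x \<in> carrier R" "u x \<le> 1"
  shows "u (psum d m x) \<le> \<eta>"
  using d
proof (induction m)
  case (Suc m)
  have "u (d m) * u x ^ m \<le> \<eta> * 1"
    using Suc.prems x e by (intro mult_mono power_le_one zero_le_power u_nonneg) auto
  then have "u (d m \<otimes> x [^] m) \<le> \<eta>"
    using Suc.prems x by (simp add: u_mult u_pow)
  then show ?case
    using u_add_max[of "d m \<otimes> x [^] m" "psum d m x"] Suc x by force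
qed (use e in simp)

lemma psum_lipschitz:
  assumes d: "\<And>i. i < m \<Longrightarrow> d i \<in> carrier R" "\<And>i. i < m \<Longrightarrow> u (d i) \<le> \<eta>" and e: "0 \<le> \<eta>"
    and x: "x \<in> carrier R" "u x \<le> 1" and y: "y \<in> carrier R" "u y \<le> 1"
  shows "u (psum d m x \<ominus> psum d m y) \<le> \<eta> * u (x \<ominus> y)"
  using d
proof (induction m)
  case 0
  then show ?case
    using e x y by (simp add: a_minus_def u_nonneg)
next
  case (Suc m)
  have c: "d m \<in> carrier R" "x [^] m \<in> carrier R" "y [^] m \<in> carrier R" "psum d m x \<in> carrier R" "psum d m y \<in> carrier R"
    using Suc.prems x y by auto
  have "(d m \<otimes> x [^] m \<oplus> psum d m x) \<ominus> (d m \<otimes> y [^] m \<oplus> psum d m y)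
      = d m \<otimes> (x [^] m \<ominus> y [^] m) \<oplus> (psum d m x \<ominus> psum d m y)"
    using c by algebra
  then have "u (psum d (Suc m) x \<ominus> psum d (Suc m) y) \<le> max (u (d m) * u (x [^] m \<ominus> y [^] m)) (u (psum d m x \<ominus> psum d m y))"
    using u_add_max[of "d m \<otimes> (x [^] m \<ominus> y [^] m)" "psum d m x \<ominus> psum d m y"] c by (simp add: u_mult)
  moreover have "u (d m) * u (x [^] m \<ominus> y [^] m) \<le> \<eta> * u (x \<ominus> y)"
    using Suc.prems c e x y by (intro mult_mono u_pow_minus u_nonneg) auto
  moreover have "u (psum d m x \<ominus> psum d m y) \<le> \<eta> * u (x \<ominus> y)"
    using Suc by auto
  ultimately show ?case
    by linarith
qed

text \<open>The disc of radius \<open>s\<close> around \<beta> contains no point of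
  \<open>bs\<close>, so each factor \<open>x - b\<close> has the constant value
  \<open>u (\<beta> \<ominus> b)\<close> on it. Changing one factor at a time costs at most the
  ratio \<open>u (x \<ominus> y) / s\<close>.\<close>

lemma rprod_variation:
  assumes \<beta>: "\<beta> \<in> carrier R" and s: "0 < s"
    and x: "x \<in> carrier R" "u (x \<ominus> \<beta>) < s" and y: "y \<in> carrier R" "u (y \<ominus> \<beta>) < s"
  shows "set bs \<subseteq> carrier R \<Longrightarrow> (\<And>b. b \<in> set bs \<Longrightarrow> s \<le> u (\<beta> \<ominus> b)) \<Longrightarrow>
    u (rprod bs x) = u (rprod bs \<beta>) \<and> u (rprod bs x \<ominus> rprod bs y) \<le> u (x \<ominus> y) / s * u (rprod bs \<beta>)"
proof (induction bs)
  case Nil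
  then show ?case
    using s x y by (simp add: a_minus_def r_neg u_nonneg)
next
  case (Cons b bs)
  have b: "b \<in> carrier R" "set bs \<subseteq> carrier R" "s \<le> u (\<beta> \<ominus> b)"
    using Cons.prems by auto
  have IH: "u (rprod bs x) = u (rprod bs \<beta>)" "u (rprod bs x \<ominus> rprod bs y) \<le> u (x \<ominus> y) / s * u (rprod bs \<beta>)"
    using Cons by auto
  have xb: "u (z \<ominus> b) = u (\<beta> \<ominus> b)" if z: "z \<in> carrier R" "u (z \<ominus> \<beta>) < s" for z
  proof (rule u_eq_of_close)
    have "(\<beta> \<ominus> b) \<ominus> (z \<ominus> b) = \<beta> \<ominus> z"
      using z(1) \<beta> b(1) by algebra
    then show "u ((\<beta> \<ominus> b) \<ominus> (z \<ominus> b)) < u (\<beta> \<ominus> b)"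
      using z b \<beta> u_minus_commute[of \<beta> z] by simp
  qed (use z \<beta> b in auto)
  have uy: "u (rprod bs \<beta>) \<ge> 0" "u (\<beta> \<ominus> b) \<ge> 0" "u (x \<ominus> y) \<ge> 0"
    using b \<beta> x y by (auto intro!: u_nonneg)
  have P: "rprod bs x \<in> carrier R" "rprod bs y \<in> carrier R"
    using b x y by auto
  have "(x \<ominus> b) \<otimes> rprod bs x \<ominus> (y \<ominus> b) \<otimes> rprod bs y
      = (y \<ominus> b) \<otimes> (rprod bs x \<ominus> rprod bs y) \<oplus> (x \<ominus> y) \<otimes> rprod bs x"
    using x(1) y(1) b(1) P by algebra
  then have "u (rprod (b # bs) x \<ominus> rprod (b # bs) y)
      \<le> max (u (y \<ominus> b) * u (rprod bs x \<ominus> rprod bs y)) (u (x \<ominus> y) * u (rprod bs x))"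
    using u_add_max[of "(y \<ominus> b) \<otimes> (rprod bs x \<ominus> rprod bs y)" "(x \<ominus> y) \<otimes> rprod bs x"] x y b P
    by (simp add: u_mult)
  also have "u (y \<ominus> b) * u (rprod bs x \<ominus> rprod bs y) \<le> u (\<beta> \<ominus> b) * (u (x \<ominus> y) / s * u (rprod bs \<beta>))"
    unfolding xb[OF y] using IH uy by (intro mult_left_mono) auto
  also have "u (x \<ominus> y) * u (rprod bs x) \<le> u (\<beta> \<ominus> b) * (u (x \<ominus> y) / s * u (rprod bs \<beta>))"
  proof -
    have "u (x \<ominus> y) * u (rprod bs \<beta>) * 1 \<le> u (x \<ominus> y) * u (rprod bs \<beta>) * (u (\<beta> \<ominus> b) / s)"
      using uy s b by (intro mult_left_mono) auto
    then show ?thesis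
      using IH by (simp add: mult.commute mult.left_commute)
  qed
  finally have "u (rprod (b # bs) x \<ominus> rprod (b # bs) y) \<le> u (x \<ominus> y) / s * (u (\<beta> \<ominus> b) * u (rprod bs \<beta>))"
    by (simp add: mult.commute mult.left_commute)
  then show ?case
    using IH(1) b \<beta> x xb[OF x] by (simp add: u_mult)
qed

end

section \<open>Newton iteration near a simple root\<close>

context local_extension
begin

lemma complete_carrier: "complete_set (carrier R)"
proof -
  obtain Us where "independent k0 Us" "Span k0 Us = carrier R"
    using finite_dimensionE[OF k0 fin_dim] exists_base[OF k0] by blast
  then show ?thesis
    using complete_independent_Span[OF k0 k0_complete] by metis
qed

text \<open>The map \<open>x - f(x) / g'(\<beta>)\<close> is a contraction of the disc of radius \<open>s / p\<close> around a root
  \<open>\<beta>\<close> of \<open>g\<close> if \<open>f\<close> is close enough to \<open>g\<close>, as it is for \<open>g\<close>. Its fixed point is a root of \<open>f\<close>.\<close>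

lemma root_near:
  assumes \<beta>: "\<beta> \<in> carrier R" "u \<beta> \<le> 1" and bs: "set bs \<subseteq> carrier R"
    and s: "0 < s" "s \<le> 1" "\<And>b. b \<in> set bs \<Longrightarrow> s \<le> u (\<beta> \<ominus> b)"
    and d: "\<And>i. i < n \<Longrightarrow> d i \<in> carrier R" "\<And>i. i < n \<Longrightarrow> u (d i) \<le> \<eta>"
    and eta: "0 \<le> \<eta>" "\<eta> \<le> s / p * u (rprod bs \<beta>)"
  shows "\<exists>x\<in>carrier R. u (x \<ominus> \<beta>) < s \<and> rprod (\<beta> # bs) x \<oplus> psum d n x = \<zero>"
proof -
  \<comment> \<open>The derivative at \<beta> of the product over
    \<open>\<beta> # bs\<close>.\<close>
  define c0 where "c0 = rprod bs \<beta>"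
  define r where "r = s / p"
  define q where "q = 1 / real p"
  define f where "f x = rprod (\<beta> # bs) x \<oplus> psum d n x" for x
  define N where "N x = x \<ominus> inv c0 \<otimes> f x" for x
  have r: "0 < r" "r < s" "r \<le> 1" "r / s = q" and q: "0 < q" "q < 1"
    using s p_gt_1 by (auto simp: r_def q_def divide_less_eq divide_le_eq)
  have rq: "r \<le> q"
    using s p_gt_1 by (auto simp: r_def q_def divide_right_mono)
  have c0: "c0 \<in> carrier R"
    using bs \<beta> by (simp add: c0_def)
  have "u c0 > 0"
  proof -
    have "0 < (\<Prod>b\<leftarrow>bs. u (\<beta> \<ominus> b))"
    proof -
      have "0 < u (\<beta> \<ominus> b)" if "b \<in> set bs" for b
        using s(3)[OF that] s(1) by linarith
      then show ?thesis
        by (induction bs) auto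
    qed
    then show ?thesis
      using bs \<beta> by (simp add: c0_def u_rprod)
  qed
  then have c0nz: "c0 \<noteq> \<zero>"
    by auto
  have ic: "inv c0 \<in> carrier R" "c0 \<otimes> inv c0 = \<one>" "u (inv c0) = 1 / u c0"
    using c0 c0nz by (simp_all add: field_Units u_inv inverse_eq_divide)
  have fin: "f x \<in> carrier R" "N x \<in> carrier R" if "x \<in> carrier R" for x
    using that bs \<beta> d ic by (auto simp: f_def N_def)
  have ux: "u x \<le> 1" if x: "x \<in> carrier R" "u (x \<ominus> \<beta>) \<le> r" for x
  proof -
    have "u x \<le> max (u \<beta>) (u (\<beta> \<ominus> x))"
      by (rule u_le_of_close) (use x \<beta> in auto)
    then show ?thesis
      using x \<beta> r by (simp add: u_minus_commute[of \<beta> x])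
  qed
  \<comment> \<open>On the disc of radius \<open>r\<close> the map \<open>f\<close> agrees with
    multiplication by \<open>c0\<close> up to an error smaller by the factor
    \<open>q = 1 / p\<close>; dividing by \<open>c0\<close> makes \<open>N\<close> a contraction
    with ratio \<open>q\<close>.\<close>
  have lin: "u (f x \<ominus> f y \<ominus> c0 \<otimes> (x \<ominus> y)) \<le> q * u c0 * u (x \<ominus> y)"
    if x: "x \<in> carrier R" "u (x \<ominus> \<beta>) \<le> r" and y: "y \<in> carrier R" "u (y \<ominus> \<beta>) \<le> r" for x y
  proof -
    have xs: "u (x \<ominus> \<beta>) < s" "u (y \<ominus> \<beta>) < s" "u (\<beta> \<ominus> \<beta>) < s"
      using x y r s \<beta> by (auto simp: a_minus_def r_neg)
    define g where "g = rprod bs"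
    define h where "h = psum d n"
    have P: "g x \<in> carrier R" "g y \<in> carrier R" "h x \<in> carrier R" "h y \<in> carrier R" "g \<beta> \<in> carrier R"
      using bs x y d \<beta> by (auto simp: g_def h_def)
    have uxy: "0 \<le> u (x \<ominus> y)" "0 \<le> u c0"
      using x y c0 by (auto intro!: u_nonneg)
    \<comment> \<open>An exact splitting of the error into three parts: the variation of the product
      from \<beta>, its variation between \<open>x\<close> and \<open>y\<close>, and the
      perturbation \<open>h\<close>. The first two carry a factor of size at most
      \<open>r / s = q\<close>.\<close>
    have eq: "((x \<ominus> \<beta>) \<otimes> g x \<oplus> h x) \<ominus> ((y \<ominus> \<beta>) \<otimes> g y \<oplus> h y) \<ominus> g \<beta> \<otimes> (x \<ominus> y)
      = ((x \<ominus> y) \<otimes> (g x \<ominus> g \<beta>) \<oplus> (y \<ominus> \<beta>) \<otimes> (g x \<ominus> g y)) \<oplus> (h x \<ominus> h y)"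
      using x(1) y(1) \<beta>(1) P by algebra
    have g1: "u (g x \<ominus> g \<beta>) \<le> u (x \<ominus> \<beta>) / s * u c0"
      unfolding g_def c0_def using rprod_variation[OF \<beta>(1) s(1) x(1) xs(1) \<beta>(1) xs(3) bs s(3)] by blast
    have g2: "u (g x \<ominus> g y) \<le> u (x \<ominus> y) / s * u c0"
      unfolding g_def c0_def using rprod_variation[OF \<beta>(1) s(1) x(1) xs(1) y(1) xs(2) bs s(3)] by blast
    have h1: "u (h x \<ominus> h y) \<le> \<eta> * u (x \<ominus> y)"
      unfolding h_def by (intro psum_lipschitz d eta x y ux)
    have "u ((x \<ominus> y) \<otimes> (g x \<ominus> g \<beta>)) \<le> u (x \<ominus> y) * (r / s * u c0)"
    proof -
      have "u (x \<ominus> \<beta>) / s * u c0 \<le> r / s * u c0"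
        using x s uxy by (intro mult_right_mono divide_right_mono) auto
      then have le: "u (g x \<ominus> g \<beta>) \<le> r / s * u c0"
        using g1 by linarith
      have m: "u ((x \<ominus> y) \<otimes> (g x \<ominus> g \<beta>)) = u (x \<ominus> y) * u (g x \<ominus> g \<beta>)"
        using x y P by (simp add: u_mult)
      show ?thesis
        unfolding m by (rule mult_left_mono[OF le uxy(1)])
    qed
    moreover have "u ((y \<ominus> \<beta>) \<otimes> (g x \<ominus> g y)) \<le> r * (u (x \<ominus> y) / s * u c0)"
    proof -
      have m: "u ((y \<ominus> \<beta>) \<otimes> (g x \<ominus> g y)) = u (y \<ominus> \<beta>) * u (g x \<ominus> g y)"
        using y \<beta> P by (simp add: u_mult)
      show ?thesis
        unfolding m by (rule mult_mono[OF y(2) g2]) (use r P in \<open>auto intro!: u_nonneg\<close>)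
    qed
    moreover have "\<eta> * u (x \<ominus> y) \<le> q * u c0 * u (x \<ominus> y)"
    proof -
      have "\<eta> \<le> r * u c0"
        using eta by (simp add: r_def c0_def)
      also have "\<dots> \<le> q * u c0"
        using rq uxy by (intro mult_right_mono) auto
      finally show ?thesis
        using uxy by (intro mult_right_mono) auto
    qed
    moreover have "u (x \<ominus> y) * (r / s * u c0) = q * u c0 * u (x \<ominus> y)"
      "r * (u (x \<ominus> y) / s * u c0) = q * u c0 * u (x \<ominus> y)"
      unfolding r(4)[symmetric] by simp_all
    ultimately have M1: "max (u ((x \<ominus> y) \<otimes> (g x \<ominus> g \<beta>))) (u ((y \<ominus> \<beta>) \<otimes> (g x \<ominus> g y))) \<le> q * u c0 * u (x \<ominus> y)"
      and M2: "u (h x \<ominus> h y) \<le> q * u c0 * u (x \<ominus> y)"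
      using h1 by simp_all
    have M3: "u (((x \<ominus> y) \<otimes> (g x \<ominus> g \<beta>) \<oplus> (y \<ominus> \<beta>) \<otimes> (g x \<ominus> g y)) \<oplus> (h x \<ominus> h y))
        \<le> max (max (u ((x \<ominus> y) \<otimes> (g x \<ominus> g \<beta>))) (u ((y \<ominus> \<beta>) \<otimes> (g x \<ominus> g y)))) (u (h x \<ominus> h y))"
      using u_add_max[of "(x \<ominus> y) \<otimes> (g x \<ominus> g \<beta>)" "(y \<ominus> \<beta>) \<otimes> (g x \<ominus> g y)"]
        u_add_max[of "(x \<ominus> y) \<otimes> (g x \<ominus> g \<beta>) \<oplus> (y \<ominus> \<beta>) \<otimes> (g x \<ominus> g y)" "h x \<ominus> h y"] x y \<beta> P by force
    have "u (((x \<ominus> y) \<otimes> (g x \<ominus> g \<beta>) \<oplus> (y \<ominus> \<beta>) \<otimes> (g x \<ominus> g y)) \<oplus> (h x \<ominus> h y)) \<le> q * u c0 * u (x \<ominus> y)"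
      by (rule order_trans[OF M3], rule max.boundedI[OF M1 M2])
    then show ?thesis
      using eq by (simp add: f_def g_def h_def c0_def)
  qed
  have contr: "u (N x \<ominus> N y) \<le> q * u (x \<ominus> y)"
    if x: "x \<in> carrier R" "u (x \<ominus> \<beta>) \<le> r" and y: "y \<in> carrier R" "u (y \<ominus> \<beta>) \<le> r" for x y
  proof -
    have "(\<ominus> (inv c0)) \<otimes> (f x \<ominus> f y \<ominus> c0 \<otimes> (x \<ominus> y)) = (c0 \<otimes> inv c0) \<otimes> (x \<ominus> y) \<ominus> inv c0 \<otimes> f x \<oplus> inv c0 \<otimes> f y"
      using x(1) y(1) fin(1)[OF x(1)] fin(1)[OF y(1)] ic(1) c0 by algebra
    moreover have "\<one> \<otimes> (x \<ominus> y) \<ominus> inv c0 \<otimes> f x \<oplus> inv c0 \<otimes> f y = N x \<ominus> N y"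
      unfolding N_def using x(1) y(1) fin(1)[OF x(1)] fin(1)[OF y(1)] ic(1) one_closed by algebra
    ultimately have "N x \<ominus> N y = (\<ominus> (inv c0)) \<otimes> (f x \<ominus> f y \<ominus> c0 \<otimes> (x \<ominus> y))"
      using ic by simp
    then have "u (N x \<ominus> N y) = 1 / u c0 * u (f x \<ominus> f y \<ominus> c0 \<otimes> (x \<ominus> y))"
      using x y fin ic c0 by (simp add: u_mult u_uminus)
    also have "\<dots> \<le> 1 / u c0 * (q * u c0 * u (x \<ominus> y))"
      using lin[OF x y] \<open>u c0 > 0\<close> by (intro mult_left_mono) auto
    also have "\<dots> = q * u (x \<ominus> y)"
      using \<open>u c0 > 0\<close> by simp
    finally show ?thesis .
  qed
  have \<beta>\<beta>: "\<beta> \<ominus> \<beta> = \<zero>"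
    using \<beta> by (simp add: a_minus_def r_neg)
  have N\<beta>: "u (N \<beta> \<ominus> \<beta>) \<le> r"
  proof -
    have "f \<beta> = psum d n \<beta>"
      using \<beta> bs d by (simp add: f_def \<beta>\<beta>)
    then have "u (f \<beta>) \<le> r * u c0"
      using psum_small[of n d \<eta> \<beta>] d eta \<beta> by (simp add: r_def c0_def)
    moreover have "N \<beta> \<ominus> \<beta> = \<ominus> (inv c0 \<otimes> f \<beta>)"
      unfolding N_def using \<beta>(1) ic(1) fin(1)[OF \<beta>(1)] by algebra
    ultimately show ?thesis
      using ic fin \<beta> \<open>u c0 > 0\<close> by (simp add: u_uminus u_mult divide_le_eq)
  qed
  have N_disc: "u (N x \<ominus> \<beta>) \<le> r" if x: "x \<in> carrier R" "u (x \<ominus> \<beta>) \<le> r" for x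
  proof -
    have "u (N x \<ominus> \<beta>) \<le> max (u (N x \<ominus> N \<beta>)) (u (N \<beta> \<ominus> \<beta>))"
      using fin x \<beta> by (intro u_triangle_max) auto
    moreover have "u (N x \<ominus> N \<beta>) \<le> q * u (x \<ominus> \<beta>)"
      using x \<beta> r by (intro contr) (simp_all add: \<beta>\<beta>)
    moreover have "q * u (x \<ominus> \<beta>) \<le> q * r"
      using x q by (intro mult_left_mono) auto
    moreover have "q * r \<le> r"
      using q r by (simp add: mult_le_cancel_right1)
    ultimately show ?thesis
      using N\<beta> by linarith
  qed
  define it where "it n = (N ^^ n) \<beta>" for n
  have "it n \<in> carrier R \<and> u (it n \<ominus> \<beta>) \<le> r" for n
  proof (induction n)
    case 0
    show ?case
      using \<beta> r by (simp add: it_def \<beta>\<beta>)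
  next
    case (Suc n)
    have "it (Suc n) = N (it n)"
      by (simp add: it_def)
    then show ?case
      using fin N_disc Suc by simp
  qed
  then have it: "it n \<in> carrier R" "u (it n \<ominus> \<beta>) \<le> r" for n
    by auto
  have step: "u (it (Suc n) \<ominus> it n) \<le> q ^ n * r" for n
  proof (induction n)
    case 0
    then show ?case using N\<beta> by (simp add: it_def)
  next
    case (Suc n)
    have "u (it (Suc (Suc n)) \<ominus> it (Suc n)) \<le> q * u (it (Suc n) \<ominus> it n)"
      using contr[OF it it, of "Suc n" n] by (simp add: it_def)
    also have "\<dots> \<le> q * (q ^ n * r)"
      using Suc q by (intro mult_left_mono) auto
    finally show ?case by simp
  qed
  have far: "u (it (n + m) \<ominus> it n) \<le> q ^ n * r" for n m
  proof (induction m)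
    case 0
    then show ?case using it q r by (simp add: a_minus_def r_neg)
  next
    case (Suc m)
    have "u (it (Suc (n + m)) \<ominus> it n) \<le> max (u (it (Suc (n + m)) \<ominus> it (n + m))) (u (it (n + m) \<ominus> it n))"
      by (intro u_triangle_max it)
    moreover have "u (it (Suc (n + m)) \<ominus> it (n + m)) \<le> q ^ n * r"
    proof -
      have "q ^ (n + m) * r \<le> q ^ n * r"
        using q r by (intro mult_right_mono power_decreasing) auto
      then show ?thesis
        using step[of "n + m"] by linarith
    qed
    ultimately show ?case
      using Suc by simp
  qed
  have "cauchy_in it"
    unfolding cauchy_in_def
  proof (intro allI impI)
    fix e :: real assume "0 < e"
    then obtain M where M: "q ^ M < e / r"
      using real_arch_pow_inv[of "e / r" q] q r by auto
    have "u (it m \<ominus> it n) < e" if "m \<ge> M" "n \<ge> M" for m n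
    proof -
      have "u (it m \<ominus> it M) \<le> q ^ M * r" "u (it n \<ominus> it M) \<le> q ^ M * r"
        using far[of M "m - M"] far[of M "n - M"] that by auto
      moreover have "u (it m \<ominus> it n) \<le> max (u (it m \<ominus> it M)) (u (it M \<ominus> it n))"
        by (intro u_triangle_max it)
      moreover have "q ^ M * r < e"
        using M r by (simp add: less_divide_eq)
      ultimately show ?thesis
        using it by (simp add: u_minus_commute[of "it M" "it n"])
    qed
    then show "\<exists>N. \<forall>m\<ge>N. \<forall>n\<ge>N. u (it m \<ominus> it n) < e"
      by blast
  qed
  then obtain l where l: "l \<in> carrier R" "(\<lambda>n. u (it n \<ominus> l)) \<longlonglongrightarrow> 0"
    using complete_carrier it(1) unfolding complete_set_def by blast
  have ln: "u (l \<ominus> \<beta>) \<le> r"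
  proof -
    obtain n where "norm (u (it n \<ominus> l) - 0) < r"
      using LIMSEQ_D[OF l(2) r(1)] by (meson order_refl)
    then have n: "u (it n \<ominus> l) < r"
      by (simp add: abs_less_iff)
    have "u (l \<ominus> \<beta>) \<le> max (u (l \<ominus> it n)) (u (it n \<ominus> \<beta>))"
      using l it \<beta> by (intro u_triangle_max) auto
    then show ?thesis
      using n it(2)[of n] u_minus_commute[OF l(1) it(1)[of n]] by linarith
  qed
  have "u (N l \<ominus> l) \<le> u (it n \<ominus> l) + u (it (Suc n) \<ominus> l)" for n
  proof -
    have "u (N l \<ominus> it (Suc n)) \<le> q * u (l \<ominus> it n)"
      using contr[OF l(1) ln it] by (simp add: it_def)
    also have "\<dots> \<le> 1 * u (l \<ominus> it n)"
      using q it l by (intro mult_right_mono u_nonneg) auto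
    finally show ?thesis
      using u_triangle[of "N l" "it (Suc n)" l] it l fin by (simp add: u_minus_commute[of l "it n"])
  qed
  moreover have "(\<lambda>n. u (it n \<ominus> l) + u (it (Suc n) \<ominus> l)) \<longlonglongrightarrow> 0 + 0"
    by (intro tendsto_add l(2) LIMSEQ_Suc[OF l(2)])
  ultimately have "u (N l \<ominus> l) \<le> 0"
    by (intro LIMSEQ_le_const[where X = "\<lambda>n. u (it n \<ominus> l) + u (it (Suc n) \<ominus> l)"]) auto
  moreover have "N l \<ominus> l = \<ominus> (inv c0 \<otimes> f l)"
    unfolding N_def using l(1) ic(1) fin(1)[OF l(1)] by algebra
  ultimately have "u (f l) \<le> 0"
    using ic fin l \<open>u c0 > 0\<close> by (simp add: u_uminus u_mult divide_le_0_iff)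
  then have "f l = \<zero>"
    using fin l u_nonneg u_eq_0 by (metis antisym)
  then show ?thesis
    using l ln r by (auto simp: f_def intro!: bexI[of _ l])
qed

text \<open>The discs of radius \<open>s\<close> around the points of \<open>bs\<close> are
  disjoint, and \<open>root_near\<close> puts a root into each, so the nearby polynomial has as many
  distinct roots as its degree. The product in the bound on \<eta> is the value of the derivative at
  \<open>b\<close>.\<close>

theorem splitted_near:
  assumes bs: "distinct bs" "set bs \<subseteq> carrier R" "\<And>b. b \<in> set bs \<Longrightarrow> u b \<le> 1"
    and s: "0 < s" "s \<le> 1" "\<And>b b'. b \<in> set bs \<Longrightarrow> b' \<in> set bs \<Longrightarrow> b \<noteq> b' \<Longrightarrow> s \<le> u (b \<ominus> b')"
    and eta: "0 \<le> \<eta>" "\<And>b. b \<in> set bs \<Longrightarrow> \<eta> \<le> s / p * (\<Prod>b'\<in>set bs - {b}. u (b \<ominus> b'))"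
    and n: "n = length bs"
    and a: "\<And>i. i < n \<Longrightarrow> a i \<in> carrier R" "\<And>i. i < n \<Longrightarrow> u (a i \<ominus> rc bs i) \<le> \<eta>"
  shows "splitted (\<one> # map a (rev [0..<n]))"
proof -
  define P where "P = \<one> # map a (rev [0..<n])"
  define d where "d i = a i \<ominus> rc bs i" for i
  have P: "P \<in> carrier (poly_ring R)" "P \<noteq> []" "length P - 1 = n"
    using a by (auto simp: P_def univ_poly_carrier[symmetric] intro!: polynomialI)
  \<comment> \<open>The leading terms of both monic polynomials cancel, since \<open>rc bs n\<close>
    is \<open>\<one>\<close>; only the \<open>n\<close> lower coefficients enter the
    perturbation.\<close>
  have ev: "eval P x = rprod bs x \<oplus> psum d n x" if x: "x \<in> carrier R" for x
  proof -
    have "psum a m x = psum (rc bs) m x \<oplus> psum d m x" if "m \<le> n" for m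
      using that
    proof (induction m)
      case (Suc m)
      have c: "a m \<in> carrier R" "rc bs m \<in> carrier R" "x [^] m \<in> carrier R" "psum (rc bs) m x \<in> carrier R" "psum d m x \<in> carrier R"
        using Suc.prems a bs x by (auto simp: d_def)
      have "a m \<otimes> x [^] m \<oplus> (psum (rc bs) m x \<oplus> psum d m x)
        = rc bs m \<otimes> x [^] m \<oplus> psum (rc bs) m x \<oplus> ((a m \<ominus> rc bs m) \<otimes> x [^] m \<oplus> psum d m x)"
        using c by algebra
      then show ?case
        using Suc by (simp flip: d_def)
    qed simp
    then have "eval P x = x [^] n \<oplus> (psum (rc bs) n x \<oplus> psum d n x)"
      using x a by (simp add: P_def psum_def)
    also have "\<dots> = (rc bs n \<otimes> x [^] n \<oplus> psum (rc bs) n x) \<oplus> psum d n x"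
      using x a bs n by (simp add: rc_length a_assoc d_def)
    also have "rc bs n \<otimes> x [^] n \<oplus> psum (rc bs) n x = rprod bs x"
      using psum_rc[OF bs(2) x] by (simp add: n)
    finally show ?thesis .
  qed
  have "\<exists>x. is_root P x \<and> u (x \<ominus> b) < s" if b: "b \<in> set bs" for b
  proof -
    define bs' where "bs' = remove1 b bs"
    have bs': "set bs' = set bs - {b}" "distinct bs'" "mset (b # bs') = mset bs"
      using bs(1) b by (auto simp: bs'_def)
    have rp: "rprod bs x = rprod (b # bs') x" if x: "x \<in> carrier R" for x
    proof -
      have "rc bs = rc (b # bs')"
        using bs' bs by (intro rc_mset) auto
      moreover have "length bs = length (b # bs')"
        using bs'(3) by (metis mset_eq_length)
      ultimately show ?thesis
        using psum_rc[OF bs(2) x] psum_rc[of "b # bs'" x] bs' bs b x by auto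
    qed
    have bR: "b \<in> carrier R"
      using b bs by auto
    have "u (rprod bs' b) = (\<Prod>b'\<in>set bs - {b}. u (b \<ominus> b'))"
      using bs' bs bR by (subst u_rprod) (auto simp: prod.distinct_set_conv_list[symmetric])
    then have "\<eta> \<le> s / p * u (rprod bs' b)"
      using eta(2)[OF b] by simp
    moreover have "d i \<in> carrier R" "u (d i) \<le> \<eta>" if "i < n" for i
      using that a bs by (auto simp: d_def)
    moreover have "set bs' \<subseteq> carrier R"
      using bs bs' by auto
    ultimately have "\<exists>x\<in>carrier R. u (x \<ominus> b) < s \<and> rprod (b # bs') x \<oplus> psum d n x = \<zero>"
      using bR bs(3)[OF b] s(1,2) s(3)[OF b] bs'(1) eta(1) by (intro root_near[where \<eta> = \<eta>]) auto
    then show ?thesis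
      using ev rp P by (auto simp: is_root_def)
  qed
  then obtain \<rho> where \<rho>: "\<And>b. b \<in> set bs \<Longrightarrow> is_root P (\<rho> b)" "\<And>b. b \<in> set bs \<Longrightarrow> u (\<rho> b \<ominus> b) < s"
    by metis
  have "inj_on \<rho> (set bs)"
  proof (rule inj_onI, rule ccontr)
    fix b b' assume *: "b \<in> set bs" "b' \<in> set bs" "\<rho> b = \<rho> b'" "b \<noteq> b'"
    have c: "\<rho> b \<in> carrier R" "b \<in> carrier R" "b' \<in> carrier R"
      using \<rho>(1)[OF *(1)] * bs by (auto simp: is_root_def)
    have "u (b \<ominus> b') \<le> max (u (b \<ominus> \<rho> b)) (u (\<rho> b \<ominus> b'))"
      using c by (intro u_triangle_max)
    moreover have "u (b \<ominus> \<rho> b) < s" "u (\<rho> b \<ominus> b') < s"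
      using \<rho>(2)[OF *(1)] \<rho>(2)[OF *(2)] *(3) u_minus_commute[OF c(1,2)] by auto
    ultimately show False
      using s(3)[OF *(1,2,4)] by linarith
  qed
  then have "card (\<rho> ` set bs) = n"
    using bs n by (simp add: card_image distinct_card)
  moreover have "\<rho> ` set bs \<subseteq> set_mset (roots P)"
    using \<rho> roots_mem_iff_is_root[OF P(1)] by auto
  ultimately have "n \<le> card (set_mset (roots P))"
    using card_mono[of "set_mset (roots P)" "\<rho> ` set bs"] by simp
  also have "\<dots> \<le> size (roots P)"
    by (metis size_mset_set mset_set_set_mset_msubset size_mset_mono)
  finally have "size (roots P) = length P - 1"
    using size_roots_le_degree[OF P(1)] P(3) by simp
  then show ?thesis
    by (simp add: splitted_def P_def)
qed

end

section \<open>Polynomials that split in a Galois extension\<close>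

text \<open>Each constraint excludes at most one of the \<open>card C + 1\<close>
  candidates.\<close>

lemma avoid_bad_values:
  assumes fin: "finite C"
    and bad: "\<And>c t t'. \<lbrakk>c \<in> C; t \<le> card C; t' \<le> card C; bad c t; bad c t'\<rbrakk> \<Longrightarrow> t = t'"
  shows "\<exists>t\<le>card C. \<forall>c\<in>C. \<not> bad c (t::nat)"
proof (rule ccontr)
  assume "\<not> ?thesis"
  then have "\<exists>c\<in>C. bad c t" if "t \<le> card C" for t
    using that by blast
  then obtain g where g: "\<And>t. t \<le> card C \<Longrightarrow> g t \<in> C \<and> bad (g t) t"
    by metis
  have "inj_on g {..card C}"
    using g bad by (intro inj_onI) (metis atMost_iff)
  moreover have "g ` {..card C} \<subseteq> C"
    using g by auto
  ultimately have "card {..card C} \<le> card C"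
    using fin card_inj_on_le by blast
  then show False
    by simp
qed

lemma card_residue_class_le: "card {j \<in> {..<n}. j mod m = c} \<le> n div m + (1::nat)"
proof (cases "m = 0")
  case True
  \<comment> \<open>Division by \<open>0\<close> returns \<open>0\<close> and \<open>j mod 0\<close>
    is \<open>j\<close>, so the class is contained in a singleton and the bound reads 1.\<close>
  then have "{j \<in> {..<n}. j mod m = c} \<subseteq> {c}"
    by auto
  then show ?thesis
    using card_mono[of "{c}" "{j \<in> {..<n}. j mod m = c}"] by simp
next
  case False
  have "inj_on (\<lambda>j. j div m) {j \<in> {..<n}. j mod m = c}"
    by (rule inj_onI) (metis (mono_tags, lifting) div_mult_mod_eq mem_Collect_eq)
  moreover have "(\<lambda>j. j div m) ` {j \<in> {..<n}. j mod m = c} \<subseteq> {..n div m}"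
    by (auto intro: div_le_mono)
  ultimately have "card {j \<in> {..<n}. j mod m = c} \<le> card {..n div m}"
    by (intro card_inj_on_le) auto
  then show ?thesis
    by simp
qed

text \<open>The geometric series in Legendre's formula; the \<open>Q - 1\<close> of the final bound
  originates here.\<close>

lemma sum_div_powers_le:
  assumes "2 \<le> (Q::nat)"
  shows "(\<Sum>l=1..M. real (n div Q ^ l)) \<le> real n / (real Q - 1)"
proof -
  have "(\<Sum>l=1..M. real (n div Q ^ l)) \<le> (\<Sum>l=1..M. real n / real Q ^ l)"
  proof (intro sum_mono)
    fix l
    have "real (n div Q ^ l) \<le> real n / real (Q ^ l)"
      by (rule of_nat_div_le_of_nat)
    then show "real (n div Q ^ l) \<le> real n / real Q ^ l"
      by simp
  qed
  also have "\<dots> = real n * (\<Sum>l=1..M. (1 / real Q) ^ l)"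
    by (simp add: sum_distrib_left power_divide)
  also have "(\<Sum>l=1..M. (1 / real Q) ^ l) \<le> 1 / (real Q - 1)"
  proof -
    have "(\<Sum>l=1..M. (1 / real Q) ^ l) = (1 - (1 / real Q) ^ M) / (real Q - 1)"
      using assms by (induction M) (simp_all add: field_simps)
    also have "\<dots> \<le> 1 / (real Q - 1)"
      using assms by (intro divide_right_mono) auto
    finally show ?thesis .
  qed
  then have "real n * (\<Sum>l=1..M. (1 / real Q) ^ l) \<le> real n * (1 / (real Q - 1))"
    by (intro mult_left_mono) auto
  finally show ?thesis
    by simp
qed

section \<open>Evenly spread points in the valuation ring\<close>

context padic_field
begin

text \<open>Factors \<open>p\<close> of \<open>n\<close> are removed one by one, each costing
  \<open>1 / p\<close>. What remains is prime to \<open>p\<close> and is a unit by a Bezout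
  identity.\<close>

lemma nat_elem_ge: "0 < n \<Longrightarrow> 1 / real n \<le> u (nat_elem n)"
proof (induction n rule: less_induct)
  case (less n)
  show ?case
  proof (cases "p dvd n")
    case True
    then obtain m where m: "n = p * m" by blast
    then have m': "0 < m" "m < n"
      using less.prems p_gt_1 by auto
    have "1 / real n = 1 / p * (1 / real m)"
      by (simp add: m)
    also have "\<dots> \<le> 1 / p * u (nat_elem m)"
      using less.IH[OF m'(2,1)] by (intro mult_left_mono) auto
    also have "\<dots> = u (nat_elem n)"
      by (simp add: m nat_elem_mult u_mult u_p)
    finally show ?thesis .
  next
    case False
    then have "algebraic_semidom_class.coprime p n"
      using prime_imp_coprime[OF prime_p] by simp
    then obtain a b where ab: "n * a = p * b + 1"
      using bezout_nat[of n p] less.prems by (auto simp: ac_simps)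
    have "u (nat_elem (p * b)) < 1"
    proof -
      have "u (nat_elem (p * b)) = 1 / p * u (nat_elem b)"
        by (simp add: nat_elem_mult u_mult u_p)
      also have "\<dots> \<le> 1 / p * 1"
        by (intro mult_left_mono u_nat_elem_le) auto
      finally show ?thesis
        using p_gt_1 by (simp add: order.strict_trans1)
    qed
    moreover have "nat_elem (n * a) \<ominus> \<one> = nat_elem (p * b)"
    proof -
      have "nat_elem (n * a) = nat_elem (p * b) \<oplus> \<one>"
        unfolding ab by (simp add: nat_elem_Suc)
      then show ?thesis
        by (simp only: add_minus_cancel nat_elem_in one_closed)
    qed
    ultimately have "u (nat_elem (n * a)) = u \<one>"
      by (intro u_eq_of_close) (simp_all add: u_minus_commute[of \<one>])
    then have "u (nat_elem n) * u (nat_elem a) = 1"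
      by (simp add: nat_elem_mult u_mult)
    then have "1 \<le> u (nat_elem n)"
      using u_nat_elem_le[of n] u_nat_elem_le[of a] u_nonneg[of "nat_elem n"] u_nonneg[of "nat_elem a"]
      by (metis mult.commute mult_left_le nat_elem_in)
    then show ?thesis
      using less.prems by (smt (verit) divide_le_eq_1 of_nat_0_less_iff of_nat_1 of_nat_le_iff less_one not_le)
  qed
qed

lemma u_nat_elem_minus:
  assumes "t \<noteq> t'" "t \<le> m" "t' \<le> m"
  shows "1 / real m \<le> u (nat_elem t \<ominus> nat_elem t')"
proof -
  have *: "1 / real m \<le> u (nat_elem t \<ominus> nat_elem t')" if "t' < t" "t \<le> m" for t t' :: nat
  proof -
    have "nat_elem t = nat_elem (t - t') \<oplus> nat_elem t'"
      using that by (simp flip: nat_elem_add)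
    then have "nat_elem t \<ominus> nat_elem t' = nat_elem (t - t')"
      by (simp only: add_minus_cancel nat_elem_in)
    moreover have "1 / real m \<le> 1 / real (t - t')"
      using that by (intro divide_left_mono) auto
    ultimately show ?thesis
      using nat_elem_ge[of "t - t'"] that by simp
  qed
  show ?thesis
    using *[of t' t] *[of t t'] assms u_minus_commute[of "nat_elem t" "nat_elem t'"]
    by (cases "t < t'") auto
qed

definition Q :: nat where "Q = card (carrier Res)"

lemma Q_ge_2: "2 \<le> Q"
proof -
  interpret RR: field Res by (rule field_Res)
  have "card {\<zero>\<^bsub>Res\<^esub>, \<one>\<^bsub>Res\<^esub>} \<le> card (carrier Res)"
    using finite_Res by (intro card_mono) auto
  then show ?thesis
    by (simp add: Q_def)
qed

lemma residue_reps:
  "\<exists>r. (\<forall>i<Q. r i \<in> carrier R \<and> u (r i) \<le> 1) \<and> (\<forall>i<Q. \<forall>j<Q. u (r i \<ominus> r j) < 1 \<longrightarrow> i = j)"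
proof -
  obtain h where h: "bij_betw h {0..<Q} (carrier Res)"
    using ex_bij_betw_nat_finite[OF finite_Res] unfolding Q_def by blast
  have "\<exists>x. x \<in> carrier R \<and> u x \<le> 1 \<and> rescls x = h i" if "i < Q" for i
  proof -
    have "h i \<in> carrier Res"
      using h that by (auto simp: bij_betw_def)
    then show ?thesis
      by (auto simp: carrier_Res)
  qed
  then obtain r where r: "\<And>i. i < Q \<Longrightarrow> r i \<in> carrier R \<and> u (r i) \<le> 1 \<and> rescls (r i) = h i"
    by metis
  have "i = j" if "i < Q" "j < Q" "u (r i \<ominus> r j) < 1" for i j
  proof -
    have "rescls (r i) = rescls (r j)"
      using rescls_eq_iff[of "r i" "r j"] r that by simp
    then have "h i = h j"
      using r that by simp
    then show ?thesis
      using h that by (auto simp: bij_betw_def inj_on_def)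
  qed
  then show ?thesis
    using r by blast
qed

text \<open>The witness \<open>y j\<close> is the expansion of \<open>j\<close> in base \<open>Q\<close>, with the digits replaced by
  representatives of the residue classes and the base by a uniformizer \<open>\<pi>\<close>.\<close>

lemma equidistributed_points:
  "\<exists>y. (\<forall>j. y j \<in> carrier R \<and> u (y j) \<le> 1) \<and>
     (\<forall>l\<le>M. \<forall>j j'. u (y j \<ominus> y j') \<le> rho ^ l \<longrightarrow> j mod Q ^ l = j' mod Q ^ l)"
proof (induction M)
  case 0
  show ?case
    by (intro exI[of _ "\<lambda>j. \<zero>"]) simp
next
  case (Suc M)
  obtain y where y: "\<And>j. y j \<in> carrier R" "\<And>j. u (y j) \<le> 1"
    "\<And>l j j'. l \<le> M \<Longrightarrow> u (y j \<ominus> y j') \<le> rho ^ l \<Longrightarrow> j mod Q ^ l = j' mod Q ^ l"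
    using Suc by blast
  obtain r where r: "\<And>i. i < Q \<Longrightarrow> r i \<in> carrier R" "\<And>i. i < Q \<Longrightarrow> u (r i) \<le> 1"
    "\<And>i j. i < Q \<Longrightarrow> j < Q \<Longrightarrow> u (r i \<ominus> r j) < 1 \<Longrightarrow> i = j"
    using residue_reps by blast
  obtain \<pi> where pi: "\<pi> \<in> carrier R" "u \<pi> = rho"
    using rho_ex by blast
  define z where "z j = r (j mod Q) \<oplus> \<pi> \<otimes> y (j div Q)" for j
  have Q: "j mod Q < Q" for j
    using Q_ge_2 by simp
  have rho1: "rho * u (y j) \<le> 1" for j
    using mult_le_one[OF less_imp_le[OF rho_less] u_nonneg[OF y(1)] y(2)] .
  have z: "z j \<in> carrier R" "u (z j) \<le> 1" for j
  proof -
    show "z j \<in> carrier R"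
      using r[OF Q] y pi by (simp add: z_def)
    have "u (z j) \<le> max (u (r (j mod Q))) (rho * u (y (j div Q)))"
      using u_add_max[of "r (j mod Q)" "\<pi> \<otimes> y (j div Q)"] r[OF Q] y pi by (simp add: z_def u_mult)
    also have "\<dots> \<le> 1"
      using r(2)[OF Q] rho1 by (rule max.boundedI)
    finally show "u (z j) \<le> 1" .
  qed
  have "j mod Q ^ l = j' mod Q ^ l" if l: "l \<le> Suc M" and c: "u (z j \<ominus> z j') \<le> rho ^ l" for l j j'
  proof (cases l)
    case (Suc m)
    let ?a = "r (j mod Q)" and ?a' = "r (j' mod Q)" and ?b = "y (j div Q)" and ?b' = "y (j' div Q)"
    have car: "?a \<in> carrier R" "?a' \<in> carrier R" "?b \<in> carrier R" "?b' \<in> carrier R"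
      using r[OF Q] y by auto
    have ub: "u (\<pi> \<otimes> (?b \<ominus> ?b')) < 1"
    proof -
      have "u (?b \<ominus> ?b') \<le> 1"
        using u_minus_max[OF car(3,4)] y(2) by (meson max.boundedI order_trans)
      then have "rho * u (?b \<ominus> ?b') \<le> rho * 1"
        using rho_pos by (intro mult_left_mono) auto
      then show ?thesis
        using rho_less car pi by (simp add: u_mult)
    qed
    \<comment> \<open>Both terms on the right have value below 1, so the leading digits represent
      the same residue class and are equal. They cancel, and dividing by \<pi> leads to the points
      of the previous stage with \<open>l\<close> lowered by one.\<close>
    have "?a \<ominus> ?a' = (z j \<ominus> z j') \<ominus> \<pi> \<otimes> (?b \<ominus> ?b')"
      unfolding z_def using car pi(1) by algebra
    then have "u (?a \<ominus> ?a') \<le> max (u (z j \<ominus> z j')) (u (\<pi> \<otimes> (?b \<ominus> ?b')))"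
      using u_minus_max[of "z j \<ominus> z j'" "\<pi> \<otimes> (?b \<ominus> ?b')"] z car pi by simp
    moreover have "u (z j \<ominus> z j') < 1"
    proof -
      have "rho ^ Suc m < 1"
        using rho_pos rho_less by (intro power_Suc_less_one)
      then show ?thesis
        using c Suc by simp
    qed
    ultimately have "u (?a \<ominus> ?a') < 1"
      using ub by linarith
    then have m: "j mod Q = j' mod Q"
      by (rule r(3)[OF Q Q])
    have "z j \<ominus> z j' = \<pi> \<otimes> (?b \<ominus> ?b')"
      unfolding z_def m using car(2-4) pi(1) by algebra
    then have "rho * u (?b \<ominus> ?b') \<le> rho * rho ^ m"
      using c Suc car pi by (simp add: u_mult)
    then have "u (?b \<ominus> ?b') \<le> rho ^ m"
      using rho_pos by simp
    then have "(j div Q) mod Q ^ m = (j' div Q) mod Q ^ m"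
      using y(3)[of m] l Suc by simp
    then show ?thesis
      using m by (simp add: Suc mod_mult2_eq)
  qed simp
  then show ?case
    using z by blast
qed

end

section \<open>Keeping conjugates apart\<close>

context local_extension
begin

text \<open>Induction on the pairs to be separated, with candidates
  \<open>\<theta> \<oplus> nat_elem t \<otimes> b\<close>, where \<open>b\<close> separates the new
  pair. Two values of \<open>t\<close> failing for the same pair would give
  \<open>\<tau> b = \<sigma> b\<close> and then \<open>\<tau> \<theta> = \<sigma> \<theta>\<close>;
  the first is false for the new pair, the second for an old one. A final scaling by
  \<open>k0\<close> reaches the unit ball.\<close>

lemma separating_element:
  "\<exists>\<theta>\<in>carrier R. u \<theta> \<le> 1 \<and> \<theta> \<noteq> \<zero> \<and> (\<forall>\<tau>\<in>Gal. \<forall>\<sigma>\<in>Gal. \<tau> \<noteq> \<sigma> \<longrightarrow> \<tau> \<theta> \<noteq> \<sigma> \<theta>)"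
proof -
  have ind: "finite P \<Longrightarrow> P \<subseteq> {(\<tau>, \<sigma>). \<tau> \<in> Gal \<and> \<sigma> \<in> Gal \<and> \<tau> \<noteq> \<sigma>} \<Longrightarrow>
    \<exists>\<theta>\<in>carrier R. \<theta> \<noteq> \<zero> \<and> (\<forall>(\<tau>, \<sigma>)\<in>P. \<tau> \<theta> \<noteq> \<sigma> \<theta>)" for P
  proof (induction P rule: finite_induct)
    case empty
    then show ?case
      by (intro bexI[of _ \<one>]) auto
  next
    case (insert x P)
    obtain \<tau>0 \<sigma>0 where x: "x = (\<tau>0, \<sigma>0)" "\<tau>0 \<in> Gal" "\<sigma>0 \<in> Gal" "\<tau>0 \<noteq> \<sigma>0"
      using insert.prems by auto
    obtain \<theta> where t: "\<theta> \<in> carrier R" "\<theta> \<noteq> \<zero>" "\<forall>(\<tau>, \<sigma>)\<in>P. \<tau> \<theta> \<noteq> \<sigma> \<theta>"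
      using insert by auto
    obtain b where b: "b \<in> carrier R" "\<tau>0 b \<noteq> \<sigma>0 b"
      using x extensionalityI[of \<tau>0 "carrier R" \<sigma>0] by (auto simp: Gal_iff)
    define bad where "bad = (\<lambda>(\<tau> :: 'a \<Rightarrow> 'a, \<sigma> :: 'a \<Rightarrow> 'a) t. \<tau> (\<theta> \<oplus> nat_elem t \<otimes> b) = \<sigma> (\<theta> \<oplus> nat_elem t \<otimes> b))"
    have "t1 = t2" if c: "c \<in> insert x P" and b1: "bad c t1" and b2: "bad c t2" for c t1 t2
    proof (rule ccontr)
      assume ne: "t1 \<noteq> t2"
      obtain \<tau> \<sigma> where c': "c = (\<tau>, \<sigma>)" by (cases c)
      have G: "\<tau> \<in> Gal" "\<sigma> \<in> Gal"
        using c c' insert.prems by auto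
      interpret t: ring_hom_ring R R \<tau> by (rule Gal_ring_hom_ring[OF G(1)])
      interpret s: ring_hom_ring R R \<sigma> by (rule Gal_ring_hom_ring[OF G(2)])
      have fx: "\<tau> (nat_elem n) = nat_elem n" "\<sigma> (nat_elem n) = nat_elem n" for n
        using nat_elem_subring[OF subfieldE(1)[OF k]] Gal_fix G by auto
      define A where "A = \<tau> \<theta> \<ominus> \<sigma> \<theta>"
      define B where "B = \<tau> b \<ominus> \<sigma> b"
      have car: "\<tau> \<theta> \<in> carrier R" "\<sigma> \<theta> \<in> carrier R" "\<tau> b \<in> carrier R" "\<sigma> b \<in> carrier R"
        using t b Gal_in G by auto
      then have AB: "A \<in> carrier R" "B \<in> carrier R"
        by (auto simp: A_def B_def)
      have z: "A \<oplus> nat_elem n \<otimes> B = \<zero>" if "bad c n" for n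
      proof -
        have "\<tau> \<theta> \<oplus> nat_elem n \<otimes> \<tau> b = \<sigma> \<theta> \<oplus> nat_elem n \<otimes> \<sigma> b"
          using that t b by (simp add: bad_def c' fx)
        moreover have "A \<oplus> nat_elem n \<otimes> B = (\<tau> \<theta> \<oplus> nat_elem n \<otimes> \<tau> b) \<ominus> (\<sigma> \<theta> \<oplus> nat_elem n \<otimes> \<sigma> b)"
          unfolding A_def B_def using car nat_elem_in[of n] by algebra
        ultimately show ?thesis
          using car by (simp add: a_minus_def r_neg)
      qed
      have "(nat_elem t1 \<ominus> nat_elem t2) \<otimes> B = (A \<oplus> nat_elem t1 \<otimes> B) \<ominus> (A \<oplus> nat_elem t2 \<otimes> B)"
        using AB nat_elem_in[of t1] nat_elem_in[of t2] by algebra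
      then have "(nat_elem t1 \<ominus> nat_elem t2) \<otimes> B = \<zero>"
        using z b1 b2 by (simp add: a_minus_def)
      moreover have "nat_elem t1 \<ominus> nat_elem t2 \<noteq> \<zero>"
      proof
        assume eq: "nat_elem t1 \<ominus> nat_elem t2 = \<zero>"
        have "1 / real (max t1 t2) \<le> 0"
          using u_nat_elem_minus[OF ne, of "max t1 t2"] unfolding eq by simp
        then show False
          using ne by (simp add: divide_le_0_iff max_def split: if_splits)
      qed
      ultimately have "B = \<zero>"
        using integral[OF _ minus_closed[OF nat_elem_in nat_elem_in] AB(2)] by blast
      then have "A = \<zero>"
        using z[OF b1] AB by simp
      show False
      proof (cases "c = x")
        case True
        then show ?thesis
          using \<open>B = \<zero>\<close> b c' x car by (simp add: B_def r_right_minus_eq)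
      next
        case False
        then have "\<tau> \<theta> \<noteq> \<sigma> \<theta>"
          using t(3) c c' by auto
        then show ?thesis
          using \<open>A = \<zero>\<close> car by (simp add: A_def r_right_minus_eq)
      qed
    qed
    then obtain n where n: "\<forall>c\<in>insert x P. \<not> bad c n"
      using avoid_bad_values[of "insert x P" bad] insert.hyps by blast
    define \<theta>' where "\<theta>' = \<theta> \<oplus> nat_elem n \<otimes> b"
    have "\<tau>0 \<theta>' \<noteq> \<sigma>0 \<theta>'"
      using n x by (auto simp: bad_def \<theta>'_def)
    then have "\<theta>' \<noteq> \<zero>"
      using x ring_hom_zero[OF Gal_hom ring_axioms ring_axioms] by metis
    then show ?case
      using n t b by (intro bexI[of _ \<theta>']) (auto simp: bad_def \<theta>'_def)
  qed
  obtain \<theta> where t: "\<theta> \<in> carrier R" "\<theta> \<noteq> \<zero>" "\<And>\<tau> \<sigma>. \<tau> \<in> Gal \<Longrightarrow> \<sigma> \<in> Gal \<Longrightarrow> \<tau> \<noteq> \<sigma> \<Longrightarrow> \<tau> \<theta> \<noteq> \<sigma> \<theta>"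
  proof -
    have "finite {(\<tau>, \<sigma>). \<tau> \<in> Gal \<and> \<sigma> \<in> Gal \<and> \<tau> \<noteq> \<sigma>}"
      by (rule finite_subset[of _ "Gal \<times> Gal"]) (use finite_Gal in auto)
    then show thesis
      using ind[of "{(\<tau>, \<sigma>). \<tau> \<in> Gal \<and> \<sigma> \<in> Gal \<and> \<tau> \<noteq> \<sigma>}"] that by blast
  qed
  obtain a where a: "a \<in> k0" "a \<noteq> \<zero>" "u (\<theta> \<otimes> a) \<le> 1"
    using scale_into_unit[OF t(1,2)] by blast
  have ac: "a \<in> carrier R"
    using a k0_in by auto
  have "\<tau> (\<theta> \<otimes> a) \<noteq> \<sigma> (\<theta> \<otimes> a)" if "\<tau> \<in> Gal" "\<sigma> \<in> Gal" "\<tau> \<noteq> \<sigma>" for \<tau> \<sigma>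
  proof -
    have "\<tau> (\<theta> \<otimes> a) = \<tau> \<theta> \<otimes> a" "\<sigma> (\<theta> \<otimes> a) = \<sigma> \<theta> \<otimes> a"
      using ring_hom_mult[OF Gal_hom] that t ac Gal_fix a k0_k by (metis subsetD)+
    then show ?thesis
      using t(3)[OF that] m_rcancel[OF a(2) ac] Gal_in that t by simp
  qed
  moreover have "\<theta> \<otimes> a \<noteq> \<zero>"
    using integral[of \<theta> a] t(1,2) a(2) ac by blast
  moreover have "\<theta> \<otimes> a \<in> carrier R"
    using t ac by simp
  ultimately show ?thesis
    using a(3) by blast
qed

end

context local_extension
begin

lemma Gal_lin:
  assumes "\<tau> \<in> Gal" "a \<in> carrier R" "b \<in> carrier R"
  shows "\<tau> (a \<oplus> nat_elem n \<otimes> b) = \<tau> a \<oplus> nat_elem n \<otimes> \<tau> b"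
proof -
  interpret t: ring_hom_ring R R \<tau> by (rule Gal_ring_hom_ring[OF assms(1)])
  have "\<tau> (nat_elem n) = nat_elem n"
    using nat_elem_subring[OF subfieldE(1)[OF k]] Gal_fix[OF assms(1)] by auto
  then show ?thesis
    using assms by simp
qed

text \<open>The evenly spread points may meet each other's conjugates or their own. Adding
  \<open>p ^ M * t\<close> times \<theta> moves a point by at most \<open>1 / p ^ M\<close>, and
  some \<open>t\<close> satisfies all constraints at once. In \<open>s\<close>, the factor
  \<open>1 / p ^ M\<close> is the value of \<open>p ^ M\<close>,
  \<open>1 / (card Gal ^ 2 * n)\<close> bounds from below the difference of two candidates
  \<open>t\<close>, and \<delta> bounds both \<theta> and the differences of its conjugates.\<close>

lemma perturbed_points:
  assumes \<theta>: "\<theta> \<in> carrier R" "u \<theta> \<le> 1" "0 < \<delta>" "\<delta> \<le> u \<theta>"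
      "\<forall>\<tau>\<in>Gal. \<forall>\<sigma>\<in>Gal. \<tau> \<noteq> \<sigma> \<longrightarrow> \<delta> \<le> u (\<tau> \<theta> \<ominus> \<sigma> \<theta>)"
    and y': "\<forall>j. y j \<in> carrier R \<and> u (y j) \<le> 1"
    and n: "0 < n" and s: "s = \<delta> / (real p ^ M * real (card Gal ^ 2 * n))"
  shows "m \<le> n \<Longrightarrow> \<exists>z. (\<forall>j<m. z j \<in> carrier R \<and> u (z j) \<le> 1 \<and> u (z j \<ominus> y j) \<le> 1 / real p ^ M) \<and>
     (\<forall>\<tau>\<in>Gal. \<forall>\<sigma>\<in>Gal. \<forall>j<m. \<forall>j'<m. (\<tau>, j) \<noteq> (\<sigma>, j') \<longrightarrow> s \<le> u (\<tau> (z j) \<ominus> \<sigma> (z j')))"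
proof (induction m)
  case 0
  then show ?case by simp
next
  case (Suc m)
  have y: "y j \<in> carrier R" "u (y j) \<le> 1" for j
    using y' by auto
  have "m \<le> n"
    using Suc.prems by simp
  from Suc.IH[OF this] obtain z where zz: "(\<forall>j<m. z j \<in> carrier R \<and> u (z j) \<le> 1 \<and> u (z j \<ominus> y j) \<le> 1 / real p ^ M) \<and>
     (\<forall>\<tau>\<in>Gal. \<forall>\<sigma>\<in>Gal. \<forall>j<m. \<forall>j'<m. (\<tau>, j) \<noteq> (\<sigma>, j') \<longrightarrow> s \<le> u (\<tau> (z j) \<ominus> \<sigma> (z j')))"
    by (rule exE)
  then have z: "\<And>j. j < m \<Longrightarrow> z j \<in> carrier R" "\<And>j. j < m \<Longrightarrow> u (z j) \<le> 1"
      "\<And>j. j < m \<Longrightarrow> u (z j \<ominus> y j) \<le> 1 / real p ^ M"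
    and sep: "\<And>\<tau> \<sigma> j j'. \<lbrakk>\<tau> \<in> Gal; \<sigma> \<in> Gal; j < m; j' < m; (\<tau>, j) \<noteq> (\<sigma>, j')\<rbrakk> \<Longrightarrow> s \<le> u (\<tau> (z j) \<ominus> \<sigma> (z j'))"
    by blast+
  have G: "0 < card Gal"
    using finite_Gal Gal_id by (auto simp: card_gt_0_iff)
  define W where "W = card Gal ^ 2 * n"
  have W: "0 < W"
    using G n by (simp add: W_def)
  define v where "v t = y m \<oplus> nat_elem (p ^ M * t) \<otimes> \<theta>" for t
  have v: "v t \<in> carrier R" for t
    using y \<theta> by (simp add: v_def)
  have vy: "u (v t \<ominus> y m) \<le> 1 / real p ^ M" for t
  proof -
    have "v t \<ominus> y m = nat_elem (p ^ M * t) \<otimes> \<theta>"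
      unfolding v_def using y(1)[of m] \<theta>(1) nat_elem_in[of "p ^ M * t"] by algebra
    then have "u (v t \<ominus> y m) = 1 / real p ^ M * (u (nat_elem t) * u \<theta>)"
      using \<theta> by (simp add: u_mult nat_elem_mult u_p_pow)
    also have "\<dots> \<le> 1 / real p ^ M * 1"
      using \<theta> u_nat_elem_le by (intro mult_left_mono mult_le_one u_nonneg) auto
    finally show ?thesis by simp
  qed
  have v1: "u (v t) \<le> 1" for t
  proof -
    have "1 / real p ^ M \<le> 1"
      using p_gt_1 by (simp add: divide_le_eq)
    then show ?thesis
      using u_le_of_close[OF y(1)[of m] v[of t]] vy[of t] y(2)[of m] u_minus_commute[OF y(1)[of m] v[of t]]
      by linarith
  qed
  define bad where "bad = (\<lambda>(\<tau> :: 'a \<Rightarrow> 'a, \<sigma> :: 'a \<Rightarrow> 'a, j) t. u (\<tau> (v t) \<ominus> \<sigma> (if j = m then v t else z j)) < s)"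
  \<comment> \<open>The pair of a conjugate of the new point with itself is left out, its difference
    being zero. At most \<open>card Gal ^ 2 * n\<close> constraints remain, which is the number in
    the denominator of \<open>s\<close>.\<close>
  define C where "C = {(\<tau>, \<sigma>, j). \<tau> \<in> Gal \<and> \<sigma> \<in> Gal \<and> (j < m \<or> j = m \<and> \<tau> \<noteq> \<sigma>)}"
  have sub: "C \<subseteq> Gal \<times> Gal \<times> {..m}"
    by (auto simp: C_def)
  have finC: "finite C"
    using finite_subset[OF sub] finite_Gal by simp
  have "card C \<le> card (Gal \<times> Gal \<times> {..m})"
    using card_mono[OF _ sub] finite_Gal by simp
  also have "\<dots> = card Gal * (card Gal * Suc m)"
    by (simp add: card_cartesian_product)
  also have "\<dots> \<le> card Gal * (card Gal * n)"
    using Suc.prems by (intro mult_le_mono2)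
  also have "\<dots> = W"
    by (simp add: W_def power2_eq_square)
  finally have CW: "card C \<le> W" .
  have diff: "s \<le> u (nat_elem (p ^ M * t) \<ominus> nat_elem (p ^ M * t')) * e"
    if "t \<noteq> t'" "t \<le> card C" "t' \<le> card C" "\<delta> \<le> e" for t t' e
  proof -
    have "nat_elem (p ^ M * t) \<ominus> nat_elem (p ^ M * t') = nat_elem (p ^ M) \<otimes> (nat_elem t \<ominus> nat_elem t')"
      unfolding nat_elem_mult using nat_elem_in[of t] nat_elem_in[of t'] nat_elem_in[of "p ^ M"] by algebra
    then have "u (nat_elem (p ^ M * t) \<ominus> nat_elem (p ^ M * t')) = 1 / real p ^ M * u (nat_elem t \<ominus> nat_elem t')"
      by (simp add: u_mult u_p_pow)
    moreover have "1 / real p ^ M * (1 / real W) \<le> 1 / real p ^ M * u (nat_elem t \<ominus> nat_elem t')"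
      using that CW by (intro mult_left_mono u_nat_elem_minus) auto
    ultimately have "1 / real p ^ M * (1 / real W) * \<delta> \<le> u (nat_elem (p ^ M * t) \<ominus> nat_elem (p ^ M * t')) * e"
      using that \<theta>(3) by (intro mult_mono u_nonneg) auto
    then show ?thesis
      by (simp add: s W_def)
  qed
  have "t = t'" if c: "c \<in> C" and t: "t \<le> card C" "t' \<le> card C" and b: "bad c t" "bad c t'" for c t t'
  proof (rule ccontr)
    assume ne: "t \<noteq> t'"
    obtain \<tau> \<sigma> j where c': "c = (\<tau>, \<sigma>, j)" by (cases c) auto
    have Gm: "\<tau> \<in> Gal" "\<sigma> \<in> Gal"
      using c c' by (auto simp: C_def)
    let ?K = "nat_elem (p ^ M * t)" and ?K' = "nat_elem (p ^ M * t')"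
    have vt: "\<tau> (v i) = \<tau> (y m) \<oplus> nat_elem (p ^ M * i) \<otimes> \<tau> \<theta>" "\<sigma> (v i) = \<sigma> (y m) \<oplus> nat_elem (p ^ M * i) \<otimes> \<sigma> \<theta>" for i
      unfolding v_def using Gm y \<theta> by (auto intro!: Gal_lin)
    have car: "\<tau> (y m) \<in> carrier R" "\<sigma> (y m) \<in> carrier R" "\<tau> \<theta> \<in> carrier R" "\<sigma> \<theta> \<in> carrier R" "?K \<in> carrier R" "?K' \<in> carrier R"
      using Gm y \<theta> Gal_in by auto
    show False
    proof (cases "j = m")
      case True
      then have ts: "\<tau> \<noteq> \<sigma>"
        using c c' by (auto simp: C_def)
      \<comment> \<open>If two values of \<open>t\<close> failed, the part coming from
        \<open>y m\<close> would cancel between them, leaving a product that \<open>diff\<close>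
        shows to be at least \<open>s\<close> although both differences are smaller.\<close>
      have "(\<tau> (v t) \<ominus> \<sigma> (v t)) \<ominus> (\<tau> (v t') \<ominus> \<sigma> (v t')) = (?K \<ominus> ?K') \<otimes> (\<tau> \<theta> \<ominus> \<sigma> \<theta>)"
        unfolding vt using car by algebra
      then have "u (?K \<ominus> ?K') * u (\<tau> \<theta> \<ominus> \<sigma> \<theta>) \<le> max (u (\<tau> (v t) \<ominus> \<sigma> (v t))) (u (\<tau> (v t') \<ominus> \<sigma> (v t')))"
        using u_minus_max[of "\<tau> (v t) \<ominus> \<sigma> (v t)" "\<tau> (v t') \<ominus> \<sigma> (v t')"] car v Gm Gal_in by (simp add: u_mult)
      also have "\<dots> < s"
        using b True by (simp add: bad_def c')
      finally show False
        using diff[OF ne t \<theta>(5)[rule_format, OF Gm ts]] by simp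
    next
      case False
      then have j: "j < m"
        using c c' by (auto simp: C_def)
      have "\<tau> (v t) \<ominus> \<tau> (v t') = (?K \<ominus> ?K') \<otimes> \<tau> \<theta>"
        unfolding vt using car by algebra
      then have "u (?K \<ominus> ?K') * u \<theta> = u (\<tau> (v t) \<ominus> \<tau> (v t'))"
        using car Gal_isometry[OF Gm(1) \<theta>(1)] by (simp add: u_mult)
      also have "\<dots> \<le> max (u (\<tau> (v t) \<ominus> \<sigma> (z j))) (u (\<sigma> (z j) \<ominus> \<tau> (v t')))"
        using v z(1)[OF j] Gm Gal_in by (intro u_triangle_max) auto
      also have "\<dots> < s"
        using b False v z(1)[OF j] Gm Gal_in by (simp add: bad_def c' u_minus_commute[of "\<sigma> (z j)"])
      finally show False
        using diff[OF ne t \<theta>(4)] by simp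
    qed
  qed
  then obtain t where t: "\<And>c. c \<in> C \<Longrightarrow> \<not> bad c t"
    using avoid_bad_values[OF finC, of bad] by blast
  define z' where "z' = z(m := v t)"
  have "s \<le> u (\<tau> (z' j) \<ominus> \<sigma> (z' j'))"
    if "\<tau> \<in> Gal" "\<sigma> \<in> Gal" "j < Suc m" "j' < Suc m" "(\<tau>, j) \<noteq> (\<sigma>, j')" for \<tau> \<sigma> j j'
  proof -
    consider "j < m" "j' < m" | "j = m" | "j < m" "j' = m"
      using \<open>j < Suc m\<close> \<open>j' < Suc m\<close> by linarith
    then show ?thesis
    proof cases
      case 1
      then show ?thesis using sep[of \<tau> \<sigma> j j'] that by (simp add: z'_def)
    next
      case 2
      then have "(\<tau>, \<sigma>, j') \<in> C"
        using that by (auto simp: C_def)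
      then show ?thesis
        using t[of "(\<tau>, \<sigma>, j')"] 2 by (auto simp: bad_def z'_def split: if_splits)
    next
      case 3
      then have "(\<sigma>, \<tau>, j) \<in> C"
        using that by (auto simp: C_def)
      then have "s \<le> u (\<sigma> (v t) \<ominus> \<tau> (z j))"
        using t[of "(\<sigma>, \<tau>, j)"] 3 by (auto simp: bad_def split: if_splits)
      then show ?thesis
        using 3 that v z(1) Gal_in by (simp add: z'_def u_minus_commute[of "\<tau> (z j)"])
    qed
  qed
  moreover have "z' j \<in> carrier R \<and> u (z' j) \<le> 1 \<and> u (z' j \<ominus> y j) \<le> 1 / real p ^ M" if "j < Suc m" for j
    using that z v v1 vy by (auto simp: z'_def less_Suc_eq)
  ultimately show ?case
    by blast
qed

section \<open>The product of differences and the local polynomial\<close>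

lemma u_rc_le: "set bs \<subseteq> carrier R \<Longrightarrow> (\<And>b. b \<in> set bs \<Longrightarrow> u b \<le> 1) \<Longrightarrow> u (rc bs i) \<le> 1"
proof (induction bs arbitrary: i)
  case (Cons b bs)
  have "u (b \<otimes> rc bs i) \<le> 1"
    using Cons by (auto simp: u_mult intro!: mult_le_one u_nonneg)
  moreover have "u (if i = 0 then \<zero> else rc bs (i - 1)) \<le> 1"
    using Cons by auto
  ultimately show ?case
    using u_minus_max[of "if i = 0 then \<zero> else rc bs (i - 1)" "b \<otimes> rc bs i"] Cons.prems
    by (auto simp del: rc.simps simp add: rc.simps(2) split: if_splits)
qed simp

text \<open>If \<open>u x = rho ^ a\<close> with \<open>a < M\<close>, one factor \<open>rho\<close>
  is collected for each level from \<open>1\<close> to \<open>a\<close>, which gives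
  \<open>u x\<close> exactly; if \<open>a\<close> is at least \<open>M\<close>, the bound
  \<open>s\<close> takes over. In this form a product over many points can be regrouped into counts
  per level.\<close>

lemma value_ge:
  assumes "x \<in> carrier R" "u x \<le> 1" "0 < s" "s \<le> 1" "s \<le> u x"
  shows "(if u x \<le> rho ^ M then s else 1) * (\<Prod>l=1..M. if u x \<le> rho ^ l then rho else 1) \<le> u x"
proof -
  have "x \<noteq> \<zero>"
    using assms by auto
  then obtain a where a: "u x = rho ^ a"
    using rho_value assms by blast
  have le_iff: "u x \<le> rho ^ l \<longleftrightarrow> l \<le> a" for l
    unfolding a using rho_pos rho_less by (simp add: power_decreasing_iff)
  show ?thesis
  proof (cases "M \<le> a")
    case True
    have "s * (\<Prod>l=1..M. if u x \<le> rho ^ l then rho else 1) \<le> s * 1"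
      using assms rho_pos rho_less by (intro mult_left_mono prod_le_1) auto
    moreover have "u x \<le> rho ^ M"
      using True le_iff by blast
    ultimately show ?thesis
      using assms(5) by (simp only: if_True mult_1_right)
  next
    case False
    have "(\<Prod>l=1..M. if u x \<le> rho ^ l then rho else 1) = (\<Prod>l=1..M. if l \<le> a then rho else 1)"
      by (simp only: le_iff)
    also have "\<dots> = (\<Prod>l\<in>{1..M} \<inter> {l. l \<le> a}. rho)"
      by (subst prod.inter_restrict) auto
    also have "{1..M} \<inter> {l. l \<le> a} = {1..a}"
      using False by auto
    finally show ?thesis
      using False le_iff a by simp
  qed
qed

text \<open>The product of the differences from one root is regrouped by levels: at level
  \<open>l\<close> the disc around the root contains at most
  \<open>card Gal * (n div Q ^ l + 1)\<close> roots. Summing the quotients gives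
  \<open>n / (Q - 1)\<close>, the summands \<open>1\<close> give \<open>M\<close>, and
  \<open>s ^ card Gal\<close> accounts for roots too close to be distinguished at level
  \<open>M\<close>.\<close>

theorem local_polynomial:
  assumes \<theta>: "\<theta> \<in> carrier R" "u \<theta> \<le> 1" "0 < \<delta>" "\<delta> \<le> u \<theta>"
      "\<forall>\<tau>\<in>Gal. \<forall>\<sigma>\<in>Gal. \<tau> \<noteq> \<sigma> \<longrightarrow> \<delta> \<le> u (\<tau> \<theta> \<ominus> \<sigma> \<theta>)"
    and n: "0 < n" "n < Q ^ M"
    and s: "s = \<delta> / (real p ^ M * real (card Gal ^ 2 * n))"
    and \<eta>: "0 \<le> \<eta>" "\<eta> \<le> s / p * (s ^ card Gal * rho powr (card Gal * (M + n / (Q - 1))))"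
  shows "\<exists>c. (\<forall>i. c i \<in> k \<and> u (c i) \<le> 1) \<and>
    (\<forall>a. (\<forall>i<card Gal * n. a i \<in> carrier R \<and> u (a i \<ominus> c i) \<le> \<eta>) \<longrightarrow>
      splitted (\<one> # map a (rev [0..<card Gal * n])))"
proof -
  let ?G = "card Gal"
  have G: "0 < ?G"
    using finite_Gal Gal_id by (auto simp: card_gt_0_iff)
  have s1: "0 < s" "s \<le> 1"
  proof -
    have "1 * 1 \<le> real p ^ M * real (?G ^ 2 * n)"
      using p_gt_1 G n by (intro mult_mono) (simp_all add: Suc_le_eq flip: of_nat_power of_nat_mult)
    then show "0 < s" "s \<le> 1"
      unfolding s using \<theta> by (auto simp: divide_le_eq)
  qed
  obtain y where y: "\<And>j. y j \<in> carrier R" "\<And>j. u (y j) \<le> 1"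
    "\<And>l j j'. l \<le> M \<Longrightarrow> u (y j \<ominus> y j') \<le> rho ^ l \<Longrightarrow> j mod Q ^ l = j' mod Q ^ l"
    using equidistributed_points[of M] by blast
  obtain z where z: "\<And>j. j < n \<Longrightarrow> z j \<in> carrier R" "\<And>j. j < n \<Longrightarrow> u (z j) \<le> 1"
      "\<And>j. j < n \<Longrightarrow> u (z j \<ominus> y j) \<le> 1 / real p ^ M"
    and sep: "\<And>\<tau> \<sigma> j j'. \<lbrakk>\<tau> \<in> Gal; \<sigma> \<in> Gal; j < n; j' < n; (\<tau>, j) \<noteq> (\<sigma>, j')\<rbrakk> \<Longrightarrow> s \<le> u (\<tau> (z j) \<ominus> \<sigma> (z j'))"
  proof -
    have "\<forall>j. y j \<in> carrier R \<and> u (y j) \<le> 1"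
      using y by blast
    from perturbed_points[OF \<theta> this n(1) s order_refl] obtain z
      where zz: "(\<forall>j<n. z j \<in> carrier R \<and> u (z j) \<le> 1 \<and> u (z j \<ominus> y j) \<le> 1 / real p ^ M) \<and>
        (\<forall>\<tau>\<in>Gal. \<forall>\<sigma>\<in>Gal. \<forall>j<n. \<forall>j'<n. (\<tau>, j) \<noteq> (\<sigma>, j') \<longrightarrow> s \<le> u (\<tau> (z j) \<ominus> \<sigma> (z j')))"
      by (rule exE)
    show thesis
      by (rule that[of z]) (use zz in blast)+
  qed
  \<comment> \<open>The perturbation of the points is no larger than \<open>rho ^ M\<close>, so it
    is invisible at every level up to \<open>M\<close>.\<close>
  have pM: "1 / real p ^ M \<le> rho ^ M"
  proof -
    have "1 / real p ^ M = (rho ^ ram) ^ M"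
      by (simp add: ram(1)[symmetric] power_divide)
    also have "\<dots> \<le> rho ^ M"
      using rho_pos rho_less ram(2) by (simp flip: power_mult add: power_decreasing)
    finally show ?thesis .
  qed
  have z_mod: "j mod Q ^ l = j' mod Q ^ l" if "j < n" "j' < n" "l \<le> M" "u (z j \<ominus> z j') \<le> rho ^ l" for j j' l
  proof -
    have rM: "rho ^ M \<le> rho ^ l"
      using rho_pos rho_less that by (intro power_decreasing) auto
    have "u (y j \<ominus> y j') \<le> max (u (y j \<ominus> z j)) (u (z j \<ominus> y j'))"
      "u (z j \<ominus> y j') \<le> max (u (z j \<ominus> z j')) (u (z j' \<ominus> y j'))"
      using y z that by (auto intro!: u_triangle_max)
    then have "u (y j \<ominus> y j') \<le> rho ^ l"
      using z(3)[OF that(1)] z(3)[OF that(2)] that(4) rM pM u_minus_commute[OF y(1)[of j] z(1)[OF that(1)]]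
      by linarith
    then show ?thesis
      using y(3) that by blast
  qed
  define I where "I = Gal \<times> {..<n}"
  define pt where "pt = (\<lambda>(\<tau> :: 'a \<Rightarrow> 'a, j). \<tau> (z j))"
  have finI: "finite I" and cardI: "card I = ?G * n"
    using finite_Gal by (auto simp: I_def card_cartesian_product)
  have pt: "pt i \<in> carrier R" "u (pt i) \<le> 1" if "i \<in> I" for i
    using that z Gal_in Gal_isometry by (auto simp: I_def pt_def)
  have pt_sep: "s \<le> u (pt i \<ominus> pt i')" if "i \<in> I" "i' \<in> I" "i \<noteq> i'" for i i'
    using that sep by (auto simp: I_def pt_def)
  have inj: "inj_on pt I"
  proof (rule inj_onI, rule ccontr)
    fix i i' assume *: "i \<in> I" "i' \<in> I" "pt i = pt i'" "i \<noteq> i'"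
    then show False
      using pt_sep[OF *(1,2,4)] s1 pt(1)[OF *(2)] by (simp add: a_minus_def r_neg)
  qed
  obtain bs where bs: "set bs = pt ` I" "distinct bs"
    using finite_distinct_list[of "pt ` I"] finI by auto
  have len: "length bs = ?G * n"
    using bs inj cardI by (metis card_image distinct_card)
  have bsR: "set bs \<subseteq> carrier R" "\<And>b. b \<in> set bs \<Longrightarrow> u b \<le> 1"
    using bs pt by auto
  have stable: "\<sigma> ` set bs = set bs" if s: "\<sigma> \<in> Gal" for \<sigma>
  proof -
    have "\<sigma> ` set bs = (\<Union>j<n. (\<lambda>\<tau>. compose (carrier R) \<sigma> \<tau> (z j)) ` Gal)"
      unfolding bs I_def pt_def using z by (force simp: compose_def image_iff)
    also have "\<dots> = (\<Union>j<n. (\<lambda>\<tau>. \<tau> (z j)) ` (compose (carrier R) \<sigma> ` Gal))"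
      by (simp add: image_image)
    also have "compose (carrier R) \<sigma> ` Gal = Gal"
      using Gal_compose[OF s] by (simp add: bij_betw_def)
    also have "(\<Union>j<n. (\<lambda>\<tau>. \<tau> (z j)) ` Gal) = set bs"
      unfolding bs I_def pt_def by force
    finally show ?thesis .
  qed
  have prod_ge: "s ^ ?G * rho powr (?G * (M + n / (Q - 1))) \<le> (\<Prod>b'\<in>set bs - {b}. u (b \<ominus> b'))" if b: "b \<in> set bs" for b
  proof -
    obtain i where i: "i \<in> I" "b = pt i"
      using b bs by auto
    let ?J = "I - {i}" and ?v = "\<lambda>i'. u (pt i \<ominus> pt i')"
    have finJ: "finite ?J"
      using finI by simp
    \<comment> \<open>For each \<sigma> the points \<open>\<sigma> (z j)\<close> in the disc have
      indices congruent modulo \<open>Q ^ l\<close>: they are close to each other, \<sigma> is an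
      isometry, and close points \<open>z j\<close> have congruent indices.\<close>
    have count: "card {i' \<in> ?J. ?v i' \<le> rho ^ l} \<le> ?G * (n div Q ^ l + 1)" if l: "l \<le> M" for l
    proof -
      define H where "H \<sigma> = {j' \<in> {..<n}. u (pt i \<ominus> \<sigma> (z j')) \<le> rho ^ l}" for \<sigma>
      have H: "card (H \<sigma>) \<le> n div Q ^ l + 1" if sg: "\<sigma> \<in> Gal" for \<sigma>
      proof (cases "H \<sigma> = {}")
        case False
        then obtain j0 where j0: "j0 \<in> H \<sigma>" by blast
        have "H \<sigma> \<subseteq> {j \<in> {..<n}. j mod Q ^ l = j0 mod Q ^ l}"
        proof clarify
          fix j assume j: "j \<in> H \<sigma>"
          have jn: "j < n" "j0 < n"
            using j j0 by (auto simp: H_def)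
          have zc: "\<sigma> (z j) \<in> carrier R" "\<sigma> (z j0) \<in> carrier R"
            using z jn Gal_in[OF sg] by auto
          have "u (z j \<ominus> z j0) = u (\<sigma> (z j) \<ominus> \<sigma> (z j0))"
            using Gal_isometry[OF sg] Gal_minus[OF sg] z jn by (metis minus_closed)
          also have "\<dots> \<le> max (u (\<sigma> (z j) \<ominus> pt i)) (u (pt i \<ominus> \<sigma> (z j0)))"
            using zc pt i by (intro u_triangle_max) auto
          also have "\<dots> \<le> rho ^ l"
            using j j0 zc pt[OF i(1)] by (simp add: H_def u_minus_commute[of "\<sigma> (z j)"])
          finally show "j \<in> {..<n} \<and> j mod Q ^ l = j0 mod Q ^ l"
            using z_mod jn l by auto
        qed
        then have "card (H \<sigma>) \<le> card {j \<in> {..<n}. j mod Q ^ l = j0 mod Q ^ l}"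
          by (intro card_mono) auto
        then show ?thesis
          using card_residue_class_le[of n "Q ^ l" "j0 mod Q ^ l"] by linarith
      qed simp
      have "{i' \<in> ?J. ?v i' \<le> rho ^ l} \<subseteq> (SIGMA \<sigma>:Gal. H \<sigma>)"
        by (auto simp: I_def pt_def H_def)
      then have "card {i' \<in> ?J. ?v i' \<le> rho ^ l} \<le> card (SIGMA \<sigma>:Gal. H \<sigma>)"
        using finite_Gal by (intro card_mono) (auto simp: H_def)
      also have "\<dots> = (\<Sum>\<sigma>\<in>Gal. card (H \<sigma>))"
        using finite_Gal by (intro card_SigmaI) (auto simp: H_def)
      also have "\<dots> \<le> (\<Sum>\<sigma>\<in>Gal. n div Q ^ l + 1)"
        by (intro sum_mono H)
      finally show ?thesis
        by simp
    qed
    have if_prod: "(\<Prod>i'\<in>?J. if ?v i' \<le> e then c else 1) = c ^ card {i' \<in> ?J. ?v i' \<le> e}" for e c :: real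
      using finJ by (simp add: prod.inter_filter[symmetric])
    have "s ^ ?G * (\<Prod>l=1..M. rho ^ (?G * (n div Q ^ l + 1)))
        \<le> s ^ card {i' \<in> ?J. ?v i' \<le> rho ^ M} * (\<Prod>l=1..M. rho ^ card {i' \<in> ?J. ?v i' \<le> rho ^ l})"
    proof (intro mult_mono prod_mono conjI power_decreasing prod_nonneg)
      \<comment> \<open>Since \<open>n < Q ^ M\<close>, the quotient \<open>n div Q ^ M\<close> is
        zero, leaving at most one root per automorphism at the last level.\<close>
      show "card {i' \<in> ?J. ?v i' \<le> rho ^ M} \<le> ?G"
        using count[of M] n by simp
    qed (use s1 rho_pos rho_less count in \<open>auto intro!: prod_nonneg\<close>)
    also have "\<dots> = (\<Prod>i'\<in>?J. (if ?v i' \<le> rho ^ M then s else 1) * (\<Prod>l=1..M. if ?v i' \<le> rho ^ l then rho else 1))"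
      unfolding prod.distrib by (subst prod.swap) (simp only: if_prod)
    also have "\<dots> \<le> (\<Prod>i'\<in>?J. ?v i')"
    proof (intro prod_mono conjI value_ge)
      fix i' assume i': "i' \<in> ?J"
      show "u (pt i \<ominus> pt i') \<le> 1"
        using u_minus_max[of "pt i" "pt i'"] pt[OF i(1)] pt[of i'] i' by auto
      show "s \<le> u (pt i \<ominus> pt i')"
        using pt_sep[of i i'] i i' by auto
      show "0 \<le> (if ?v i' \<le> rho ^ M then s else 1) * (\<Prod>l=1..M. if ?v i' \<le> rho ^ l then rho else 1)"
        using s1 rho_pos by (intro mult_nonneg_nonneg prod_nonneg) auto
    qed (use pt i s1 in auto)
    also have "(\<Prod>i'\<in>?J. ?v i') = (\<Prod>b'\<in>pt ` ?J. u (b \<ominus> b'))"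
      unfolding i(2) by (subst prod.reindex) (auto intro: inj_on_subset[OF inj])
    also have "pt ` ?J = set bs - {b}"
      unfolding bs i(2) using inj i(1) by (auto simp: inj_on_def)
    finally have main: "s ^ ?G * (\<Prod>l=1..M. rho ^ (?G * (n div Q ^ l + 1))) \<le> (\<Prod>b'\<in>set bs - {b}. u (b \<ominus> b'))" .
    have "(\<Prod>l=1..M. rho ^ (?G * (n div Q ^ l + 1))) = rho ^ (\<Sum>l=1..M. ?G * (n div Q ^ l + 1))"
      by (simp add: power_sum)
    also have "\<dots> = rho powr (\<Sum>l=1..M. real ?G * (real (n div Q ^ l) + 1))"
      using rho_pos by (simp add: powr_realpow[symmetric] algebra_simps)
    also have "(\<Sum>l=1..M. real ?G * (real (n div Q ^ l) + 1)) = ?G * ((\<Sum>l=1..M. real (n div Q ^ l)) + M)"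
      by (simp add: sum_distrib_left[symmetric] sum.distrib)
    finally have "(\<Prod>l=1..M. rho ^ (?G * (n div Q ^ l + 1))) = rho powr (?G * ((\<Sum>l=1..M. real (n div Q ^ l)) + M))" .
    moreover have "rho powr (?G * (M + n / (Q - 1))) \<le> rho powr (?G * ((\<Sum>l=1..M. real (n div Q ^ l)) + M))"
    proof (rule powr_mono')
      have "(\<Sum>l=1..M. real (n div Q ^ l)) \<le> n / (Q - 1)"
        using sum_div_powers_le[OF Q_ge_2, of n M] Q_ge_2 by (simp add: of_nat_diff)
      then show "?G * ((\<Sum>l=1..M. real (n div Q ^ l)) + M) \<le> ?G * (M + n / (Q - 1))"
        by (intro mult_left_mono) auto
    qed (use rho_pos rho_less in auto)
    ultimately have "s ^ ?G * rho powr (?G * (M + n / (Q - 1))) \<le> s ^ ?G * (\<Prod>l=1..M. rho ^ (?G * (n div Q ^ l + 1)))"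
      using s1 by (intro mult_left_mono) auto
    then show ?thesis
      using main by linarith
  qed
  show ?thesis
  proof (intro exI[of _ "rc bs"] conjI allI impI)
    fix i show "rc bs i \<in> k"
      by (rule rc_in_k[OF bs(2) bsR(1) stable])
    show "u (rc bs i) \<le> 1"
      by (rule u_rc_le[OF bsR])
  next
    fix a assume a: "\<forall>i<?G * n. a i \<in> carrier R \<and> u (a i \<ominus> rc bs i) \<le> \<eta>"
    show "splitted (\<one> # map a (rev [0..<?G * n]))"
    proof (rule splitted_near[OF bs(2) bsR s1 _ \<eta>(1) _ len[symmetric]])
      show "s \<le> u (b \<ominus> b')" if "b \<in> set bs" "b' \<in> set bs" "b \<noteq> b'" for b b'
        using that pt_sep unfolding bs by blast
      show "\<eta> \<le> s / p * (\<Prod>b'\<in>set bs - {b}. u (b \<ominus> b'))" if "b \<in> set bs" for b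
      proof -
        have "s / p * (s ^ ?G * rho powr (?G * (M + n / (Q - 1)))) \<le> s / p * (\<Prod>b'\<in>set bs - {b}. u (b \<ominus> b'))"
          using prod_ge[OF that] s1 by (intro mult_left_mono) auto
        then show ?thesis
          using \<eta>(2) by linarith
      qed
    qed (use a in auto)
  qed
qed

end

section \<open>Asymptotics in the degree\<close>

lemma eventually_log_terms_le:
  assumes "0 < (\<epsilon>::real)"
  shows "eventually (\<lambda>n::nat. A + B * ln (real n + 1) + C * ln (real n) \<le> \<epsilon> * real n) sequentially"
proof -
  have lim: "((\<lambda>n::nat. A * (1 / real n) + B * (ln (real n + 1) / real n) + C * (ln (real n) / real n)) \<longlongrightarrow> A * 0 + B * 0 + C * 0) sequentially"
  proof (intro tendsto_add tendsto_mult tendsto_const)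
    show "(\<lambda>n::nat. 1 / real n) \<longlonglongrightarrow> 0" by real_asymp
    show "(\<lambda>n::nat. ln (real n + 1) / real n) \<longlonglongrightarrow> 0" by real_asymp
    show "(\<lambda>n::nat. ln (real n) / real n) \<longlonglongrightarrow> 0" by real_asymp
  qed
  have "eventually (\<lambda>n::nat. A * (1 / real n) + B * (ln (real n + 1) / real n) + C * (ln (real n) / real n) < \<epsilon>) sequentially"
    by (rule order_tendstoD(2)[OF lim]) (use assms in simp)
  then show ?thesis
    using eventually_gt_at_top[of 0]
  proof eventually_elim
    case (elim n)
    then have "(A * (1 / real n) + B * (ln (real n + 1) / real n) + C * (ln (real n) / real n)) * real n < \<epsilon> * real n"
      by (intro mult_strict_right_mono) auto
    moreover have "(A * (1 / real n) + B * (ln (real n + 1) / real n) + C * (ln (real n) / real n)) * real n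
        = A + B * ln (real n + 1) + C * ln (real n)"
      using elim by (simp add: field_simps)
    ultimately show ?case
      by simp
  qed
qed

context local_extension
begin

text \<open>Rounds the tolerance of \<open>local_polynomial\<close> to a power of \<open>p\<close>.
  The degree is a multiple of \<open>G = card Gal\<close> because roots come as full sets of
  conjugates, and everything besides \<open>n / (ram * (Q - 1))\<close> is logarithmic and goes into
  \<epsilon>.\<close>

theorem local_splitting:
  assumes eps: "0 < \<epsilon>"
  shows "\<exists>G>0. \<exists>n0. \<forall>n\<ge>n0. G dvd n \<longrightarrow> (\<exists>m. \<exists>c. real m \<le> n * (1 / (real ram * (real Q - 1)) + \<epsilon>) \<and>
    (\<forall>i. c i \<in> k \<and> u (c i) \<le> 1) \<and>
    (\<forall>a. (\<forall>i<n. a i \<in> carrier R \<and> u (a i \<ominus> c i) \<le> 1 / real p ^ m) \<longrightarrow> splitted (\<one> # map a (rev [0..<n]))))"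
proof -
  obtain \<theta> where \<theta>: "\<theta> \<in> carrier R" "u \<theta> \<le> 1" "\<theta> \<noteq> \<zero>"
    "\<And>\<tau> \<sigma>. \<tau> \<in> Gal \<Longrightarrow> \<sigma> \<in> Gal \<Longrightarrow> \<tau> \<noteq> \<sigma> \<Longrightarrow> \<tau> \<theta> \<noteq> \<sigma> \<theta>"
    using separating_element by blast
  define D where "D = insert (u \<theta>) ((\<lambda>(\<tau>, \<sigma>). u (\<tau> \<theta> \<ominus> \<sigma> \<theta>)) ` {(\<tau>, \<sigma>). \<tau> \<in> Gal \<and> \<sigma> \<in> Gal \<and> \<tau> \<noteq> \<sigma>})"
  have "finite {(\<tau>, \<sigma>). \<tau> \<in> Gal \<and> \<sigma> \<in> Gal \<and> \<tau> \<noteq> \<sigma>}"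
    by (rule finite_subset[of _ "Gal \<times> Gal"]) (use finite_Gal in auto)
  then have finD: "finite D"
    unfolding D_def by (intro finite.insertI finite_imageI)
  have Dpos: "0 < d" if "d \<in> D" for d
    using that \<theta> Gal_in by (auto simp: D_def r_right_minus_eq intro!: u_pos)
  define \<delta> where "\<delta> = Min D"
  have dD: "\<delta> \<in> D"
    unfolding \<delta>_def by (rule Min_in[OF finD]) (simp add: D_def)
  have dle: "\<delta> \<le> d" if "d \<in> D" for d
    unfolding \<delta>_def by (rule Min_le[OF finD that])
  have \<delta>: "0 < \<delta>" "\<delta> \<le> u \<theta>" "\<forall>\<tau>\<in>Gal. \<forall>\<sigma>\<in>Gal. \<tau> \<noteq> \<sigma> \<longrightarrow> \<delta> \<le> u (\<tau> \<theta> \<ominus> \<sigma> \<theta>)"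
    using Dpos[OF dD] dle by (auto simp: D_def)
  define G where "G = card Gal"
  have G: "0 < G"
    using finite_Gal Gal_id by (auto simp: G_def card_gt_0_iff)
  have lp: "0 < ln (real p)" "1 < real p"
    using p_gt_1 by auto
  \<comment> \<open>The bound for \<open>- ln Y / ln p + 1\<close> sorted by growth:
    \<open>Bc\<close> collects what \<open>M\<close> contributes, through \<open>ln (n + 1)\<close>,
    \<open>Cc\<close> the factor \<open>n\<close> in the denominator of \<open>s\<close>, and
    \<open>Ac\<close> the constants.\<close>
  define Ac where "Ac = 2 + (G + 1) * (- ln \<delta> / ln p + 1 + ln (real G ^ 2) / ln p) + real G"
  define Bc where "Bc = (2 * real G + 1) / ln 2"
  define Cc where "Cc = (real G + 1) / ln p"
  obtain N0 where N0: "\<And>n. n \<ge> N0 \<Longrightarrow> Ac + Bc * ln (real n + 1) + Cc * ln (real n) \<le> (\<epsilon> * G) * real n"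
    using eventually_log_terms_le[of "\<epsilon> * G" Ac Bc Cc] eps G by (auto simp: eventually_sequentially)
  have "\<exists>m c. real m \<le> N * (1 / (real ram * (real Q - 1)) + \<epsilon>) \<and> (\<forall>i. c i \<in> k \<and> u (c i) \<le> 1) \<and>
    (\<forall>a. (\<forall>i<N. a i \<in> carrier R \<and> u (a i \<ominus> c i) \<le> 1 / real p ^ m) \<longrightarrow> splitted (\<one> # map a (rev [0..<N])))"
    if N: "N \<ge> G * Suc N0" "G dvd N" for N
  proof -
    obtain n where n: "N = G * n"
      using N by blast
    have nN: "n \<ge> Suc N0"
      using N(1) G unfolding n by (simp only: mult_le_cancel1)
    \<comment> \<open>Chosen so that \<open>2 ^ M\<close>, and therefore \<open>Q ^ M\<close>,
      exceeds \<open>n\<close>; the number of levels stays logarithmic.\<close>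
    define M where "M = nat \<lceil>log 2 (real n + 1)\<rceil>"
    have M1: "log 2 (real n + 1) \<le> M" and M2: "real M \<le> log 2 (real n + 1) + 1"
    proof -
      have "0 \<le> log 2 (real n + 1)"
        by simp
      then have "real M = of_int \<lceil>log 2 (real n + 1)\<rceil>"
        by (simp add: M_def)
      then show "log 2 (real n + 1) \<le> M" "real M \<le> log 2 (real n + 1) + 1"
        by linarith+
    qed
    have "real n + 1 \<le> 2 powr M"
      using M1 by (simp add: log_le_iff)
    then have "real (n + 1) \<le> real (2 ^ M)"
      by (simp add: powr_realpow)
    then have "n < 2 ^ M"
      by linarith
    also have "2 ^ M \<le> Q ^ M"
      using Q_ge_2 by (intro power_mono) auto
    finally have nQ: "n < Q ^ M" .
    define s where "s = \<delta> / (real p ^ M * real (G ^ 2 * n))"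
    have s: "0 < s"
      using \<delta> lp G nN by (simp add: s_def)
    define Y where "Y = s / p * (s ^ G * rho powr (G * (M + n / (Q - 1))))"
    have Y: "0 < Y"
      using s lp rho_pos by (simp add: Y_def)
    \<comment> \<open>The least natural exponent with \<open>1 / p ^ m\<close> at most
      \<open>Y\<close>. A negative exponent is truncated to zero, whence the maximum with
      \<open>0\<close> in the upper estimate.\<close>
    define m where "m = nat \<lceil>- ln Y / ln p\<rceil>"
    have m1: "- ln Y / ln p \<le> m" and m2: "real m \<le> max 0 (- ln Y / ln p + 1)"
      unfolding m_def by linarith+
    have "1 / real p ^ m \<le> Y"
    proof -
      have "(- ln Y / ln p) * ln p \<le> m * ln p"
        using m1 lp by (intro mult_right_mono) auto
      then have "- ln Y \<le> m * ln p"
        using lp by simp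
      then have "ln (1 / real p ^ m) \<le> ln Y"
        using lp by (simp add: ln_div ln_realpow)
      then show ?thesis
        using Y lp by (subst (asm) ln_le_cancel_iff) auto
    qed
    then obtain c where c: "\<forall>i. c i \<in> k \<and> u (c i) \<le> 1"
      "\<forall>a. (\<forall>i<G * n. a i \<in> carrier R \<and> u (a i \<ominus> c i) \<le> 1 / real p ^ m) \<longrightarrow> splitted (\<one> # map a (rev [0..<G * n]))"
    proof -
      have "0 < n" "0 \<le> 1 / real p ^ m"
        using nN by auto
      then show thesis
        using local_polynomial[OF \<theta>(1,2) \<delta> _ nQ s_def[unfolded G_def], of "1 / real p ^ m"]
          \<open>1 / real p ^ m \<le> Y\<close> that unfolding Y_def G_def by blast
    qed
    have lrho: "ln rho = - ln p / ram"
    proof -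
      have "ln (1 / real p) = ln (rho ^ ram)"
        using ram(1) by simp
      then have "- ln p = ram * ln rho"
        using lp rho_pos by (simp add: ln_div ln_realpow)
      then show ?thesis
        using ram(2) by (simp add: field_simps)
    qed
    have ls: "ln s = ln \<delta> - M * ln p - ln (real G ^ 2) - ln n"
      unfolding s_def using \<delta> lp G nN by (simp add: ln_div ln_mult ln_realpow)
    have "ln Y = ln s - ln p + G * ln s + G * (M + n / (Q - 1)) * ln rho"
      unfolding Y_def using s lp rho_pos by (simp add: ln_mult ln_div ln_realpow ln_powr)
    then have "- ln Y / ln p = 1 + (G + 1) * (- ln s / ln p) + G * (M + n / (Q - 1)) / ram"
      unfolding lrho using lp by (simp add: field_simps)
    also have "- ln s / ln p = - ln \<delta> / ln p + M + ln (real G ^ 2) / ln p + ln n / ln p"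
      unfolding ls using lp by (simp add: field_simps)
    finally have lY: "- ln Y / ln p = 1 + (G + 1) * (- ln \<delta> / ln p + M + ln (real G ^ 2) / ln p + ln n / ln p)
        + G * (M + n / (Q - 1)) / ram" .
    have "real G * M / ram \<le> real G * M / 1"
      using ram(2) by (intro divide_left_mono) auto
    then have GM: "real G * M / ram \<le> G * M"
      by simp
    have "- ln Y / ln p + 1 \<le> 2 + (G + 1) * (- ln \<delta> / ln p + M + ln (real G ^ 2) / ln p + ln n / ln p) + G * M + G * (n / (Q - 1)) / ram"
      unfolding lY using GM by (simp add: distrib_left add_divide_distrib)
    also have "\<dots> = 2 + (G + 1) * (- ln \<delta> / ln p + ln (real G ^ 2) / ln p + ln n / ln p) + (2 * G + 1) * real M + G * (n / (Q - 1)) / ram"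
      by (simp add: algebra_simps)
    also have "\<dots> \<le> 2 + (G + 1) * (- ln \<delta> / ln p + ln (real G ^ 2) / ln p + ln n / ln p) + (2 * G + 1) * (log 2 (real n + 1) + 1) + G * (n / (Q - 1)) / ram"
      using M2 by (intro add_mono mult_left_mono order_refl) auto
    also have "\<dots> = Ac + Bc * ln (real n + 1) + Cc * ln (real n) + G * (n / (Q - 1)) / ram"
    proof -
      have id: "2 + (g + 1) * (a + b + x / l) + (2 * g + 1) * (y / l2 + 1) + z
          = 2 + (g + 1) * (a + 1 + b) + g + (2 * g + 1) / l2 * y + (g + 1) / l * x + z" for g a b x l y l2 z :: real
        by (simp add: algebra_simps add_divide_distrib)
      show ?thesis
        unfolding Ac_def Bc_def Cc_def log_def of_nat_add of_nat_mult of_nat_1 of_nat_numeral by (rule id)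
    qed
    also have "\<dots> \<le> (\<epsilon> * G) * real n + G * (n / (Q - 1)) / ram"
      using N0[of n] nN by simp
    also have "\<dots> = N * (1 / (real ram * (real Q - 1)) + \<epsilon>)"
      using Q_ge_2 by (simp add: n of_nat_diff algebra_simps)
    finally have "- ln Y / ln p + 1 \<le> N * (1 / (real ram * (real Q - 1)) + \<epsilon>)" .
    moreover have "0 \<le> N * (1 / (real ram * (real Q - 1)) + \<epsilon>)"
      using Q_ge_2 eps by (intro mult_nonneg_nonneg add_nonneg_nonneg) auto
    ultimately have "real m \<le> N * (1 / (real ram * (real Q - 1)) + \<epsilon>)"
      using m2 by linarith
    then show ?thesis
      using c unfolding n by blast
  qed
  then show ?thesis
    using G by blast
qed

end

context padic_galois
begin

sublocale X: local_extension L u p k0L kL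
  by (intro local_extension.intro local_extension_axioms.intro Q.padic_field_axioms
      kL k0L_subset complete_kL fin_dim_kL galois)

text \<open>The target coefficients lie in the image of K_v; density of \<open>F\<close> in its
  completion moves them into \<open>F\<close> at the same precision, since an ultrametric distance
  does not grow when two errors are combined.\<close>

theorem split_approximations:
  assumes eps: "0 < \<epsilon>"
  shows "\<exists>G>0. \<exists>n0. \<forall>n\<ge>n0. G dvd n \<longrightarrow> (\<exists>m. \<exists>b.
    real m \<le> n * (1 / (real ram_index * (real (residue_order F w) ^ in_deg - 1)) + \<epsilon>) \<and>
    (\<forall>i. b i \<in> F \<and> w (b i) \<le> 1) \<and>
    (\<forall>a. (\<forall>i<n. a i \<in> F \<and> w (a i - b i) \<le> 1 / real p ^ m) \<longrightarrow>
      ring.splitted L (map (\<lambda>a. \<iota> (emb a)) (1 # map a (rev [0..<n])))))"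
proof -
  obtain G n0 where G: "0 < G" and n0: "\<And>n. n \<ge> n0 \<Longrightarrow> G dvd n \<Longrightarrow>
    (\<exists>m c. real m \<le> n * (1 / (real Q.ram * (real Q.Q - 1)) + \<epsilon>) \<and> (\<forall>i. c i \<in> kL \<and> u (c i) \<le> 1) \<and>
    (\<forall>a. (\<forall>i<n. a i \<in> carrier L \<and> u (a i \<ominus>\<^bsub>L\<^esub> c i) \<le> 1 / real p ^ m) \<longrightarrow> L.splitted (\<one>\<^bsub>L\<^esub> # map a (rev [0..<n]))))"
    using X.local_splitting[OF eps] by blast
  have QQ: "real Q.Q = real (residue_order F w) ^ in_deg"
    using card_Res by (simp add: Q.Q_def)
  \<comment> \<open>The relative ramification index is at most the one over the p-adic numbers, and
    the residue field of \<open>L\<close> has \<open>residue_order F w ^ in_deg\<close>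
    elements.\<close>
  have le: "1 / (real Q.ram * (real Q.Q - 1)) \<le> 1 / (real ram_index * (real (residue_order F w) ^ in_deg - 1))"
  proof (rule divide_left_mono)
    show "real ram_index * (real (residue_order F w) ^ in_deg - 1) \<le> real Q.ram * (real Q.Q - 1)"
      unfolding QQ[symmetric] using ram_index Q.Q_ge_2 by (intro mult_right_mono) auto
    show "0 < real Q.ram * (real Q.Q - 1) * (real ram_index * (real (residue_order F w) ^ in_deg - 1))"
      unfolding QQ[symmetric] using ram_index Q.Q_ge_2 Q.ram(2) by (intro mult_pos_pos) auto
  qed simp
  have "\<exists>m b. real m \<le> n * (1 / (real ram_index * (real (residue_order F w) ^ in_deg - 1)) + \<epsilon>) \<and>
    (\<forall>i. b i \<in> F \<and> w (b i) \<le> 1) \<and>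
    (\<forall>a. (\<forall>i<n. a i \<in> F \<and> w (a i - b i) \<le> 1 / real p ^ m) \<longrightarrow>
      ring.splitted L (map (\<lambda>a. \<iota> (emb a)) (1 # map a (rev [0..<n]))))" if n: "n \<ge> n0" "G dvd n" for n
  proof -
    obtain m c where m: "real m \<le> n * (1 / (real Q.ram * (real Q.Q - 1)) + \<epsilon>)"
      and c: "\<And>i. c i \<in> kL" "\<And>i. u (c i) \<le> 1"
      and spl: "\<And>a. (\<forall>i<n. a i \<in> carrier L \<and> u (a i \<ominus>\<^bsub>L\<^esub> c i) \<le> 1 / real p ^ m) \<Longrightarrow> L.splitted (\<one>\<^bsub>L\<^esub> # map a (rev [0..<n]))"
      using n0[OF n] by blast
    have pm: "0 < 1 / real p ^ m" "1 / real p ^ m \<le> 1"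
      using p_gt_1 by (auto simp: divide_le_eq)
    have "\<exists>b. b \<in> F \<and> w b \<le> 1 \<and> u (\<iota> (emb b) \<ominus>\<^bsub>L\<^esub> c i) \<le> 1 / real p ^ m" for i
    proof -
      obtain x where x: "x \<in> carrier E" "c i = \<iota> x"
        using c(1)[of i] by (auto simp: kL_def)
      obtain b where b: "b \<in> F" "cabs (x \<ominus>\<^bsub>E\<^esub> emb b) < 1 / real p ^ m"
        using clos_approx[of x F, OF _ pm(1)] x by (auto simp: clos_F)
      have "w b \<le> max (cabs x) (cabs (x \<ominus>\<^bsub>E\<^esub> emb b))"
        using E.u_le_of_close[OF x(1), of "emb b"] b by (simp add: cabs_emb)
      moreover have "cabs x \<le> 1"
        using c(2)[of i] x by (simp add: u_\<iota>)
      ultimately have "w b \<le> 1"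
        using b pm by linarith
      moreover have "u (\<iota> (emb b) \<ominus>\<^bsub>L\<^esub> c i) = cabs (x \<ominus>\<^bsub>E\<^esub> emb b)"
        using x b by (simp add: u_\<iota>_minus E.u_minus_commute)
      ultimately show ?thesis
        using b by auto
    qed
    then obtain b where b: "\<And>i. b i \<in> F" "\<And>i. w (b i) \<le> 1" "\<And>i. u (\<iota> (emb (b i)) \<ominus>\<^bsub>L\<^esub> c i) \<le> 1 / real p ^ m"
      by metis
    have "L.splitted (map (\<lambda>a. \<iota> (emb a)) (1 # map a (rev [0..<n])))"
      if a: "\<forall>i<n. a i \<in> F \<and> w (a i - b i) \<le> 1 / real p ^ m" for a
    proof -
      have cc: "c i \<in> carrier L" for i
        using c(1) subfieldE(3)[OF kL] by blast
      have "L.splitted (\<one>\<^bsub>L\<^esub> # map (\<lambda>i. \<iota> (emb (a i))) (rev [0..<n]))"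
      proof (rule spl, intro allI impI conjI)
        fix i assume i: "i < n"
        have ai: "a i \<in> F" "w (a i - b i) \<le> 1 / real p ^ m"
          using a i by auto
        show "\<iota> (emb (a i)) \<in> carrier L"
          using ai by simp
        have "u (\<iota> (emb (a i)) \<ominus>\<^bsub>L\<^esub> c i) \<le> max (u (\<iota> (emb (a i)) \<ominus>\<^bsub>L\<^esub> \<iota> (emb (b i)))) (u (\<iota> (emb (b i)) \<ominus>\<^bsub>L\<^esub> c i))"
          using ai b cc by (intro L.u_triangle_max) auto
        also have "u (\<iota> (emb (a i)) \<ominus>\<^bsub>L\<^esub> \<iota> (emb (b i))) = w (a i - b i)"
          using ai b by (simp add: u_\<iota>_minus emb_minus cabs_emb)
        finally show "u (\<iota> (emb (a i)) \<ominus>\<^bsub>L\<^esub> c i) \<le> 1 / real p ^ m"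
          using ai b(3)[of i] by linarith
      qed
      then show ?thesis
        by (simp add: comp_def)
    qed
    moreover have "real m \<le> n * (1 / (real ram_index * (real (residue_order F w) ^ in_deg - 1)) + \<epsilon>)"
      using m mult_left_mono[OF le, of "real n"] by (simp add: distrib_left)
    ultimately show ?thesis
      using b by blast
  qed
  then show ?thesis
    using G by blast
qed

end

section \<open>Archimedean places\<close>

definition rat_polys :: "real poly set" where
  "rat_polys = {q. \<forall>i. coeff q i \<in> \<rat>}"

definition ev :: "real poly \<Rightarrow> complex \<Rightarrow> complex" where
  "ev q z = poly (map_poly of_real q) z"

lemma ev_0 [simp]: "ev 0 z = 0"
  by (simp add: ev_def)

lemma ev_pCons [simp]: "ev (pCons c q) z = of_real c + z * ev q z"
  by (cases "pCons c q = 0") (simp_all add: ev_def map_poly_pCons)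

lemma ev_add: "ev (p + q) z = ev p z + ev q z"
  by (induction p q rule: poly_induct2) (simp_all add: algebra_simps)

lemma ev_smult: "ev (smult c q) z = of_real c * ev q z"
  by (induction q) (simp_all add: algebra_simps)

lemma ev_mult: "ev (p * q) z = ev p z * ev q z"
  by (induction p) (simp_all add: ev_add ev_smult algebra_simps)

lemma ev_uminus: "ev (- q) z = - ev q z"
proof -
  have "ev q z + ev (- q) z = 0"
    unfolding ev_add[symmetric] by simp
  then show ?thesis
    by (rule minus_unique[symmetric])
qed

lemma ev_minus: "ev (p - q) z = ev p z - ev q z"
  by (simp only: diff_conv_add_uminus ev_add ev_uminus)

lemma ev_1 [simp]: "ev 1 z = 1"
  unfolding one_pCons ev_pCons by simp

lemma ev_power: "ev (q ^ n) z = ev q z ^ n"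
  by (induction n) (simp_all add: ev_mult)

lemma ev_cnj: "ev q (cnj z) = cnj (ev q z)"
  by (induction q) simp_all

lemma rat_polys_pCons [simp]: "pCons c q \<in> rat_polys \<longleftrightarrow> c \<in> \<rat> \<and> q \<in> rat_polys"
  unfolding rat_polys_def by (auto simp: coeff_pCons split: nat.splits)

lemma rat_polys_0 [simp]: "0 \<in> rat_polys"
  by (simp add: rat_polys_def)

lemma rat_polys_add: "p \<in> rat_polys \<Longrightarrow> q \<in> rat_polys \<Longrightarrow> p + q \<in> rat_polys"
  and rat_polys_minus: "p \<in> rat_polys \<Longrightarrow> q \<in> rat_polys \<Longrightarrow> p - q \<in> rat_polys"
  and rat_polys_mult: "p \<in> rat_polys \<Longrightarrow> q \<in> rat_polys \<Longrightarrow> p * q \<in> rat_polys"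
  by (auto simp: rat_polys_def coeff_mult intro!: Rats_sum)

text \<open>A submultiplicative weighted sum norm. With \<open>a = w \<alpha>\<close> it dominates
  the value of \<open>q\<close> at \<alpha>; with \<open>a = 1\<close> it serves later as a
  coefficient norm for Mahler measures.\<close>

definition wnorm :: "real \<Rightarrow> real poly \<Rightarrow> real" where
  "wnorm a q = (\<Sum>i\<le>degree q. \<bar>coeff q i\<bar> * a ^ i)"

lemma wnorm_0 [simp]: "wnorm a 0 = 0"
  by (simp add: wnorm_def)

lemma wnorm_pCons [simp]: "wnorm a (pCons c q) = \<bar>c\<bar> + a * wnorm a q"
proof (cases "q = 0")
  case False
  then show ?thesis
    by (simp add: wnorm_def sum.atMost_Suc_shift sum_distrib_left mult_ac del: sum.atMost_Suc)
qed (simp add: wnorm_def)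

lemma wnorm_nonneg: "0 \<le> a \<Longrightarrow> 0 \<le> wnorm a q"
  by (simp add: wnorm_def sum_nonneg)

lemma wnorm_uminus: "wnorm a (- q) = wnorm a q"
  by (simp add: wnorm_def)

lemma wnorm_add: "0 \<le> a \<Longrightarrow> wnorm a (p + q) \<le> wnorm a p + wnorm a q"
proof (induction p q rule: poly_induct2)
  case (pCons c p d q)
  have "a * wnorm a (p + q) \<le> a * (wnorm a p + wnorm a q)"
    using pCons by (intro mult_left_mono) auto
  then show ?case
    by (simp add: algebra_simps)
qed simp

lemma wnorm_minus: "0 \<le> a \<Longrightarrow> wnorm a (p - q) \<le> wnorm a p + wnorm a q"
  using wnorm_add[of a p "- q"] by (simp add: wnorm_uminus)

lemma wnorm_minus_commute: "wnorm a (p - q) = wnorm a (q - p)"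
  using wnorm_uminus[of a "p - q"] by simp

lemma wnorm_smult: "wnorm a (smult c q) = \<bar>c\<bar> * wnorm a q"
  by (induction q) (simp_all add: abs_mult algebra_simps)

lemma wnorm_mult: "0 \<le> a \<Longrightarrow> wnorm a (p * q) \<le> wnorm a p * wnorm a q"
proof (induction p)
  case (pCons c p)
  have "wnorm a (pCons c p * q) \<le> wnorm a (smult c q) + wnorm a (pCons 0 (p * q))"
    using wnorm_add[OF \<open>0 \<le> a\<close>, of "smult c q" "pCons 0 (p * q)"] by simp
  also have "\<dots> \<le> \<bar>c\<bar> * wnorm a q + a * (wnorm a p * wnorm a q)"
    using pCons by (simp add: wnorm_smult mult_left_mono)
  finally show ?case
    by (simp add: algebra_simps)
qed simp

lemma rat_polys_dense: "0 \<le> a \<Longrightarrow> 0 < e \<Longrightarrow> \<exists>r\<in>rat_polys. wnorm a (q - r) < e"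
proof (induction q arbitrary: e)
  case 0
  then show ?case
    by (intro bexI[of _ 0]) auto
next
  case (pCons c q)
  obtain r where r: "r \<in> rat_polys" "wnorm a (q - r) < e / (2 * (a + 1))"
    using pCons.IH[of "e / (2 * (a + 1))"] pCons.prems by auto
  obtain d where d: "d \<in> \<rat>" "c < d" "d < c + e / 2"
    using Rats_dense_in_real[of c "c + e / 2"] pCons.prems by auto
  have "a * wnorm a (q - r) \<le> (a + 1) * wnorm a (q - r)"
    using pCons.prems wnorm_nonneg by (intro mult_right_mono) auto
  also have "\<dots> < e / 2"
    using r(2) pCons.prems by (simp add: less_divide_eq algebra_simps)
  finally have "wnorm a (pCons c q - pCons d r) < e"
    using d by simp
  then show ?case
    using r d by (intro bexI[of _ "pCons d r"]) auto
qed

text \<open>The real polynomial with roots \<open>z\<close> and \<open>cnj z\<close>; for real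
  \<open>z\<close> it is the square of a linear factor, so both cases can be treated
  uniformly.\<close>

definition quad :: "complex \<Rightarrow> real poly" where
  "quad z = [:(cmod z)\<^sup>2, - 2 * Re z, 1:]"

lemma quad_eq: "quad z = [:Re z * Re z + Im z * Im z, - 2 * Re z, 1:]"
  unfolding quad_def cmod_power2 by (simp add: power2_eq_square)

lemma degree_quad: "degree (quad z) = 2"
  by (simp add: quad_def)

lemma quad_real: "Im z = 0 \<Longrightarrow> quad z = [:- Re z, 1:] * [:- Re z, 1:]"
  by (simp add: quad_eq)

lemma ev_quad: "ev (quad z) z = 0"
  by (simp add: quad_eq complex_eq_iff algebra_simps)

lemma of_real_of_rat: "complex_of_real (of_rat r) = of_rat r"
  by (cases r) (simp add: of_rat_rat)

lemma ev_real: "Im z = 0 \<Longrightarrow> ev q z = of_real (poly q (Re z))"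
proof -
  assume "Im z = 0"
  then have "z = of_real (Re z)"
    by (simp add: complex_eq_iff)
  then have "ev q z = ev q (of_real (Re z))"
    by simp
  also have "\<dots> = of_real (poly q (Re z))"
    by (induction q) auto
  finally show ?thesis .
qed

lemma quad_dvd:
  assumes "ev q z = 0" "Im z \<noteq> 0"
  shows "quad z dvd q"
proof -
  have deg: "degree (q mod quad z) < 2"
    using degree_mod_less[of "quad z" q] degree_quad[of z] by fastforce
  define c d where "c = coeff (q mod quad z) 0" and "d = coeff (q mod quad z) 1"
  have r: "q mod quad z = [:c, d:]"
    using deg by (intro poly_eqI) (auto simp: c_def d_def coeff_pCons coeff_eq_0 split: nat.splits)
  have "q = q div quad z * quad z + [:c, d:]"
    using div_mult_mod_eq[of q "quad z"] r by simp
  then have "ev q z = ev (q div quad z) z * ev (quad z) z + ev [:c, d:] z"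
    by (metis ev_add ev_mult)
  then have "of_real c + z * of_real d = 0"
    using assms ev_quad by simp
  then have "d = 0" "c = 0"
    using assms(2) by (auto simp: complex_eq_iff)
  then show ?thesis
    using r by (simp add: mod_eq_0_iff_dvd)
qed

section \<open>Archimedean absolute values come from complex roots\<close>

locale archimedean_subfield = valued_subfield +
  fixes \<alpha> :: complex
  assumes \<alpha>: "\<alpha> \<in> F" and w_rat: "\<And>r. w (of_rat r) = \<bar>of_rat r\<bar>"
begin

lemma ev_F: "q \<in> rat_polys \<Longrightarrow> ev q \<alpha> \<in> F"
proof (induction q)
  case (pCons c q)
  then obtain r where "c = of_rat r"
    by (auto elim: Rats_cases)
  then have "complex_of_real c = of_rat r"
    by (simp add: of_real_of_rat)
  then show ?case
    using pCons \<alpha> by simp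
qed simp

lemma w_real_rat: "c \<in> \<rat> \<Longrightarrow> w (of_real c) = \<bar>c\<bar>"
  by (elim Rats_cases) (simp add: w_rat of_real_of_rat)

lemma real_rat_F: "c \<in> \<rat> \<Longrightarrow> complex_of_real c \<in> F"
  by (elim Rats_cases) (simp add: of_real_of_rat)

lemma w_ev_le: "q \<in> rat_polys \<Longrightarrow> w (ev q \<alpha>) \<le> wnorm (w \<alpha>) q"
proof (induction q)
  case (pCons c q)
  have "w (ev (pCons c q) \<alpha>) \<le> w (of_real c) + w \<alpha> * w (ev q \<alpha>)"
    using w_add[of "of_real c" "\<alpha> * ev q \<alpha>"] pCons.prems ev_F \<alpha> real_rat_F by (simp add: w_mult)
  also have "\<dots> \<le> \<bar>c\<bar> + w \<alpha> * wnorm (w \<alpha>) q"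
    using pCons \<alpha> w_nonneg by (auto simp: w_real_rat intro!: mult_left_mono)
  finally show ?case
    by simp
qed simp

lemma w_ev_diff: "p \<in> rat_polys \<Longrightarrow> q \<in> rat_polys \<Longrightarrow> w (ev p \<alpha>) - w (ev q \<alpha>) \<le> wnorm (w \<alpha>) (p - q)"
  using w_diff_ge[OF ev_F ev_F, of p q] w_ev_le[OF rat_polys_minus, of p q] by (simp add: ev_minus)

text \<open>The absolute value extends by continuity to a multiplicative seminorm \<open>W\<close> on real polynomials.\<close>

lemma seminorm_ex: "\<exists>x. \<forall>r\<in>rat_polys. \<bar>x - w (ev r \<alpha>)\<bar> \<le> wnorm (w \<alpha>) (q - r)"
proof -
  have a: "0 \<le> w \<alpha>"
    using \<alpha> w_nonneg by blast
  have le: "w (ev r \<alpha>) - wnorm (w \<alpha>) (q - r) \<le> w (ev s \<alpha>) + wnorm (w \<alpha>) (q - s)"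
    if "r \<in> rat_polys" "s \<in> rat_polys" for r s
    using w_ev_diff[OF that] wnorm_add[OF a, of "r - q" "q - s"] wnorm_minus_commute[of "w \<alpha>" r q] by simp
  \<comment> \<open>Each rational polynomial \<open>r\<close> confines the desired value to an
    interval around \<open>w (ev r \<alpha>)\<close>. By \<open>le\<close> every left end lies below
    every right end, so the supremum of the left ends lies in all intervals.\<close>
  define x where "x = (SUP r\<in>rat_polys. w (ev r \<alpha>) - wnorm (w \<alpha>) (q - r))"
  have bdd: "bdd_above ((\<lambda>r. w (ev r \<alpha>) - wnorm (w \<alpha>) (q - r)) ` rat_polys)"
    using le[OF _ rat_polys_0] by (intro bdd_aboveI2)
  have "\<bar>x - w (ev r \<alpha>)\<bar> \<le> wnorm (w \<alpha>) (q - r)" if "r \<in> rat_polys" for r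
  proof -
    have "w (ev r \<alpha>) - wnorm (w \<alpha>) (q - r) \<le> x"
      unfolding x_def by (rule cSUP_upper[OF that bdd])
    moreover have "x \<le> w (ev r \<alpha>) + wnorm (w \<alpha>) (q - r)"
      unfolding x_def by (rule cSUP_least) (use le[OF _ that] rat_polys_0 in blast)+
    ultimately show ?thesis
      by (simp add: abs_le_iff)
  qed
  then show ?thesis
    by blast
qed

definition W :: "real poly \<Rightarrow> real" where
  "W q = (SOME x. \<forall>r\<in>rat_polys. \<bar>x - w (ev r \<alpha>)\<bar> \<le> wnorm (w \<alpha>) (q - r))"

lemma W: "r \<in> rat_polys \<Longrightarrow> \<bar>W q - w (ev r \<alpha>)\<bar> \<le> wnorm (w \<alpha>) (q - r)"
  unfolding W_def using someI_ex[OF seminorm_ex[of q]] by blast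

lemma W_rat: "r \<in> rat_polys \<Longrightarrow> W r = w (ev r \<alpha>)"
  using W[of r r] by simp

lemma W_approx: "\<exists>r. (\<forall>n. r n \<in> rat_polys) \<and> (\<lambda>n. wnorm (w \<alpha>) (q - r n)) \<longlonglongrightarrow> 0 \<and>
  (\<lambda>n. w (ev (r n) \<alpha>)) \<longlonglongrightarrow> W q"
proof -
  have a: "0 \<le> w \<alpha>"
    using \<alpha> w_nonneg by blast
  have "\<exists>r\<in>rat_polys. wnorm (w \<alpha>) (q - r) < inverse (Suc n)" for n
    using rat_polys_dense[OF a, of "inverse (Suc n)"] by simp
  then obtain r where r: "\<And>n. r n \<in> rat_polys" "\<And>n. wnorm (w \<alpha>) (q - r n) < inverse (Suc n)"
    by metis
  have lim: "(\<lambda>n. wnorm (w \<alpha>) (q - r n)) \<longlonglongrightarrow> 0"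
  proof (rule tendsto_sandwich[of "\<lambda>n. 0" _ _ "\<lambda>n. inverse (real (Suc n))"])
    show "(\<lambda>n. inverse (real (Suc n))) \<longlonglongrightarrow> 0"
      by (rule LIMSEQ_inverse_real_of_nat)
  qed (use r wnorm_nonneg[OF a] in \<open>auto intro!: always_eventually less_imp_le\<close>)
  have "(\<lambda>n. w (ev (r n) \<alpha>) - W q) \<longlonglongrightarrow> 0"
  proof (rule tendsto_rabs_zero_cancel, rule tendsto_sandwich[OF _ _ tendsto_const lim])
    show "\<forall>\<^sub>F n in sequentially. \<bar>w (ev (r n) \<alpha>) - W q\<bar> \<le> wnorm (w \<alpha>) (q - r n)"
      using W[OF r(1), of q] by (simp add: abs_minus_commute)
  qed auto
  then have "(\<lambda>n. w (ev (r n) \<alpha>)) \<longlonglongrightarrow> W q"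
    by (simp add: LIM_zero_iff)
  then show ?thesis
    using r lim by blast
qed

lemma W_limit:
  assumes "\<And>n. r n \<in> rat_polys" "(\<lambda>n. wnorm (w \<alpha>) (q - r n)) \<longlonglongrightarrow> 0"
  shows "(\<lambda>n. w (ev (r n) \<alpha>)) \<longlonglongrightarrow> W q"
proof -
  have "(\<lambda>n. w (ev (r n) \<alpha>) - W q) \<longlonglongrightarrow> 0"
  proof (rule tendsto_rabs_zero_cancel, rule tendsto_sandwich[OF _ _ tendsto_const assms(2)])
    show "\<forall>\<^sub>F n in sequentially. \<bar>w (ev (r n) \<alpha>) - W q\<bar> \<le> wnorm (w \<alpha>) (q - r n)"
      using W[OF assms(1), of q] by (simp add: abs_minus_commute)
  qed auto
  then show ?thesis
    by (simp add: LIM_zero_iff)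
qed

lemma W_nonneg: "0 \<le> W q"
proof -
  obtain r where "\<forall>n. r n \<in> rat_polys" "(\<lambda>n. w (ev (r n) \<alpha>)) \<longlonglongrightarrow> W q"
    using W_approx by blast
  then show ?thesis
    using ev_F w_nonneg by (intro LIMSEQ_le_const) auto
qed

lemma W_add: "W (p + q) \<le> W p + W q"
  and W_mult: "W (p * q) = W p * W q"
proof -
  have a: "0 \<le> w \<alpha>"
    using \<alpha> w_nonneg by blast
  obtain r where r: "\<And>n. r n \<in> rat_polys" "(\<lambda>n. wnorm (w \<alpha>) (p - r n)) \<longlonglongrightarrow> 0" "(\<lambda>n. w (ev (r n) \<alpha>)) \<longlonglongrightarrow> W p"
    using W_approx[of p] by blast
  obtain s where s: "\<And>n. s n \<in> rat_polys" "(\<lambda>n. wnorm (w \<alpha>) (q - s n)) \<longlonglongrightarrow> 0" "(\<lambda>n. w (ev (s n) \<alpha>)) \<longlonglongrightarrow> W q"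
    using W_approx[of q] by blast
  have "(\<lambda>n. w (ev (r n + s n) \<alpha>)) \<longlonglongrightarrow> W (p + q)"
  proof (rule W_limit)
    have "(\<lambda>n. wnorm (w \<alpha>) (p - r n) + wnorm (w \<alpha>) (q - s n)) \<longlonglongrightarrow> 0 + 0"
      by (intro tendsto_add r s)
    then show "(\<lambda>n. wnorm (w \<alpha>) (p + q - (r n + s n))) \<longlonglongrightarrow> 0"
    proof (intro tendsto_sandwich[of "\<lambda>n. 0" "\<lambda>n. wnorm (w \<alpha>) (p + q - (r n + s n))" _ "\<lambda>n. wnorm (w \<alpha>) (p - r n) + wnorm (w \<alpha>) (q - s n)"] always_eventually allI)
      show "wnorm (w \<alpha>) (p + q - (r n + s n)) \<le> wnorm (w \<alpha>) (p - r n) + wnorm (w \<alpha>) (q - s n)" for n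
        using wnorm_add[OF a, of "p - r n" "q - s n"] by (simp add: algebra_simps)
    qed (use wnorm_nonneg[OF a] in auto)
  qed (use r s rat_polys_add in auto)
  moreover have "(\<lambda>n. w (ev (r n) \<alpha>) + w (ev (s n) \<alpha>)) \<longlonglongrightarrow> W p + W q"
    by (intro tendsto_add r s)
  ultimately show "W (p + q) \<le> W p + W q"
    by (rule LIMSEQ_le) (use ev_F[OF r(1)] ev_F[OF s(1)] w_add in \<open>auto simp: ev_add\<close>)
  have "(\<lambda>n. w (ev (r n * s n) \<alpha>)) \<longlonglongrightarrow> W (p * q)"
  proof (rule W_limit)
    have "(\<lambda>n. wnorm (w \<alpha>) (p - r n) * (wnorm (w \<alpha>) q + wnorm (w \<alpha>) (q - s n)) + wnorm (w \<alpha>) p * wnorm (w \<alpha>) (q - s n))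
        \<longlonglongrightarrow> 0 * (wnorm (w \<alpha>) q + 0) + wnorm (w \<alpha>) p * 0"
      by (intro tendsto_intros r s)
    then show "(\<lambda>n. wnorm (w \<alpha>) (p * q - r n * s n)) \<longlonglongrightarrow> 0"
    proof (intro tendsto_sandwich[of "\<lambda>n. 0" "\<lambda>n. wnorm (w \<alpha>) (p * q - r n * s n)" _ "\<lambda>n. wnorm (w \<alpha>) (p - r n) * (wnorm (w \<alpha>) q + wnorm (w \<alpha>) (q - s n)) + wnorm (w \<alpha>) p * wnorm (w \<alpha>) (q - s n)"] always_eventually allI)
      fix n
      have "p * q - r n * s n = (p - r n) * (q - (q - s n)) + p * (q - s n)"
        by (simp add: algebra_simps)
      then have "wnorm (w \<alpha>) (p * q - r n * s n) \<le> wnorm (w \<alpha>) ((p - r n) * (q - (q - s n))) + wnorm (w \<alpha>) (p * (q - s n))"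
        using wnorm_add[OF a] by metis
      also have "\<dots> \<le> wnorm (w \<alpha>) (p - r n) * wnorm (w \<alpha>) (q - (q - s n)) + wnorm (w \<alpha>) p * wnorm (w \<alpha>) (q - s n)"
        by (intro add_mono wnorm_mult a)
      also have "\<dots> \<le> wnorm (w \<alpha>) (p - r n) * (wnorm (w \<alpha>) q + wnorm (w \<alpha>) (q - s n)) + wnorm (w \<alpha>) p * wnorm (w \<alpha>) (q - s n)"
        by (intro add_mono mult_left_mono wnorm_minus wnorm_nonneg a order_refl)
      finally show "wnorm (w \<alpha>) (p * q - r n * s n) \<le> wnorm (w \<alpha>) (p - r n) * (wnorm (w \<alpha>) q + wnorm (w \<alpha>) (q - s n)) + wnorm (w \<alpha>) p * wnorm (w \<alpha>) (q - s n)" .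
    qed (use wnorm_nonneg[OF a] in auto)
  qed (use r s rat_polys_mult in auto)
  moreover have "(\<lambda>n. w (ev (r n * s n) \<alpha>)) \<longlonglongrightarrow> W p * W q"
    using tendsto_mult[OF r(3) s(3)] ev_F[OF r(1)] ev_F[OF s(1)] by (simp add: ev_mult w_mult)
  ultimately show "W (p * q) = W p * W q"
    by (rule LIMSEQ_unique)
qed

lemma W_const: "W [:c:] = \<bar>c\<bar>"
proof (rule ccontr)
  assume "W [:c:] \<noteq> \<bar>c\<bar>"
  then have "0 < \<bar>W [:c:] - \<bar>c\<bar>\<bar> / 2"
    by simp
  then obtain d where d: "d \<in> \<rat>" "c < d" "d < c + \<bar>W [:c:] - \<bar>c\<bar>\<bar> / 2"
    using Rats_dense_in_real[of c "c + \<bar>W [:c:] - \<bar>c\<bar>\<bar> / 2"] by auto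
  have "\<bar>W [:c:] - \<bar>d\<bar>\<bar> \<le> \<bar>c - d\<bar>"
    using W[of "[:d:]" "[:c:]"] d by (simp add: w_real_rat)
  then show False
    using d abs_triangle_ineq3[of d c] abs_triangle_ineq[of "W [:c:] - \<bar>d\<bar>" "\<bar>d\<bar> - \<bar>c\<bar>"] by simp
qed

lemma W_power: "W (q ^ n) = W q ^ n"
proof (induction n)
  case 0
  then show ?case
    unfolding power_0 one_pCons W_const by simp
qed (simp add: W_mult)

lemma W_add_null: "W g = 0 \<Longrightarrow> W (q + g * t) = W q"
proof -
  assume g: "W g = 0"
  have "W (q + g * t) \<le> W q"
    using W_add[of q "g * t"] g by (simp add: W_mult)
  moreover have "W q \<le> W (q + g * t)"
    using W_add[of "q + g * t" "g * (- t)"] g W_mult[of g "- t"] by simp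
  ultimately show ?thesis by simp
qed

lemma W_null_root:
  "W q = 0 \<Longrightarrow> q \<noteq> 0 \<Longrightarrow> \<exists>z. ev q z = 0 \<and> W (quad z) = 0"
proof (induction "degree q" arbitrary: q rule: less_induct)
  case less
  have "degree q \<noteq> 0"
    using less.prems W_const by (metis abs_eq_0 degree_eq_zeroE pCons_0_0)
  moreover have "degree (map_poly complex_of_real q) = degree q"
    by (rule degree_map_poly) simp
  ultimately obtain z where z: "ev q z = 0"
    unfolding ev_def using fundamental_theorem_of_algebra[of "map_poly complex_of_real q"]
    by (auto simp: constant_degree)
  have "\<exists>g t. q = g * t \<and> 0 < degree g \<and> (W g = 0 \<longrightarrow> W (quad z) = 0)"
  proof (cases "Im z = 0")
    case True
    have "poly q (Re z) = 0"
      using z ev_real[OF True] by simp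
    then obtain t where t: "q = [:- Re z, 1:] * t"
      using poly_eq_0_iff_dvd by blast
    have "W [:- Re z, 1:] = 0 \<longrightarrow> W (quad z) = 0"
      unfolding quad_real[OF True] W_mult by simp
    then show ?thesis
      using t by (intro exI[of _ "[:- Re z, 1:]"] exI[of _ t]) simp
  next
    case False
    obtain t where "q = quad z * t"
      using quad_dvd[OF z False] by (rule dvdE)
    then show ?thesis
      by (intro exI[of _ "quad z"] exI[of _ t]) (simp add: degree_quad)
  qed
  then obtain g t where gt: "q = g * t" "0 < degree g" "W g = 0 \<longrightarrow> W (quad z) = 0"
    by blast
  show ?case
  proof (cases "W g = 0")
    case True
    then show ?thesis using gt z by blast
  next
    case False
    then have "W t = 0"
      using less.prems gt by (simp add: W_mult)
    moreover have "t \<noteq> 0" "degree t < degree q"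
      using less.prems gt by (auto simp: degree_mult_eq)
    ultimately obtain z' where "ev t z' = 0" "W (quad z') = 0"
      using less.hyps by blast
    then show ?thesis
      using gt by (auto simp: ev_mult)
  qed
qed

text \<open>The seminorm \<open>W\<close> depends only on the residue modulo \<open>quad z\<close>,
  that is, on the value at \<open>z\<close>. For real \<open>z\<close> this value is a real
  constant. Otherwise \<open>W\<close> amounts to a multiplicative seminorm on the complex numbers
  extending the usual one on the reals, and that is the usual modulus.\<close>

lemma W_eq_cmod:
  assumes qz: "W (quad z) = 0"
  shows "W q = cmod (ev q z)"
proof (cases "Im z = 0")
  case True
  have evr: "ev q z = of_real (poly q (Re z))"
    by (rule ev_real[OF True])
  have lin: "W [:- Re z, 1:] = 0"
    using qz unfolding quad_real[OF True] W_mult by simp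
  have "poly (q - [:poly q (Re z):]) (Re z) = 0"
    by simp
  then have "[:- Re z, 1:] dvd q - [:poly q (Re z):]"
    unfolding poly_eq_0_iff_dvd .
  then obtain t where "q = [:poly q (Re z):] + [:- Re z, 1:] * t"
    by (metis add.commute diff_add_cancel dvdE)
  then have "W q = W [:poly q (Re z):]"
    using W_add_null[OF lin] by metis
  then show ?thesis
    by (simp add: W_const evr)
next
  case False
  define x y where "x = Re z" and "y = Im z"
  have y: "y \<noteq> 0"
    using False by (simp add: y_def)
  \<comment> \<open>A linear real polynomial taking the value \<i> at \<open>z\<close>; modulo
    \<open>quad z\<close> its square is \<open>-1\<close>, which forces
    \<open>W J = 1\<close>.\<close>
  define J where "J = [:- x / y, 1 / y:]"
  have evJ: "ev J z = \<i>"
    using y by (simp add: J_def x_def y_def complex_eq_iff field_simps)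
  have J2: "J * J = [:- 1:] + quad z * [:1 / y\<^sup>2:]"
    using y by (simp add: J_def quad_eq x_def[symmetric] y_def[symmetric] power2_eq_square field_simps)
  have "W J * W J = 1"
    using W_add_null[OF qz, of "[:- 1:]" "[:1 / y\<^sup>2:]"] by (simp flip: W_mult add: J2 W_const)
  then have WJ: "W J = 1"
    using W_nonneg[of J] by (simp add: square_eq_1_iff)
  have dec: "W q = W ([:Re (ev q z):] + [:Im (ev q z):] * J)" for q
  proof -
    have "ev (q - ([:Re (ev q z):] + [:Im (ev q z):] * J)) z = 0"
      by (simp add: ev_minus ev_add ev_smult evJ complex_eq_iff)
    then obtain t where "q - ([:Re (ev q z):] + [:Im (ev q z):] * J) = quad z * t"
      using quad_dvd[OF _ False] by (auto simp: dvd_def)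
    then have "q = ([:Re (ev q z):] + [:Im (ev q z):] * J) + quad z * t"
      by (simp add: algebra_simps)
    then show ?thesis
      using W_add_null[OF qz] by metis
  qed
  have two: "W q \<le> 2 * cmod (ev q z)" for q
  proof -
    have "W q \<le> \<bar>Re (ev q z)\<bar> + \<bar>Im (ev q z)\<bar>"
      unfolding dec[of q] using W_add[of "[:Re (ev q z):]" "[:Im (ev q z):] * J"] by (simp only: W_mult W_const WJ mult_1_right)
    also have "\<dots> \<le> 2 * cmod (ev q z)"
      using abs_Re_le_cmod[of "ev q z"] abs_Im_le_cmod[of "ev q z"] by linarith
    finally show ?thesis .
  qed
  \<comment> \<open>The factor 2 is removed by applying \<open>two\<close> to all powers of
    \<open>q\<close>.\<close>
  have upper: "W q \<le> cmod (ev q z)" for q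
  proof (cases "ev q z = 0")
    case True
    then show ?thesis using two[of q] by simp
  next
    case nz: False
    show ?thesis
    proof (rule ccontr)
      assume "\<not> ?thesis"
      then have "1 < W q / cmod (ev q z)"
        using nz by simp
      then obtain n where n: "2 < (W q / cmod (ev q z)) ^ n"
        using real_arch_pow by blast
      have "W q ^ n \<le> 2 * cmod (ev q z) ^ n"
        using two[of "q ^ n"] by (simp add: W_power ev_power norm_power)
      then show False
        using n nz by (simp add: power_divide less_divide_eq)
    qed
  qed
  show ?thesis
  proof (rule antisym[OF upper])
    \<comment> \<open>\<open>?s\<close> plays the part of the complex conjugate: modulo
      \<open>quad z\<close> the product \<open>?r * ?s\<close> is the constant squared modulus, so
      the upper bound for \<open>?s\<close> becomes a lower bound for \<open>q\<close>.\<close>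
    let ?a = "Re (ev q z)" and ?b = "Im (ev q z)"
    let ?r = "[:?a:] + [:?b:] * J" and ?s = "[:?a:] - [:?b:] * J"
    have evs: "ev ?s z = cnj (ev q z)"
      by (simp add: ev_minus ev_smult evJ complex_eq_iff)
    have "?r * ?s = [:?a\<^sup>2:] - [:?b\<^sup>2:] * (J * J)"
      by (simp add: algebra_simps power2_eq_square)
    also have "\<dots> = [:?a\<^sup>2 + ?b\<^sup>2:] + quad z * ([:- ?b\<^sup>2:] * [:1 / y\<^sup>2:])"
      unfolding J2 by (simp add: algebra_simps)
    finally have "W (?r * ?s) = W [:?a\<^sup>2 + ?b\<^sup>2:]"
      using W_add_null[OF qz] by metis
    then have "W q * W ?s = \<bar>?a\<^sup>2 + ?b\<^sup>2\<bar>"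
      unfolding W_mult W_const dec[of q, symmetric] .
    then have "W q * W ?s = (cmod (ev q z))\<^sup>2"
      unfolding cmod_power2 by simp
    moreover have "W q * W ?s \<le> W q * cmod (ev q z)"
      using upper[of ?s] W_nonneg[of q] by (intro mult_left_mono) (simp_all only: evs complex_mod_cnj)
    ultimately have "cmod (ev q z) * cmod (ev q z) \<le> W q * cmod (ev q z)"
      by (simp add: power2_eq_square)
    then show "cmod (ev q z) \<le> W q"
      using W_nonneg[of q] by (cases "ev q z = 0") auto
  qed
qed

text \<open>Since \<open>P\<close> annihilates \<alpha>, the seminorm vanishes on \<open>P\<close>;
  the root found by \<open>W_null_root\<close> then describes the absolute value completely.\<close>

theorem archimedean_embedding:
  assumes "P \<in> rat_polys" "P \<noteq> 0" "ev P \<alpha> = 0"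
  shows "\<exists>z. ev P z = 0 \<and> (\<forall>q\<in>rat_polys. w (ev q \<alpha>) = cmod (ev q z))"
proof -
  have "W P = 0"
    using W_rat[OF assms(1)] assms(3) by simp
  then obtain z where z: "ev P z = 0" "W (quad z) = 0"
    using W_null_root assms by blast
  then show ?thesis
    using W_rat W_eq_cmod[OF z(2)] by (intro exI[of _ z] conjI ballI) metis+
qed

end

section \<open>Height and Mahler measure\<close>

lemma C_nat_pow [simp]: "x [^]\<^bsub>\<C>\<^esub> (n::nat) = x ^ n"
proof -
  interpret C: field \<C> by (rule field_C)
  show ?thesis
    by (induction n) (simp_all add: mult.commute)
qed

lemma eval_C: "ring.eval \<C> xs x = poly (Poly (rev xs)) x"
  by (induction xs) (simp_all add: ring.eval.simps[OF ring_C] Poly_append poly_monom)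

lemma rat_poly_exists:
  assumes "\<And>i. coeff q i \<in> (\<rat> :: complex set)"
  shows "\<exists>P. q = map_poly of_rat P"
proof -
  define g where "g z = (THE r. z = of_rat r)" for z :: complex
  have g: "of_rat (g z) = z" if "z \<in> \<rat>" for z
    using that by (elim Rats_cases) (simp add: g_def)
  have "g 0 = 0"
    using g[of 0] by simp
  then have "q = map_poly of_rat (map_poly g q)"
    using assms g by (intro poly_eqI) (simp add: coeff_map_poly)
  then show ?thesis
    by blast
qed

lemma ev_of_rat: "ev (map_poly of_rat P) z = poly (map_poly of_rat P) z"
proof -
  have "map_poly complex_of_real (map_poly of_rat P) = map_poly of_rat P"
    by (intro poly_eqI) (simp add: coeff_map_poly of_real_of_rat)
  then show ?thesis
    by (simp add: ev_def)
qed

lemma rat_polys_of_rat [simp]: "map_poly of_rat P \<in> rat_polys"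
  by (simp add: rat_polys_def coeff_map_poly)

lemma rational_eval:
  assumes "set xs \<subseteq> \<rat>"
  shows "\<exists>P. Poly (rev xs) = (map_poly of_rat P :: complex poly)"
  using assms by (intro rat_poly_exists) (auto simp: coeff_Poly_eq nth_default_def rev_nth subset_iff)

interpretation of_rat_poly_hom: map_poly_inj_idom_hom "of_rat :: rat \<Rightarrow> complex" ..

lemma irreducible_root_dvd:
  fixes P Q :: "rat poly"
  assumes "Factorial_Ring.irreducible P" "poly (map_poly of_rat P) \<alpha> = (0::complex)" "poly (map_poly of_rat Q) \<alpha> = (0::complex)"
  shows "P dvd Q"
proof (rule ccontr)
  assume nd: "\<not> P dvd Q"
  have "gcd P Q dvd P" by simp
  then have "is_unit (gcd P Q) \<or> P dvd gcd P Q"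
    using assms(1) by (auto simp: irreducible_altdef)
  then have "is_unit (gcd P Q)"
    using nd dvd_trans[OF _ gcd_dvd2[of P Q]] by blast
  then have "gcd P Q = 1"
    unfolding is_unit_gcd coprime_iff_gcd_eq_1 .
  moreover have "fst (bezout_coefficients P Q) * P + snd (bezout_coefficients P Q) * Q = gcd P Q"
    by (rule bezout_coefficients_fst_snd)
  ultimately obtain a b where "a * P + b * Q = 1"
    by auto
  then have "poly (map_poly of_rat (a * P + b * Q)) \<alpha> = (1::complex)"
    by simp
  then show False
    using assms by (simp add: of_rat_poly_hom.hom_add of_rat_poly_hom.hom_mult)
qed

lemma Span_dimension_le:
  assumes "field R" "subfield K R" "set Us \<subseteq> carrier R"
  shows "\<exists>n\<le>length Us. ring.dimension R n K (ring.Span R K Us)"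
proof -
  interpret field R by fact
  show ?thesis
    using assms(3)
  proof (induction Us)
    case Nil
    then show ?case
      using dimension.zero_dim by (intro exI[of _ 0]) (simp add: Span.simps)
  next
    case (Cons v Us)
    then obtain n where n: "n \<le> length Us" "dimension n K (Span K Us)"
      by auto
    show ?case
    proof (cases "v \<in> Span K Us")
      case True
      then have "Span K (v # Us) \<subseteq> Span K Us"
        using Span_base_incl[OF assms(2)] Cons.prems mono_Span_subset[OF assms(2)] by (metis insert_subset list.set(2))
      moreover have "Span K Us \<subseteq> Span K (v # Us)"
        using mono_Span[OF assms(2)] Cons.prems by auto
      ultimately show ?thesis
        using n by (metis le_SucI length_Cons subset_antisym)
    next
      case False
      then have "dimension (Suc n) K (Span K (v # Us))"
        using Suc_dim[of v "Span K Us" n K] n Cons.prems by (simp add: Span.simps)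
      then show ?thesis
        using n by auto
    qed
  qed
qed

section \<open>Local degrees at archimedean places\<close>

context archimedean_subfield
begin

context
  fixes z
  assumes F_ev: "\<And>x. x \<in> F \<Longrightarrow> \<exists>q\<in>rat_polys. x = ev q \<alpha>"
    and wz: "\<And>q. q \<in> rat_polys \<Longrightarrow> w (ev q \<alpha>) = cmod (ev q z)"
begin

lemma local_degree_le:
  assumes "set Vs \<subseteq> F"
    and "\<And>a e. a \<in> F \<Longrightarrow> 0 < e \<Longrightarrow> \<exists>b\<in>ring.Span \<C> \<rat> Vs. w (a - b) < e"
  shows "local_degree F w \<le> length Vs"
proof -
  have S: "E.Span (clos \<rat>) (map emb Vs) = carrier E"
    by (rule Span_dense_completion[OF subfield_Rats assms(1)]) (rule assms(2))
  have sub: "subfield (clos \<rat>) E"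
    by (rule subfield_clos[OF subfield_Rats Rats_F])
  have "set (map emb Vs) \<subseteq> carrier E"
    using assms(1) by auto
  then obtain n where n: "n \<le> length Vs" "E.dimension n (clos \<rat>) (carrier E)"
    using Span_dimension_le[OF E.field_axioms sub, of "map emb Vs"] unfolding S by auto
  then show ?thesis
    using E.dimI[OF sub n(2)] by (simp add: local_degree_def over_def)
qed

lemma local_degree_real:
  assumes "Im z = 0"
  shows "local_degree F w \<le> 1"
proof -
  interpret C: field \<C> by (rule field_C)
  have "local_degree F w \<le> length [1::complex]"
  proof (rule local_degree_le)
    fix a and e :: real assume a: "a \<in> F" and e: "0 < e"
    obtain q where q: "q \<in> rat_polys" "a = ev q \<alpha>"
      using F_ev[OF a] by blast
    obtain r where r: "poly q (Re z) - e < of_rat r" "of_rat r < poly q (Re z)"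
      using of_rat_dense[of "poly q (Re z) - e" "poly q (Re z)"] e by auto
    have "[:of_rat r:] \<in> rat_polys"
      by simp
    then have "w (a - of_rat r) = cmod (ev (q - [:of_rat r:]) z)"
      using wz[OF rat_polys_minus[OF q(1), of "[:of_rat r:]"]] q(2) by (simp add: ev_minus of_real_of_rat)
    also have "\<dots> = \<bar>poly (q - [:of_rat r:]) (Re z)\<bar>"
      unfolding ev_real[OF assms] by (rule norm_of_real)
    also have "\<dots> < e"
      using r by simp
    finally have "w (a - of_rat r) < e" .
    moreover have "of_rat r \<in> C.Span \<rat> [1]"
      by (auto simp: C.Span.simps C.line_extension_mem_iff intro!: bexI[of _ "of_rat r"])
    ultimately show "\<exists>b\<in>C.Span \<rat> [1]. w (a - b) < e"
      by blast
  qed simp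
  then show ?thesis
    by simp
qed

text \<open>The absolute value is the modulus after sending \<alpha> to \<open>z\<close>, and
  rational combinations of \<open>1\<close> and a nonreal \<open>z\<close> are dense in the complex
  numbers.\<close>

lemma local_degree_nonreal:
  assumes "Im z \<noteq> 0"
  shows "local_degree F w \<le> 2"
proof -
  interpret C: field \<C> by (rule field_C)
  have "local_degree F w \<le> length [\<alpha>, 1::complex]"
  proof (rule local_degree_le)
    fix a and e :: real assume a: "a \<in> F" and e: "0 < e"
    obtain q where q: "q \<in> rat_polys" "a = ev q \<alpha>"
      using F_ev[OF a] by blast
    \<comment> \<open>The real coordinates of \<open>ev q z\<close> with respect to the basis
      \<open>1, z\<close>, to be approximated by rationals.\<close>
    define t s where "t = Im (ev q z) / Im z" and "s = Re (ev q z) - t * Re z"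
    have ts: "ev q z = of_real s + z * of_real t"
      using assms by (simp add: complex_eq_iff t_def s_def)
    \<comment> \<open>Errors \<delta> in both coordinates add up to
      \<open>(1 + cmod z) * \<delta>\<close>, which is \<open>e / 2\<close>.\<close>
    define \<delta> where "\<delta> = e / (2 * (cmod z + 1))"
    have \<delta>: "\<delta> > 0"
      using e by (auto simp: \<delta>_def intro!: divide_pos_pos add_nonneg_pos)
    obtain r1 where r1: "s - \<delta> < of_rat r1" "of_rat r1 < s"
      using of_rat_dense[of "s - \<delta>" s] \<delta> by auto
    obtain r2 where r2: "t - \<delta> < of_rat r2" "of_rat r2 < t"
      using of_rat_dense[of "t - \<delta>" t] \<delta> by auto
    let ?p = "[:of_rat r1, of_rat r2:] :: real poly"
    have "w (a - (of_rat r1 + \<alpha> * of_rat r2)) = cmod (ev (q - ?p) z)"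
      using wz[OF rat_polys_minus[OF q(1), of ?p]] q(2) by (simp add: ev_minus of_real_of_rat)
    also have "ev (q - ?p) z = of_real (s - of_rat r1) + z * of_real (t - of_rat r2)"
      by (simp add: ev_minus ts of_real_of_rat algebra_simps)
    also have "cmod \<dots> \<le> \<bar>s - of_rat r1\<bar> + cmod z * \<bar>t - of_rat r2\<bar>"
      by (rule order_trans[OF norm_triangle_ineq]) (simp add: norm_mult del: of_real_diff)
    also have "\<dots> \<le> \<delta> + cmod z * \<delta>"
      using r1 r2 by (intro add_mono mult_left_mono) auto
    also have "\<dots> = e / 2"
    proof -
      have "cmod z + 1 \<noteq> 0"
        using norm_ge_zero[of z] by linarith
      then show ?thesis
        by (simp add: \<delta>_def divide_simps) (simp add: algebra_simps)
    qed
    finally have "w (a - (of_rat r1 + \<alpha> * of_rat r2)) < e"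
      using e by simp
    moreover have "of_rat r1 + \<alpha> * of_rat r2 \<in> C.Span \<rat> [\<alpha>, 1]"
    proof -
      have "of_rat r1 \<in> C.line_extension \<rat> 1 {0}"
        by (auto simp: C.line_extension_mem_iff intro!: bexI[of _ "of_rat r1"])
      then have "of_rat r1 + \<alpha> * of_rat r2 \<in> C.line_extension \<rat> \<alpha> (C.line_extension \<rat> 1 {0})"
        unfolding C.line_extension_mem_iff[of _ _ \<alpha>]
        by (intro bexI[of _ "of_rat r2"] bexI[of _ "of_rat r1"]) (simp_all add: mult.commute add.commute)
      then show ?thesis
        by (simp add: C.Span.simps)
    qed
    ultimately show "\<exists>b\<in>C.Span \<rat> [\<alpha>, 1]. w (a - b) < e"
      by blast
  qed (use \<alpha> in simp)
  then show ?thesis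
    by simp
qed

end

end

section \<open>Height of an algebraic integer\<close>

lemma (in padic_subfield) w_algebraic_int_le:
  assumes "x \<in> F" "algebraic_int x"
  shows "w x \<le> 1"
proof (rule ccontr)
  assume "\<not> w x \<le> 1"
  then have gt: "1 < w x" by simp
  obtain P where P: "lead_coeff P = 1" "\<And>i. coeff P i \<in> \<int>" "poly P x = 0"
    using assms(2) by (auto simp: algebraic_int.simps)
  define n where "n = Polynomial.degree P"
  have n: "n \<noteq> 0"
  proof
    assume "n = 0"
    then obtain c where "P = [:c:]"
      using degree_eq_zeroE n_def by metis
    then show False
      using P by simp
  qed
  have F: "coeff P i \<in> F" "w (coeff P i) \<le> 1" for i
    using P(2)[of i] w_of_int_le by (auto elim!: Ints_cases)
  have "0 = (\<Sum>i<Suc n. coeff P i * x ^ i)"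
    using P(3) by (simp add: poly_altdef n_def lessThan_Suc_atMost)
  then have "x ^ n = - (\<Sum>i<n. coeff P i * x ^ i)"
    using P(1) by (simp add: n_def eq_neg_iff_add_eq_0 add.commute)
  then have "w (x ^ n) = w (\<Sum>i<n. coeff P i * x ^ i)"
    using F assms(1) by (simp add: w_uminus)
  also have "\<dots> \<le> w x ^ (n - 1)"
  proof (rule w_sum_max)
    fix i assume i: "i \<in> {..<n}"
    show "coeff P i * x ^ i \<in> F"
      using F assms(1) by simp
    have "w (coeff P i * x ^ i) = w (coeff P i) * w x ^ i"
      using F assms(1) by (simp add: w_mult w_power)
    also have "\<dots> \<le> 1 * w x ^ i"
      using F gt by (intro mult_right_mono) auto
    also have "\<dots> \<le> w x ^ (n - 1)"
      using i gt by (simp add: power_increasing)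
    finally show "w (coeff P i * x ^ i) \<le> w x ^ (n - 1)" .
  qed (use gt in simp)
  also have "\<dots> < w x ^ n"
    using gt n by (intro power_strict_increasing) auto
  finally show False
    using assms(1) by (simp add: w_power)
qed

text \<open>For a monic polynomial the Mahler measure is the product of
  \<open>max 1 (cmod a)\<close> over its roots with multiplicity; leaving out roots or
  multiplicities only drops nonnegative logarithms.\<close>

lemma sum_roots_le_mahler:
  fixes p :: "complex poly"
  assumes "lead_coeff p = 1" "Z \<subseteq> {z. poly p z = 0}"
  shows "(\<Sum>z\<in>Z. ln (max 1 (cmod z))) \<le> ln (mahler_measure_poly p)"
proof -
  let ?rs = "complex_roots_complex p"
  have p: "(\<Prod>a\<leftarrow>?rs. [:- a, 1:]) = p"
    using complex_roots(1)[of p] assms(1) by simp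
  have roots: "{z. poly p z = 0} \<subseteq> set ?rs"
  proof
    fix z assume "z \<in> {z. poly p z = 0}"
    then have "poly (\<Prod>a\<leftarrow>?rs. [:- a, 1:]) z = 0"
      using p by simp
    then show "z \<in> set ?rs"
      by (auto simp: poly_prod_list prod_list_zero_iff)
  qed
  have ln_list: "ln (\<Prod>a\<leftarrow>xs. max 1 (cmod a)) = (\<Sum>a\<leftarrow>xs. ln (max 1 (cmod a)))" for xs
  proof (induction xs)
    case (Cons a xs)
    have "(\<Prod>a\<leftarrow>xs. max 1 (cmod a)) > 0"
      by (induction xs) auto
    then show ?case
      using Cons by (simp add: ln_mult_pos)
  qed simp
  have set_list: "(\<Sum>z\<in>set xs. ln (max 1 (cmod z))) \<le> (\<Sum>a\<leftarrow>xs. ln (max 1 (cmod a)))" for xs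
    by (induction xs) (auto simp: sum.insert_if intro: add_increasing)
  have "(\<Sum>z\<in>Z. ln (max 1 (cmod z))) \<le> (\<Sum>z\<in>set ?rs. ln (max 1 (cmod z)))"
    using assms(2) roots by (intro sum_mono2) auto
  also have "\<dots> \<le> ln (mahler_measure_poly p)"
    using set_list[of ?rs] assms(1) by (simp add: mahler_measure_poly_def ln_list)
  finally show ?thesis .
qed


lemma nonarchimedean_place:
  assumes "number_field F" "w \<in> nonarchimedean_places F"
  obtains p where "padic_subfield F w p"
proof -
  obtain p where "Factorial_Ring.prime p" "\<And>r. w (of_rat r) = padic_abs p r"
    using assms(2) by (auto simp: nonarchimedean_places_def)
  then have "padic_subfield F w p"
    using assms
    by (intro padic_subfield.intro valued_subfield.intro complex_subfield.intro valued_subfield_axioms.intro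
        padic_subfield_axioms.intro) (auto simp: number_field_def nonarchimedean_places_def)
  then show thesis
    by (rule that)
qed

lemma generate_field_root:
  assumes P: "Factorial_Ring.irreducible (P :: rat poly)" "poly (map_poly of_rat P) \<alpha> = 0"
  defines "F \<equiv> generate_field \<C> {\<alpha>}"
  shows "number_field F" "\<alpha> \<in> F" "Polynomial.degree P \<le> global_degree F"
    "\<And>x. x \<in> F \<Longrightarrow> \<exists>Q. x = poly (map_poly of_rat Q) \<alpha>"
proof -
  interpret C: field \<C> by (rule field_C)
  note Q = subfield_Rats
  have sub: "subfield F \<C>"
    unfolding F_def by (rule C.generate_field_is_subfield) simp
  then interpret complex_subfield F
    by (rule complex_subfield.intro)
  show \<alpha>F: "\<alpha> \<in> F"
    unfolding F_def by (rule generate_field.intros) simp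
  define xs where "xs = rev (coeffs (map_poly of_rat P :: complex poly))"
  have P0: "P \<noteq> 0"
    using P by auto
  have "xs \<in> carrier (univ_poly \<C> \<rat>)"
    using P0 by (auto simp: xs_def univ_poly_def polynomial_def hd_rev last_coeffs_eq_coeff_degree coeffs_map_poly last_map)
  moreover have "xs \<noteq> []"
    using P0 by (simp add: xs_def)
  moreover have "C.eval xs \<alpha> = \<zero>\<^bsub>\<C>\<^esub>"
    using P(2) unfolding xs_def eval_C rev_rev_ident Poly_coeffs by simp
  ultimately have alg: "C.algebraic \<rat> \<alpha>"
    using C.algebraicI[of xs \<rat> \<alpha>] by (simp add: over_def)
  have se: "subfield (C.simple_extension \<rat> \<alpha>) \<C>"
    using C.simple_extension_is_subfield[OF Q, of \<alpha>] alg by (simp add: over_def)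
  have "F \<subseteq> C.simple_extension \<rat> \<alpha>"
    unfolding F_def by (rule C.generate_field_min_subfield1[OF _ se])
      (use C.simple_extension_mem[OF subfieldE(1)[OF Q], of \<alpha>] in auto)
  moreover have "C.simple_extension \<rat> \<alpha> \<subseteq> F"
    by (rule C.simple_extension_subring_incl[OF subfieldE(1)[OF sub] Rats_F \<alpha>F])
  ultimately have F: "F = C.simple_extension \<rat> \<alpha>" ..
  have fd: "C.finite_dimension \<rat> F"
    using C.finite_dimension_simple_extension[OF Q, of \<alpha>] alg F by (simp add: over_def)
  show "number_field F"
    using sub fd by (simp add: number_field_def)
  show "\<exists>Q. x = poly (map_poly of_rat Q) \<alpha>" if "x \<in> F" for x
  proof -
    have "x \<in> C.simple_extension \<rat> \<alpha>"
      using that F by simp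
    then obtain xs where "xs \<in> carrier (univ_poly \<C> \<rat>)" "x = C.eval xs \<alpha>"
      using C.simple_extension_as_eval_img[of \<rat> \<alpha>] unfolding F by (auto simp del: C.eval.simps)
    then show ?thesis
      using rational_eval[of xs] by (fastforce simp: eval_C univ_poly_def polynomial_def)
  qed
  let ?I = "C.Irr \<rat> \<alpha>"
  have I: "?I \<in> carrier (univ_poly \<C> \<rat>)" "hd ?I = 1" "C.eval ?I \<alpha> = 0" "?I \<noteq> []"
    using C.IrrE[OF Q, of \<alpha>] alg by (auto simp: over_def ring_irreducible_def univ_poly_zero)
  have gd: "global_degree F = length ?I - 1"
    using C.simple_extension_dim[OF Q, of \<alpha>] alg F by (simp add: over_def global_degree_def)
  obtain Q' where Q': "Poly (rev ?I) = (map_poly of_rat Q' :: complex poly)"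
    using rational_eval[of ?I] I by (auto simp: univ_poly_def polynomial_def)
  have "P dvd Q'"
    using irreducible_root_dvd[OF P] I Q' by (simp add: eval_C)
  moreover have "Q' \<noteq> 0"
  proof
    assume "Q' = 0"
    then have "coeff (Poly (rev ?I)) (length ?I - 1) = 0"
      using Q' by simp
    then show False
      using I by (simp add: coeff_Poly_eq nth_default_def rev_nth hd_conv_nth)
  qed
  ultimately have "Polynomial.degree P \<le> Polynomial.degree Q'"
    by (rule dvd_imp_degree_le)
  also have "\<dots> = Polynomial.degree (Poly (rev ?I))"
    unfolding Q' by simp
  also have "\<dots> \<le> length ?I - 1"
    by (rule degree_le) (auto simp: coeff_Poly_eq nth_default_def)
  finally show "Polynomial.degree P \<le> global_degree F"
    using gd by simp
qed

text \<open>Each archimedean place \<open>w\<close> has local degree at most the cardinality of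
  \<open>{Z w, cnj (Z w)}\<close>. These sets are disjoint sets of roots of \<open>P\<close>, so the
  archimedean part of the height is bounded by the logarithmic Mahler measure.\<close>

theorem weil_height_le_mahler:
  assumes P: "Factorial_Ring.irreducible (P :: rat poly)" "lead_coeff P = 1" "poly (map_poly of_rat P) \<alpha> = 0"
    and int: "algebraic_int \<alpha>"
  shows "weil_height \<alpha> \<le> ln (mahler_measure_poly (map_poly of_rat P)) / Polynomial.degree P"
proof -
  define F where "F = generate_field \<C> {\<alpha>}"
  have nf: "number_field F" and \<alpha>F: "\<alpha> \<in> F" and deg: "Polynomial.degree P \<le> global_degree F"
    and F_ev: "\<And>x. x \<in> F \<Longrightarrow> \<exists>Q. x = poly (map_poly of_rat Q) \<alpha>"
    using generate_field_root[OF P(1,3)] unfolding F_def by auto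
  have F_ev': "\<exists>q\<in>rat_polys. x = ev q \<alpha>" if "x \<in> F" for x
    using F_ev[OF that] ev_of_rat rat_polys_of_rat by metis
  have dP: "0 < Polynomial.degree P"
  proof (rule ccontr)
    assume "\<not> ?thesis"
    then obtain c where "P = [:c:]"
      using degree_eq_zeroE by blast
    then show False
      using P by simp
  qed
  let ?p = "map_poly of_rat P :: complex poly"
  let ?q = "map_poly of_rat P :: real poly"
  have arch: "\<exists>z. ev ?q z = 0 \<and> (\<forall>q\<in>rat_polys. w (ev q \<alpha>) = cmod (ev q z)) \<and>
      local_degree F w \<le> card {z, cnj z}" if w: "w \<in> archimedean_places F" for w
  proof -
    interpret archimedean_subfield F w \<alpha>
      using nf w \<alpha>F
      by (intro archimedean_subfield.intro valued_subfield.intro complex_subfield.intro valued_subfield_axioms.intro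
        archimedean_subfield_axioms.intro) (auto simp: number_field_def archimedean_places_def)
    have "?q \<noteq> 0" "ev ?q \<alpha> = 0"
      using P by (auto simp: ev_of_rat)
    then obtain z where z: "ev ?q z = 0" "\<And>q. q \<in> rat_polys \<Longrightarrow> w (ev q \<alpha>) = cmod (ev q z)"
      using archimedean_embedding[of ?q] by auto
    have "local_degree F w \<le> card {z, cnj z}"
    proof (cases "Im z = 0")
      case True
      then have "cnj z = z"
        by (simp add: complex_eq_iff)
      then show ?thesis
        using local_degree_real[OF F_ev' z(2) True] by simp
    next
      case False
      then have "cnj z \<noteq> z"
        by (auto simp: complex_eq_iff)
      then show ?thesis
        using local_degree_nonreal[OF F_ev' z(2) False] by (simp add: card_insert_if)
    qed
    then show ?thesis
      using z by blast
  qed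
  then obtain Z where Z: "\<And>w. w \<in> archimedean_places F \<Longrightarrow> ev ?q (Z w) = 0"
    "\<And>w q. w \<in> archimedean_places F \<Longrightarrow> q \<in> rat_polys \<Longrightarrow> w (ev q \<alpha>) = cmod (ev q (Z w))"
    "\<And>w. w \<in> archimedean_places F \<Longrightarrow> local_degree F w \<le> card {Z w, cnj (Z w)}"
    by metis
  \<comment> \<open>Every element of \<open>F\<close> is a rational polynomial in \<alpha>, so the
    place is determined by \<open>Z w\<close>, and conjugation does not change moduli.\<close>
  have Zdet: "w = w'" if w: "w \<in> archimedean_places F" "w' \<in> archimedean_places F"
    and eq: "Z w = Z w' \<or> Z w = cnj (Z w')" for w w'
  proof (rule extensionalityI[of w F w'])
    show "w x = w' x" if "x \<in> F" for x
    proof -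
      obtain q where q: "q \<in> rat_polys" "x = ev q \<alpha>"
        using F_ev'[OF \<open>x \<in> F\<close>] by blast
      show ?thesis
        using Z(2)[OF w(1) q(1)] Z(2)[OF w(2) q(1)] q(2) eq by (auto simp: ev_cnj)
    qed
  qed (use w in \<open>auto simp: archimedean_places_def\<close>)
  have p0: "?p \<noteq> 0"
    using P by auto
  have fin_roots: "finite {z. poly ?p z = 0}"
    by (rule poly_roots_finite[OF p0])
  have Zroot: "poly ?p (Z w) = 0" "poly ?p (cnj (Z w)) = 0" if "w \<in> archimedean_places F" for w
    using Z(1)[OF that] ev_cnj[of ?q "Z w"] by (simp_all add: ev_of_rat)
  have fin: "finite (archimedean_places F)"
  proof (rule inj_on_finite[OF _ _ fin_roots])
    show "inj_on Z (archimedean_places F)"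
      using Zdet by (auto intro!: inj_onI)
  qed (use Zroot in auto)
  have w\<alpha>: "w \<alpha> = cmod (Z w)" if "w \<in> archimedean_places F" for w
    using Z(2)[OF that, of "[:0, 1:]"] by (simp only: rat_polys_pCons rat_polys_0 ev_pCons ev_0) simp
  have "height_over F \<alpha> = (\<Sum>\<^sub>\<infinity>w\<in>archimedean_places F. place_weight F w * ln (max 1 (w \<alpha>)))"
    unfolding height_over_def
  \<comment> \<open>At nonarchimedean places the integer \<alpha> has value at most 1, so the
    logarithm is zero; what remains is a finite sum.\<close>
  proof (rule infsum_cong_neutral)
    fix w assume "w \<in> places F - archimedean_places F"
    then obtain p where "padic_subfield F w p"
      using nonarchimedean_place[OF nf] by (auto simp: places_def)
    then have "w \<alpha> \<le> 1"
      using padic_subfield.w_algebraic_int_le[OF _ \<alpha>F int] by blast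
    then show "place_weight F w * ln (max 1 (w \<alpha>)) = 0"
      by (simp add: max_def)
  qed (auto simp: places_def)
  also have "\<dots> = (\<Sum>w\<in>archimedean_places F. place_weight F w * ln (max 1 (w \<alpha>)))"
    using fin by (rule infsum_finite)
  also have "\<dots> = (\<Sum>w\<in>archimedean_places F. local_degree F w * ln (max 1 (w \<alpha>))) / global_degree F"
    by (simp add: place_weight_def sum_divide_distrib)
  also have "\<dots> \<le> (\<Sum>w\<in>archimedean_places F. \<Sum>z\<in>{Z w, cnj (Z w)}. ln (max 1 (cmod z))) / global_degree F"
  proof (intro divide_right_mono sum_mono)
    fix w assume w: "w \<in> archimedean_places F"
    have "(\<Sum>z\<in>{Z w, cnj (Z w)}. ln (max 1 (cmod z))) = (\<Sum>z\<in>{Z w, cnj (Z w)}. ln (max 1 (w \<alpha>)))"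
      using w\<alpha>[OF w] by (intro sum.cong) auto
    then show "local_degree F w * ln (max 1 (w \<alpha>)) \<le> (\<Sum>z\<in>{Z w, cnj (Z w)}. ln (max 1 (cmod z)))"
      using Z(3)[OF w] by (simp only: sum_constant) (intro mult_right_mono, auto)
  qed simp
  also have "(\<Sum>w\<in>archimedean_places F. \<Sum>z\<in>{Z w, cnj (Z w)}. ln (max 1 (cmod z))) =
      (\<Sum>z\<in>(\<Union>w\<in>archimedean_places F. {Z w, cnj (Z w)}). ln (max 1 (cmod z)))"
  proof (rule sum.UNION_disjoint[symmetric, OF fin])
    show "\<forall>w\<in>archimedean_places F. \<forall>w'\<in>archimedean_places F. w \<noteq> w' \<longrightarrow> {Z w, cnj (Z w)} \<inter> {Z w', cnj (Z w')} = {}"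
    proof (intro ballI impI)
      fix w w' assume "w \<in> archimedean_places F" "w' \<in> archimedean_places F" "w \<noteq> w'"
      then have "Z w \<noteq> Z w'" "Z w \<noteq> cnj (Z w')"
        using Zdet by blast+
      then show "{Z w, cnj (Z w)} \<inter> {Z w', cnj (Z w')} = {}"
        by (metis Int_insert_right complex_cnj_cancel_iff complex_cnj_cnj insertE disjoint_iff empty_iff)
    qed
  qed auto
  also have "\<dots> \<le> ln (mahler_measure_poly ?p)"
    using P(2) Zroot by (intro sum_roots_le_mahler) auto
  finally have "height_over F \<alpha> \<le> ln (mahler_measure_poly ?p) / global_degree F"
    by (simp add: divide_right_mono)
  \<comment> \<open>The degree of \<open>F\<close> is at least that of \<open>P\<close>, and the
    numerator is nonnegative.\<close>
  also have "\<dots> \<le> ln (mahler_measure_poly ?p) / Polynomial.degree P"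
  proof (intro divide_left_mono)
    show "0 \<le> ln (mahler_measure_poly ?p)"
      using sum_roots_le_mahler[of ?p "{}"] P(2) by simp
  qed (use deg dP in auto)
  finally show ?thesis
    by (simp add: weil_height_def F_def)
qed

section \<open>Algebraic integers\<close>

definition Zspan :: "complex set \<Rightarrow> complex set" where
  "Zspan V = {\<Sum>v\<in>V. of_int (c v) * v | c. True}"

text \<open>Multiplication by \<open>x\<close> preserves the group generated by \<open>V\<close>.
  For a finite \<open>V\<close> with a nonzero element this characterizes integrality in a form that
  passes directly to sums and products.\<close>

definition acts_on :: "complex \<Rightarrow> complex set \<Rightarrow> bool" where
  "acts_on x V \<longleftrightarrow> (\<forall>v\<in>V. x * v \<in> Zspan V)"

lemma Zspan_0 [simp]: "0 \<in> Zspan V"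
  unfolding Zspan_def by (auto intro!: exI[of _ "\<lambda>v. 0"])

lemma Zspan_add: "a \<in> Zspan V \<Longrightarrow> b \<in> Zspan V \<Longrightarrow> a + b \<in> Zspan V"
proof -
  assume "a \<in> Zspan V" "b \<in> Zspan V"
  then obtain c d where "a = (\<Sum>v\<in>V. of_int (c v) * v)" "b = (\<Sum>v\<in>V. of_int (d v) * v)"
    by (auto simp: Zspan_def)
  then have "a + b = (\<Sum>v\<in>V. of_int (c v + d v) * v)"
    by (simp add: sum.distrib ring_distribs)
  then show ?thesis
    unfolding Zspan_def by (intro CollectI exI[of _ "\<lambda>v. c v + d v"]) simp
qed

lemma Zspan_of_int_mult: "a \<in> Zspan V \<Longrightarrow> of_int n * a \<in> Zspan V"
proof -
  assume "a \<in> Zspan V"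
  then obtain c where "a = (\<Sum>v\<in>V. of_int (c v) * v)"
    by (auto simp: Zspan_def)
  then have "of_int n * a = (\<Sum>v\<in>V. of_int (n * c v) * v)"
    by (simp add: sum_distrib_left mult.assoc)
  then show ?thesis
    unfolding Zspan_def by (intro CollectI exI[of _ "\<lambda>v. n * c v"]) simp
qed

lemma Zspan_sum: "(\<And>i. i \<in> I \<Longrightarrow> g i \<in> Zspan V) \<Longrightarrow> sum g I \<in> Zspan V"
  by (induction I rule: infinite_finite_induct) (auto intro: Zspan_add)

lemma Zspan_base: "finite V \<Longrightarrow> v \<in> V \<Longrightarrow> v \<in> Zspan V"
proof -
  assume V: "finite V" "v \<in> V"
  have "(\<Sum>x\<in>V. of_int (if x = v then 1 else 0) * x) = (\<Sum>x\<in>V. if x = v then x else 0)"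
    by (rule sum.cong) auto
  then have "v = (\<Sum>x\<in>V. of_int (if x = v then 1 else 0) * x)"
    using V by simp
  then show ?thesis
    unfolding Zspan_def by (intro CollectI exI[of _ "\<lambda>x. if x = v then 1 else 0"]) simp
qed

lemma Zspan_subset:
  assumes "\<And>v. v \<in> V \<Longrightarrow> y * v \<in> Zspan V'" "a \<in> Zspan V"
  shows "y * a \<in> Zspan V'"
proof -
  obtain c where "a = (\<Sum>v\<in>V. of_int (c v) * v)"
    using assms(2) by (auto simp: Zspan_def)
  then have "y * a = (\<Sum>v\<in>V. of_int (c v) * (y * v))"
    by (simp add: sum_distrib_left mult_ac)
  then show ?thesis
    using assms(1) by (auto intro!: Zspan_sum Zspan_of_int_mult)
qed

lemma acts_on_Zspan: "acts_on x V \<Longrightarrow> a \<in> Zspan V \<Longrightarrow> x * a \<in> Zspan V"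
  unfolding acts_on_def by (rule Zspan_subset) auto

lemma acts_on_add: "acts_on x V \<Longrightarrow> acts_on y V \<Longrightarrow> acts_on (x + y) V"
  and acts_on_mult: "acts_on x V \<Longrightarrow> acts_on y V \<Longrightarrow> acts_on (x * y) V"
  and acts_on_of_int: "finite V \<Longrightarrow> acts_on (of_int n) V"
  using acts_on_Zspan
  by (auto simp: acts_on_def ring_distribs mult.assoc intro!: Zspan_add Zspan_of_int_mult intro: Zspan_base)

text \<open>The elements of \<open>V\<close> form a nonzero eigenvector, with eigenvalue
  \<open>x\<close>, of an integer matrix, whose characteristic polynomial is monic.\<close>

lemma algebraic_int_of_acts_on:
  assumes V: "finite V" "v0 \<in> V" "v0 \<noteq> 0" and x: "acts_on x V"
  shows "algebraic_int x"
proof -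
  define n where "n = card V"
  obtain h where h: "bij_betw h {0..<n} V"
    using ex_bij_betw_nat_finite[OF V(1)] n_def by blast
  have hV: "h i \<in> V" if "i < n" for i
    using h that by (auto simp: bij_betw_def)
  have "\<forall>v\<in>V. \<exists>c. x * v = (\<Sum>u\<in>V. of_int (c u) * u)"
    using x by (auto simp: acts_on_def Zspan_def)
  then obtain c where c: "\<And>v. v \<in> V \<Longrightarrow> x * v = (\<Sum>u\<in>V. of_int (c v u) * u)"
    by metis
  define A :: "int mat" where "A = mat n n (\<lambda>(i, j). c (h i) (h j))"
  have A: "A \<in> carrier_mat n n"
    by (simp add: A_def)
  let ?A = "map_mat complex_of_int A"
  let ?v = "vec n h"
  have "?A *\<^sub>v ?v = x \<cdot>\<^sub>v ?v"
  proof (rule eq_vecI)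
    fix i assume i: "i < dim_vec (x \<cdot>\<^sub>v ?v)"
    then have "x * h i = (\<Sum>u\<in>V. of_int (c (h i) u) * u)"
      by (intro c hV) simp
    also have "\<dots> = (\<Sum>j = 0..<n. of_int (c (h i) (h j)) * h j)"
      using h by (intro sum.reindex_bij_betw[symmetric])
    finally show "(?A *\<^sub>v ?v) $ i = (x \<cdot>\<^sub>v ?v) $ i"
      using i by (simp add: A_def scalar_prod_def)
  qed (simp add: A_def)
  moreover have "?v \<noteq> 0\<^sub>v n"
  proof
    assume "?v = 0\<^sub>v n"
    then have "h i = 0" if "i < n" for i
      using that by (metis index_vec index_zero_vec(1))
    moreover obtain i where "i < n" "h i = v0"
      using h V(2) by (auto simp: bij_betw_def image_iff)
    ultimately show False
      using V(3) by blast
  qed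
  ultimately have "eigenvalue ?A x"
    using A unfolding eigenvalue_def eigenvector_def by (intro exI[of _ ?v]) simp
  then have "poly (char_poly ?A) x = 0"
    using eigenvalue_root_char_poly[of ?A n x] A by simp
  moreover have "char_poly ?A = map_poly of_int (char_poly A)"
    using of_int_hom.char_poly_hom[OF A] by simp
  moreover have "lead_coeff (char_poly A) = 1"
    using degree_monic_char_poly[OF A] by simp
  ultimately show ?thesis
    by (auto simp: algebraic_int_altdef_ipoly)
qed

text \<open>Multiplication by \<alpha> raises the exponent \<open>j\<close>; at the top the relation
  for \<open>\<alpha> ^ n\<close> brings it back, with coefficients that act on
  \<open>V\<close>.\<close>

lemma acts_on_extension:
  assumes V: "finite V" and a: "\<And>i. i < n \<Longrightarrow> acts_on (a i) V"
    and \<alpha>: "\<alpha> ^ n = (\<Sum>i<n. a i * \<alpha> ^ i)"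
  defines "V' \<equiv> (\<lambda>(j, v). \<alpha> ^ j * v) ` ({..<n} \<times> V)"
  shows "acts_on \<alpha> V'" "\<And>y. acts_on y V \<Longrightarrow> acts_on y V'"
proof -
  have fin: "finite V'"
    using V by (simp add: V'_def)
  have in_V': "\<alpha> ^ j * v \<in> Zspan V'" if "j < n" "v \<in> V" for j v
    using that by (intro Zspan_base[OF fin]) (auto simp: V'_def)
  have in_V'2: "\<alpha> ^ j * z \<in> Zspan V'" if "j < n" "z \<in> Zspan V" for j z
    using in_V'[OF that(1)] that(2) by (rule Zspan_subset)
  show "acts_on y V'" if "acts_on y V" for y
    unfolding acts_on_def
  proof
    fix u assume "u \<in> V'"
    then obtain j v where u: "j < n" "v \<in> V" "u = \<alpha> ^ j * v"
      by (auto simp: V'_def)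
    have "\<alpha> ^ j * (y * v) \<in> Zspan V'"
      using that u by (intro in_V'2) (auto simp: acts_on_def)
    then show "y * u \<in> Zspan V'"
      by (simp add: u(3) mult_ac)
  qed
  show "acts_on \<alpha> V'"
    unfolding acts_on_def
  proof
    fix u assume "u \<in> V'"
    then obtain j v where u: "j < n" "v \<in> V" "u = \<alpha> ^ j * v"
      by (auto simp: V'_def)
    show "\<alpha> * u \<in> Zspan V'"
    proof (cases "Suc j < n")
      case True
      then show ?thesis
        using in_V'[OF True u(2)] by (simp add: u(3) mult.assoc)
    next
      case False
      then have "n = Suc j"
        using u by simp
      then have "\<alpha> * u = \<alpha> ^ n * v"
        by (simp add: u(3))
      also have "\<dots> = (\<Sum>i<n. \<alpha> ^ i * (a i * v))"
        unfolding \<alpha> sum_distrib_right by (simp add: mult_ac)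
      also have "\<dots> \<in> Zspan V'"
        using a u(2) by (intro Zspan_sum in_V'2) (auto simp: acts_on_def)
      finally show ?thesis .
    qed
  qed
qed

lemma monic_root_power:
  fixes P :: "complex poly"
  assumes "lead_coeff P = 1" "poly P x = 0"
  shows "x ^ Polynomial.degree P = (\<Sum>i<Polynomial.degree P. - coeff P i * x ^ i)" "0 < Polynomial.degree P"
proof -
  have "0 = (\<Sum>i<Suc (Polynomial.degree P). coeff P i * x ^ i)"
    using assms(2) by (simp add: poly_altdef lessThan_Suc_atMost)
  then show "x ^ Polynomial.degree P = (\<Sum>i<Polynomial.degree P. - coeff P i * x ^ i)"
    using assms(1) by (simp add: sum_negf eq_neg_iff_add_eq_0 add.commute)
  show "0 < Polynomial.degree P"
  proof (rule ccontr)
    assume "\<not> ?thesis"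
    then obtain c where "P = [:c:]"
      using degree_eq_zeroE by blast
    then show False
      using assms by simp
  qed
qed

lemma common_module:
  assumes "finite Y" "\<And>x. x \<in> Y \<Longrightarrow> algebraic_int x"
  shows "\<exists>V. finite V \<and> 1 \<in> V \<and> (\<forall>x\<in>Y. acts_on x V)"
  using assms
proof (induction Y)
  case (insert x Y)
  then obtain V where V: "finite V" "1 \<in> V" "\<forall>x\<in>Y. acts_on x V"
    by auto
  obtain P where P: "lead_coeff P = 1" "\<And>i. coeff P i \<in> \<int>" "poly P x = 0"
    using insert.prems by (auto simp: algebraic_int.simps)
  define n where "n = Polynomial.degree P"
  have n: "x ^ n = (\<Sum>i<n. - coeff P i * x ^ i)" "0 < n"
    using monic_root_power[OF P(1,3)] by (simp_all add: n_def)
  have a: "acts_on (- coeff P i) V" for i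
    using P(2)[of i] acts_on_of_int[OF V(1)] by (auto elim!: Ints_cases simp flip: of_int_minus)
  define V' where "V' = (\<lambda>(j, v). x ^ j * v) ` ({..<n} \<times> V)"
  have "1 \<in> V'"
    unfolding V'_def using V n by (intro image_eqI[of _ _ "(0, 1)"]) auto
  moreover have "finite V'"
    using V by (simp add: V'_def)
  ultimately show ?case
    using acts_on_extension[OF V(1) a n(1)] V(3) unfolding V'_def by blast
qed (auto intro!: exI[of _ "{1}"])

lemma algebraic_int_add: "algebraic_int x \<Longrightarrow> algebraic_int y \<Longrightarrow> algebraic_int (x + y :: complex)"
  and algebraic_int_mult: "algebraic_int x \<Longrightarrow> algebraic_int y \<Longrightarrow> algebraic_int (x * y :: complex)"
proof -
  assume "algebraic_int x" "algebraic_int y"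
  then obtain V where V: "finite V" "1 \<in> V" "acts_on x V" "acts_on y V"
    using common_module[of "{x, y}"] by auto
  show "algebraic_int (x + y)" "algebraic_int (x * y)"
    using algebraic_int_of_acts_on[OF V(1,2)] acts_on_add[OF V(3,4)] acts_on_mult[OF V(3,4)] by auto
qed

lemma algebraic_int_diff: "algebraic_int x \<Longrightarrow> algebraic_int y \<Longrightarrow> algebraic_int (x - y :: complex)"
  using algebraic_int_add[of x "- y"] by simp

lemma algebraic_int_power: "algebraic_int x \<Longrightarrow> algebraic_int (x ^ n :: complex)"
  by (induction n) (auto intro: algebraic_int_mult)

lemma algebraic_int_sum: "(\<And>i. i \<in> I \<Longrightarrow> algebraic_int (g i)) \<Longrightarrow> algebraic_int (sum g I :: complex)"
  by (induction I rule: infinite_finite_induct) (auto intro: algebraic_int_add)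

lemma algebraic_int_prod: "(\<And>i. i \<in> I \<Longrightarrow> algebraic_int (g i)) \<Longrightarrow> algebraic_int (prod g I :: complex)"
  by (induction I rule: infinite_finite_induct) (auto intro: algebraic_int_mult)

text \<open>Transitivity of integrality: a group preserved by all coefficients is enlarged by the
  powers of \<open>x\<close> below the degree.\<close>

lemma algebraic_int_monic_root:
  fixes P :: "complex poly"
  assumes "lead_coeff P = 1" "\<And>i. algebraic_int (coeff P i)" "poly P x = 0"
  shows "algebraic_int x"
proof -
  define n where "n = Polynomial.degree P"
  have n: "x ^ n = (\<Sum>i<n. - coeff P i * x ^ i)" "0 < n"
    using monic_root_power[OF assms(1,3)] by (simp_all add: n_def)
  obtain V where V: "finite V" "1 \<in> V" "\<forall>i<n. acts_on (- coeff P i) V"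
    using common_module[of "(\<lambda>i. - coeff P i) ` {..<n}"] assms(2) by auto
  define V' where "V' = (\<lambda>(j, v). x ^ j * v) ` ({..<n} \<times> V)"
  have V': "1 \<in> V'" "finite V'"
    unfolding V'_def using V n by (auto intro!: image_eqI[of _ _ "(0, 1)"])
  have "acts_on x V'"
    using acts_on_extension(1)[OF V(1) _ n(1)] V(3) unfolding V'_def by blast
  then show ?thesis
    using algebraic_int_of_acts_on[OF V'(2,1)] by simp
qed

text \<open>Kronecker's observation: the coefficients of \<open>P / (X - x)\<close> are algebraic integers, although \<open>x\<close>
  need not be one.\<close>

lemma algebraic_int_horner:
  fixes P :: "int poly"
  assumes P: "poly (map_poly of_int P) x = (0 :: complex)" and j: "j < Polynomial.degree P"
  defines "m \<equiv> Polynomial.degree P"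
  shows "algebraic_int (\<Sum>i\<le>j. of_int (coeff P (m - j + i)) * x ^ i)" (is "algebraic_int ?b")
proof (rule algebraic_int_of_acts_on)
  let ?V = "(\<lambda>i. x ^ i) ` {..<m}"
  show fin: "finite ?V"
    by simp
  show "1 \<in> ?V" "(1::complex) \<noteq> 0"
    using j by (auto simp: m_def intro!: image_eqI[of _ _ 0])
  have pw: "x ^ i \<in> Zspan ?V" if "i < m" for i
    using that by (intro Zspan_base[OF fin]) auto
  show "acts_on ?b ?V"
    unfolding acts_on_def
  proof
    fix v assume "v \<in> ?V"
    then obtain i where i: "i < m" "v = x ^ i"
      by auto
    show "?b * v \<in> Zspan ?V"
    proof (cases "i + j < m")
      case True
      have "?b * v = (\<Sum>l\<le>j. of_int (coeff P (m - j + l)) * x ^ (l + i))"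
        unfolding i sum_distrib_right by (simp add: power_add mult_ac)
      also have "\<dots> \<in> Zspan ?V"
        using True by (intro Zspan_sum Zspan_of_int_mult pw) auto
      finally show ?thesis .
    next
      case False
      \<comment> \<open>Once \<open>i + j\<close> reaches \<open>m\<close>, the relation
        \<open>P(x) = 0\<close> replaces \<open>?b * x ^ (m - j)\<close>, the upper part of the sum,
        by minus the lower part, after which all powers stay below \<open>m\<close>.\<close>
      have split: "{..m} = {..<m - j} \<union> {m - j..m}"
        using j by (auto simp: m_def)
      have "0 = (\<Sum>l\<le>m. of_int (coeff P l) * x ^ l)"
        using P by (simp add: poly_altdef m_def)
      also have "\<dots> = (\<Sum>l<m - j. of_int (coeff P l) * x ^ l) + (\<Sum>l\<in>{m - j..m}. of_int (coeff P l) * x ^ l)"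
        unfolding split by (rule sum.union_disjoint) auto
      also have "(\<Sum>l\<in>{m - j..m}. of_int (coeff P l) * x ^ l) = (\<Sum>l\<le>j. of_int (coeff P (m - j + l)) * x ^ (m - j + l))"
        using j by (intro sum.reindex_bij_witness[of _ "\<lambda>l. m - j + l" "\<lambda>l. l - (m - j)"]) (auto simp: m_def)
      also have "\<dots> = ?b * x ^ (m - j)"
        unfolding sum_distrib_right by (simp add: power_add mult_ac)
      finally have b: "?b * x ^ (m - j) = - (\<Sum>l<m - j. of_int (coeff P l) * x ^ l)"
        by (simp add: eq_neg_iff_add_eq_0 add.commute)
      have "v = x ^ (m - j) * x ^ (i - (m - j))"
        using False i by (simp flip: power_add)
      then have "?b * v = - (\<Sum>l<m - j. of_int (coeff P l) * x ^ l) * x ^ (i - (m - j))"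
        unfolding b[symmetric] by (simp add: mult_ac)
      also have "\<dots> = (\<Sum>l<m - j. of_int (- coeff P l) * x ^ (l + (i - (m - j))))"
        unfolding sum_negf[symmetric] sum_distrib_right by (simp add: power_add mult_ac)
      also have "\<dots> \<in> Zspan ?V"
        using False i by (intro Zspan_sum Zspan_of_int_mult pw) auto
      finally show ?thesis .
    qed
  qed
qed

section \<open>Approximation by algebraic integers\<close>

lemma number_field_algebraic:
  assumes "number_field F" "x \<in> F"
  shows "algebraic x"
proof -
  interpret C: field \<C> by (rule field_C)
  have "C.algebraic \<rat> x"
    using C.finite_dimension_imp_algebraic[OF subfield_Rats, of F x] assms subfieldE(1)[of F \<C>]
    by (simp add: number_field_def over_def)
  then obtain I where I: "I \<in> carrier (univ_poly \<C> \<rat>)" "hd I = 1" "C.eval I x = 0" "I \<noteq> []"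
    using C.IrrE[OF subfield_Rats, of x] by (auto simp: over_def ring_irreducible_def univ_poly_zero)
  have Q: "set I \<subseteq> \<rat>"
    using I by (auto simp: univ_poly_def polynomial_def)
  show ?thesis
  proof (rule algebraicI')
    show "poly (Poly (rev I)) x = 0"
      using I by (simp add: eval_C)
    show "coeff (Poly (rev I)) i \<in> \<rat>" for i
      using Q by (auto simp: coeff_Poly_eq nth_default_def rev_nth subset_iff)
    show "Poly (rev I) \<noteq> 0"
    proof
      assume "Poly (rev I) = 0"
      then have "coeff (Poly (rev I)) (length I - 1) = 0"
        by simp
      then show False
        using I by (simp add: coeff_Poly_eq nth_default_def rev_nth hd_conv_nth)
    qed
  qed
qed

lemma primitive_root_polynomial:
  assumes "algebraic (x::complex)"
  shows "\<exists>P. P \<noteq> 0 \<and> poly (map_poly of_int P) x = 0 \<and> content P = 1"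
proof -
  obtain Q where Q: "Q \<noteq> 0" "poly (map_poly of_int Q) x = 0"
    using algebraicE'[OF assms] by blast
  have "Q = smult (content Q) (primitive_part Q)"
    by simp
  then have "poly (map_poly of_int (smult (content Q) (primitive_part Q))) x = 0"
    using Q by simp
  then have "of_int (content Q) * poly (map_poly of_int (primitive_part Q)) x = 0"
    unfolding of_int_hom.map_poly_hom_smult poly_smult .
  then have "poly (map_poly of_int (primitive_part Q)) x = 0"
    using Q by simp
  then show ?thesis
    using Q by (intro exI[of _ "primitive_part Q"]) simp
qed

section \<open>Density of algebraic integers and independence of places\<close>

context padic_subfield
begin

lemma number_field_F: "number_field F"
  using sf fin_dim by (simp add: number_field_def)

lemma w_of_int_less_1: "w (of_int m) < 1 \<Longrightarrow> int p dvd m"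
  using p_gt_1 by (auto simp: w_of_int not_dvd_imp_multiplicity_0 split: if_splits intro: ccontr)

lemma w_prod: "(\<And>i. i \<in> I \<Longrightarrow> g i \<in> F) \<Longrightarrow> w (prod g I) = (\<Prod>i\<in>I. w (g i)) \<and> prod g I \<in> F"
  by (induction I rule: infinite_finite_induct) (simp_all add: w_mult)

text \<open>Two powers of the unit \<open>z\<close> share a class modulo \<open>p ^ k\<close>
  because there are finitely many classes; cancelling the smaller one gives \<open>N\<close>, and
  multiples of \<open>N\<close> inherit the congruence.\<close>

lemma unit_power:
  assumes z: "z \<in> F" "w z = 1"
  shows "\<exists>N>0. \<forall>l. w (z ^ (N * l) - 1) \<le> 1 / real p ^ k"
proof -
  obtain cl :: "complex \<Rightarrow> (nat \<Rightarrow> complex) set" where cl: "finite (cl ` {x \<in> F. w x \<le> 1})"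
    "\<And>x y. \<lbrakk>x \<in> F; y \<in> F; w x \<le> 1; w y \<le> 1; cl x = cl y\<rbrakk> \<Longrightarrow> w (x - y) \<le> 1 / real p ^ k"
    using integral_residue_classes[of k] by metis
  have z1: "z ^ i \<in> F" "w (z ^ i) = 1" for i
    using z by (simp_all add: w_power)
  have "range (\<lambda>i. cl (z ^ i)) \<subseteq> cl ` {x \<in> F. w x \<le> 1}"
    using z1 by auto
  then have "finite (range (\<lambda>i. cl (z ^ i)))"
    using cl(1) finite_subset by blast
  then have "\<not> inj (\<lambda>i. cl (z ^ i))"
    using finite_imageD infinite_UNIV_nat by blast
  then obtain i j where ij: "i < j" "cl (z ^ j) = cl (z ^ i)"
    unfolding inj_def by (metis linorder_neqE_nat)
  define N where "N = j - i"
  have "w (z ^ j - z ^ i) \<le> 1 / real p ^ k"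
    using cl(2)[of "z ^ j" "z ^ i"] z1 ij by simp
  moreover have "z ^ j - z ^ i = z ^ i * (z ^ N - 1)"
    using ij by (simp add: N_def algebra_simps flip: power_add)
  ultimately have N: "w (z ^ N - 1) \<le> 1 / real p ^ k"
    using z1 by (simp add: w_mult)
  have "w (z ^ (N * l) - 1) \<le> 1 / real p ^ k" for l
  proof (induction l)
    case (Suc l)
    have "z ^ (N * Suc l) - 1 = z ^ N * (z ^ (N * l) - 1) + (z ^ N - 1)"
      by (simp add: power_add algebra_simps)
    moreover have "w (z ^ N * (z ^ (N * l) - 1)) \<le> 1 / real p ^ k"
      using Suc z1 by (simp add: w_mult)
    ultimately show ?case
      using Suc w_add_max[OF F_mult[OF z1(1) F_diff[OF z1(1) F_1]] F_diff[OF z1(1) F_1], of N "N * l" N] N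
      by (simp only:)
  qed simp
  then show ?thesis
    using ij by (intro exI[of _ N]) (simp add: N_def)
qed

text \<open>The integers \<open>b j\<close> of \<open>algebraic_int_horner\<close> satisfy
  \<open>b (Suc j) = x * b j + c\<close> with \<open>c\<close> a coefficient of \<open>P\<close>. If
  none were a unit at \<open>w\<close>, the recursion would make all coefficients divisible by
  \<open>p\<close>, contradicting primitivity; a unit \<open>b j\<close> yields the
  quotient.\<close>

lemma integral_quotient:
  assumes x: "x \<in> F" "w x \<le> 1"
  shows "\<exists>a b. a \<in> F \<and> b \<in> F \<and> algebraic_int a \<and> algebraic_int b \<and> w b = 1 \<and> x * b = a"
proof -
  obtain P where P: "P \<noteq> 0" "poly (map_poly of_int P) x = 0" "content P = 1"
    using primitive_root_polynomial[OF number_field_algebraic[OF number_field_F x(1)]] by blast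
  define m where "m = Polynomial.degree P"
  define b where "b j = (\<Sum>i\<le>j. of_int (coeff P (m - j + i)) * x ^ i)" for j
  have bF: "b j \<in> F" for j
    using x by (auto simp: b_def)
  have rec: "b (Suc j) = x * b j + of_int (coeff P (m - Suc j))" if "j < m" for j
  proof -
    have "b (Suc j) = of_int (coeff P (m - Suc j)) + (\<Sum>i\<le>j. of_int (coeff P (m - Suc j + Suc i)) * x ^ Suc i)"
      unfolding b_def sum.atMost_Suc_shift by simp
    also have "(\<Sum>i\<le>j. of_int (coeff P (m - Suc j + Suc i)) * x ^ Suc i) = x * b j"
      unfolding b_def sum_distrib_left using that by (intro sum.cong) (auto simp: Suc_diff_Suc)
    finally show ?thesis
      by simp
  qed
  have int: "algebraic_int (b j)" if "j \<le> m" for j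
  proof (cases "j = m")
    case True
    then have "b j = 0"
      using P(2) by (simp add: b_def poly_altdef m_def)
    then show ?thesis
      by simp
  next
    case False
    then show ?thesis
      using algebraic_int_horner[OF P(2), of j] that by (simp add: b_def m_def)
  qed
  have "\<exists>j<m. w (b j) = 1"
  proof (rule ccontr)
    assume no: "\<not> ?thesis"
    have lt: "w (b j) < 1" if "j \<le> m" for j
    proof (cases "j = m")
      case True
      then have "b j = 0"
        using P(2) by (simp add: b_def poly_altdef m_def)
      then show ?thesis
        by simp
    next
      case False
      then show ?thesis
        using no that w_algebraic_int_le[OF bF int[OF that]] by (metis le_neq_implies_less less_eq_real_def)
    qed
    have "int p dvd coeff P i" for i
    proof (cases "i \<le> m")
      case le: True
      show ?thesis
      proof (cases "i = m")
        case True
        then show ?thesis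
          using lt[of 0] by (intro w_of_int_less_1) (simp add: b_def)
      next
        case False
        define j where "j = m - Suc i"
        have j: "j < m" "m - Suc j = i"
          using False le by (auto simp: j_def)
        have "of_int (coeff P i) = b (Suc j) - x * b j"
          using rec[OF j(1)] j(2) by simp
        moreover have "w (x * b j) < 1"
          using x bF lt[of j] j w_nonneg[OF x(1)] w_nonneg[OF bF[of j]] mult_left_le_one_le[of "w (b j)" "w x"]
          by (simp add: w_mult)
        ultimately have "w (of_int (coeff P i)) < 1"
          using w_diff_max[of "b (Suc j)" "x * b j"] lt[of "Suc j"] j x bF by simp
        then show ?thesis
          by (rule w_of_int_less_1)
      qed
    qed (simp add: m_def coeff_eq_0)
    then have "int p dvd content P"
      unfolding content_def by (intro gcd_list_greatest) (metis insertI2 range_coeff rangeE)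
    then show False
      using P(3) p_gt_1 by (simp add: zdvd1_eq)
  qed
  then obtain j where j: "j < m" "w (b j) = 1"
    by blast
  have "x * b j = b (Suc j) - of_int (coeff P (m - Suc j))"
    using rec[OF j(1)] by simp
  then show ?thesis
    using j int bF by (intro exI[of _ "b (Suc j) - of_int (coeff P (m - Suc j))"] exI[of _ "b j"])
      (auto intro!: algebraic_int_diff)
qed

text \<open>With \<open>x = a / b\<close> and \<open>b ^ N\<close> close to 1, the integer
  \<open>b ^ (N - 1)\<close> is an approximate inverse of \<open>b\<close>.\<close>

lemma algebraic_int_dense:
  assumes x: "x \<in> F" "w x \<le> 1"
  shows "\<exists>a\<in>F. algebraic_int a \<and> w (x - a) \<le> 1 / real p ^ k"
proof -
  obtain a b where ab: "a \<in> F" "b \<in> F" "algebraic_int a" "algebraic_int b" "w b = 1" "x * b = a"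
    using integral_quotient[OF x] by blast
  obtain N where N: "N > 0" "\<And>l. w (b ^ (N * l) - 1) \<le> 1 / real p ^ k"
    using unit_power[OF ab(2,5)] by blast
  have "b ^ N = b * b ^ (N - 1)"
    using N(1) by (cases N) auto
  then have "x - a * b ^ (N - 1) = - (x * (b ^ N - 1))"
    using ab(6) by (simp add: algebra_simps)
  then have "w (x - a * b ^ (N - 1)) = w x * w (b ^ N - 1)"
    using x ab by (simp add: w_uminus w_mult)
  also have "\<dots> \<le> 1 * (1 / real p ^ k)"
    using N(2)[of 1] x ab w_nonneg by (intro mult_mono) auto
  finally show ?thesis
    using ab by (intro bexI[of _ "a * b ^ (N - 1)"]) (auto intro: algebraic_int_mult algebraic_int_power)
qed

text \<open>Comparing \<open>x ^ n\<close> with powers of \<open>p\<close> recovers the absolute value from its valuation ring.\<close>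

lemma abs_le_of_integral:
  assumes w': "padic_subfield F w' p" and le: "\<And>x. x \<in> F \<Longrightarrow> w x \<le> 1 \<Longrightarrow> w' x \<le> 1"
    and x: "x \<in> F"
  shows "w' x \<le> w x"
proof (rule ccontr)
  interpret w': padic_subfield F w' p by fact
  assume "\<not> w' x \<le> w x"
  then have lt: "w x < w' x" by simp
  then have x0: "x \<noteq> 0"
    by auto
  then have pos: "0 < w x"
    using x w_nonneg[of x] w_eq_0[of x] by linarith
  then obtain b where b: "real p < (w' x / w x) ^ b"
    using real_arch_pow[of "w' x / w x" "real p"] lt by auto
  \<comment> \<open>\<open>p powr a\<close> is the least integral power of \<open>p\<close> strictly
    above \<open>w x ^ b\<close>. As \<open>b\<close> opened a gap larger than \<open>p\<close>, it
    is still below \<open>w' x ^ b\<close>, so \<open>x ^ b\<close> times an element of value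
    \<open>p powr (- a)\<close> separates the valuation rings.\<close>
  define a where "a = \<lfloor>log p (w x ^ b)\<rfloor> + 1"
  have P: "real p powr log p (w x ^ b) = w x ^ b"
    using p_gt_1 pos by simp
  have "log p (w x ^ b) < of_int a" "of_int a \<le> log p (w x ^ b) + 1"
    unfolding a_def by linarith+
  then have "real p powr log p (w x ^ b) < p powr a" "p powr a \<le> p powr (log p (w x ^ b) + 1)"
    using p_gt_1 by simp_all
  then have 1: "w x ^ b < p powr a" and 2: "p powr a \<le> w x ^ b * p"
    using p_gt_1 P by (simp_all add: powr_add)
  have 3: "w x ^ b * p < w' x ^ b"
    using b pos by (simp add: power_divide less_divide_eq mult.commute)
  define q where "q = (if 0 \<le> a then of_nat p ^ nat a else inverse (of_nat p ^ nat (- a)) :: complex)"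
  have q: "q \<in> F" "w q = p powr (- a)" "w' q = p powr (- a)"
    using p_gt_1 by (simp_all add: q_def w_power w'.w_power w_inverse w'.w_inverse w_p w'.w_p powr_minus powr_realpow power_inverse divide_inverse flip: powr_realpow)
  have "w (x ^ b * q) \<le> 1"
    using 1 q x p_gt_1 by (simp add: w_mult w_power powr_minus divide_inverse[symmetric] divide_le_eq)
  then have "w' (x ^ b * q) \<le> 1"
    using le q x by simp
  then have "w' x ^ b \<le> p powr a"
    using q x p_gt_1 by (simp add: w'.w_mult w'.w_power powr_minus divide_inverse[symmetric] divide_le_eq)
  then show False
    using 2 3 by simp
qed

text \<open>Different primes are separated by \<open>p'\<close>. For the same prime, inclusion of
  valuation rings would force equality of the absolute values, so some \<open>x\<close> is integral
  at \<open>w\<close> and not at \<open>w'\<close>; its denominator from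
  \<open>integral_quotient\<close> is a unit at \<open>w\<close> and must be small at
  \<open>w'\<close>.\<close>

lemma separating_integer:
  assumes w': "padic_subfield F w' p'" and ext: "w \<in> extensional F" "w' \<in> extensional F" and ne: "w \<noteq> w'"
  shows "\<exists>e\<in>F. algebraic_int e \<and> w e = 1 \<and> w' e < 1"
proof (cases "p = p'")
  case False
  interpret w': padic_subfield F w' p' by fact
  have "\<not> p dvd p'"
    using False prime_p w'.prime_p primes_dvd_imp_eq by blast
  then have "w (of_nat p') = 1"
    using w_of_int[of "int p'"] w'.p_gt_1 by (simp add: not_dvd_imp_multiplicity_0)
  moreover have "w' (of_nat p') < 1"
    using w'.p_gt_1 by (simp add: w'.w_p)
  ultimately show ?thesis
    by (intro bexI[of _ "of_nat p'"]) auto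
next
  case True
  interpret w': padic_subfield F w' p
    using w' True by simp
  have "\<exists>x\<in>F. w x \<le> 1 \<and> 1 < w' x"
  proof (rule ccontr)
    assume "\<not> ?thesis"
    then have le: "w' x \<le> w x" if "x \<in> F" for x
      using abs_le_of_integral[OF w'.padic_subfield_axioms _ that] by force
    have "w x = w' x" if "x \<in> F" for x
    proof (rule antisym)
      show "w x \<le> w' x"
      proof (cases "x = 0")
        case False
        then have "inverse (w' x) \<le> inverse (w x)" "0 < w x" "0 < w' x"
          using le[of "inverse x"] that w_nonneg[OF that] w_eq_0[OF that] w'.w_nonneg[OF that] w'.w_eq_0[OF that]
          by (auto simp: w_inverse w'.w_inverse order_less_le)
        then show ?thesis
          by simp
      qed simp
    qed (rule le[OF that])
    then show False
      using ne extensionalityI[OF ext] by blast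
  qed
  then obtain x where x: "x \<in> F" "w x \<le> 1" "1 < w' x"
    by blast
  obtain a b where ab: "a \<in> F" "b \<in> F" "algebraic_int a" "algebraic_int b" "w b = 1" "x * b = a"
    using integral_quotient[OF x(1,2)] by blast
  have "w' x * w' b \<le> 1"
    using w'.w_algebraic_int_le[OF ab(1,3)] x ab by (simp flip: w'.w_mult)
  then have "w' b < 1"
    using x(3) by (smt (verit) mult_le_cancel_right1 mult_less_cancel_right1 w'.w_nonneg ab(2))
  then show ?thesis
    using ab by blast
qed

end

text \<open>Weak approximation by integers. The product \<open>E v\<close> of separating integers is
  a unit at \<open>v\<close> and small elsewhere; a high power with exponent divisible by
  \<open>N v\<close> is close to 1 at \<open>v\<close> and to 0 at the other places, and such powers
  glue the local solutions \<open>a v\<close>.\<close>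

theorem integral_approximation:
  assumes S: "finite S" "S \<subseteq> extensional K" "\<And>v. v \<in> S \<Longrightarrow> padic_subfield K v (p v)"
    and b: "\<And>v. v \<in> S \<Longrightarrow> b v \<in> K" "\<And>v. v \<in> S \<Longrightarrow> v (b v) \<le> 1"
    and \<eta>: "0 < \<eta>" and K: "complex_subfield K"
  shows "\<exists>x\<in>K. algebraic_int x \<and> (\<forall>v\<in>S. v (x - b v) \<le> \<eta>)"
proof -
  interpret complex_subfield K by (rule K)
  have small: "\<exists>k. 1 / real (p v) ^ k \<le> \<eta>" if "v \<in> S" for v
  proof -
    interpret padic_subfield K v "p v" by (rule S(3)[OF that])
    have "inverse (real (p v)) < 1"
      using p_gt_1 by (simp add: inverse_less_1_iff)
    then obtain k where "inverse (real (p v)) ^ k < \<eta>"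
      using real_arch_pow_inv[OF \<eta>] by blast
    then show ?thesis
      by (intro exI[of _ k]) (simp add: power_inverse divide_inverse)
  qed
  have "\<forall>v\<in>S. \<forall>v'\<in>S - {v}. \<exists>e\<in>K. algebraic_int e \<and> v e = 1 \<and> v' e < 1"
    using padic_subfield.separating_integer[OF S(3) S(3)] S(2) by blast
  then obtain e where e: "\<And>v v'. v \<in> S \<Longrightarrow> v' \<in> S - {v} \<Longrightarrow> e v v' \<in> K \<and> algebraic_int (e v v') \<and> v (e v v') = 1 \<and> v' (e v v') < 1"
    by metis
  define E where "E v = (\<Prod>v'\<in>S - {v}. e v v')" for v
  have E: "E v \<in> K \<and> algebraic_int (E v) \<and> v (E v) = 1 \<and> (\<forall>v'\<in>S - {v}. v' (E v) < 1)" if v: "v \<in> S" for v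
  proof (intro conjI ballI)
    interpret padic_subfield K v "p v" by (rule S(3)[OF v])
    show "E v \<in> K" "v (E v) = 1"
      using w_prod[of "S - {v}" "e v"] e[OF v] by (simp_all add: E_def)
    show "algebraic_int (E v)"
      unfolding E_def using e[OF v] by (intro algebraic_int_prod) blast
    fix v' assume v': "v' \<in> S - {v}"
    then interpret v': padic_subfield K v' "p v'" by (intro S(3)) simp
    have "v' (E v) = (\<Prod>u\<in>S - {v}. v' (e v u))"
      unfolding E_def using v'.w_prod[of "S - {v}" "e v"] e[OF v] by blast
    also have "\<dots> = v' (e v v') * (\<Prod>u\<in>S - {v} - {v'}. v' (e v u))"
      using S(1) v' by (intro prod.remove) auto
    also have "\<dots> \<le> v' (e v v') * 1"
      using e[OF v] v' v'.w_nonneg v'.w_algebraic_int_le by (intro mult_left_mono prod_le_1) auto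
    also have "\<dots> < 1"
      using e[OF v v'] by simp
    finally show "v' (E v) < 1" .
  qed
  have "\<exists>a N. a \<in> K \<and> algebraic_int a \<and> v (b v - a) \<le> \<eta> \<and> 0 < N \<and> (\<forall>l. v (E v ^ (N * l) - 1) \<le> \<eta>)" if v: "v \<in> S" for v
  proof -
    interpret padic_subfield K v "p v" by (rule S(3)[OF v])
    obtain k where k: "1 / real (p v) ^ k \<le> \<eta>"
      using small[OF v] by blast
    obtain a where a: "a \<in> K" "algebraic_int a" "v (b v - a) \<le> 1 / real (p v) ^ k"
      using algebraic_int_dense[OF b[OF v], of k] by blast
    obtain N where N: "0 < N" "\<And>l. v (E v ^ (N * l) - 1) \<le> 1 / real (p v) ^ k"
      using unit_power[of "E v" k] E[OF v] by blast
    show ?thesis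
      using a N k order_trans by blast
  qed
  then obtain a N where aN: "\<And>v. v \<in> S \<Longrightarrow> a v \<in> K" "\<And>v. v \<in> S \<Longrightarrow> algebraic_int (a v)"
    "\<And>v. v \<in> S \<Longrightarrow> v (b v - a v) \<le> \<eta>" "\<And>v. v \<in> S \<Longrightarrow> 0 < N v" "\<And>v l. v \<in> S \<Longrightarrow> v (E v ^ (N v * l) - 1) \<le> \<eta>"
    by metis
  have "\<exists>l0. \<forall>l\<ge>l0. v' (E v ^ (N v * l)) \<le> \<eta>" if v: "v \<in> S" "v' \<in> S - {v}" for v v'
  proof -
    interpret v': padic_subfield K v' "p v'" using v by (intro S(3)) simp
    have E1: "E v \<in> K" "v' (E v) < 1" "0 \<le> v' (E v)"
      using E[OF v(1)] v v'.w_nonneg by auto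
    obtain l0 where l0: "v' (E v) ^ l0 < \<eta>"
      using real_arch_pow_inv[OF \<eta> E1(2)] by blast
    have "v' (E v ^ (N v * l)) \<le> \<eta>" if "l \<ge> l0" for l
    proof -
      have "1 * l \<le> N v * l"
        using aN(4)[OF v(1)] by (intro mult_right_mono) auto
      then have "l0 \<le> N v * l"
        using that by linarith
      then have "v' (E v) ^ (N v * l) \<le> v' (E v) ^ l0"
        using that E1 by (intro power_decreasing) auto
      then show ?thesis
        using l0 E1 by (simp add: v'.w_power)
    qed
    then show ?thesis by blast
  qed
  then obtain L where L: "\<And>v v' l. v \<in> S \<Longrightarrow> v' \<in> S - {v} \<Longrightarrow> l \<ge> L v v' \<Longrightarrow> v' (E v ^ (N v * l)) \<le> \<eta>"
    by metis
  \<comment> \<open>A single exponent above all the thresholds \<open>L v v'\<close>; closeness to 1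
    holds for every multiple of \<open>N v\<close> and is not disturbed.\<close>
  define l where "l = (\<Sum>v\<in>S. \<Sum>v'\<in>S. L v v')"
  have lL: "L v v' \<le> l" if "v \<in> S" "v' \<in> S" for v v'
  proof -
    have "L v v' \<le> (\<Sum>v'\<in>S. L v v')"
      using S(1) that by (intro member_le_sum) auto
    also have "\<dots> \<le> l"
      unfolding l_def using S(1) that by (intro member_le_sum[of v S "\<lambda>v. \<Sum>v'\<in>S. L v v'"]) auto
    finally show ?thesis .
  qed
  define U where "U v = E v ^ (N v * l)" for v
  define x where "x = (\<Sum>v\<in>S. U v * a v)"
  have U: "U v \<in> K" "algebraic_int (U v)" if "v \<in> S" for v
    using E[OF that] by (auto simp: U_def intro: algebraic_int_power)
  have "v (x - b v) \<le> \<eta>" if v: "v \<in> S" for v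
  proof -
    interpret padic_subfield K v "p v" by (rule S(3)[OF v])
    have "x = U v * a v + (\<Sum>v'\<in>S - {v}. U v' * a v')"
      unfolding x_def using S(1) v by (rule sum.remove)
    then have eq: "x - b v = ((U v - 1) * a v - (b v - a v)) + (\<Sum>v'\<in>S - {v}. U v' * a v')"
      by (simp add: algebra_simps)
    have le: "v (z * a v') \<le> \<eta>" if "v' \<in> S" "z \<in> K" "v z \<le> \<eta>" for z v'
    proof -
      have "v z * v (a v') \<le> \<eta> * 1"
        using that aN w_nonneg w_algebraic_int_le \<eta> by (intro mult_mono) auto
      then show ?thesis
        using that aN by (simp add: w_mult)
    qed
    have "v ((U v - 1) * a v - (b v - a v)) \<le> \<eta>"
    proof -
      have "v (U v - 1) \<le> \<eta>"
        unfolding U_def by (rule aN(5)[OF v])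
      then have "v ((U v - 1) * a v) \<le> \<eta>"
        using U v by (intro le) auto
      then show ?thesis
        using w_diff_max[of "(U v - 1) * a v" "b v - a v"] aN(1,3)[OF v] U(1)[OF v] b(1)[OF v] by simp
    qed
    moreover have "v (\<Sum>v'\<in>S - {v}. U v' * a v') \<le> \<eta>"
    proof (rule w_sum_max)
      fix v' assume v': "v' \<in> S - {v}"
      then show "U v' * a v' \<in> K"
        using U aN by simp
      have "v (U v') \<le> \<eta>"
        unfolding U_def using v v' lL by (intro L) auto
      then show "v (U v' * a v') \<le> \<eta>"
        using v' U by (intro le) auto
    qed (use \<eta> in simp)
    moreover have "(U v - 1) * a v - (b v - a v) \<in> K" "(\<Sum>v'\<in>S - {v}. U v' * a v') \<in> K"
      using U(1)[OF v] aN(1)[OF v] b(1)[OF v] by (auto intro!: F_sum F_mult U(1) aN(1))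
    ultimately show ?thesis
      unfolding eq using w_add_max[of "(U v - 1) * a v - (b v - a v)" "\<Sum>v'\<in>S - {v}. U v' * a v'"] by linarith
  qed
  moreover have "x \<in> K" "algebraic_int x"
    unfolding x_def using U aN by (auto intro!: algebraic_int_sum algebraic_int_mult)
  ultimately show ?thesis
    by blast
qed

section \<open>Norms of polynomials\<close>

lemma coeff_mult_of_degree_le:
  fixes p q :: "'a::comm_semiring_1 poly"
  assumes "Polynomial.degree p \<le> a" "Polynomial.degree q \<le> b"
  shows "coeff (p * q) (a + b) = coeff p a * coeff q b"
proof -
  have "coeff (p * q) (a + b) = (\<Sum>i\<le>a + b. coeff p i * coeff q (a + b - i))"
    by (simp add: coeff_mult)
  also have "\<dots> = (\<Sum>i\<le>a + b. if i = a then coeff p a * coeff q b else 0)"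
  proof (rule sum.cong)
    fix i
    have "coeff p i = 0 \<or> coeff q (a + b - i) = 0" if "i \<noteq> a"
    proof (cases "i < a")
      case True
      then have "coeff q (a + b - i) = 0"
        using assms(2) by (intro coeff_eq_0) linarith
      then show ?thesis ..
    next
      case False
      then have "coeff p i = 0"
        using assms(1) that by (intro coeff_eq_0) linarith
      then show ?thesis ..
    qed
    then show "coeff p i * coeff q (a + b - i) = (if i = a then coeff p a * coeff q b else 0)"
      by auto
  qed simp
  finally show ?thesis
    by simp
qed

lemma det_poly_degree:
  fixes A :: "'a::comm_ring_1 poly mat"
  assumes A: "A \<in> carrier_mat d d" and deg: "\<And>i j. i < d \<Longrightarrow> j < d \<Longrightarrow> Polynomial.degree (A $$ (i, j)) \<le> n"
  shows "Polynomial.degree (det A) \<le> d * n" "coeff (det A) (d * n) = det (map_mat (\<lambda>q. coeff q n) A)"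
proof -
  have prod: "Polynomial.degree (\<Prod>i\<in>I. A $$ (i, p i)) \<le> card I * n \<and>
      coeff (\<Prod>i\<in>I. A $$ (i, p i)) (card I * n) = (\<Prod>i\<in>I. coeff (A $$ (i, p i)) n)"
    if "finite I" "I \<subseteq> {0..<d}" "\<And>i. i \<in> I \<Longrightarrow> p i < d" for I p
    using that
  proof (induction I)
    case (insert i I)
    then have IH: "Polynomial.degree (\<Prod>i\<in>I. A $$ (i, p i)) \<le> card I * n"
      "coeff (\<Prod>i\<in>I. A $$ (i, p i)) (card I * n) = (\<Prod>i\<in>I. coeff (A $$ (i, p i)) n)"
      by auto
    have di: "Polynomial.degree (A $$ (i, p i)) \<le> n"
      using insert.prems by (intro deg) auto
    show ?case
      using insert.hyps IH di coeff_mult_of_degree_le[OF di IH(1)] degree_mult_le[of "A $$ (i, p i)" "\<Prod>i\<in>I. A $$ (i, p i)"]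
      by simp
  qed simp
  have sgn: "signof p * q = smult (signof p) q" for p :: "nat \<Rightarrow> nat" and q :: "'a poly"
    by (cases p rule: sign_cases) simp_all
  have each: "Polynomial.degree (\<Prod>i = 0..<d. A $$ (i, p i)) \<le> d * n"
    "coeff (\<Prod>i = 0..<d. A $$ (i, p i)) (d * n) = (\<Prod>i = 0..<d. coeff (A $$ (i, p i)) n)"
    if "p permutes {0..<d}" for p
    using prod[of "{0..<d}" p] permutes_in_image[OF that] by auto
  show "Polynomial.degree (det A) \<le> d * n"
    unfolding det_def'[OF A] sgn using each
    by (intro degree_sum_le) (auto intro: order_trans[OF degree_smult_le] finite_permutations)
  have "coeff (det A) (d * n) = (\<Sum>p | p permutes {0..<d}. signof p * (\<Prod>i = 0..<d. coeff (A $$ (i, p i)) n))"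
    unfolding det_def'[OF A] sgn using each by (simp add: coeff_sum)
  also have "\<dots> = det (map_mat (\<lambda>q. coeff q n) A)"
    unfolding det_def'[OF iffD2[OF map_carrier_mat A]]
  proof (intro sum.cong refl arg_cong2[where f = "(*)"] prod.cong)
    fix p i assume "p \<in> {p. p permutes {0..<d}}" "i \<in> {0..<d}"
    then have "i < d" "p i < d"
      using permutes_in_image[of p "{0..<d}" i] by auto
    then show "coeff (A $$ (i, p i)) n = map_mat (\<lambda>q. coeff q n) A $$ (i, p i)"
      using A by simp
  qed
  finally show "coeff (det A) (d * n) = det (map_mat (\<lambda>q. coeff q n) A)" .
qed

section \<open>Coefficient norm and Mahler measure\<close>

interpretation of_rat_real_poly_hom: map_poly_inj_idom_hom "of_rat :: rat \<Rightarrow> real" ..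

text \<open>The sum of the absolute values of the coefficients; its submultiplicativity makes it
  suitable for estimating a determinant of polynomials.\<close>

definition rnorm :: "rat poly \<Rightarrow> real" where
  "rnorm q = wnorm 1 (map_poly of_rat q)"

lemma rnorm_nonneg: "0 \<le> rnorm q"
  by (simp add: rnorm_def wnorm_nonneg)

lemma rnorm_add: "rnorm (p + q) \<le> rnorm p + rnorm q"
  by (simp add: rnorm_def of_rat_real_poly_hom.hom_add wnorm_add)

lemma rnorm_mult: "rnorm (p * q) \<le> rnorm p * rnorm q"
  by (simp add: rnorm_def of_rat_real_poly_hom.hom_mult wnorm_mult)

lemma rnorm_0 [simp]: "rnorm 0 = 0"
  by (simp add: rnorm_def)

lemma rnorm_1 [simp]: "rnorm 1 = 1"
  by (simp add: rnorm_def wnorm_def)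

lemma rnorm_uminus: "rnorm (- q) = rnorm q"
  by (simp add: rnorm_def of_rat_real_poly_hom.hom_uminus wnorm_uminus)

lemma rnorm_sum: "rnorm (sum g I) \<le> (\<Sum>i\<in>I. rnorm (g i))"
  by (induction I rule: infinite_finite_induct) (auto intro: order_trans[OF rnorm_add])

lemma rnorm_prod_le:
  assumes "\<And>i. i \<in> I \<Longrightarrow> rnorm (g i) \<le> C"
  shows "rnorm (prod g I) \<le> C ^ card I"
  using assms
proof (induction I rule: infinite_finite_induct)
  case (insert i I)
  have "rnorm (g i) \<le> C"
    using insert.prems by blast
  then have "rnorm (g i) * rnorm (prod g I) \<le> C * C ^ card I"
    using insert order_trans[OF rnorm_nonneg] by (intro mult_mono rnorm_nonneg) auto
  then show ?case
    using insert.hyps rnorm_mult[of "g i" "prod g I"] by simp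
qed simp_all

lemma rnorm_le:
  assumes "Polynomial.degree q \<le> n"
  shows "rnorm q \<le> (\<Sum>j\<le>n. \<bar>of_rat (coeff q j)\<bar>)"
proof -
  have "rnorm q = (\<Sum>j\<le>Polynomial.degree q. \<bar>of_rat (coeff q j)\<bar>)"
    by (simp add: rnorm_def wnorm_def)
  also have "\<dots> \<le> (\<Sum>j\<le>n. \<bar>of_rat (coeff q j)\<bar>)"
    using assms by (intro sum_mono2) auto
  finally show ?thesis .
qed

lemma rnorm_det_le:
  assumes A: "A \<in> carrier_mat d d" and C: "\<And>i j. i < d \<Longrightarrow> j < d \<Longrightarrow> rnorm (A $$ (i, j)) \<le> C"
  shows "rnorm (det A) \<le> fact d * C ^ d"
proof -
  have "rnorm (det A) \<le> (\<Sum>p | p permutes {0..<d}. rnorm (signof p * (\<Prod>i = 0..<d. A $$ (i, p i))))"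
    unfolding det_def'[OF A] by (rule rnorm_sum)
  also have "\<dots> \<le> (\<Sum>p | p permutes {0..<d}. C ^ d)"
  proof (rule sum_mono)
    fix p assume p: "p \<in> {p. p permutes {0..<d}}"
    have "rnorm (signof p * (\<Prod>i = 0..<d. A $$ (i, p i))) = rnorm (\<Prod>i = 0..<d. A $$ (i, p i))"
      by (cases p rule: sign_cases) (simp_all add: rnorm_uminus)
    also have "\<dots> \<le> C ^ card {0..<d}"
      using p permutes_in_image[of p "{0..<d}"] by (intro rnorm_prod_le C) auto
    finally show "rnorm (signof p * (\<Prod>i = 0..<d. A $$ (i, p i))) \<le> C ^ d"
      by simp
  qed
  also have "\<dots> = fact d * C ^ d"
    by (simp add: card_permutations[OF refl])
  finally show ?thesis .
qed

lemma cmod_of_rat: "cmod (of_rat r) = \<bar>of_rat r\<bar>"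
  by (simp flip: of_real_of_rat)

text \<open>Landau's inequality bounds the measure by the Euclidean norm of the coefficients, which
  is at most their absolute sum.\<close>

lemma mahler_le_rnorm: "mahler_measure_poly (map_poly of_rat q) \<le> rnorm q"
proof -
  have l2: "(\<Sum>a\<leftarrow>xs. (cmod a)\<^sup>2) \<le> (\<Sum>a\<leftarrow>xs. cmod a)\<^sup>2 \<and> 0 \<le> (\<Sum>a\<leftarrow>xs. cmod a)" for xs
  proof (induction xs)
    case (Cons a xs)
    have "0 \<le> 2 * cmod a * (\<Sum>a\<leftarrow>xs. cmod a)"
      using Cons by simp
    then show ?case
      using Cons norm_ge_zero[of a] by (simp only: list.map sum_list.Cons power2_sum) linarith
  qed simp
  let ?q = "map_poly of_rat q :: complex poly"
  have "mahler_measure_poly ?q \<le> sqrt (\<Sum>a\<leftarrow>coeffs ?q. (cmod a)\<^sup>2)"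
    by (rule Landau_inequality)
  also have "\<dots> \<le> (\<Sum>a\<leftarrow>coeffs ?q. cmod a)"
    using l2[of "coeffs ?q"] by (intro real_le_lsqrt) auto
  also have "\<dots> = rnorm q"
  proof (cases "q = 0")
    case False
    then have "(\<Sum>a\<leftarrow>coeffs ?q. cmod a) = (\<Sum>j\<leftarrow>[0..<Suc (Polynomial.degree q)]. \<bar>of_rat (coeff q j)\<bar>)"
      by (simp add: coeffs_def o_def cmod_of_rat del: coeffs_map_poly upt_Suc)
    also have "\<dots> = (\<Sum>j\<in>{0..<Suc (Polynomial.degree q)}. \<bar>of_rat (coeff q j)\<bar>)"
      by (simp only: sum_list_distinct_conv_sum_set distinct_upt set_upt)
    also have "\<dots> = rnorm q"
      by (simp add: rnorm_def wnorm_def atLeast0AtMost atLeastLessThanSuc_atLeastAtMost)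
    finally show ?thesis .
  qed simp
  finally show ?thesis .
qed

text \<open>Both the logarithmic Mahler measure and the degree are additive over a monic
  factorization, so the ratio for the product is a weighted mean and one factor does not exceed
  it.\<close>

lemma good_factor:
  fixes F :: "rat poly"
  assumes "lead_coeff F = 1" "0 < Polynomial.degree F"
  shows "\<exists>P. Factorial_Ring.irreducible P \<and> lead_coeff P = 1 \<and> P dvd F \<and>
    ln (mahler_measure_poly (map_poly of_rat P)) / Polynomial.degree P
      \<le> ln (mahler_measure_poly (map_poly of_rat F)) / Polynomial.degree F"
  using assms
proof (induction "Polynomial.degree F" arbitrary: F rule: less_induct)
  case less
  let ?M = "\<lambda>q::rat poly. mahler_measure_poly (map_poly of_rat q)"
  show ?case
  proof (cases "Factorial_Ring.irreducible F")
    case True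
    then show ?thesis
      using less.prems(1) by (intro exI[of _ F] conjI order_refl dvd_refl)
  next
    case False
    have F0: "F \<noteq> 0" "\<not> is_unit F"
      using less.prems by (auto simp: is_unit_iff_degree)
    then obtain G0 H0 where GH0: "F = G0 * H0" "\<not> is_unit G0" "\<not> is_unit H0"
      using False unfolding Factorial_Ring.irreducible_def by blast
    have nz: "G0 \<noteq> 0" "H0 \<noteq> 0"
      using GH0(1) F0 by auto
    then have dpos: "0 < Polynomial.degree G0" "0 < Polynomial.degree H0"
      using GH0 by (simp_all add: is_unit_iff_degree)
    define c where "c = lead_coeff G0"
    define G H where "G = smult (1 / c) G0" and "H = smult c H0"
    have c: "c \<noteq> 0"
      using nz by (simp add: c_def)
    have F: "F = G * H"
      using c by (simp add: G_def H_def GH0)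
    have G: "lead_coeff G = 1"
      using c by (simp add: G_def c_def)
    then have H: "lead_coeff H = 1"
      using less.prems(1) by (simp add: F lead_coeff_mult)
    have sum: "Polynomial.degree F = Polynomial.degree G + Polynomial.degree H"
      using nz c by (simp add: G_def H_def GH0(1) degree_mult_eq)
    have pos: "0 < Polynomial.degree G" "0 < Polynomial.degree H"
      using dpos c by (simp_all add: G_def H_def)
    then have deg: "Polynomial.degree G < Polynomial.degree F" "Polynomial.degree H < Polynomial.degree F"
      using sum by simp_all
    have M1: "1 \<le> ?M Q" if "lead_coeff Q = 1" for Q :: "rat poly"
    proof -
      have "0 \<le> ln (?M Q)"
        using sum_roots_le_mahler[of "map_poly of_rat Q" "{}"] that by simp
      moreover have "?M Q = mahler_measure_monic (map_poly of_rat Q)"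
        using that by (simp add: mahler_measure_poly_via_monic)
      ultimately show ?thesis
        using mahler_measure_monic_ge_1 by simp
    qed
    have "?M F = ?M G * ?M H"
      unfolding F of_rat_poly_hom.hom_mult by (rule measure_eq_prod)
    then have lnF: "ln (?M F) = ln (?M G) + ln (?M H)"
      using M1[OF G] M1[OF H] by (simp add: ln_mult_pos)
    have "ln (?M G) / Polynomial.degree G \<le> ln (?M F) / Polynomial.degree F \<or>
        ln (?M H) / Polynomial.degree H \<le> ln (?M F) / Polynomial.degree F"
    proof (rule ccontr)
      assume "\<not> ?thesis"
      then have "ln (?M F) / Polynomial.degree F < ln (?M G) / Polynomial.degree G"
        "ln (?M F) / Polynomial.degree F < ln (?M H) / Polynomial.degree H"
        by auto
      then have "ln (?M F) / Polynomial.degree F * Polynomial.degree G < ln (?M G)"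
        "ln (?M F) / Polynomial.degree F * Polynomial.degree H < ln (?M H)"
        using pos by (simp_all add: pos_less_divide_eq)
      then have "ln (?M F) / Polynomial.degree F * (Polynomial.degree G + Polynomial.degree H) < ln (?M F)"
        unfolding lnF by (simp add: ring_distribs)
      then show False
        using less.prems(2) unfolding sum[symmetric] by simp
    qed
    then show ?thesis
    proof
      assume le: "ln (?M G) / Polynomial.degree G \<le> ln (?M F) / Polynomial.degree F"
      obtain P where P: "Factorial_Ring.irreducible P" "lead_coeff P = 1" "P dvd G"
        "ln (?M P) / Polynomial.degree P \<le> ln (?M G) / Polynomial.degree G"
        using less.hyps[OF deg(1) G pos(1)] by blast
      then show ?thesis
        using le F by (intro exI[of _ P]) (simp add: dvd_mult2)
    next
      assume le: "ln (?M H) / Polynomial.degree H \<le> ln (?M F) / Polynomial.degree F"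
      obtain P where P: "Factorial_Ring.irreducible P" "lead_coeff P = 1" "P dvd H"
        "ln (?M P) / Polynomial.degree P \<le> ln (?M H) / Polynomial.degree H"
        using less.hyps[OF deg(2) H pos(2)] by blast
      then show ?thesis
        using le F by (intro exI[of _ P]) (simp add: dvd_mult)
    qed
  qed
qed

section \<open>The norm from K[X] to the rational polynomials\<close>

context complex_subfield
begin

lemma coeff_mult_F:
  "(\<And>i. coeff p i \<in> F) \<Longrightarrow> (\<And>i. coeff q i \<in> F) \<Longrightarrow> coeff (p * q) i \<in> F"
  by (simp add: coeff_mult)

text \<open>Euclid's algorithm with all coefficients kept in \<open>F\<close>; at its end the
  fundamental theorem of algebra turns the absence of a common root into a nonzero constant. The
  measure uses lengths of coefficient lists because, unlike degrees, they distinguish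
  \<open>0\<close> from a nonzero constant.\<close>

lemma bezout_no_common_root:
  assumes "\<And>i. coeff p i \<in> F" "\<And>i. coeff q i \<in> F" "\<And>z. \<not> (poly p z = 0 \<and> poly q z = 0)"
  shows "\<exists>a b. (\<forall>i. coeff a i \<in> F) \<and> (\<forall>i. coeff b i \<in> F) \<and> a * p + b * q = 1"
  using assms
proof (induction "length (coeffs p) + length (coeffs q)" arbitrary: p q rule: less_induct)
  case less
  have const: "\<exists>a. (\<forall>i. coeff a i \<in> F) \<and> a * p = 1"
    if p: "\<And>i. coeff p i \<in> F" "\<And>z. poly p z \<noteq> 0" for p
  proof -
    have "constant (poly p)"
      using fundamental_theorem_of_algebra[of p] p(2) by blast
    then have "Polynomial.degree p = 0"
      by (simp add: constant_degree)
    then obtain c where c: "p = [:c:]"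
      using degree_eq_zeroE by blast
    have "c \<noteq> 0" "c \<in> F"
      using p(2)[of 0] p(1)[of 0] c by auto
    then show ?thesis
      using c by (intro exI[of _ "[:inverse c:]"]) (auto simp: coeff_pCons split: nat.splits)
  qed
  show ?case
  proof (cases "p = 0 \<or> q = 0")
    case True
    then show ?thesis
    proof
      assume "p = 0"
      then obtain b where "\<forall>i. coeff b i \<in> F" "b * q = 1"
        using const[of q] less.prems by auto
      then show ?thesis
        using \<open>p = 0\<close> by (intro exI[of _ 0] exI[of _ b]) auto
    next
      assume "q = 0"
      then obtain b where "\<forall>i. coeff b i \<in> F" "b * p = 1"
        using const[of p] less.prems by auto
      then show ?thesis
        using \<open>q = 0\<close> by (intro exI[of _ b] exI[of _ 0]) auto
    qed
  next
    case False
    have reduce: "\<exists>t. (\<forall>i. coeff t i \<in> F) \<and> length (coeffs (p - t * q)) < length (coeffs p)"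
      if pq: "\<And>i. coeff p i \<in> F" "\<And>i. coeff q i \<in> F" "p \<noteq> 0" "q \<noteq> 0" "Polynomial.degree q \<le> Polynomial.degree p" for p q
    proof -
      define c k where "c = lead_coeff p / lead_coeff q" and "k = Polynomial.degree p - Polynomial.degree q"
      define t where "t = monom c k"
      have c: "c \<in> F" "c \<noteq> 0"
        using pq by (simp_all add: c_def)
      have dt: "Polynomial.degree (t * q) = Polynomial.degree p"
        using c pq by (simp add: t_def k_def degree_mult_eq degree_monom_eq)
      have lt: "coeff (t * q) (Polynomial.degree p) = lead_coeff p"
        using lead_coeff_mult[of t q] c pq unfolding dt by (simp add: t_def degree_monom_eq c_def)
      have "Polynomial.degree (p - t * q) \<le> Polynomial.degree p"
        using dt by (intro degree_diff_le) simp_all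
      moreover have "coeff (p - t * q) (Polynomial.degree p) = 0"
        using lt by simp
      ultimately have "p - t * q = 0 \<or> Polynomial.degree (p - t * q) < Polynomial.degree p"
        by (metis leading_coeff_0_iff le_neq_implies_less)
      then have "length (coeffs (p - t * q)) < length (coeffs p)"
        using pq by (auto simp: length_coeffs_degree) (metis coeffs_eq_Nil length_coeffs_degree list.size(3) not_less_eq zero_less_Suc)
      moreover have "coeff t i \<in> F" for i
        using c by (simp add: t_def)
      ultimately show ?thesis
        by blast
    qed
    show ?thesis
    proof (cases "Polynomial.degree q \<le> Polynomial.degree p")
      case True
      obtain t where t: "\<And>i. coeff t i \<in> F" "length (coeffs (p - t * q)) < length (coeffs p)"
        using reduce[OF less.prems(1,2) _ _ True] False by blast
      have "\<exists>a b. (\<forall>i. coeff a i \<in> F) \<and> (\<forall>i. coeff b i \<in> F) \<and> a * (p - t * q) + b * q = 1"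
        using t less.prems coeff_mult_F[of t q] by (intro less.hyps) auto
      then obtain a b where ab: "\<And>i. coeff a i \<in> F" "\<And>i. coeff b i \<in> F" "a * (p - t * q) + b * q = 1"
        by blast
      have "a * p + (b - a * t) * q = 1"
        using ab(3) by (simp add: algebra_simps)
      moreover have "coeff (b - a * t) i \<in> F" for i
        using ab t coeff_mult_F[of a t] by simp
      ultimately show ?thesis
        using ab(1) by blast
    next
      case nle: False
      obtain t where t: "\<And>i. coeff t i \<in> F" "length (coeffs (q - t * p)) < length (coeffs q)"
        using reduce[OF less.prems(2,1)] False nle by fastforce
      have "\<exists>a b. (\<forall>i. coeff a i \<in> F) \<and> (\<forall>i. coeff b i \<in> F) \<and> a * p + b * (q - t * p) = 1"
        using t less.prems coeff_mult_F[of t p] by (intro less.hyps) auto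
      then obtain a b where ab: "\<And>i. coeff a i \<in> F" "\<And>i. coeff b i \<in> F" "a * p + b * (q - t * p) = 1"
        by blast
      have "(a - b * t) * p + b * q = 1"
        using ab(3) by (simp add: algebra_simps)
      moreover have "coeff (a - b * t) i \<in> F" for i
        using ab t coeff_mult_F[of b t] by simp
      ultimately show ?thesis
        using ab(2) by blast
    qed
  qed
qed

end

locale rational_basis = complex_subfield K for K +
  fixes d :: nat and \<omega> :: "nat \<Rightarrow> complex" and co :: "complex \<Rightarrow> nat \<Rightarrow> rat"
  assumes \<omega>_in: "i < d \<Longrightarrow> \<omega> i \<in> K"
    and expand: "x \<in> K \<Longrightarrow> x = (\<Sum>i<d. of_rat (co x i) * \<omega> i)"
    and indep: "\<And>c i. (\<Sum>i<d. of_rat (c i) * \<omega> i) = 0 \<Longrightarrow> i < d \<Longrightarrow> c i = 0"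
begin

lemma co_eqI:
  assumes "x = (\<Sum>i<d. of_rat (c i) * \<omega> i)" "i < d"
  shows "co x i = c i"
proof -
  have "x \<in> K"
    unfolding assms(1) using \<omega>_in by (intro F_sum) auto
  then have "(\<Sum>i<d. of_rat (co x i) * \<omega> i) = (\<Sum>i<d. of_rat (c i) * \<omega> i)"
    using expand assms(1) by metis
  then have "(\<Sum>i<d. of_rat (co x i - c i) * \<omega> i) = 0"
    by (simp add: of_rat_diff left_diff_distrib sum_subtractf)
  then show ?thesis
    using indep[of "\<lambda>i. co x i - c i" i] assms(2) by simp
qed

lemma co_add: "x \<in> K \<Longrightarrow> y \<in> K \<Longrightarrow> i < d \<Longrightarrow> co (x + y) i = co x i + co y i"
  by (rule co_eqI[of _ "\<lambda>i. co x i + co y i"])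
     (simp_all add: of_rat_add distrib_right sum.distrib flip: expand)

lemma co_0: "i < d \<Longrightarrow> co 0 i = 0"
  by (rule co_eqI[of _ "\<lambda>i. 0"]) simp_all

lemma co_of_rat_mult: "x \<in> K \<Longrightarrow> i < d \<Longrightarrow> co (of_rat r * x) i = r * co x i"
  by (rule co_eqI[of _ "\<lambda>i. r * co x i"])
     (simp_all add: of_rat_mult mult.assoc flip: expand sum_distrib_left)

lemma co_\<omega>: "k < d \<Longrightarrow> i < d \<Longrightarrow> co (\<omega> k) i = (if i = k then 1 else 0)"
proof (rule co_eqI[of _ "\<lambda>i. if i = k then 1 else 0"])
  assume k: "k < d"
  have "(\<Sum>i<d. of_rat (if i = k then 1 else 0) * \<omega> i) = (\<Sum>i<d. if i = k then \<omega> i else 0)"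
    by (rule sum.cong) auto
  then show "\<omega> k = (\<Sum>i<d. of_rat (if i = k then 1 else 0) * \<omega> i)"
    using k by simp
qed

lemma co_sum: "(\<And>j. j \<in> J \<Longrightarrow> g j \<in> K) \<Longrightarrow> i < d \<Longrightarrow> co (sum g J) i = (\<Sum>j\<in>J. co (g j) i)"
  by (induction J rule: infinite_finite_induct) (simp_all add: co_0 co_add)

lemma co_mult_\<omega>:
  assumes "x \<in> K" "y \<in> K" "i < d" "l < d"
  shows "co (x * y * \<omega> i) l = (\<Sum>k<d. co (x * \<omega> i) k * co (y * \<omega> k) l)"
proof -
  have xi: "x * \<omega> i \<in> K"
    using assms \<omega>_in by simp
  have "x * y * \<omega> i = y * (\<Sum>k<d. of_rat (co (x * \<omega> i) k) * \<omega> k)"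
    using expand[OF xi] by (simp add: mult_ac)
  also have "\<dots> = (\<Sum>k<d. of_rat (co (x * \<omega> i) k) * (y * \<omega> k))"
    unfolding sum_distrib_left by (simp add: mult_ac)
  finally have "co (x * y * \<omega> i) l = co (\<Sum>k<d. of_rat (co (x * \<omega> i) k) * (y * \<omega> k)) l"
    by simp
  also have "\<dots> = (\<Sum>k<d. co (of_rat (co (x * \<omega> i) k) * (y * \<omega> k)) l)"
    using assms \<omega>_in by (intro co_sum) auto
  also have "\<dots> = (\<Sum>k<d. co (x * \<omega> i) k * co (y * \<omega> k) l)"
    using assms \<omega>_in by (intro sum.cong) (auto intro!: co_of_rat_mult)
  finally show ?thesis .
qed

text \<open>The matrix of multiplication by \<open>q\<close> on K[X] over the rational polynomials
  in the basis \<omega>; row \<open>i\<close> holds the coordinates of \<open>q\<close> times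
  \<open>\<omega> i\<close>.\<close>

definition norm_mat :: "complex poly \<Rightarrow> rat poly mat" where
  "norm_mat q = mat d d (\<lambda>(i, l). map_poly (\<lambda>c. co (c * \<omega> i) l) q)"

lemma norm_mat_carrier [simp]: "norm_mat q \<in> carrier_mat d d"
  by (simp add: norm_mat_def)

lemma coeff_norm_mat: "i < d \<Longrightarrow> l < d \<Longrightarrow> coeff (norm_mat q $$ (i, l)) j = co (coeff q j * \<omega> i) l"
  by (simp add: norm_mat_def coeff_map_poly co_0)

lemma norm_mat_mult:
  assumes "\<And>i. coeff p i \<in> K" "\<And>i. coeff q i \<in> K"
  shows "norm_mat (p * q) = norm_mat p * norm_mat q"
proof (rule eq_matI)
  fix i l assume "i < dim_row (norm_mat p * norm_mat q)" "l < dim_col (norm_mat p * norm_mat q)"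
  then have il: "i < d" "l < d"
    by (simp_all add: norm_mat_def)
  show "norm_mat (p * q) $$ (i, l) = (norm_mat p * norm_mat q) $$ (i, l)"
  proof (rule poly_eqI)
    fix j
    have "coeff ((norm_mat p * norm_mat q) $$ (i, l)) j
        = (\<Sum>k<d. \<Sum>a\<le>j. co (coeff p a * \<omega> i) k * co (coeff q (j - a) * \<omega> k) l)"
      using il by (simp add: scalar_prod_def coeff_sum coeff_mult coeff_norm_mat atLeast0LessThan
          carrier_matD[OF norm_mat_carrier])
    also have "\<dots> = (\<Sum>a\<le>j. \<Sum>k<d. co (coeff p a * \<omega> i) k * co (coeff q (j - a) * \<omega> k) l)"
      by (rule sum.swap)
    also have "\<dots> = (\<Sum>a\<le>j. co (coeff p a * coeff q (j - a) * \<omega> i) l)"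
      using assms il by (simp add: co_mult_\<omega>)
    also have "\<dots> = co (coeff (p * q) j * \<omega> i) l"
      using assms il \<omega>_in by (simp add: coeff_mult sum_distrib_right co_sum)
    finally show "coeff (norm_mat (p * q) $$ (i, l)) j = coeff ((norm_mat p * norm_mat q) $$ (i, l)) j"
      using il by (simp add: coeff_norm_mat)
  qed
qed (simp_all add: norm_mat_def)

definition norm_poly :: "complex poly \<Rightarrow> rat poly" where
  "norm_poly q = det (norm_mat q)"

lemma norm_poly_monic:
  assumes f: "lead_coeff f = 1"
  shows "Polynomial.degree (norm_poly f) = d * Polynomial.degree f" "lead_coeff (norm_poly f) = 1"
proof -
  let ?n = "Polynomial.degree f"
  have deg: "Polynomial.degree (norm_mat f $$ (i, l)) \<le> ?n" if "i < d" "l < d" for i l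
    using that by (intro degree_le) (simp add: coeff_norm_mat coeff_eq_0 co_0)
  have "map_mat (\<lambda>q. coeff q ?n) (norm_mat f) = 1\<^sub>m d"
    using f by (intro eq_matI) (auto simp: coeff_norm_mat co_\<omega> carrier_matD[OF norm_mat_carrier])
  then have c: "coeff (norm_poly f) (d * ?n) = 1"
    using det_poly_degree(2)[OF norm_mat_carrier deg] by (simp add: norm_poly_def)
  show *: "Polynomial.degree (norm_poly f) = d * ?n"
    using det_poly_degree(1)[OF norm_mat_carrier deg] c le_degree[of "norm_poly f" "d * ?n"]
    by (simp add: norm_poly_def)
  show "lead_coeff (norm_poly f) = 1"
    using c * by simp
qed

lemma norm_poly_rnorm:
  fixes C :: real
  assumes f: "lead_coeff f = 1" and C: "1 \<le> C"
    and co: "\<And>i j l. i < d \<Longrightarrow> l < d \<Longrightarrow> j < Polynomial.degree f \<Longrightarrow> \<bar>of_rat (co (coeff f j * \<omega> i) l)\<bar> \<le> C"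
  shows "rnorm (norm_poly f) \<le> fact d * (1 + Polynomial.degree f * C) ^ d"
  unfolding norm_poly_def
proof (rule rnorm_det_le[OF norm_mat_carrier])
  fix i l assume il: "i < d" "l < d"
  let ?n = "Polynomial.degree f"
  have "Polynomial.degree (norm_mat f $$ (i, l)) \<le> ?n"
    using il by (intro degree_le) (simp add: coeff_norm_mat coeff_eq_0 co_0)
  then have "rnorm (norm_mat f $$ (i, l)) \<le> (\<Sum>j\<le>?n. \<bar>of_rat (coeff (norm_mat f $$ (i, l)) j)\<bar>)"
    by (rule rnorm_le)
  also have "\<dots> = (\<Sum>j<?n. \<bar>of_rat (co (coeff f j * \<omega> i) l)\<bar>) + \<bar>of_rat (co (\<omega> i) l)\<bar>"
    using il f by (simp add: coeff_norm_mat lessThan_Suc_atMost[symmetric])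
  also have "\<dots> \<le> (\<Sum>j<?n. C) + 1"
    using il by (intro add_mono sum_mono co) (auto simp: co_\<omega>)
  finally show "rnorm (norm_mat f $$ (i, l)) \<le> 1 + ?n * C"
    by simp
qed

text \<open>If \<open>P\<close> and \<open>f\<close> had no common root, then \<open>norm_poly f\<close> would be a unit modulo \<open>P\<close>.\<close>

lemma norm_poly_common_root:
  assumes f: "\<And>i. coeff f i \<in> K" and P: "P dvd norm_poly f" "0 < Polynomial.degree P"
  shows "\<exists>z. poly (map_poly of_rat P) z = 0 \<and> poly f z = 0"
proof (rule ccontr)
  assume no: "\<not> ?thesis"
  let ?P = "map_poly of_rat P :: complex poly"
  have PK: "coeff ?P i \<in> K" for i
    by (simp add: coeff_map_poly)
  obtain a b where ab: "\<And>i. coeff a i \<in> K" "\<And>i. coeff b i \<in> K" "a * ?P + b * f = 1"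
    using bezout_no_common_root[of ?P f] PK f no by blast
  have "Polynomial.degree ?P \<noteq> 0"
    using P(2) by simp
  then obtain \<beta> where \<beta>: "poly ?P \<beta> = 0"
    using fundamental_theorem_of_algebra[of ?P] by (auto simp: constant_degree)
  define \<phi> where "\<phi> = (\<lambda>q::rat poly. poly (map_poly of_rat q) \<beta>)"
  interpret \<phi>: comm_ring_hom \<phi>
    by unfold_locales (simp_all add: \<phi>_def of_rat_poly_hom.hom_add of_rat_poly_hom.hom_mult)
  \<comment> \<open>Since \<open>b * f\<close> is \<open>1 - a * ?P\<close>, its matrix is the
    identity minus \<open>P\<close> times the matrix of \<open>a\<close>, and evaluation at the root
    \<beta> of \<open>P\<close> kills the second term.\<close>
  have "map_mat \<phi> (norm_mat (b * f)) = 1\<^sub>m d"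
  proof (rule eq_matI)
    fix i l assume "i < dim_row (1\<^sub>m d :: complex mat)" "l < dim_col (1\<^sub>m d :: complex mat)"
    then have il: "i < d" "l < d"
      by simp_all
    have "norm_mat (b * f) $$ (i, l) = (if i = l then 1 else 0) - P * norm_mat a $$ (i, l)"
    proof (rule poly_eqI)
      fix j
      have bf: "b * f = 1 - a * ?P"
        using ab(3) by (simp add: algebra_simps)
      have aPK: "coeff (a * ?P) j \<in> K"
        using ab PK by (intro coeff_mult_F)
      have K1: "coeff 1 j \<in> K"
        by (simp add: coeff_1)
      have "co (coeff (b * f) j * \<omega> i) l + co (coeff (a * ?P) j * \<omega> i) l = co (coeff 1 j * \<omega> i) l"
        using il \<omega>_in aPK K1 by (subst co_add[symmetric]) (simp_all add: bf flip: distrib_right)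
      moreover have "co (coeff (a * ?P) j * \<omega> i) l = coeff (P * norm_mat a $$ (i, l)) j"
      proof -
        have "coeff (?P * a) j * \<omega> i = (\<Sum>k\<le>j. of_rat (coeff P k) * (coeff a (j - k) * \<omega> i))"
          unfolding coeff_mult sum_distrib_right by (simp add: coeff_map_poly mult_ac)
        then have "co (coeff (a * ?P) j * \<omega> i) l = (\<Sum>k\<le>j. coeff P k * co (coeff a (j - k) * \<omega> i) l)"
          using il \<omega>_in ab by (simp add: co_sum co_of_rat_mult mult.commute[of a])
        then show ?thesis
          using il by (simp add: coeff_mult coeff_norm_mat)
      qed
      moreover have "co (coeff 1 j * \<omega> i) l = coeff (if i = l then 1 else 0) j"
        using il by (auto simp: coeff_1 co_\<omega> co_0)
      ultimately show "coeff (norm_mat (b * f) $$ (i, l)) j = coeff ((if i = l then 1 else 0) - P * norm_mat a $$ (i, l)) j"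
        using il by (simp add: coeff_norm_mat)
    qed
    then show "map_mat \<phi> (norm_mat (b * f)) $$ (i, l) = 1\<^sub>m d $$ (i, l)"
      using il \<beta> by (simp add: carrier_matD[OF norm_mat_carrier] \<phi>.hom_minus \<phi>.hom_mult)
        (simp add: \<phi>_def)
  qed (simp_all add: norm_mat_def)
  then have "\<phi> (det (norm_mat (b * f))) = 1"
    using \<phi>.hom_det[of "norm_mat (b * f)"] by simp
  then have "\<phi> (norm_poly b * norm_poly f) = 1"
    using norm_mat_mult[OF ab(2) f] det_mult[OF norm_mat_carrier norm_mat_carrier, of b f] by (simp add: norm_poly_def)
  moreover have "\<phi> (norm_poly f) = 0"
    using P(1) \<beta> by (auto simp: \<phi>_def of_rat_poly_hom.hom_mult elim!: dvdE)
  ultimately show False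
    by (simp add: \<phi>.hom_mult)
qed

text \<open>The norm has degree \<open>d * n\<close> and coefficient norm at most
  \<open>fact d * (1 + n * C) ^ d\<close>. Dividing logarithms cancels the power \<open>d\<close>,
  so the height sees the size of the coefficients of \<open>f\<close> once, divided by
  \<open>n\<close>.\<close>

theorem small_height_root:
  fixes C :: real
  assumes f: "lead_coeff f = 1" "0 < Polynomial.degree f" "\<And>i. coeff f i \<in> K" "\<And>i. algebraic_int (coeff f i)"
    and C: "1 \<le> C" and d: "0 < d"
    and co: "\<And>i j l. i < d \<Longrightarrow> l < d \<Longrightarrow> j < Polynomial.degree f \<Longrightarrow> \<bar>of_rat (co (coeff f j * \<omega> i) l)\<bar> \<le> C"
  shows "\<exists>\<alpha>. poly f \<alpha> = 0 \<and>
    weil_height \<alpha> \<le> (ln (fact d) / d + ln (1 + Polynomial.degree f * C)) / Polynomial.degree f"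
proof -
  let ?n = "Polynomial.degree f"
  let ?F = "norm_poly f"
  obtain P where P: "Factorial_Ring.irreducible P" "lead_coeff P = 1" "P dvd ?F"
    "ln (mahler_measure_poly (map_poly of_rat P)) / Polynomial.degree P
      \<le> ln (mahler_measure_poly (map_poly of_rat ?F)) / Polynomial.degree ?F"
    using good_factor[of ?F] norm_poly_monic[OF f(1)] f(2) d by auto
  have degP: "0 < Polynomial.degree P"
    using P(1,2) by (metis gr0I is_unit_iff_degree Factorial_Ring.irreducible_def)
  obtain \<alpha> where \<alpha>: "poly (map_poly of_rat P) \<alpha> = 0" "poly f \<alpha> = 0"
    using norm_poly_common_root[OF f(3) P(3) degP] by blast
  have "weil_height \<alpha> \<le> ln (mahler_measure_poly (map_poly of_rat P)) / Polynomial.degree P"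
    by (rule weil_height_le_mahler[OF P(1,2) \<alpha>(1) algebraic_int_monic_root[OF f(1,4) \<alpha>(2)]])
  also have "\<dots> \<le> ln (mahler_measure_poly (map_poly of_rat ?F)) / Polynomial.degree ?F"
    by (rule P(4))
  also have "\<dots> \<le> ln (fact d * (1 + ?n * C) ^ d) / Polynomial.degree ?F"
  proof (rule divide_right_mono)
    have "0 < mahler_measure_poly (map_poly of_rat ?F)"
      using norm_poly_monic(2)[OF f(1)] mahler_measure_monic_ge_1[of "map_poly of_rat ?F"]
      by (simp add: mahler_measure_poly_via_monic)
    moreover have "mahler_measure_poly (map_poly of_rat ?F) \<le> fact d * (1 + ?n * C) ^ d"
      using mahler_le_rnorm norm_poly_rnorm[OF f(1) C co] by (rule order_trans)
    ultimately show "ln (mahler_measure_poly (map_poly of_rat ?F)) \<le> ln (fact d * (1 + ?n * C) ^ d)"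
      by simp
  qed simp
  also have "\<dots> = (ln (fact d) + d * ln (1 + ?n * C)) / (d * ?n)"
  proof -
    have "0 < 1 + ?n * C"
      using C by (intro add_pos_nonneg) auto
    then show ?thesis
      using norm_poly_monic(1)[OF f(1)] ln_mult_pos[of "fact d" "(1 + ?n * C) ^ d"] by (simp add: ln_realpow)
  qed
  also have "\<dots> = (ln (fact d) / d + ln (1 + ?n * C)) / ?n"
    using d f(2) by (simp add: add_divide_distrib)
  finally show ?thesis
    using \<alpha>(2) by (intro exI[of _ \<alpha>] conjI)
qed

end

section \<open>Small lattice points\<close>

lemma integral_multiple:
  assumes "algebraic (x::complex)"
  shows "\<exists>c. c \<noteq> 0 \<and> algebraic_int (of_int c * x)"
proof -
  obtain P where P: "P \<noteq> 0" "poly (map_poly of_int P) x = 0"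
    using algebraicE'[OF assms] by blast
  let ?m = "Polynomial.degree P"
  have m: "?m \<noteq> 0"
  proof
    assume "?m = 0"
    then obtain c where "P = [:c:]"
      using degree_eq_zeroE by blast
    then show False
      using P by simp
  qed
  \<comment> \<open>This is the second of the integers in \<open>algebraic_int_horner\<close>; in
    degree one it is the value of the polynomial at \<open>x\<close>, hence zero.\<close>
  have "algebraic_int (of_int (coeff P (?m - 1)) + of_int (lead_coeff P) * x)"
  proof (cases "1 < ?m")
    case True
    then have "Suc (?m - 1) = ?m"
      by simp
    then have "(\<Sum>i\<le>1. of_int (coeff P (?m - 1 + i)) * x ^ i) = of_int (coeff P (?m - 1)) + of_int (lead_coeff P) * x"
      by simp
    then show ?thesis
      using algebraic_int_horner[OF P(2) True] by (simp only:)
  next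
    case False
    then have "?m = 1"
      using m by simp
    then have "of_int (coeff P (?m - 1)) + of_int (lead_coeff P) * x = poly (map_poly of_int P) x"
      by (simp add: poly_altdef)
    then show ?thesis
      using P(2) by simp
  qed
  then have "algebraic_int (of_int (coeff P (?m - 1)) + of_int (lead_coeff P) * x - of_int (coeff P (?m - 1)))"
    by (rule algebraic_int_diff) simp
  then show ?thesis
    using P(1) by (intro exI[of _ "lead_coeff P"]) simp
qed

text \<open>A rational basis becomes integral on multiplying each vector by a suitable integer. The
  lattice obtained may be smaller than the ring of integers, which affects only constants.\<close>

lemma integral_basis:
  assumes "number_field K"
  shows "\<exists>\<omega> co. rational_basis K (global_degree K) \<omega> co \<and> (\<forall>i<global_degree K. algebraic_int (\<omega> i))"
proof -
  interpret C: field \<C> by (rule field_C)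
  note Q = subfield_Rats
  interpret complex_subfield K
    using assms by (intro complex_subfield.intro) (simp add: number_field_def)
  define d where "d = global_degree K"
  have "C.dimension d \<rat> K"
    using C.finite_dimensionE[OF Q, of K] assms by (simp add: number_field_def d_def global_degree_def over_def)
  then obtain Us where Us: "C.independent \<rat> Us" "length Us = d" "C.Span \<rat> Us = K"
    using C.exists_base[OF Q] by blast
  have UK: "Us ! i \<in> K" if "i < d" for i
    using C.Span_base_incl[OF Q, of Us] Us that by auto
  have comb: "C.combine Ks Us' = (\<Sum>i<length Us'. Ks ! i * Us' ! i)" if "length Ks = length Us'" for Ks Us'
    using that
    by (induction Ks Us' rule: list_induct2) (simp_all add: C.combine.simps sum.lessThan_Suc_shift del: sum.lessThan_Suc)
  have "\<exists>c. c \<noteq> 0 \<and> algebraic_int (of_int c * Us ! i)" if "i < d" for i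
    using integral_multiple number_field_algebraic[OF assms UK[OF that]] by blast
  then obtain s where s: "\<And>i. i < d \<Longrightarrow> s i \<noteq> 0" "\<And>i. i < d \<Longrightarrow> algebraic_int (of_int (s i) * Us ! i)"
    by metis
  define \<omega> where "\<omega> i = of_int (s i) * Us ! i" for i
  have "\<exists>c. x = (\<Sum>i<d. of_rat (c i) * \<omega> i)" if "x \<in> K" for x
  proof -
    obtain Ks where Ks: "set Ks \<subseteq> \<rat>" "length Ks = d" "x = C.combine Ks Us"
      using C.Span_mem_iff_length_version[OF Q, of Us x] Us \<open>x \<in> K\<close> by auto
    have "\<forall>i. i < d \<longrightarrow> (\<exists>r. Ks ! i = of_rat r)"
      using Ks by (metis Rats_cases nth_mem subsetD)
    then obtain r where r: "\<And>i. i < d \<Longrightarrow> Ks ! i = of_rat (r i)"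
      by metis
    have "x = (\<Sum>i<d. of_rat (r i / of_int (s i)) * \<omega> i)"
      using comb[of Ks Us] Ks Us(2) r s(1) by (simp add: \<omega>_def of_rat_divide)
    then show ?thesis
      by (intro exI[of _ "\<lambda>i. r i / of_int (s i)"])
  qed
  then obtain co where co: "\<And>x. x \<in> K \<Longrightarrow> x = (\<Sum>i<d. of_rat (co x i) * \<omega> i)"
    by metis
  have indep: "c i = 0" if "(\<Sum>i<d. of_rat (c i) * \<omega> i) = 0" "i < d" for c i
  proof -
    define Ks where "Ks = map (\<lambda>i. of_rat (c i) * of_int (s i) :: complex) [0..<d]"
    have "C.combine Ks Us = 0"
      using comb[of Ks Us] that(1) Us(2) by (simp add: Ks_def \<omega>_def mult.assoc)
    moreover have "set Ks \<subseteq> \<rat>"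
      by (auto simp: Ks_def)
    ultimately have "set (take (length Us) Ks) \<subseteq> {0}"
      using C.independent_imp_trivial_combine[OF Q Us(1), of Ks] by simp
    moreover have "take (length Us) Ks = Ks" "i < length Ks"
      using that(2) Us(2) by (simp_all add: Ks_def)
    ultimately have "Ks ! i = 0"
      by (metis nth_mem singletonD subsetD)
    then show ?thesis
      using that(2) s(1) by (simp add: Ks_def)
  qed
  have "rational_basis K d \<omega> co"
    using UK co indep by unfold_locales (auto simp: \<omega>_def)
  then show ?thesis
    using s(2) unfolding d_def \<omega>_def by blast
qed

lemma shift_avoiding:
  fixes g :: "'a \<Rightarrow> complex"
  assumes "finite A" "\<gamma> \<noteq> 0"
  shows "\<exists>t\<le>card A. \<forall>z\<in>A. g z + of_nat t * \<gamma> \<noteq> 0"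
proof (rule avoid_bad_values[OF assms(1)])
  fix z t t' assume "g z + of_nat t * \<gamma> = 0" "g z + of_nat t' * \<gamma> = 0"
  then have "of_nat t * \<gamma> = of_nat t' * \<gamma>"
    by (metis add_left_cancel)
  then show "t = t'"
    using assms(2) by simp
qed

context rational_basis
begin

definition lin :: "(nat \<Rightarrow> rat) \<Rightarrow> complex" where
  "lin c = (\<Sum>i<d. of_rat (c i) * \<omega> i)"

lemma lin_in [simp]: "lin c \<in> K"
  unfolding lin_def using \<omega>_in by (intro F_sum) auto

lemma co_lin_mult:
  assumes "y \<in> K" "l < d"
  shows "co (lin c * y) l = (\<Sum>k<d. c k * co (\<omega> k * y) l)"
proof -
  have "lin c * y = (\<Sum>k<d. of_rat (c k) * (\<omega> k * y))"
    by (simp add: lin_def sum_distrib_right mult.assoc)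
  also have "co \<dots> l = (\<Sum>k<d. co (of_rat (c k) * (\<omega> k * y)) l)"
    using assms \<omega>_in by (intro co_sum) auto
  also have "\<dots> = (\<Sum>k<d. c k * co (\<omega> k * y) l)"
    using assms \<omega>_in by (intro sum.cong) (auto intro!: co_of_rat_mult)
  finally show ?thesis .
qed

text \<open>The sum of all absolute coordinates of products of two and of three basis vectors. The
  former control a multiple of \<gamma> acting on the basis, the latter \<gamma> times a
  remainder.\<close>

definition structure_bound :: real where
  "structure_bound = (\<Sum>k<d. \<Sum>l<d. \<Sum>j<d. \<bar>of_rat (co (\<omega> k * \<omega> j) l)\<bar> +
     (\<Sum>h<d. \<bar>of_rat (co (\<omega> k * (\<omega> h * \<omega> j)) l)\<bar>))"

lemma structure_bound:
  assumes "j < d" "l < d" "\<And>k. k < d \<Longrightarrow> \<bar>of_rat (c k)\<bar> \<le> (B::real)" "0 \<le> B"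
  shows "\<bar>of_rat (co (lin c * \<omega> j) l)\<bar> \<le> B * structure_bound"
    and "(\<And>h. h < d \<Longrightarrow> \<bar>of_rat (r h)\<bar> \<le> (1::real)) \<Longrightarrow>
      \<bar>of_rat (co (lin c * lin r * \<omega> j) l)\<bar> \<le> B * structure_bound"
proof -
  define s1 :: "nat \<Rightarrow> nat \<Rightarrow> nat \<Rightarrow> real"
    where "s1 k l' j' = \<bar>of_rat (co (\<omega> k * \<omega> j') l')\<bar>" for k l' j'
  define s2 :: "nat \<Rightarrow> nat \<Rightarrow> nat \<Rightarrow> real"
    where "s2 k l' j' = (\<Sum>h<d. \<bar>of_rat (co (\<omega> k * (\<omega> h * \<omega> j')) l')\<bar>)" for k l' j'
  have s: "0 \<le> s1 k l' j'" "0 \<le> s2 k l' j'" for k l' j'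
    by (auto simp: s1_def s2_def intro: sum_nonneg)
  have bound: "(\<Sum>k<d. s1 k l j + s2 k l j) \<le> structure_bound"
    unfolding structure_bound_def
  proof (rule sum_mono)
    fix k assume "k \<in> {..<d}"
    have "(s1 k l j + s2 k l j :: real) \<le> (\<Sum>j<d. s1 k l j + s2 k l j)"
      using assms s by (intro member_le_sum[of j _ "\<lambda>j. s1 k l j + s2 k l j"]) auto
    also have "\<dots> \<le> (\<Sum>l<d. \<Sum>j<d. s1 k l j + s2 k l j)"
      using assms s by (intro member_le_sum[of l _ "\<lambda>l. \<Sum>j<d. s1 k l j + s2 k l j"]) (auto intro!: sum_nonneg add_nonneg_nonneg)
    finally show "s1 k l j + s2 k l j \<le> (\<Sum>l<d. \<Sum>j<d. \<bar>of_rat (co (\<omega> k * \<omega> j) l)\<bar> +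
     (\<Sum>h<d. \<bar>of_rat (co (\<omega> k * (\<omega> h * \<omega> j)) l)\<bar>))"
      by (simp add: s1_def s2_def)
  qed
  have "\<bar>of_rat (co (lin c * \<omega> j) l)\<bar> \<le> (\<Sum>k<d. \<bar>of_rat (c k)\<bar> * s1 k l j)"
    unfolding co_lin_mult[OF \<omega>_in[OF assms(1)] assms(2)] s1_def of_rat_sum
    by (rule order_trans[OF sum_abs]) (simp add: of_rat_mult abs_mult)
  also have "\<dots> \<le> (\<Sum>k<d. B * (s1 k l j + s2 k l j))"
    using assms s by (intro sum_mono mult_mono) auto
  also have "\<dots> \<le> B * structure_bound"
    unfolding sum_distrib_left[symmetric] using bound assms(4) by (intro mult_left_mono)
  finally show "\<bar>of_rat (co (lin c * \<omega> j) l)\<bar> \<le> B * structure_bound" .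
  assume r: "\<And>h. h < d \<Longrightarrow> \<bar>of_rat (r h)\<bar> \<le> (1::real)"
  have eq: "co (lin c * lin r * \<omega> j) l = (\<Sum>k<d. c k * (\<Sum>h<d. r h * co (\<omega> k * (\<omega> h * \<omega> j)) l))"
  proof -
    have "co (\<omega> k * (lin r * \<omega> j)) l = (\<Sum>h<d. r h * co (\<omega> k * (\<omega> h * \<omega> j)) l)" if "k < d" for k
    proof -
      have "\<omega> k * (lin r * \<omega> j) = lin r * (\<omega> k * \<omega> j)"
        by (simp add: mult_ac)
      then show ?thesis
        using co_lin_mult[of "\<omega> k * \<omega> j" l r] \<omega>_in assms that by (simp add: mult.left_commute[of "\<omega> k"])
    qed
    then show ?thesis
      using co_lin_mult[of "lin r * \<omega> j" l c] \<omega>_in assms by (simp add: mult.assoc)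
  qed
  have "\<bar>of_rat (co (lin c * lin r * \<omega> j) l)\<bar> \<le> (\<Sum>k<d. \<bar>of_rat (c k)\<bar> * s2 k l j)"
    unfolding eq of_rat_sum
  proof (rule order_trans[OF sum_abs], rule sum_mono)
    fix k assume "k \<in> {..<d}"
    have "\<bar>real_of_rat (\<Sum>h<d. r h * co (\<omega> k * (\<omega> h * \<omega> j)) l)\<bar> \<le> (\<Sum>h<d. \<bar>of_rat (r h)\<bar> * \<bar>of_rat (co (\<omega> k * (\<omega> h * \<omega> j)) l)\<bar>)"
      unfolding of_rat_sum by (rule order_trans[OF sum_abs]) (simp add: of_rat_mult abs_mult)
    also have "\<dots> \<le> (\<Sum>h<d. 1 * \<bar>of_rat (co (\<omega> k * (\<omega> h * \<omega> j)) l)\<bar>)"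
      using r by (intro sum_mono mult_right_mono) auto
    also have "\<dots> = s2 k l j"
      by (simp add: s2_def)
    finally show "\<bar>of_rat (c k * (\<Sum>h<d. r h * co (\<omega> k * (\<omega> h * \<omega> j)) l))\<bar> \<le> \<bar>of_rat (c k)\<bar> * (s2 k l j)"
      by (simp add: of_rat_mult abs_mult mult_left_mono)
  qed
  also have "\<dots> \<le> (\<Sum>k<d. B * (s1 k l j + s2 k l j))"
    using assms s by (intro sum_mono mult_mono) auto
  also have "\<dots> \<le> B * structure_bound"
    unfolding sum_distrib_left[symmetric] using bound assms(4) by (intro mult_left_mono)
  finally show "\<bar>of_rat (co (lin c * lin r * \<omega> j) l)\<bar> \<le> B * structure_bound" .
qed

lemma structure_bound_nonneg: "0 \<le> structure_bound"
  unfolding structure_bound_def by (intro sum_nonneg add_nonneg_nonneg) auto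

end

text \<open>The integral root serves two purposes: \<open>(b + 1) ^ d\<close> box points outnumber
  \<open>q\<close> classes, while \<open>b ^ d \<le> q\<close> bounds the coordinates of the
  resulting point.\<close>

lemma floor_root:
  fixes q d :: nat
  assumes "1 \<le> q" "0 < d"
  shows "\<exists>b::nat. 1 \<le> b \<and> b ^ d \<le> q \<and> q < (b + 1) ^ d"
proof -
  have "q < (q + 1) ^ d"
    using assms self_le_power[of "q + 1" d] by linarith
  then have ex: "\<exists>b. q < (b + 1) ^ d" by blast
  define b where "b = (LEAST b. q < (b + 1) ^ d)"
  have b: "q < (b + 1) ^ d"
    unfolding b_def using ex by (rule LeastI_ex)
  have b1: "1 \<le> b"
  proof (rule ccontr)
    assume "\<not> 1 \<le> b"
    then have "b = 0" by simp
    then show False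
      using b assms by simp
  qed
  then have "\<not> q < (b - 1 + 1) ^ d"
    using not_less_Least[of "b - 1" "\<lambda>b. q < (b + 1) ^ d"] by (simp add: b_def)
  then show ?thesis
    using b b1 by (intro exI[of _ b]) simp
qed

section \<open>Pigeonhole principle and reduction modulo a small element\<close>

context rational_basis
begin

text \<open>The box with coordinates from \<open>0\<close> to \<open>B\<close> has more points than
  there are combined residue classes, so two of them are congruent at every place and their
  difference is as desired. Integrality of the basis keeps the box in all valuation rings, where the
  labels apply.\<close>

lemma small_lattice_point:
  assumes S: "finite S" "\<And>v. v \<in> S \<Longrightarrow> padic_subfield K v (p v)"
    and int: "\<And>i. i < d \<Longrightarrow> algebraic_int (\<omega> i)"
    and B: "(\<Prod>v\<in>S. p v ^ (m v * local_degree K v)) < (B + 1) ^ d"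
  shows "\<exists>c. lin (\<lambda>i. of_int (c i)) \<noteq> 0 \<and> (\<forall>i<d. \<bar>c i\<bar> \<le> int B) \<and>
    (\<forall>v\<in>S. v (lin (\<lambda>i. of_int (c i))) \<le> 1 / real (p v) ^ m v)"
proof -
  define good where "good v cl \<longleftrightarrow> finite (cl ` {x \<in> K. v x \<le> 1}) \<and>
      card (cl ` {x \<in> K. v x \<le> 1}) \<le> p v ^ (m v * local_degree K v) \<and>
      (\<forall>x y. x \<in> K \<longrightarrow> y \<in> K \<longrightarrow> v x \<le> 1 \<longrightarrow> v y \<le> 1 \<longrightarrow> cl x = cl y \<longrightarrow> v (x - y) \<le> 1 / real (p v) ^ m v)"
    for v :: "complex \<Rightarrow> real" and cl :: "complex \<Rightarrow> (nat \<Rightarrow> complex) set"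
  have "\<forall>v\<in>S. \<exists>cl. good v cl"
  proof
    fix v assume "v \<in> S"
    then interpret padic_subfield K v "p v" by (rule S(2))
    show "\<exists>cl. good v cl"
      by (rule integral_residue_classes[of "m v"]) (auto simp: good_def)
  qed
  then obtain cl where good: "\<forall>v\<in>S. good v (cl v)"
    using bchoice by blast
  have cl: "finite (cl v ` {x \<in> K. v x \<le> 1})"
    "card (cl v ` {x \<in> K. v x \<le> 1}) \<le> p v ^ (m v * local_degree K v)"
    "\<And>x y. x \<in> K \<Longrightarrow> y \<in> K \<Longrightarrow> v x \<le> 1 \<Longrightarrow> v y \<le> 1 \<Longrightarrow> cl v x = cl v y \<Longrightarrow> v (x - y) \<le> 1 / real (p v) ^ m v"
    if "v \<in> S" for v
    using good that by (simp_all add: good_def)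
  define \<Lambda> where "\<Lambda> = PiE {..<d} (\<lambda>_. {0..B})"
  define pt where "pt c = lin (\<lambda>i. of_nat (c i))" for c :: "nat \<Rightarrow> nat"
  define T where "T = PiE S (\<lambda>v. cl v ` {x \<in> K. v x \<le> 1})"
  define \<Phi> where "\<Phi> c = restrict (\<lambda>v. cl v (pt c)) S" for c
  have pt_int: "v (pt c) \<le> 1" if v: "v \<in> S" for v c
  proof -
    have "algebraic_int (pt c)"
      unfolding pt_def lin_def using int by (intro algebraic_int_sum algebraic_int_mult) auto
    then show ?thesis
      using padic_subfield.w_algebraic_int_le[OF S(2)[OF v]] by (simp add: pt_def)
  qed
  have "card T = (\<Prod>v\<in>S. card (cl v ` {x \<in> K. v x \<le> 1}))"
    unfolding T_def by (rule card_PiE[OF S(1)])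
  also have "\<dots> \<le> (\<Prod>v\<in>S. p v ^ (m v * local_degree K v))"
    using cl by (intro prod_mono) auto
  also have "\<dots> < card \<Lambda>"
    using B by (simp add: \<Lambda>_def card_PiE)
  finally have "card T < card \<Lambda>" .
  moreover have "\<Phi> ` \<Lambda> \<subseteq> T"
    using pt_int by (auto simp: \<Phi>_def T_def pt_def)
  moreover have "finite T"
    unfolding T_def using S(1) cl by (intro finite_PiE) auto
  ultimately have "\<not> inj_on \<Phi> \<Lambda>"
    using card_inj_on_le[of \<Phi> \<Lambda> T] by linarith
  then obtain c c' where c: "c \<in> \<Lambda>" "c' \<in> \<Lambda>" "c \<noteq> c'" "\<Phi> c = \<Phi> c'"
    unfolding inj_on_def by blast
  define e where "e i = int (c i) - int (c' i)" for i
  have pte: "lin (\<lambda>i. of_int (e i)) = pt c - pt c'"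
    by (simp add: pt_def lin_def e_def of_rat_diff sum_subtractf left_diff_distrib)
  have "lin (\<lambda>i. of_int (e i)) \<noteq> 0"
  proof
    assume "lin (\<lambda>i. of_int (e i)) = 0"
    then have "(of_int (e i) :: rat) = 0" if "i < d" for i
      using indep[of "\<lambda>i. of_int (e i)" i] that by (simp add: lin_def)
    then have "c i = c' i" if "i < d" for i
      using that by (simp add: e_def)
    then show False
      using c PiE_ext[of c "{..<d}" "\<lambda>_. {0..B}" c'] by (simp add: \<Lambda>_def)
  qed
  moreover have "\<bar>e i\<bar> \<le> int B" if "i < d" for i
  proof -
    have "c i \<le> B" "c' i \<le> B"
      using PiE_mem[of c "{..<d}" "\<lambda>_. {0..B}" i] PiE_mem[of c' "{..<d}" "\<lambda>_. {0..B}" i] c that by (auto simp: \<Lambda>_def)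
    then show ?thesis
      by (simp add: e_def)
  qed
  moreover have "v (lin (\<lambda>i. of_int (e i))) \<le> 1 / real (p v) ^ m v" if v: "v \<in> S" for v
  proof -
    have "cl v (pt c) = cl v (pt c')"
      using c(4) v unfolding \<Phi>_def by (metis restrict_apply')
    then show ?thesis
      unfolding pte using pt_int[OF v] by (intro cl(3)[OF v]) (simp_all add: pt_def)
  qed
  ultimately show ?thesis
    by blast
qed

text \<open>Multiples of \<gamma> by integers do not disturb the local conditions, so the
  coefficients can be reduced to the size of \<gamma>. The constant \<open>C\<close> precedes
  \<open>n\<close>, \<open>m\<close> and \<open>b\<close>, so its contribution dies out as
  \<open>n\<close> grows; it depends on \<open>A\<close> through the number of shifts that avoiding
  \<open>A\<close> may take.\<close>

theorem approximating_root:
  assumes S: "finite S" "S \<subseteq> extensional K" "\<And>v. v \<in> S \<Longrightarrow> padic_subfield K v (p v)"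
    and int: "\<And>i. i < d \<Longrightarrow> algebraic_int (\<omega> i)" and d: "0 < d" and A: "finite A"
  shows "\<exists>C>0. \<forall>n m b. 0 < n \<longrightarrow> (\<forall>v\<in>S. \<forall>i<n. b v i \<in> K \<and> v (b v i) \<le> 1) \<longrightarrow>
    (\<exists>a \<alpha>. (\<forall>i<n. a i \<in> K) \<and> (\<forall>v\<in>S. \<forall>i<n. v (a i - b v i) \<le> 1 / real (p v) ^ m v) \<and>
      \<alpha> ^ n + (\<Sum>i<n. a i * \<alpha> ^ i) = 0 \<and> \<alpha> \<notin> A \<and>
      weil_height \<alpha> \<le> (C + ln (1 + real n * C) + (\<Sum>v\<in>S. m v * (local_degree K v / d) * ln (p v))) / n)"
proof -
  \<comment> \<open>A reduced coefficient is \<gamma> times a remainder plus at most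
    \<open>card A\<close> copies of \<gamma>, each bounded by \<open>B * structure_bound\<close>;
    the added 1 ensures \<open>C1 \<ge> 1\<close>.\<close>
  define C1 where "C1 = structure_bound * (1 + card A) + 1"
  define C where "C = C1 + ln (fact d) / d"
  have C1: "1 \<le> C1"
    using structure_bound_nonneg by (simp add: C1_def)
  have lnf: "0 \<le> ln (fact d) / d"
    by (simp add: fact_ge_1)
  have C: "C1 \<le> C" "ln (fact d) / d \<le> C" "0 < C"
    using C1 lnf unfolding C_def by linarith+
  show ?thesis
  proof (intro exI[of _ C] conjI allI impI)
    fix n :: nat and m :: "(complex \<Rightarrow> real) \<Rightarrow> nat" and b :: "(complex \<Rightarrow> real) \<Rightarrow> nat \<Rightarrow> complex"
    assume n: "0 < n" and b: "\<forall>v\<in>S. \<forall>i<n. b v i \<in> K \<and> v (b v i) \<le> 1"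
    have p: "1 < p v" if "v \<in> S" for v
      using padic_subfield.p_gt_1[OF S(3)[OF that]] .
    define Q where "Q = (\<Prod>v\<in>S. p v ^ (m v * local_degree K v))"
    have "1 \<le> Q"
      unfolding Q_def using p by (intro prod_ge_1 one_le_power) force
    then obtain B where B: "1 \<le> B" "B ^ d \<le> Q" "Q < (B + 1) ^ d"
      using floor_root[OF _ d] by blast
    obtain c where c: "lin (\<lambda>i. of_int (c i)) \<noteq> 0" "\<And>i. i < d \<Longrightarrow> \<bar>c i\<bar> \<le> int B"
      "\<And>v. v \<in> S \<Longrightarrow> v (lin (\<lambda>i. of_int (c i))) \<le> 1 / real (p v) ^ m v"
      using small_lattice_point[OF S(1,3) int B(3)[unfolded Q_def]] by blast
    define \<gamma> where "\<gamma> = lin (\<lambda>i. of_int (c i))"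
    have \<gamma>: "\<gamma> \<noteq> 0" "\<gamma> \<in> K" "\<And>v. v \<in> S \<Longrightarrow> v \<gamma> \<le> 1 / real (p v) ^ m v"
      using c by (simp_all add: \<gamma>_def)
    have lin_int: "algebraic_int (lin (\<lambda>i. of_int (c i)))" for c
      unfolding lin_def using int by (intro algebraic_int_sum algebraic_int_mult) auto
    \<comment> \<open>One tolerance that is small enough at every place, as
      \<open>integral_approximation\<close> works with a common one.\<close>
    define \<eta> where "\<eta> = 1 / real (\<Prod>v\<in>S. p v ^ m v)"
    have Ppos: "0 < (\<Prod>v\<in>S. p v ^ m v)"
      using p by (intro prod_pos zero_less_power) force
    have \<eta>: "0 < \<eta>" "\<And>v. v \<in> S \<Longrightarrow> \<eta> \<le> 1 / real (p v) ^ m v"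
    proof -
      show "0 < \<eta>"
        unfolding \<eta>_def using Ppos by (intro divide_pos_pos) (simp_all only: of_nat_0_less_iff zero_less_one)
      fix v assume v: "v \<in> S"
      have "p v ^ m v dvd (\<Prod>v\<in>S. p v ^ m v)"
        using S(1) v by (rule dvd_prodI)
      then have "p v ^ m v \<le> (\<Prod>v\<in>S. p v ^ m v)"
        using Ppos by (rule dvd_imp_le)
      then have "real (p v ^ m v) \<le> real (\<Prod>v\<in>S. p v ^ m v)"
        by (rule of_nat_mono)
      then show "\<eta> \<le> 1 / real (p v) ^ m v"
        unfolding \<eta>_def using p[OF v] Ppos
        by (intro divide_left_mono mult_pos_pos)
          (simp_all only: of_nat_0_less_iff semiring_1_class.of_nat_power zero_le_one zero_less_power)
    qed
    have "\<exists>x\<in>K. algebraic_int x \<and> (\<forall>v\<in>S. v (x - b v i) \<le> \<eta>)" if "i < n" for i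
      using b that by (intro integral_approximation[OF S _ _ \<eta>(1) complex_subfield_axioms]) auto
    then obtain x where x: "\<And>i. i < n \<Longrightarrow> x i \<in> K" "\<And>i. i < n \<Longrightarrow> algebraic_int (x i)"
      "\<And>i v. i < n \<Longrightarrow> v \<in> S \<Longrightarrow> v (x i - b v i) \<le> \<eta>"
      by metis
    \<comment> \<open>Division with remainder by \<gamma>: the coordinates of
      \<open>x i / \<gamma>\<close> are rounded down to give \<open>\<mu> i\<close>, and a remainder
      \<open>\<gamma> * lin (r i)\<close> with the coordinates of \<open>r i\<close> in
      \<open>[0, 1)\<close> is left.\<close>
    define s where "s i = co (x i / \<gamma>)" for i
    define \<mu> where "\<mu> i = lin (\<lambda>l. of_int \<lfloor>s i l\<rfloor>)" for i
    define r where "r i = (\<lambda>l. frac (s i l))" for i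
    have xr: "x i - \<gamma> * \<mu> i = \<gamma> * lin (r i)" if "i < n" for i
    proof -
      have "x i / \<gamma> = lin (s i)"
        unfolding lin_def s_def using x(1)[OF that] \<gamma>(2) by (intro expand) simp
      also have "\<dots> = \<mu> i + lin (r i)"
        by (simp add: \<mu>_def r_def lin_def frac_def of_rat_diff left_diff_distrib sum_subtractf)
      finally show ?thesis
        using \<gamma>(1) by (simp add: divide_eq_eq algebra_simps)
    qed
    \<comment> \<open>The reduced polynomial before its constant term is shifted by
      \<open>of_nat t * \<gamma>\<close>; each element of \<open>A\<close> is a root for at most one
      \<open>t\<close>.\<close>
    define g where "g z = z ^ n + (\<Sum>i<n. (x i - \<gamma> * \<mu> i) * z ^ i)" for z
    obtain t where t: "t \<le> card A" "\<And>z. z \<in> A \<Longrightarrow> g z + of_nat t * \<gamma> \<noteq> 0"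
      using shift_avoiding[OF A \<gamma>(1), of g] by blast
    define a where "a i = x i - \<gamma> * \<mu> i + (if i = 0 then of_nat t * \<gamma> else 0)" for i
    have aK: "a i \<in> K" and ai: "algebraic_int (a i)" if "i < n" for i
    proof -
      show "a i \<in> K"
        using x that \<gamma> by (simp add: a_def \<mu>_def)
      show "algebraic_int (a i)"
        using x that lin_int unfolding a_def \<mu>_def \<gamma>_def
        by (auto intro!: algebraic_int_add algebraic_int_diff algebraic_int_mult)
    qed
    have av: "v (a i - b v i) \<le> 1 / real (p v) ^ m v" if v: "v \<in> S" and i: "i < n" for v i
    proof -
      interpret v: padic_subfield K v "p v" by (rule S(3)[OF v])
      define y where "y = (if i = 0 then of_nat t else 0) - \<mu> i"
      have y: "y \<in> K" "algebraic_int y"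
        using lin_int by (auto simp: y_def \<mu>_def intro!: algebraic_int_diff)
      have eq: "a i - b v i = (x i - b v i) + \<gamma> * y"
        by (simp add: a_def y_def algebra_simps)
      have "v (\<gamma> * y) \<le> 1 / real (p v) ^ m v"
      proof -
        have "v \<gamma> * v y \<le> 1 / real (p v) ^ m v * 1"
          using \<gamma> y v v.w_nonneg v.w_algebraic_int_le by (intro mult_mono) auto
        then show ?thesis
          using \<gamma> y by (simp add: v.w_mult)
      qed
      moreover have "v (x i - b v i) \<le> 1 / real (p v) ^ m v"
        using x(3)[OF i v] \<eta>(2)[OF v] by simp
      moreover have "x i - b v i \<in> K" "\<gamma> * y \<in> K"
        using x(1)[OF i] b i v \<gamma> y by auto
      ultimately show ?thesis
        unfolding eq using v.w_add_max[of "x i - b v i" "\<gamma> * y"] by linarith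
    qed
    have bound: "\<bar>of_rat (co (a i * \<omega> j) l)\<bar> \<le> C1 * B" if i: "i < n" and j: "j < d" and l: "l < d" for i j l
    proof -
      have cB: "\<bar>of_rat (of_int (c k))\<bar> \<le> real B" if "k < d" for k
        using c(2)[OF that] by (simp flip: of_int_abs)
      have r1: "\<bar>of_rat (r i h)\<bar> \<le> (1::real)" for h
      proof -
        have "of_rat (r i h) \<le> (of_rat 1 :: real)" "(of_rat 0 :: real) \<le> of_rat (r i h)"
          unfolding of_rat_less_eq r_def using frac_lt_1[of "s i h"] frac_ge_0[of "s i h"] by simp_all
        then show ?thesis
          by simp
      qed
      have 1: "\<bar>of_rat (co (\<gamma> * lin (r i) * \<omega> j) l)\<bar> \<le> B * structure_bound"
        unfolding \<gamma>_def by (rule structure_bound(2)[OF j l cB _ r1]) simp_all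
      have 2: "\<bar>of_rat (co (\<gamma> * \<omega> j) l)\<bar> \<le> B * structure_bound"
        unfolding \<gamma>_def by (rule structure_bound(1)[OF j l cB]) simp_all
      define t' where "t' = (if i = 0 then t else 0)"
      have "a i = \<gamma> * lin (r i) + of_nat t' * \<gamma>"
        by (simp add: a_def xr[OF i] t'_def)
      then have "a i * \<omega> j = \<gamma> * lin (r i) * \<omega> j + of_rat (of_nat t') * (\<gamma> * \<omega> j)"
        by (simp add: algebra_simps)
      then have "co (a i * \<omega> j) l = co (\<gamma> * lin (r i) * \<omega> j) l + of_nat t' * co (\<gamma> * \<omega> j) l"
        using \<gamma>(2) \<omega>_in[OF j] l co_of_rat_mult[of "\<gamma> * \<omega> j" l "of_nat t'"]
        by (simp only: co_add F_mult F_of_rat lin_in)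
      then have "\<bar>of_rat (co (a i * \<omega> j) l)\<bar> \<le> \<bar>real_of_rat (co (\<gamma> * lin (r i) * \<omega> j) l)\<bar> + t' * \<bar>real_of_rat (co (\<gamma> * \<omega> j) l)\<bar>"
        using abs_triangle_ineq[of "real_of_rat (co (\<gamma> * lin (r i) * \<omega> j) l)" "real_of_rat (of_nat t' * co (\<gamma> * \<omega> j) l)"]
        by (simp add: of_rat_add of_rat_mult abs_mult)
      also have "\<dots> \<le> B * structure_bound + card A * (B * structure_bound)"
        using 1 2 t(1) structure_bound_nonneg by (intro add_mono mult_mono) (auto simp: t'_def)
      also have "\<dots> \<le> C1 * B"
        by (simp add: C1_def algebra_simps)
      finally show ?thesis .
    qed
    define f where "f = Poly (map a [0..<n] @ [1])"
    have cf: "coeff f i = (if i < n then a i else if i = n then 1 else 0)" for i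
      by (auto simp: f_def coeff_Poly_eq nth_default_def nth_append)
    have df: "Polynomial.degree f = n"
      using le_degree[of f n] by (intro antisym degree_le) (auto simp: cf)
    have pf: "poly f z = z ^ n + (\<Sum>i<n. a i * z ^ i)" for z
      unfolding poly_altdef df lessThan_Suc_atMost[symmetric] by (simp add: cf)
    have CB: "1 \<le> C1 * B"
      using mult_mono[of 1 C1 1 "real B"] C1 B by simp
    have "\<exists>\<alpha>. poly f \<alpha> = 0 \<and>
      weil_height \<alpha> \<le> (ln (fact d) / d + ln (1 + Polynomial.degree f * (C1 * B))) / Polynomial.degree f"
    proof (rule small_height_root)
      show "lead_coeff f = 1" "0 < Polynomial.degree f"
        using df n by (simp_all add: cf)
      show "coeff f i \<in> K" "algebraic_int (coeff f i)" for i
        using aK ai by (auto simp: cf)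
    qed (use CB d bound df in \<open>auto simp: cf\<close>)
    then obtain \<alpha> where \<alpha>: "poly f \<alpha> = 0" "weil_height \<alpha> \<le> (ln (fact d) / d + ln (1 + n * (C1 * B))) / n"
      unfolding df by blast
    have "\<alpha> \<notin> A"
    proof
      assume "\<alpha> \<in> A"
      then have "g \<alpha> + of_nat t * \<gamma> \<noteq> 0"
        by (rule t(2))
      moreover have "poly f \<alpha> = g \<alpha> + of_nat t * \<gamma>"
      proof -
        have "(\<Sum>i<n. a i * \<alpha> ^ i) = (\<Sum>i<n. (x i - \<gamma> * \<mu> i) * \<alpha> ^ i) + (\<Sum>i<n. if i = 0 then of_nat t * \<gamma> else 0)"
          unfolding sum.distrib[symmetric] by (intro sum.cong) (auto simp: a_def algebra_simps)
        then show ?thesis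
          using n by (simp add: pf g_def)
      qed
      ultimately show False
        using \<alpha>(1) by simp
    qed
    moreover have "weil_height \<alpha> \<le> (C + ln (1 + n * C) + (\<Sum>v\<in>S. m v * (local_degree K v / d) * ln (p v))) / n"
    proof -
      have "ln (1 + n * (C1 * B)) \<le> ln ((1 + n * C) * B)"
      proof -
        have "1 + n * (C1 * B) \<le> B + n * (C * B)"
          using B(1) C(1,3) C1 by (intro add_mono mult_mono) auto
        moreover have "0 < 1 + n * (C1 * B)"
          using CB by (intro add_pos_nonneg) auto
        ultimately show ?thesis
          by (simp add: algebra_simps)
      qed
      also have "\<dots> = ln (1 + n * C) + ln B"
      proof -
        have "0 < 1 + n * C"
          using C(3) by (intro add_pos_nonneg) auto
        then show ?thesis
          using B(1) by (intro ln_mult_pos) auto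
      qed
      \<comment> \<open>From \<open>B ^ d \<le> Q\<close>: extracting the \<open>d\<close>-th root
        turns the local degrees in the exponents of \<open>Q\<close> into the weights
        \<open>local_degree K v / d\<close>.\<close>
      also have "ln B \<le> (\<Sum>v\<in>S. m v * (local_degree K v / d) * ln (p v))"
      proof -
        have "d * ln B = ln (B ^ d)"
          using B(1) by (simp add: ln_realpow)
        also have "\<dots> \<le> ln Q"
        proof -
          have "real B ^ d \<le> real Q" "0 < real B ^ d"
            using B(1) of_nat_mono[OF B(2), where ?'a = real] by simp_all
          then show ?thesis
            unfolding semiring_1_class.of_nat_power by (intro ln_mono)
        qed
        also have "\<dots> = (\<Sum>v\<in>S. ln (p v ^ (m v * local_degree K v)))"
        proof -
          have "0 < real (p v ^ (m v * local_degree K v))" if "v \<in> S" for v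
            using p[OF that] by simp
          then show ?thesis
            unfolding Q_def of_nat_prod using S(1) by (intro ln_prod) auto
        qed
        also have "\<dots> = (\<Sum>v\<in>S. (m v * local_degree K v) * ln (p v))"
          using p by (intro sum.cong) (auto simp: ln_realpow intro!: ln_realpow)
        finally have "ln B \<le> (\<Sum>v\<in>S. (m v * local_degree K v) * ln (p v)) / d"
          using d by (simp add: pos_le_divide_eq mult.commute)
        also have "\<dots> = (\<Sum>v\<in>S. m v * (local_degree K v / d) * ln (p v))"
          by (simp add: sum_divide_distrib)
        finally show ?thesis .
      qed
      finally have "ln (fact d) / d + ln (1 + n * (C1 * B)) \<le> C + ln (1 + n * C) + (\<Sum>v\<in>S. m v * (local_degree K v / d) * ln (p v))"
        using C(2) by linarith
      then show ?thesis
        using \<alpha>(2) n by (meson divide_right_mono of_nat_0_le_iff order_trans)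
    qed
    ultimately show "\<exists>a \<alpha>. (\<forall>i<n. a i \<in> K) \<and> (\<forall>v\<in>S. \<forall>i<n. v (a i - b v i) \<le> 1 / real (p v) ^ m v) \<and>
      \<alpha> ^ n + (\<Sum>i<n. a i * \<alpha> ^ i) = 0 \<and> \<alpha> \<notin> A \<and>
      weil_height \<alpha> \<le> (C + ln (1 + real n * C) + (\<Sum>v\<in>S. m v * (local_degree K v / d) * ln (p v))) / n"
      using aK av \<alpha>(1) pf by (intro exI[of _ a] exI[of _ \<alpha>]) auto
  qed (rule C(3))
qed

end

section \<open>The upper bound\<close>

text \<open>The constructed polynomial may be reducible over \<open>K\<close>, while
  \<open>totally\<close> asks about the minimal polynomial; this passes the splitting to a divisor
  after mapping both to \<open>L\<close>.\<close>

lemma (in padic_galois) splitted_of_pdivides: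
  assumes P: "P \<in> carrier (univ_poly \<C> F)" and Q: "Q \<in> carrier (univ_poly \<C> F)" "Q \<noteq> []"
    and dvd: "P pdivides\<^bsub>\<C>\<^esub> Q" and split: "L.splitted (map (\<lambda>a. \<iota> (emb a)) Q)"
  shows "L.splitted (map (\<lambda>a. \<iota> (emb a)) P)"
proof -
  interpret C: field \<C> by (rule field_C)
  let ?h = "\<lambda>a. \<iota> (emb a)"
  have h: "?h \<in> Ring.ring_hom (field_of F) L"
    using ring_hom_trans[OF emb_hom \<iota>_hom] by (simp add: comp_def)
  interpret H: ring_hom_ring "field_of F" L ?h
    by (rule ring_hom_ringI2[OF _ L.ring_axioms h]) (use field_F in \<open>simp add: field_def domain_def cring_def\<close>)
  have cons: "univ_poly (field_of F) = univ_poly \<C>"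
    by (rule C.univ_poly_consistent[OF subfieldE(1)[OF sf]])
  obtain G where G: "G \<in> carrier (univ_poly \<C> F)" "Q = P \<otimes>\<^bsub>univ_poly \<C> F\<^esub> G"
    using dvd unfolding C.pdivides_iff_shell[OF sf P Q(1)] factor_def by blast
  have in_F: "set xs \<subseteq> carrier (field_of F)" if "xs \<in> carrier (univ_poly \<C> F)" for xs
    using that by (auto simp: univ_poly_def polynomial_def)
  have map_in: "map ?h xs \<in> carrier (univ_poly L (carrier L))" if "xs \<in> carrier (univ_poly \<C> F)" for xs
    using polynomial_hom[OF h field_F L.field_axioms, of xs] that by (simp add: cons)
  have "Q = V.poly_mult P G"
    using G(2) by (simp add: univ_poly_mult flip: cons)
  then have "L.poly_mult (map ?h P) (map ?h G) = L.normalize (map ?h Q)"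
    using H.poly_mult_hom'[OF in_F[OF P] in_F[OF G(1)]] by simp
  also have "\<dots> = map ?h Q"
    using map_in[OF Q(1)] L.normalize_polynomial by (simp add: univ_poly_carrier)
  finally have "map ?h Q = map ?h P \<otimes>\<^bsub>univ_poly L (carrier L)\<^esub> map ?h G"
    by (simp add: univ_poly_mult)
  then have "map ?h P pdivides\<^bsub>L\<^esub> map ?h Q"
    unfolding pdivides_def factor_def using map_in[OF G(1)] by blast
  then show ?thesis
    using L.pdivides_imp_splitted[OF map_in[OF P] map_in[OF Q(1)]] Q(2) split by simp
qed

lemma poly_Poly_eq_sum: "poly (Poly xs) (z::complex) = (\<Sum>i<length xs. xs ! i * z ^ i)"
proof (induction xs)
  case (Cons x xs)
  have "(\<Sum>i<length (x # xs). (x # xs) ! i * z ^ i) = x + z * (\<Sum>i<length xs. xs ! i * z ^ i)"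
    unfolding sum_distrib_left list.size add_Suc_right add_0_right sum.lessThan_Suc_shift
    by (simp add: mult.left_commute)
  then show ?case
    using Cons by simp
qed simp

theorem theorem1p3:
  fixes K :: "complex set"
    and S :: "(complex \<Rightarrow> real) set"
    and L :: "(complex \<Rightarrow> real) \<Rightarrow> 'b ring"
    and \<iota> :: "(complex \<Rightarrow> real) \<Rightarrow> (nat \<Rightarrow> complex) set \<Rightarrow> 'b"
    and absL :: "(complex \<Rightarrow> real) \<Rightarrow> 'b \<Rightarrow> real"
    and e f q p :: "(complex \<Rightarrow> real) \<Rightarrow> nat"
    and N :: "(complex \<Rightarrow> real) \<Rightarrow> real"
  assumes "number_field K"
    and "finite S" and "S \<subseteq> nonarchimedean_places K"
    and "\<And>v. v \<in> S \<Longrightarrow>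
           finite_galois_valued_extension (completion_at K v) (completion_abs v) (L v) (\<iota> v) (absL v)"
    and "\<And>v. v \<in> S \<Longrightarrow> e v = ramification_index (L v) (absL v) (\<iota> v ` carrier (completion_at K v))"
    and "\<And>v. v \<in> S \<Longrightarrow> f v = inertial_degree (L v) (absL v) (\<iota> v ` carrier (completion_at K v))"
    and "\<And>v. v \<in> S \<Longrightarrow> q v = residue_order K v"
    and "\<And>v. v \<in> S \<Longrightarrow> p v = residue_char K v"
    and "\<And>v. v \<in> S \<Longrightarrow> N v = place_weight K v"
  shows "liminf_on (totally K S L \<iota>) weil_height \<le>
           ereal (\<Sum>v\<in>S. N v * (ln (real (p v)) / (real (e v) * (real (q v) ^ f v - 1))))"
proof -
  interpret C: field \<C> by (rule field_C)
  define d where "d = global_degree K"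
  have sf: "subfield K \<C>"
    using assms(1) by (simp add: number_field_def)
  have padic: "padic_subfield K v (p v)" if v: "v \<in> S" for v
  proof -
    obtain p' where p': "padic_subfield K v p'"
      using nonarchimedean_place[OF assms(1)] assms(3) v by blast
    then show ?thesis
      using padic_subfield.residue_char[OF p'] assms(8)[OF v] by simp
  qed
  have galois: "padic_galois K v (p v) (L v) (\<iota> v) (absL v)" if "v \<in> S" for v
    using padic[OF that] assms(4)[OF that] by (intro padic_galois.intro padic_galois_axioms.intro)
  obtain \<omega> co where rb: "rational_basis K d \<omega> co" and int: "\<And>i. i < d \<Longrightarrow> algebraic_int (\<omega> i)"
    using integral_basis[OF assms(1)] unfolding d_def by blast
  interpret rational_basis K d \<omega> co by (rule rb)
  have d: "0 < d"
    using expand[of 1] by (cases d) auto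
  let ?T = "\<Sum>v\<in>S. N v * (ln (real (p v)) / (real (e v) * (real (q v) ^ f v - 1)))"
  have p1: "1 < p v" if "v \<in> S" for v
    using padic_subfield.p_gt_1[OF padic[OF that]] .
  have N: "N v = local_degree K v / d" if "v \<in> S" for v
    using assms(9)[OF that] by (simp add: place_weight_def d_def)
  have ext: "S \<subseteq> extensional K"
    using assms(3) by (auto simp: nonarchimedean_places_def)
  \<comment> \<open>The finite set \<open>A\<close> and \<delta> are fixed before the degree,
    because the constant \<open>C\<close> depends on \<open>A\<close> and its contribution is made
    small by choosing the degree afterwards.\<close>
  have main: "\<exists>\<alpha>\<in>totally K S L \<iota> - A. weil_height \<alpha> \<le> ?T + \<delta>" if A: "finite A" and \<delta>: "0 < \<delta>" for A \<delta>
  proof -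
    obtain C where C: "0 < C" and root: "\<And>n m b. 0 < n \<Longrightarrow> \<forall>v\<in>S. \<forall>i<n. b v i \<in> K \<and> v (b v i) \<le> 1 \<Longrightarrow>
      \<exists>a \<alpha>. (\<forall>i<n. a i \<in> K) \<and> (\<forall>v\<in>S. \<forall>i<n. v (a i - b v i) \<le> 1 / real (p v) ^ m v) \<and>
        \<alpha> ^ n + (\<Sum>i<n. a i * \<alpha> ^ i) = 0 \<and> \<alpha> \<notin> A \<and>
        weil_height \<alpha> \<le> (C + ln (1 + real n * C) + (\<Sum>v\<in>S. m v * (local_degree K v / d) * ln (p v))) / n"
      using approximating_root[OF assms(2) ext padic int d A] by blast
    define W where "W = (\<Sum>v\<in>S. N v * ln (p v))"
    have W: "0 \<le> W"
      unfolding W_def using p1 N by (intro sum_nonneg mult_nonneg_nonneg) (auto simp: less_imp_le)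
    \<comment> \<open>Half of \<delta> pays for the slack \<epsilon> in the exponents, weighted by
      \<open>W\<close>; the other half pays for
      \<open>(C + ln (1 + real n * C)) / n\<close>.\<close>
    obtain \<epsilon> where \<epsilon>: "0 < \<epsilon>" "\<epsilon> * W \<le> \<delta> / 2"
    proof (cases "W = 0")
      case True
      then show thesis
        using \<delta> that[of 1] by simp
    next
      case False
      then show thesis
        using \<delta> W that[of "\<delta> / 2 / W"] by simp
    qed
    define good where "good v n m b \<longleftrightarrow>
        real m \<le> n * (1 / (real (e v) * (real (q v) ^ f v - 1)) + \<epsilon>) \<and>
        (\<forall>i. b i \<in> K \<and> v (b i) \<le> 1) \<and>
        (\<forall>a. (\<forall>i<n. a i \<in> K \<and> v (a i - b i) \<le> 1 / real (p v) ^ m) \<longrightarrow>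
          ring.splitted (L v) (map (\<lambda>a. \<iota> v (completion_embed (field_of K) v a)) (1 # map a (rev [0..<n]))))"
      for v n m b
    have "\<forall>v\<in>S. \<exists>G. G > 0 \<and> (\<exists>n0. \<forall>n\<ge>n0. G dvd n \<longrightarrow> (\<exists>m b. good v n m b))"
    proof
      fix v assume v: "v \<in> S"
      interpret padic_galois K v "p v" "L v" "\<iota> v" "absL v" by (rule galois[OF v])
      show "\<exists>G. G > 0 \<and> (\<exists>n0. \<forall>n\<ge>n0. G dvd n \<longrightarrow> (\<exists>m b. good v n m b))"
        using split_approximations[OF \<epsilon>(1)]
        unfolding good_def kL_def assms(5-7)[OF v] by blast
    qed
    from bchoice[OF this] obtain G where
      G: "\<forall>v\<in>S. G v > 0 \<and> (\<exists>n0. \<forall>n\<ge>n0. G v dvd n \<longrightarrow> (\<exists>m b. good v n m b))"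
      by (rule exE)
    have "\<forall>v\<in>S. \<exists>n0. \<forall>n\<ge>n0. G v dvd n \<longrightarrow> (\<exists>m b. good v n m b)"
      using G by blast
    from bchoice[OF this] obtain n0 where n0: "\<forall>v\<in>S. \<forall>n\<ge>n0 v. G v dvd n \<longrightarrow> (\<exists>m b. good v n m b)"
      by (rule exE)
    have "(\<lambda>n. (C + ln (1 + real n * C)) / n) \<longlonglongrightarrow> 0"
      using C by real_asymp
    then have "\<forall>\<^sub>F n in sequentially. (C + ln (1 + real n * C)) / n < \<delta> / 2"
      by (rule order_tendstoD(2)) (use \<delta> in simp)
    then obtain n1 where n1: "\<And>n. n \<ge> n1 \<Longrightarrow> (C + ln (1 + real n * C)) / n < \<delta> / 2"
      by (auto simp: eventually_sequentially)
    \<comment> \<open>The degree \<open>n\<close> must be a multiple of every \<open>G v\<close> and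
      exceed all thresholds at once; a multiple of the product \<open>g\<close> achieves
      both.\<close>
    define g where "g = (\<Prod>v\<in>S. G v)"
    define n where "n = g * (n1 + (\<Sum>v\<in>S. n0 v) + 1)"
    have "0 < g"
      unfolding g_def using G by (intro prod_pos) auto
    then have nle: "n1 + (\<Sum>v\<in>S. n0 v) + 1 \<le> n"
      unfolding n_def using mult_le_mono1[of 1 g "n1 + (\<Sum>v\<in>S. n0 v) + 1"] by simp
    have "\<forall>v\<in>S. \<exists>mb. good v n (fst mb) (snd mb)"
    proof
      fix v assume v: "v \<in> S"
      have "n0 v \<le> (\<Sum>v\<in>S. n0 v)"
        using assms(2) v by (intro member_le_sum) auto
      then have "n0 v \<le> n"
        using nle by simp
      moreover have "G v dvd n"
        unfolding n_def g_def using assms(2) v by (intro dvd_mult2 dvd_prodI)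
      ultimately obtain m b where "good v n m b"
        using n0 v by blast
      then show "\<exists>mb. good v n (fst mb) (snd mb)"
        by (intro exI[of _ "(m, b)"]) simp
    qed
    from bchoice[OF this] obtain mb where mb: "\<forall>v\<in>S. good v n (fst (mb v)) (snd (mb v))"
      by (rule exE)
    define m b where "m v = fst (mb v)" and "b v = snd (mb v)" for v
    have mb: "good v n (m v) (b v)" if "v \<in> S" for v
      using mb that by (simp add: m_def b_def)
    have n: "0 < n"
      using nle by simp
    have "\<forall>v\<in>S. \<forall>i<n. b v i \<in> K \<and> v (b v i) \<le> 1"
      using mb by (simp add: good_def)
    from root[OF n this, of m] obtain a \<alpha> where a: "\<And>i. i < n \<Longrightarrow> a i \<in> K"
      "\<And>v i. v \<in> S \<Longrightarrow> i < n \<Longrightarrow> v (a i - b v i) \<le> 1 / real (p v) ^ m v"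
      and \<alpha>: "\<alpha> ^ n + (\<Sum>i<n. a i * \<alpha> ^ i) = 0" "\<alpha> \<notin> A"
        "weil_height \<alpha> \<le> (C + ln (1 + real n * C) + (\<Sum>v\<in>S. m v * (local_degree K v / d) * ln (p v))) / n"
      by blast
    let ?f = "1 # map a (rev [0..<n])"
    have f_in: "?f \<in> carrier (univ_poly \<C> K)"
      using a(1) by (auto simp: univ_poly_def polynomial_def)
    have "C.eval ?f \<alpha> = (\<Sum>i<Suc n. (map a [0..<n] @ [1]) ! i * \<alpha> ^ i)"
      unfolding eval_C by (simp add: rev_map poly_Poly_eq_sum)
    also have "\<dots> = 0"
      using \<alpha>(1) by (simp add: nth_append add.commute)
    finally have f_root: "C.eval ?f \<alpha> = 0" .
    have alg: "C.algebraic K \<alpha>"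
      using C.algebraicI[OF f_in, of \<alpha>] f_root by (simp add: over_def)
    have dvd: "C.Irr K \<alpha> pdivides\<^bsub>\<C>\<^esub> ?f"
      using C.Irr_minimal[OF sf _ _ f_in, of \<alpha>] alg f_root by (simp add: over_def)
    have Irr_in: "C.Irr K \<alpha> \<in> carrier (univ_poly \<C> K)"
      using C.IrrE(1)[OF sf, of \<alpha>] alg by (simp add: over_def)
    have "ring.splitted (L v) (map (\<lambda>a. \<iota> v (completion_embed (field_of K) v a)) (C.Irr K \<alpha>))" if v: "v \<in> S" for v
    proof -
      interpret v: padic_galois K v "p v" "L v" "\<iota> v" "absL v" by (rule galois[OF v])
      have "v.L.splitted (map (\<lambda>a. \<iota> v (completion_embed (field_of K) v a)) ?f)"
        using mb[OF v] a(1) a(2)[OF v] unfolding good_def by blast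
      then show ?thesis
        by (intro v.splitted_of_pdivides[OF Irr_in f_in _ dvd]) simp_all
    qed
    then have "\<alpha> \<in> totally K S L \<iota>"
      using alg by (simp add: totally_def)
    moreover have "weil_height \<alpha> \<le> ?T + \<delta>"
    proof -
      have "(\<Sum>v\<in>S. m v * (local_degree K v / d) * ln (p v)) / n \<le> ?T + \<epsilon> * W"
      proof -
        have "(\<Sum>v\<in>S. m v * (local_degree K v / d) * ln (p v)) / n = (\<Sum>v\<in>S. (m v / n) * (N v * ln (p v)))"
          unfolding sum_divide_distrib by (intro sum.cong) (auto simp: N mult_ac)
        also have "\<dots> \<le> (\<Sum>v\<in>S. (1 / (real (e v) * (real (q v) ^ f v - 1)) + \<epsilon>) * (N v * ln (p v)))"
        proof (intro sum_mono mult_right_mono)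
          fix v assume v: "v \<in> S"
          show "m v / n \<le> 1 / (real (e v) * (real (q v) ^ f v - 1)) + \<epsilon>"
            using mb[OF v] n unfolding good_def by (simp add: pos_divide_le_eq mult.commute)
          show "0 \<le> N v * ln (p v)"
            using p1[OF v] N[OF v] by simp
        qed
        also have "\<dots> = ?T + \<epsilon> * W"
          unfolding W_def by (simp add: ring_distribs sum.distrib sum_distrib_left mult_ac)
        finally show ?thesis .
      qed
      moreover have "(C + ln (1 + real n * C)) / n < \<delta> / 2"
        using nle by (intro n1) simp
      ultimately show ?thesis
        using \<alpha>(3) \<epsilon>(2) unfolding add_divide_distrib by linarith
    qed
    ultimately show ?thesis
      using \<alpha>(2) by blast
  qed
  show ?thesis
    unfolding liminf_on_def
  proof (rule SUP_least)
    fix A assume A: "A \<in> {F. finite F \<and> F \<subseteq> totally K S L \<iota>}"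
    show "(INF \<alpha>\<in>totally K S L \<iota> - A. ereal (weil_height \<alpha>)) \<le> ereal ?T"
    proof (rule ereal_le_epsilon2)
      fix \<delta> :: real assume "0 < \<delta>"
      then obtain \<alpha> where \<alpha>: "\<alpha> \<in> totally K S L \<iota> - A" "weil_height \<alpha> \<le> ?T + \<delta>"
        using main[of A \<delta>] A by blast
      have "(INF \<alpha>\<in>totally K S L \<iota> - A. ereal (weil_height \<alpha>)) \<le> ereal (weil_height \<alpha>)"
        using \<alpha>(1) by (rule INF_lower)
      also have "\<dots> \<le> ereal ?T + ereal \<delta>"
        using \<alpha>(2) by simp
      finally show "(INF \<alpha>\<in>totally K S L \<iota> - A. ereal (weil_height \<alpha>)) \<le> ereal ?T + ereal \<delta>" .
    qed
  qed
qed

end
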